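(* Let $i\geq 1$, $r\geq 1$ and $j\geq 1$ be integers and let $m_1,\ldots,m_j$ be positive integers. Let $M^{(j)}=\prod_{\alpha=1}^{j} m_{\alpha}$ and $m^{(j)}=\sum_{\alpha=1}^{j}\frac{1}{m_{\alpha}}$. Then $$g\left(\left(\Box_{\alpha=1}^{i} K_{2r,2r}\right)\Box\left(\Box_{\alpha=1}^{j} P_{2m_{\alpha}}\right)\right)=1+2^{2i+j-3}\,r^{i}\,M^{(j)}\,\bigl(2ir+2j-m^{(j)}-4\bigr).$$
   Context: For graphs $G_1,G_2$, the Cartesian product $G_1\Box G_2$ has vertex set $V(G_1)\times V(G_2)$, with $(v_1,v_2)$ adjacent to $(w_1,w_2)$ iff either $v_1=w_1$ and $v_2w_2\in E(G_2)$, or $v_1w_1\in E(G_1)$ and $v_2=w_2$. $\Box_{\alpha=1}^{k} X_\alpha$ denotes the repeated Cartesian product $X_1\Box X_2\Box\cdots\Box X_k$. $K_{2r,2r}$ is the complete bipartite graph with both parts of size $2r$, and $P_n$ is the path on $n$ vertices. The genus $g(G)$ of a graph $G$ is the smallest $g$ such that $G$ embeds (without edge crossings) on the orientable surface $S_g$ with $g$ handles. *)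

theory Defs
  imports "HOL-Analysis.Analysis"
begin

text \<open>
  Simple undirected graphs; an edge is the two-element set of its ends.  The type does not
  enforce this, but all graphs constructed below are of this form.
\<close>

record 'a graph =
  verts :: "'a set"
  edges :: "'a set set"

definition map_graph :: "('a \<Rightarrow> 'b) \<Rightarrow> 'a graph \<Rightarrow> 'b graph" where
  "map_graph f G = \<lparr> verts = f ` verts G, edges = (\<lambda>e. f ` e) ` edges G \<rparr>"

definition path_graph :: "nat \<Rightarrow> nat graph" where
  "path_graph n = \<lparr> verts = {..<n}, edges = {{k, Suc k} | k. Suc k < n} \<rparr>"

definition complete_bipartite :: "nat \<Rightarrow> nat \<Rightarrow> (nat + nat) graph" where
  "complete_bipartite a b =
     \<lparr> verts = {..<a} <+> {..<b}, edges = {{Inl u, Inr v} | u v. u < a \<and> v < b} \<rparr>"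

definition box_product :: "'a graph \<Rightarrow> 'b graph \<Rightarrow> ('a \<times> 'b) graph"  (infixr "\<box>" 70) where
  "G1 \<box> G2 =
     \<lparr> verts = verts G1 \<times> verts G2,
       edges = {{(v1, v2), (w1, w2)} | v1 v2 w1 w2.
                  v1 = w1 \<and> v1 \<in> verts G1 \<and> {v2, w2} \<in> edges G2 \<or>
                  {v1, w1} \<in> edges G1 \<and> v2 = w2 \<and> v2 \<in> verts G2} \<rparr>"

text \<open>
  The product of a list of graphs, whose length may vary.  The vertices of the iterated
  binary product are flattened from nested pairs to lists, so that all products of graphs
  on \<open>'a\<close> share one vertex type.  The base case is the one-vertex graph, which
  is neutral for the product up to isomorphism.
\<close>

primrec box_list :: "'a graph list \<Rightarrow> 'a list graph" where
  "box_list [] = \<lparr> verts = {[]}, edges = {} \<rparr>"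
| "box_list (X # Xs) = map_graph (\<lambda>(x, xs). x # xs) (X \<box> box_list Xs)"

text \<open>
  The orientable surface with \<open>g\<close> handles, in three-space: the boundary of a box (a
  sphere), from which the interiors of \<open>g\<close> disjoint squares on the top face and of
  the \<open>g\<close> squares below them on the bottom face are removed, and where each such pair
  of holes is joined by a tube running through the box.  Equivalently, it is the
  boundary of a box with \<open>g\<close> square tunnels drilled through it.
\<close>

definition block :: "nat \<Rightarrow> ((real \<times> real) \<times> real) set" where
  "block g = ({0..2 * real g + 1} \<times> {0..3}) \<times> {0..1}"

definition square :: "nat \<Rightarrow> (real \<times> real) set" where
  "square k = {2 * real k + 1<..<2 * real k + 2} \<times> {1<..<2}"

definition handle_surface :: "nat \<Rightarrow> ((real \<times> real) \<times> real) set" where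
  "handle_surface g =
     (frontier (block g) - (\<Union>k<g. square k \<times> {0, 1})) \<union> (\<Union>k<g. frontier (square k) \<times> {0..1})"

text \<open>
  Topological embeddings without crossings: vertices are distinct points, an edge is a
  simple arc between its ends that avoids all other vertices, and two distinct edges
  meet only in the images of common ends.
\<close>

definition embeds_in :: "'a graph \<Rightarrow> 'b::topological_space set \<Rightarrow> bool" where
  "embeds_in G S \<longleftrightarrow>
     (\<exists>(f :: 'a \<Rightarrow> 'b) (\<gamma> :: 'a set \<Rightarrow> real \<Rightarrow> 'b).
        inj_on f (verts G) \<and> f ` verts G \<subseteq> S \<and>
        (\<forall>e \<in> edges G. arc (\<gamma> e) \<and> path_image (\<gamma> e) \<subseteq> S \<and>
           {pathstart (\<gamma> e), pathfinish (\<gamma> e)} = f ` e \<and>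
           path_image (\<gamma> e) \<inter> f ` verts G = f ` e) \<and>
        (\<forall>e \<in> edges G. \<forall>e' \<in> edges G. e \<noteq> e' \<longrightarrow>
           path_image (\<gamma> e) \<inter> path_image (\<gamma> e') \<subseteq> f ` (e \<inter> e')))"

definition genus :: "'a graph \<Rightarrow> nat" where
  "genus G = (LEAST g. embeds_in G (handle_surface g))"

end

theory Submission
 imports Defs
begin

text \<open>
 Surfaces are described by the words of oriented edges on the boundaries of their faces.
 For the upper bound, the product has a rotation system all of whose faces are
 quadrilaterals.  Merging faces and normalizing the resulting word shows that two connected
 systems of words with the same Euler characteristic are realized on the same surfaces, and
 the handle surface is realized by its unit squares.
 For the lower bound, a graph embedded in the handle surface is a minor of every sufficiently
 fine square lattice on that surface.  Over the field with two elements, merging faces against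
 disconnecting vertices gives \<open>V - E + F \<ge> 2 - 2 g\<close>, where \<open>F\<close> counts classes of lattice
 faces; each class is bounded by a nonempty even subgraph, which in a bipartite graph has at
 least four edges.
\<close>

text \<open>A quadrangular cell structure has \<open>4 F\<close> darts, so Euler's formula reads
  \<open>8 g = 8 - 4 V + D\<close> with \<open>D\<close> the sum of the degrees. For a bipartite
  graph on at least three vertices the right side is also a lower bound for \<open>8 g\<close>, so
  one quadrangular embedding settles the genus. The closed formula is the vertex count times the
  average degree: a path on \<open>2 m\<close> vertices adds \<open>2 - 1/m\<close>, since its ends
  have degree one. Two obstacles shape the proof. Embedded edges are arbitrary arcs; they are traded
  for sets of lattice vertices, and regions are never shown to be discs but only counted, through a
  space of face sets. And the handle surface is a concrete set whereas a rotation system is a gluing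
  of discs; so embeddability is phrased as realizability of words and carried along moves that keep
  the Euler number. The rotation comes from an edge colouring: when cyclically consecutive colours
  commute as involutions, every corner closes up to a 4-cycle. The two matchings of one path do not
  commute, and the second is missing at its ends; this dictates the cyclic order of the
  colours.\<close>

abbreviation (input) rv :: "'a \<times> 'b => 'b \<times> 'a" where "rv \<equiv> prod.swap"

section \<open>Convex discs with a boundary parametrization\<close>

text \<open>On a compact set \<open>q\<close> is a closed map onto its image, hence a quotient map.
  It serves for polar coordinates and for the squaring map, where \<open>f\<close> is defined by
  choosing preimages.\<close>

lemma continuous_on_compact_factor:
 fixes q :: "'a::euclidean_space => 'b::euclidean_space" and f :: "'b => 'c::topological_space"
 assumes "compact K" "continuous_on K q" "continuous_on K (\<lambda>x. f (q x))"
 shows "continuous_on (q ` K) f"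
proof -
 have cl: "closed (q ` K)"
  using assms by (simp add: compact_continuous_image compact_imp_closed)
 have "closed (f -` B \<inter> q ` K)" if "closed B" for B
 proof -
  have "closed ((\<lambda>x. f (q x)) -` B \<inter> K)"
   using assms that continuous_on_closed_vimage[OF compact_imp_closed[OF assms(1)], of "\<lambda>x. f (q x)"] by blast
  hence "compact ((\<lambda>x. f (q x)) -` B \<inter> K)"
   using assms(1) by (metis compact_Int_closed inf.left_idem inf_commute)
  hence "compact (q ` ((\<lambda>x. f (q x)) -` B \<inter> K))"
   by (meson assms(2) compact_continuous_image continuous_on_subset inf_le2)
  moreover have "q ` ((\<lambda>x. f (q x)) -` B \<inter> K) = f -` B \<inter> q ` K" by auto
  ultimately show ?thesis using compact_imp_closed by metis
 qed
 thus ?thesis using cl by (simp add: continuous_on_closed_vimage)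
qed

text \<open>The period is a parameter so that a face with \<open>n\<close> letters can reserve the
  interval from \<open>k\<close> to \<open>k + 1\<close> for its letter number
  \<open>k\<close>.\<close>

definition disc_model :: "complex set => real => (real => complex) => bool" where
 "disc_model D n \<beta> \<longleftrightarrow> compact D & convex D & interior D ~= {} & 0 < n & continuous_on {0..n} \<beta> &
   \<beta> 0 = \<beta> n & inj_on \<beta> {0..<n} & \<beta> ` {0..n} = frontier D"

lemma disc_model_reparam:
 assumes "disc_model D n \<beta>" "0 < m" "continuous_on {0..m} \<rho>" "strict_mono_on {0..m} \<rho>" "\<rho> 0 = 0" "\<rho> m = n"
 shows "disc_model D m (\<beta> \<circ> \<rho>)"
proof -
 have im: "\<rho> ` {0..m} = {0..n}"
 proof
  show "\<rho> ` {0..m} <= {0..n}"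
  proof
   fix y assume "y : \<rho> ` {0..m}"
   then obtain x where x: "0 <= x" "x <= m" "y = \<rho> x" by auto
   hence "\<rho> 0 <= \<rho> x" "\<rho> x <= \<rho> m"
    using assms(2,4) strict_mono_on_leD[OF assms(4)] by auto
   thus "y : {0..n}" using x assms by auto
  qed
  show "{0..n} <= \<rho> ` {0..m}"
  proof
   fix y assume "y : {0..n}"
   hence "\<exists>x. 0 <= x & x <= m & \<rho> x = y"
    using IVT'[of \<rho> 0 y m] assms by auto
   thus "y : \<rho> ` {0..m}" by auto
  qed
 qed
 have lt: "\<rho> x : {0..<n}" if "x : {0..<m}" for x
 proof -
  have "\<rho> x < \<rho> m" using that assms(2,4) unfolding strict_mono_on_def by auto
  moreover have "\<rho> x : {0..n}" using im that by auto
  ultimately show ?thesis using assms(6) by auto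
 qed
 have inj: "inj_on \<rho> {0..m}" using assms(4) strict_mono_on_imp_inj_on by blast
 have "inj_on (\<beta> \<circ> \<rho>) {0..<m}"
 proof (rule inj_onI)
  fix x y assume h: "x : {0..<m}" "y : {0..<m}" "(\<beta> \<circ> \<rho>) x = (\<beta> \<circ> \<rho>) y"
  hence "\<rho> x = \<rho> y" using lt assms(1) unfolding disc_model_def inj_on_def by auto
  thus "x = y" using h inj_onD[OF inj, of x y] by simp
 qed
 moreover have "continuous_on {0..m} (\<beta> \<circ> \<rho>)"
  using assms im unfolding disc_model_def by (intro continuous_on_compose) auto
 moreover have "(\<beta> \<circ> \<rho>) ` {0..m} = frontier D"
  using im assms(1) unfolding disc_model_def by (metis image_comp)
 ultimately show ?thesis using assms unfolding disc_model_def by auto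
qed

section \<open>Polar coordinates of a convex disc and the extension of boundary maps\<close>

definition polar :: "complex => (real => complex) => real \<times> real => complex" where
 "polar c \<beta> = (\<lambda>(t, \<rho>). c + complex_of_real \<rho> * (\<beta> t - c))"

lemma polar_continuous:
 assumes "disc_model D n \<beta>"
 shows "continuous_on ({0..n} \<times> {0..1}) (polar c \<beta>)"
proof -
 have "continuous_on ({0..n} \<times> {0..1::real}) (\<lambda>p. \<beta> (fst p))"
  by (rule continuous_on_compose2[of "{0..n}" \<beta>]) (use assms in \<open>auto simp: disc_model_def intro: continuous_intros\<close>)
 thus ?thesis unfolding polar_def case_prod_unfold by (intro continuous_intros)
qed

lemma polar_interior:
 assumes "disc_model D n \<beta>" "c : interior D" "t : {0..n}" "0 <= \<rho>" "\<rho> < 1"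
 shows "polar c \<beta> (t, \<rho>) : interior D"
proof -
 have D: "convex D" "closed D" using assms compact_imp_closed by (auto simp: disc_model_def)
 have b: "\<beta> t : closure D" using assms by (auto simp: disc_model_def frontier_def)
 have "\<beta> t - (1-\<rho>) *\<^sub>R (\<beta> t - c) : interior D"
  using mem_interior_closure_convex_shrink[of D c "\<beta> t" "1-\<rho>"] D b assms by auto
 moreover have "\<beta> t - (1-\<rho>) *\<^sub>R (\<beta> t - c) = polar c \<beta> (t, \<rho>)"
  unfolding polar_def by (simp add: algebra_simps scaleR_conv_of_real)
 ultimately show ?thesis by simp
qed

lemma polar_image:
 assumes "disc_model D n \<beta>" "c : interior D"
 shows "polar c \<beta> ` ({0..n} \<times> {0..1}) = D"
proof
 have D: "convex D" "closed D" "bounded D" using assms compact_imp_closed compact_imp_bounded by (auto simp: disc_model_def)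
 have fr: "\<beta> ` {0..n} = frontier D" using assms by (auto simp: disc_model_def)
 have frD: "frontier D <= D" using D frontier_subset_closed by blast
 show "polar c \<beta> ` ({0..n} \<times> {0..1}) <= D"
 proof clarify
  fix t \<rho> :: real assume h: "t : {0..n}" "\<rho> : {0..1}"
  show "polar c \<beta> (t, \<rho>) : D"
  proof (cases "\<rho> < 1")
   case True thus ?thesis using polar_interior[OF assms h(1), of \<rho>] h interior_subset by auto
  next
   case False hence "\<rho> = 1" using h by auto
   thus ?thesis using fr frD h by (auto simp: polar_def)
  qed
 qed
 show "D <= polar c \<beta> ` ({0..n} \<times> {0..1})"
 proof
  fix z assume z: "z : D"
  have n: "0 < n" using assms by (auto simp: disc_model_def)
  show "z : polar c \<beta> ` ({0..n} \<times> {0..1})"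
  proof (cases "z = c")
   case True
   have "polar c \<beta> (0,0) = c" by (simp add: polar_def)
   thus ?thesis using n True by (metis SigmaI atLeastAtMost_iff imageI less_eq_real_def zero_le_one)
  next
   case False
   then obtain d where d: "0 < d" "c + d *\<^sub>R (z - c) : frontier D"
     "\<And>e. 0 <= e ==> e < d ==> c + e *\<^sub>R (z - c) : interior D"
    using ray_to_frontier[of D c "z - c"] D assms by auto
   then obtain t where t: "t : {0..n}" "\<beta> t = c + d *\<^sub>R (z - c)" using fr by (metis imageE)
   \<comment> \<open>The ray cannot leave the disc before it reaches \<open>z\<close>: by convexity
     the points strictly between \<open>c\<close> and \<open>z\<close> are interior.\<close>
   have d1: "1 <= d"
   proof (rule ccontr)
    assume "\<not> 1 <= d"
    hence "(1::real) - d : {0<..1}" using d by auto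
    hence "z - (1-d) *\<^sub>R (z - c) : interior D"
     using mem_interior_closure_convex_shrink[of D c z "1-d"] D assms z closure_subset by auto
    moreover have "z - (1-d) *\<^sub>R (z - c) = c + d *\<^sub>R (z - c)" by (simp add: algebra_simps)
    ultimately show False using d(2) by (auto simp: frontier_def)
   qed
   have "polar c \<beta> (t, 1/d) = z" using t d1 d(1)
    by (simp add: polar_def scaleR_conv_of_real)
   moreover have "(t, 1/d) : {0..n} \<times> {0..1}" using t d1 by auto
   ultimately show ?thesis by (metis imageI)
  qed
 qed
qed

text \<open>The identifications on the right depend only on the period, not on the disc, its centre
  or its loop. This is what makes the transfer between two discs of the same period well
  defined.\<close>

lemma polar_eq_iff:
 assumes "disc_model D n \<beta>" "c : interior D" "t : {0..n}" "t' : {0..n}" "\<rho> : {0..1}" "\<rho>' : {0..1}"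
 shows "polar c \<beta> (t, \<rho>) = polar c \<beta> (t', \<rho>') \<longleftrightarrow>
     \<rho> = \<rho>' & (\<rho> = 0 \<or> t = t' \<or> {t, t'} = {0, n})"
proof
 have D: "convex D" "closed D" using assms compact_imp_closed by (auto simp: disc_model_def)
 have fr: "\<beta> s : frontier D" if "s : {0..n}" for s using assms that by (auto simp: disc_model_def)
 have ne: "\<beta> s ~= c" if "s : {0..n}" for s using fr[OF that] assms(2) by (auto simp: frontier_def)
 have per: "s = s' \<or> {s, s'} = {0, n}" if "s : {0..n}" "s' : {0..n}" "\<beta> s = \<beta> s'" for s s'
 proof -
  have inj: "inj_on \<beta> {0..<n}" and e: "\<beta> 0 = \<beta> n" "0 < n" using assms(1) by (auto simp: disc_model_def)
  show ?thesis
  proof (cases "s = n")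
   case True
   thus ?thesis using inj e that by (cases "s' = n") (auto simp: inj_on_def)
  next
   case False
   thus ?thesis using inj e that by (cases "s' = n") (auto simp: inj_on_def)
  qed
 qed
 have key: "r = r' & (r = 0 \<or> \<beta> s = \<beta> s')"
  if h: "polar c \<beta> (s, r) = polar c \<beta> (s', r')" "r <= r'" "s : {0..n}" "s' : {0..n}" "r : {0..1}" "r' : {0..1}" for s s' r r'
 proof (cases "r' = 0")
  case True thus ?thesis using h by auto
 next
  case False
  have "complex_of_real r * (\<beta> s - c) = complex_of_real r' * (\<beta> s' - c)" using h(1) by (simp add: polar_def)
  hence "\<beta> s' - c = (complex_of_real r * (\<beta> s - c)) / complex_of_real r'" using False by simp
  hence e: "\<beta> s' - c = complex_of_real (r/r') * (\<beta> s - c)" by simp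
  \<comment> \<open>Otherwise the frontier point \<open>\<beta> s'\<close> would lie strictly
    between \<open>c\<close> and another frontier point, hence in the interior.\<close>
  have "r/r' \<ge> 1"
  proof (rule ccontr)
   assume "\<not> r/r' \<ge> 1"
   hence "polar c \<beta> (s, r/r') : interior D" using polar_interior[OF assms(1,2) h(3), of "r/r'"] h by auto
   moreover have "polar c \<beta> (s, r/r') = \<beta> s'"
    using e unfolding polar_def by (metis add.commute case_prod_conv diff_add_cancel)
   ultimately show False using fr[OF h(4)] by (auto simp: frontier_def)
  qed
  hence "r = r'" using h False by (auto simp: field_simps)
  thus ?thesis using e False by auto
 qed
 { assume h: "polar c \<beta> (t, \<rho>) = polar c \<beta> (t', \<rho>')"
  have "\<rho> = \<rho>' & (\<rho> = 0 \<or> \<beta> t = \<beta> t')"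
   using key[OF h] key[OF h[symmetric]] assms(3-6) by (cases "\<rho> <= \<rho>'") auto
  thus "\<rho> = \<rho>' & (\<rho> = 0 \<or> t = t' \<or> {t, t'} = {0, n})" using per assms by blast }
 { assume h: "\<rho> = \<rho>' & (\<rho> = 0 \<or> t = t' \<or> {t, t'} = {0, n})"
  have "\<beta> 0 = \<beta> n" using assms(1) by (auto simp: disc_model_def)
  thus "polar c \<beta> (t, \<rho>) = polar c \<beta> (t', \<rho>')" using h by (auto simp: polar_def doubleton_eq_iff) }
qed

text \<open>The Alexander trick: a correspondence of boundary loops is coned off. \<open>H\<close>
  sends a point to the point with the same polar coordinates in the other disc, and
  \<open>polar_eq_iff\<close> makes this independent of the chosen coordinates.\<close>

lemma disc_model_transfer:
 assumes "disc_model D n \<beta>" "disc_model D' n \<beta>'"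
 obtains H where "continuous_on D H" "inj_on H D" "H ` D = D'" "H ` interior D = interior D'"
  "\<And>t. t : {0..n} ==> H (\<beta> t) = \<beta>' t"
proof -
 obtain c where c: "c : interior D" using assms(1) by (auto simp: disc_model_def)
 obtain c' where c': "c' : interior D'" using assms(2) by (auto simp: disc_model_def)
 let ?K = "{0..n} \<times> {0..1::real}"
 let ?q = "polar c \<beta>" and ?q' = "polar c' \<beta>'"
 define H where "H = (\<lambda>z. ?q' (SOME p. p : ?K & ?q p = z))"
 have Hq: "H (?q p) = ?q' p" if "p : ?K" for p
 proof -
  define p' where "p' = (SOME p'. p' : ?K & ?q p' = ?q p)"
  have "p' : ?K & ?q p' = ?q p" unfolding p'_def by (rule someI[of _ p]) (use that in auto)
  hence "?q' p' = ?q' p"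
   using that polar_eq_iff[OF assms(1) c, of "fst p'" "fst p" "snd p'" "snd p"]
    polar_eq_iff[OF assms(2) c', of "fst p'" "fst p" "snd p'" "snd p"]
   unfolding mem_Times_iff prod.collapse by blast
  thus ?thesis unfolding H_def p'_def .
 qed
 have im: "?q ` ?K = D" "?q' ` ?K = D'" using polar_image assms c c' by blast+
 have n: "0 < n" using assms(1) by (auto simp: disc_model_def)
 have int: "polar a b ` ({0..n} \<times> {0..<1}) = interior E" if "disc_model E n b" "a : interior E" for E a b
 proof
  show "polar a b ` ({0..n} \<times> {0..<1}) <= interior E" using polar_interior[OF that] by auto
  show "interior E <= polar a b ` ({0..n} \<times> {0..<1})"
  proof
   fix z assume z: "z : interior E"
   hence "z : polar a b ` ?K" using polar_image[OF that] interior_subset by auto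
   then obtain t r where tr: "t : {0..n}" "r : {0..1}" "z = polar a b (t, r)" by auto
   have "r ~= 1"
   proof
    assume "r = 1"
    hence "z = b t" using tr by (simp add: polar_def)
    hence "z : frontier E" using that tr by (auto simp: disc_model_def)
    thus False using z by (auto simp: frontier_def)
   qed
   thus "z : polar a b ` ({0..n} \<times> {0..<1})" using tr by auto
  qed
 qed
 show ?thesis
 proof
  have "continuous_on ?K (\<lambda>x. H (?q x))"
   using polar_continuous[OF assms(2), of c'] Hq by (simp cong: continuous_on_cong)
  thus "continuous_on D H"
   using continuous_on_compact_factor[OF _ polar_continuous[OF assms(1), of c], of H] im
   by (simp add: compact_Times)
  show "inj_on H D"
  proof (rule inj_onI)
   fix x y assume h: "x : D" "y : D" "H x = H y"
   hence "x : ?q ` ?K" "y : ?q ` ?K" using im by simp_all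
   then obtain p p' where p: "p : ?K" "p' : ?K" "x = ?q p" "y = ?q p'" by blast
   hence "?q' p = ?q' p'" using h Hq by auto
   thus "x = y" using p polar_eq_iff[OF assms(1) c, of "fst p" "fst p'" "snd p" "snd p'"]
    polar_eq_iff[OF assms(2) c', of "fst p" "fst p'" "snd p" "snd p'"]
    unfolding mem_Times_iff prod.collapse by blast
  qed
  show "H ` D = D'" unfolding im[symmetric] image_image using Hq by simp
  have "H ` interior D = (\<lambda>p. H (?q p)) ` ({0..n} \<times> {0..<1})"
   using int[OF assms(1) c] by (metis image_image)
  also have "\<dots> = ?q' ` ({0..n} \<times> {0..<1})" using Hq by (intro image_cong) auto
  also have "\<dots> = interior D'" using int[OF assms(2) c'] .
  finally show "H ` interior D = interior D'" .
  show "H (\<beta> t) = \<beta>' t" if "t : {0..n}" for t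
   using Hq[of "(t,1)"] that by (simp add: polar_def)
 qed
qed

section \<open>Standard discs\<close>

lemma cis_inj: "cis a = cis b ==> 0 <= a ==> a < 2*pi ==> 0 <= b ==> b < 2*pi ==> a = b"
 using Arg2pi_unique[of 1 a "cis a"] Arg2pi_unique[of 1 b "cis b"] by (simp add: cis_conv_exp)

lemma disc_model_circle: "disc_model (cball 0 1) 2 (\<lambda>t. cis (pi * t))"
proof -
 have "(\<lambda>t. cis (pi * t)) ` {0..2} = sphere 0 1"
 proof
  show "(\<lambda>t. cis (pi * t)) ` {0..2} <= sphere 0 1" by auto
  show "sphere 0 1 <= (\<lambda>t. cis (pi * t)) ` {0..2}"
  proof
   fix z :: complex assume "z : sphere 0 1"
   hence "z = cis (pi * (Arg2pi z / pi))"
    using Arg2pi_eq[of z] by (simp add: cis_conv_exp mult.commute)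
   moreover have "Arg2pi z / pi : {0..2}" using Arg2pi_lt_2pi[of z] Arg2pi_ge_0[of z] by (auto simp: field_simps)
   ultimately show "z : (\<lambda>t. cis (pi * t)) ` {0..2}" by blast
  qed
 qed
 moreover have "inj_on (\<lambda>t. cis (pi * t)) {0..<2}"
  by (rule inj_onI, drule cis_inj) auto
 ultimately show ?thesis unfolding disc_model_def
  by (auto intro!: continuous_intros simp: cis_conv_exp mult.commute)
qed

definition half_disc :: "complex set" where "half_disc = cball 0 1 \<inter> {z. 0 <= Im z}"

text \<open>First the arc from \<open>1\<close> to \<open>-1\<close>, then the diameter back from
  \<open>-1\<close> to \<open>1\<close>. In the moves below the arc carries the old letters and the
  diameter the new ones.\<close>

definition half_loop :: "real => complex" where
 "half_loop t = (if t <= 1 then cis (pi * t) else of_real (2 * t - 3))"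

lemma interior_half_disc: "interior half_disc = ball 0 1 \<inter> {z. 0 < Im z}"
proof -
 have "{z. 0 <= Im z} = {z. inner \<i> z \<ge> 0}" by (auto simp: inner_complex_def)
 moreover have "interior {z. inner \<i> z \<ge> (0::real)} = {z. inner \<i> z > 0}" by (rule interior_halfspace_ge) simp
 ultimately show ?thesis unfolding half_disc_def by (auto simp: inner_complex_def)
qed

lemma cmod_le_1_real: "cmod (complex_of_real x) <= 1 \<longleftrightarrow> -1 <= x & x <= 1"
 by (auto simp: norm_of_real)

lemma half_real: "z : half_disc ==> Im z = 0 ==> \<exists>x. z = complex_of_real x & -1 <= x & x <= 1"
proof -
 assume "z : half_disc" "Im z = 0"
 hence "z = complex_of_real (Re z)" "cmod z <= 1" by (auto simp: complex_eq_iff half_disc_def)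
 thus ?thesis using cmod_le_1_real[of "Re z"] by metis
qed

lemma disc_model_half: "disc_model half_disc 2 half_loop"
proof -
 have cl: "closed half_disc" unfolding half_disc_def
  by (intro closed_Int closed_cball closed_Collect_le continuous_intros)
 have fr: "frontier half_disc = half_disc - interior half_disc" using cl by (simp add: frontier_def)
 have "half_loop ` {0..2} = frontier half_disc"
 proof
  show "half_loop ` {0..2} <= frontier half_disc"
   unfolding fr interior_half_disc by (auto simp: half_loop_def half_disc_def cmod_le_1_real sin_ge_zero simp del: of_real_diff of_real_mult)
  show "frontier half_disc <= half_loop ` {0..2}"
  proof
   fix z assume z: "z : frontier half_disc"
   hence zh: "z : half_disc" and d: "cmod z \<ge> 1 \<or> Im z <= 0" unfolding fr interior_half_disc by auto
   show "z : half_loop ` {0..2}"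
   proof (cases "Im z = 0")
    case True
    then obtain x where x: "z = complex_of_real x" "-1 <= x" "x <= 1" using half_real zh by blast
    show ?thesis
    proof (cases "x = -1")
     case True
     hence "half_loop 1 = z" using x by (simp add: half_loop_def)
     thus ?thesis by force
    next
     case False
     have "2 * ((x+3)/2) - 3 = x" by (simp add: field_simps)
     hence "half_loop ((x+3)/2) = z" using x False unfolding half_loop_def by (simp del: of_real_diff of_real_mult)
     moreover have "(x+3)/2 : {0..2}" using x by auto
     ultimately show ?thesis by blast
    qed
   next
    case False
    hence z1: "cmod z = 1" "0 < Im z" using zh d by (auto simp: half_disc_def)
    hence e: "z = cis (pi * (Arg2pi z / pi))"
     using Arg2pi_eq[of z] by (simp add: cis_conv_exp mult.commute)
    have "Arg2pi z <= pi" using z1 Arg2pi_le_pi by (metis less_imp_le)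
    hence "Arg2pi z / pi <= 1" "0 <= Arg2pi z / pi" using Arg2pi_ge_0[of z] by (auto simp: field_simps)
    hence "half_loop (Arg2pi z / pi) = z" using e by (simp add: half_loop_def)
    thus ?thesis using \<open>Arg2pi z / pi <= 1\<close> \<open>0 <= Arg2pi z / pi\<close>
     by (metis atLeastAtMost_iff imageI one_le_numeral order_trans)
   qed
  qed
 qed
 moreover have "inj_on half_loop {0..<2}"
 proof (rule inj_onI)
  fix s t assume h: "s : {0..<2}" "t : {0..<2}" "half_loop s = half_loop t"
  have aux: False if "u <= 1" "1 < v" "v < 2" "0 <= u" "half_loop u = half_loop v" for u v :: real
  proof -
   have e: "cis (pi * u) = of_real (2 * v - 3)" using that by (simp add: half_loop_def)
   hence "cmod (of_real (2 * v - 3)) = 1" by (metis norm_cis)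
   hence "\<bar>2 * v - 3\<bar> = 1" by (simp only: norm_of_real)
   thus False using that by linarith
  qed
  show "s = t"
  proof (cases "s <= 1"; cases "t <= 1")
   assume "s <= 1" "t <= 1"
   hence "cis (pi * s) = cis (pi * t)" using h by (simp add: half_loop_def)
   moreover have "pi * s < 2 * pi" "pi * t < 2 * pi" using h by auto
   ultimately have "pi * s = pi * t" using h by (intro cis_inj) auto
   thus ?thesis by simp
  next
   assume "\<not> s <= 1" "\<not> t <= 1"
   hence "complex_of_real (2 * s - 3) = complex_of_real (2 * t - 3)" using h by (simp add: half_loop_def)
   hence "2 * s - 3 = 2 * t - 3" by (simp only: of_real_eq_iff)
   thus ?thesis by simp
  qed (use aux[of s t] aux[of t s] h in auto)
 qed
 moreover have "continuous_on {0..2} half_loop"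
 proof -
  have "continuous_on ({0..1} \<union> {1..2}) half_loop"
   unfolding half_loop_def
   by (intro continuous_on_If) (auto intro!: continuous_intros simp: cis_conv_exp)
  moreover have "{0..1} \<union> {1..2} = {0..2::real}" by auto
  ultimately show ?thesis by simp
 qed
 moreover have "compact half_disc" unfolding half_disc_def
  by (intro compact_Int_closed compact_cball closed_Collect_le continuous_intros)
 moreover have "convex half_disc"
 proof -
  have "{z. 0 <= Im z} = {z. inner \<i> z \<ge> 0}" by (auto simp: inner_complex_def)
  hence "convex {z. 0 <= Im z}" using convex_halfspace_ge[of 0 \<i>] by simp
  thus ?thesis unfolding half_disc_def by (simp add: convex_Int)
 qed
 moreover have "\<i>/2 : interior half_disc" unfolding interior_half_disc by (simp add: norm_divide)
 ultimately show ?thesis unfolding disc_model_def by (auto simp: half_loop_def)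
qed

lemma disc_model_neg_half: "disc_model (uminus ` half_disc) 2 (\<lambda>t. - half_loop t)"
proof -
 have i: "interior (uminus ` half_disc) = uminus ` interior half_disc"
  by (rule interior_negations)
 have f: "frontier (uminus ` half_disc) = uminus ` frontier half_disc"
  unfolding frontier_def i
  by (simp add: image_set_diff inj_on_def closure_injective_linear_image[OF bounded_linear.linear[OF bounded_linear_minus[OF bounded_linear_ident]]])
 have "continuous_on {0..2} (\<lambda>t. - half_loop t)"
  using disc_model_half by (auto simp: disc_model_def intro: continuous_on_minus)
 thus ?thesis using disc_model_half
  unfolding disc_model_def i f by (auto simp: compact_negations convex_negations inj_on_def image_image[symmetric])
qed

text \<open>Gives the first half of a loop of period \<open>2\<close> to \<open>a\<close> letters
  and the second half to \<open>b\<close> letters.\<close>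

definition pl :: "real => real => real => real" where
 "pl a b t = (if t <= a then t / a else 1 + (t - a) / b)"

lemma disc_model_pl:
 assumes "disc_model D 2 \<beta>" "0 < a" "0 < b"
 shows "disc_model D (a + b) (\<beta> \<circ> pl a b)"
proof (rule disc_model_reparam[OF assms(1)])
 show "continuous_on {0..a+b} (pl a b)"
 proof -
  have "continuous_on ({0..a} \<union> {a..a+b}) (pl a b)"
   unfolding pl_def using assms by (intro continuous_on_If) (auto intro!: continuous_intros)
  moreover have "{0..a} \<union> {a..a+b} = {0..a+b}" using assms by auto
  ultimately show ?thesis by simp
 qed
 show "strict_mono_on {0..a+b} (pl a b)"
 proof (rule strict_mono_onI)
  fix r s :: real assume "r < s"
  consider "s <= a" | "r <= a" "a < s" | "a < r" using \<open>r < s\<close> by linarith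
  thus "pl a b r < pl a b s"
  proof cases
   case 2
   hence "r / a <= 1" "0 < (s-a)/b" using assms by auto
   thus ?thesis using 2 by (auto simp: pl_def)
  qed (use \<open>r < s\<close> assms in \<open>auto simp: pl_def divide_strict_right_mono\<close>)
 qed
qed (use assms in \<open>auto simp: pl_def\<close>)

lemma disc_model_std:
 assumes "0 < n"
 shows "disc_model (cball 0 1) n (\<lambda>t. cis (2 * pi * t / n))"
proof -
 have "disc_model (cball 0 1) n ((\<lambda>t. cis (pi * t)) \<circ> (\<lambda>t. 2 * t / n))"
  by (rule disc_model_reparam[OF disc_model_circle])
   (use assms in \<open>auto intro!: continuous_intros strict_mono_onI simp: divide_strict_right_mono\<close>)
 thus ?thesis by (simp add: o_def mult.assoc mult.left_commute)
qed

section \<open>Realizations of systems of boundary words\<close>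

text \<open>
 A dart is an ordered pair; reversing the pair reverses the dart.  Only the pairing matters: the
 end points of a dart in a surface are prescribed by a separate labelling \<open>s\<close>.
\<close>

definition letters :: "'l list set => 'l set" where
 "letters W = \<Union> (set ` W)"

text \<open>In the second clause \<open>t\<close> is interior while \<open>t'\<close> runs over the
  closed interval; thus the clause also keeps vertices off the interiors of edges, see
  \<open>edge_interior_not_vertex\<close>.\<close>

definition edge_system :: "'b::topological_space set => ('a \<times> 'a => 'v) => ('a \<times> 'a) set => ('a \<times> 'a => real => 'b) => bool" where
 "edge_system S s L gm \<longleftrightarrow>
   (\<forall>d\<in>L. continuous_on {0..1} (gm d) & gm d ` {0..1} <= S & (\<forall>t\<in>{0..1}. gm (rv d) t = gm d (1 - t))) &
   (\<forall>d\<in>L. \<forall>d'\<in>L. \<forall>t\<in>{0<..<1}. \<forall>t'\<in>{0..1}. gm d t = gm d' t' -->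
    d' = d & t' = t \<or> d' = rv d & t' = 1 - t) &
   (\<forall>d\<in>L. \<forall>d'\<in>L. gm d 0 = gm d' 0 \<longleftrightarrow> s d = s d')"

definition face_map :: "'b::topological_space set => ('l => real => 'b) => 'l list => complex set => (real => complex) => (complex => 'b) => bool" where
 "face_map S gm w D \<beta> \<Phi> \<longleftrightarrow> continuous_on D \<Phi> & \<Phi> ` D <= S &
   (\<forall>k<length w. \<forall>t\<in>{0..1}. \<Phi> (\<beta> (real k + t)) = gm (w ! k) t)"

text \<open>The disc and its boundary loop may vary with the word, so that half discs and squares
  can be used where they are convenient. The faces are embedded and disjoint on their interiors;
  covering \<open>S\<close> is not demanded, since only embeddings of the edge graph are read
  off.\<close>

definition realizes_on ::
 "('l list => complex set) => ('l list => real => complex) => 'b::topological_space set => ('l => 'v) => ('l::type) list set =>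
  ('l => real => 'b) => ('l list => complex => 'b) => bool" where
 "realizes_on D \<beta> S s W gm \<Phi> \<longleftrightarrow>
   (\<forall>w\<in>W. face_map S gm w (D w) (\<beta> w) (\<Phi> w)) &
   (\<forall>w\<in>W. \<forall>w'\<in>W. \<forall>z\<in>interior (D w). \<forall>z'\<in>interior (D w'). \<Phi> w z = \<Phi> w' z' --> w = w' & z = z') &
   (\<forall>w\<in>W. \<forall>z\<in>interior (D w). \<forall>d\<in>letters W. \<Phi> w z ~: gm d ` {0..1})"

definition std_loop :: "'l list => real => complex" where
 "std_loop w t = cis (2 * pi * t / length w)"

definition realizes :: "'b::topological_space set => ('a \<times> 'a => 'v) => ('a \<times> 'a) list set => bool" where
 "realizes S s W \<longleftrightarrow>
   (\<exists>gm \<Phi>. edge_system S s (letters W) gm & realizes_on (\<lambda>_. cball 0 1) std_loop S s W gm \<Phi>)"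

lemma realizes_on_transfer:
 assumes "realizes_on D \<beta> S s W gm \<Phi>"
  and "\<And>w. w : W ==> disc_model (D w) (length w) (\<beta> w)"
  and "\<And>w. w : W ==> disc_model (D' w) (length w) (\<beta>' w)"
 shows "\<exists>\<Phi>'. realizes_on D' \<beta>' S s W gm \<Phi>'"
proof -
 have "\<forall>w\<in>W. \<exists>H. continuous_on (D' w) H & inj_on H (D' w) & H ` D' w = D w & H ` interior (D' w) = interior (D w) &
   (\<forall>t\<in>{0..real (length w)}. H (\<beta>' w t) = \<beta> w t)"
 proof
  fix w assume w: "w : W"
  show "\<exists>H. continuous_on (D' w) H & inj_on H (D' w) & H ` D' w = D w & H ` interior (D' w) = interior (D w) &
   (\<forall>t\<in>{0..real (length w)}. H (\<beta>' w t) = \<beta> w t)"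
   by (rule disc_model_transfer[OF assms(3)[OF w] assms(2)[OF w]]) auto
 qed
 then obtain H where H: "\<And>w. w : W ==> continuous_on (D' w) (H w) & inj_on (H w) (D' w) & H w ` D' w = D w &
   H w ` interior (D' w) = interior (D w) & (\<forall>t\<in>{0..real (length w)}. H w (\<beta>' w t) = \<beta> w t)"
  by metis
 let ?F = "\<lambda>w z. \<Phi> w (H w z)"
 have "face_map S gm w (D' w) (\<beta>' w) (?F w)" if w: "w : W" for w
 proof -
  have f: "face_map S gm w (D w) (\<beta> w) (\<Phi> w)" using assms(1) w by (auto simp: realizes_on_def)
  have "continuous_on (D' w) (?F w)"
   by (rule continuous_on_compose2[of "D w" "\<Phi> w"]) (use H[OF w] f in \<open>auto simp: face_map_def\<close>)
  moreover have "?F w ` D' w <= S" using f H[OF w] unfolding face_map_def by blast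
  moreover have "?F w (\<beta>' w (real k + t)) = gm (w ! k) t" if "k < length w" "t : {0..1}" for k t
  proof -
   have "real k + t <= real k + 1" "real k + 1 <= real (length w)" using that by auto
   hence "real k + t : {0..length w}" using that by auto
   thus ?thesis using f H[OF w] that by (auto simp: face_map_def)
  qed
  ultimately show ?thesis by (auto simp: face_map_def)
 qed
 moreover have "w = w' & z = z'"
  if h: "w : W" "w' : W" "z : interior (D' w)" "z' : interior (D' w')" "?F w z = ?F w' z'" for w w' z z'
 proof -
  have "H w z : interior (D w)" "H w' z' : interior (D w')" using H h by blast+
  hence e: "w = w'" "H w z = H w' z'" using assms(1) h by (auto simp: realizes_on_def)
  moreover have "z : D' w" "z' : D' w" using h e interior_subset by auto
  ultimately show ?thesis using H[OF h(1)] by (auto simp: inj_on_def)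
 qed
 moreover have "?F w z ~: gm d ` {0..1}" if "w : W" "z : interior (D' w)" "d : letters W" for w z d
 proof -
  have "H w z : interior (D w)" using H that by blast
  thus ?thesis using assms(1) that unfolding realizes_on_def by blast
 qed
 ultimately have "realizes_on D' \<beta>' S s W gm ?F" unfolding realizes_on_def by blast
 thus ?thesis by blast
qed

text \<open>Each word may be given whichever model disc suits the construction at hand.\<close>

lemma realizes_iff_models:
 assumes "\<And>w. w : W ==> disc_model (D w) (length w) (\<beta> w)"
 shows "realizes S s W \<longleftrightarrow> (\<exists>gm \<Phi>. edge_system S s (letters W) gm & realizes_on D \<beta> S s W gm \<Phi>)"
proof -
 have std: "disc_model (cball 0 1) (length w) (std_loop w)" if "w : W" for w
 proof -
  have "0 < real (length w)" using assms[OF that] by (simp add: disc_model_def)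
  hence "disc_model (cball 0 1) (length w) (\<lambda>t. cis (2 * pi * t / length w))" by (rule disc_model_std)
  thus ?thesis by (simp add: std_loop_def[abs_def])
 qed
 have "(\<exists>\<Phi>. realizes_on (\<lambda>_. cball 0 1) std_loop S s W gm \<Phi>) \<longleftrightarrow> (\<exists>\<Phi>. realizes_on D \<beta> S s W gm \<Phi>)" for gm
  using realizes_on_transfer[of "\<lambda>_. cball 0 1" std_loop S s W gm _ D \<beta>]
   realizes_on_transfer[of D \<beta> S s W gm _ "\<lambda>_. cball 0 1" std_loop] assms std by blast
 thus ?thesis unfolding realizes_def by blast
qed

lemma edge_system_mono: "edge_system S s L gm ==> L' <= L ==> edge_system S s L' gm"
 unfolding edge_system_def by (meson subsetD)

lemma edge_interior_not_vertex:
 assumes "edge_system S s L gm" "d : L" "d' : L" "rv d' : L" "t : {0<..<1}"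
 shows "gm d t ~= gm d' 0"
proof
 assume h: "gm d t = gm d' 0"
 have "gm (rv d') 1 = gm d' (1 - 1)" using assms unfolding edge_system_def by (metis atLeastAtMost_iff order_refl zero_le_one)
 hence "d' = d & 0 = t \<or> d' = rv d & 0 = 1 - t"
  using assms h unfolding edge_system_def by (metis atLeastAtMost_iff order_refl zero_le_one)
 thus False using assms(5) by auto
qed

text \<open>Serves twice: for a chord that cuts a face and for a radius that ends inside a
  face.\<close>

lemma edge_system_insert:
 assumes E: "edge_system S s L gm" and L: "rv ` L <= L"
  and c: "c ~: L" "rv c ~: L" "rv c ~= c"
  and g: "continuous_on {0..1} g" "g ` {0..1} <= S"
  and inj: "\<And>t t'. t : {0<..<1} ==> t' : {0..1} ==> g t = g t' ==> t = t'"
  and disj: "\<And>t d. t : {0<..<1} ==> d : L ==> g t ~: gm d ` {0..1}"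
  and ends: "\<And>t d. t : {0<..<1} ==> d : L ==> gm d t ~= g 0 & gm d t ~= g 1"
  and v: "\<And>d. d : L ==> g 0 = gm d 0 \<longleftrightarrow> s c = s d" "\<And>d. d : L ==> g 1 = gm d 0 \<longleftrightarrow> s (rv c) = s d"
   "g 0 = g 1 \<longleftrightarrow> s c = s (rv c)"
 shows "edge_system S s (insert c (insert (rv c) L)) (gm(c := g, rv c := \<lambda>t. g (1 - t)))"
  (is "edge_system S s ?L ?gm")
proof -
 have sw: "rv d : L" if "d : L" for d using L that by blast
 have old: "?gm d = gm d" if "d : L" for d using that c by auto
 have gc: "?gm c = g" "?gm (rv c) = (\<lambda>t. g (1 - t))" using c by auto
 have r: "(\<lambda>t. 1 - t) ` {0..1} = {0..1::real}" by force
 have grev: "continuous_on {0..1} (\<lambda>t. g (1 - t))" "(\<lambda>t. g (1 - t)) ` {0..1} <= S"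
  using continuous_on_compose2[OF g(1) continuous_on_diff[OF continuous_on_const[of "{0..1}" 1] continuous_on_id]] g(2) r by auto
 have sc: "rv d ~= c" "rv d ~= rv c" "d ~= c" "d ~= rv c" if "d : L" for d
  using sw[OF that] that c by auto
 have A: "continuous_on {0..1} (?gm d) & ?gm d ` {0..1} <= S & (\<forall>t\<in>{0..1}. ?gm (rv d) t = ?gm d (1 - t))"
  if dd: "d : ?L" for d
 proof -
  consider "d = c" | "d = rv c" | "d : L" using dd by blast
  thus ?thesis
  proof cases
   case 1 thus ?thesis using g gc by simp
  next
   case 2 thus ?thesis using g gc grev c(3) by simp
  next
   case 3
   hence "?gm (rv d) = gm (rv d)" "?gm d = gm d" using sc sw by simp_all
   thus ?thesis using E 3 by (simp add: edge_system_def)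
  qed
 qed
 have gi: "g t ~= gm d t'" if "t : {0<..<1}" "d : L" "t' : {0..1}" for t d t' using disj[OF that(1,2)] that(3) by blast
 have gend: "gm d t ~= g t'" if "t : {0<..<1}" "d : L" "t' : {0..1}" for t d t'
 proof (cases "t' : {0<..<1}")
  case True thus ?thesis using gi[of t' d t] that by force
 next
  case False
  hence "t' = 0 \<or> t' = 1" using that by auto
  thus ?thesis using ends[OF that(1,2)] by auto
 qed
 have B: "d' = d & t' = t \<or> d' = rv d & t' = 1 - t"
  if h: "d : ?L" "d' : ?L" "t : {0<..<1}" "t' : {0..1}" "?gm d t = ?gm d' t'" for d d' t t'
 proof -
  have t1: "1 - t : {0<..<1}" "1 - t' : {0..1}" using h by auto
  have d3: "d = c \<or> d = rv c \<or> d : L" "d' = c \<or> d' = rv c \<or> d' : L" using h by auto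
  consider "d : L" "d' : L" | "d : L" "d' = c" | "d : L" "d' = rv c" | "d = c" "d' : L" | "d = rv c" "d' : L"
   | "d = c" "d' = c" | "d = c" "d' = rv c" | "d = rv c" "d' = c" | "d = rv c" "d' = rv c"
   using d3 by blast
  thus ?thesis
  proof cases
   case 1
   hence "gm d t = gm d' t'" using h(5) old by simp
   thus ?thesis using E 1 h(3,4) unfolding edge_system_def by blast
  next
   case 2 thus ?thesis using gend[of t d t'] old[of d] gc h by simp
  next
   case 3 thus ?thesis using gend[of t d "1 - t'"] t1 old[of d] gc h by simp
  next
   case 4 thus ?thesis using gi[of t d' t'] old[of d'] gc h by simp
  next
   case 5 thus ?thesis using gi[of "1 - t" d' t'] t1 old[of d'] gc h by simp
  next
   case 6 thus ?thesis using inj[of t t'] gc h by simp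
  next
   case 7 thus ?thesis using inj[of t "1 - t'"] t1 gc h by simp
  next
   case 8 thus ?thesis using inj[of "1 - t" t'] t1 gc h by simp
  next
   case 9 thus ?thesis using inj[of "1 - t" "1 - t'"] t1 gc h by simp
  qed
 qed
 have C: "?gm d 0 = ?gm d' 0 \<longleftrightarrow> s d = s d'" if h: "d : ?L" "d' : ?L" for d d'
 proof -
  have v': "gm d 0 = g 0 \<longleftrightarrow> s d = s c" "gm d 0 = g 1 \<longleftrightarrow> s d = s (rv c)" if "d : L" for d
   using v(1)[OF that] v(2)[OF that] by metis+
  have v3: "g 1 = g 0 \<longleftrightarrow> s (rv c) = s c" using v(3) by metis
  have g_end: "?gm c 0 = g 0" "?gm (rv c) 0 = g 1" using gc by simp_all
  have "gm d 0 = gm d' 0 \<longleftrightarrow> s d = s d'" if "d : L" "d' : L" using E that by (simp add: edge_system_def)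
  moreover have "d = c \<or> d = rv c \<or> d : L" "d' = c \<or> d' = rv c \<or> d' : L" using h by blast+
  ultimately show ?thesis using v v' v3 g_end old by (elim disjE) metis+
 qed
 show ?thesis unfolding edge_system_def
 proof (intro conjI ballI impI)
  fix d d' and t t' :: real
  assume "d : ?L" "d' : ?L" "t : {0<..<1}" "t' : {0..1}" "?gm d t = ?gm d' t'"
  thus "d' = d & t' = t \<or> d' = rv d & t' = 1 - t" by (rule B)
 qed (use A C in blast)+
qed

lemma edge_system_relabel:
 assumes "\<And>d d'. d : L ==> d' : L ==> s d = s d' \<longleftrightarrow> s' d = s' d'"
 shows "edge_system S s L gm \<longleftrightarrow> edge_system S s' L gm"
 unfolding edge_system_def using assms by (auto simp: Ball_def)

lemma realizes_relabel:
 assumes "\<And>d d'. d : letters W ==> d' : letters W ==> s d = s d' \<longleftrightarrow> s' d = s' d'"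
 shows "realizes S s W \<longleftrightarrow> realizes S s' W"
 unfolding realizes_def realizes_on_def using edge_system_relabel[of "letters W" s s' S] assms by simp

lemma realizes_rename:
 assumes R: "realizes S s W" and W: "W = map \<theta> ` W'"
  and inj: "inj_on \<theta> (letters W')" and sw: "\<And>d. d : letters W' ==> rv d : letters W' & \<theta> (rv d) = rv (\<theta> d)"
 shows "realizes S (s \<circ> \<theta>) W'"
proof -
 obtain gm \<Phi> where E: "edge_system S s (letters W) gm" and F: "realizes_on (\<lambda>_. cball 0 1) std_loop S s W gm \<Phi>"
  using R by (auto simp: realizes_def)
 have L: "\<theta> d : letters W" if "d : letters W'" for d using that W by (auto simp: letters_def)
 have inj': "w = w'" if "w : W'" "w' : W'" "map \<theta> w = map \<theta> w'" for w w'
 proof (rule map_inj_on[OF that(3)])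
  show "inj_on \<theta> (set w \<union> set w')" by (rule inj_on_subset[OF inj]) (use that in \<open>auto simp: letters_def\<close>)
 qed
 have B: "d' = d & t' = t \<or> d' = rv d & t' = 1 - t"
  if h: "d : letters W'" "d' : letters W'" "t : {0<..<1}" "t' : {0..1}" "gm (\<theta> d) t = gm (\<theta> d') t'" for d d' t t'
 proof -
  have "\<theta> d' = \<theta> d & t' = t \<or> \<theta> d' = rv (\<theta> d) & t' = 1 - t"
   using E L[OF h(1)] L[OF h(2)] h(3-5) unfolding edge_system_def by blast
  thus ?thesis using inj sw h(1,2) by (metis inj_onD)
 qed
 have "edge_system S (s \<circ> \<theta>) (letters W') (\<lambda>d. gm (\<theta> d))"
  unfolding edge_system_def
 proof (intro conjI ballI)
  fix d t assume d: "d : letters W'" and t: "t : {0..1::real}"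
  show "gm (\<theta> (rv d)) t = gm (\<theta> d) (1 - t)" using E L[OF d] sw[OF d] t by (auto simp: edge_system_def)
 qed (use E L B in \<open>auto simp: edge_system_def\<close>)
 moreover have "realizes_on (\<lambda>_. cball 0 1) std_loop S (s \<circ> \<theta>) W' (\<lambda>d. gm (\<theta> d)) (\<lambda>w. \<Phi> (map \<theta> w))"
  unfolding realizes_on_def
 proof (intro conjI ballI)
  fix w assume w: "w : W'"
  hence "face_map S gm (map \<theta> w) (cball 0 1) (std_loop (map \<theta> w)) (\<Phi> (map \<theta> w))"
   using F W by (auto simp: realizes_on_def)
  thus "face_map S (\<lambda>d. gm (\<theta> d)) w (cball 0 1) (std_loop w) (\<Phi> (map \<theta> w))"
   by (auto simp: face_map_def std_loop_def)
 next
  fix w w' and z z' :: complex assume h: "w : W'" "w' : W'" "z : interior (cball 0 1)" "z' : interior (cball 0 1)"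
  show "\<Phi> (map \<theta> w) z = \<Phi> (map \<theta> w') z' --> w = w' & z = z'"
   using F h inj'[OF h(1,2)] W unfolding realizes_on_def by blast
 next
  fix w d and z :: complex assume h: "w : W'" "z : interior (cball 0 1)" "d : letters W'"
  show "\<Phi> (map \<theta> w) z ~: gm (\<theta> d) ` {0..1}" using F h L[OF h(3)] W unfolding realizes_on_def by blast
 qed
 ultimately show ?thesis unfolding realizes_def by blast
qed

section \<open>Three moves on faces: change of base point, cutting along a chord, pendant
  edges\<close>

lemma letters_insert [simp]: "letters (insert w W) = set w \<union> letters W"
 by (simp add: letters_def)

lemma new_word: "set w \<inter> letters W = {} ==> w ~= [] ==> w ~: W"
 unfolding letters_def by (cases w) auto

text \<open>Precomposing the face map with the rotation by the angle of \<open>length x\<close>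
  letters moves the base point of the loop from the start of \<open>x\<close> to the start of
  \<open>y\<close>.\<close>

lemma realizes_rotate_imp:
 assumes R: "realizes S s (insert (x @ y) W)" and W: "set (x @ y) \<inter> letters W = {}" "x @ y ~= []"
 shows "realizes S s (insert (y @ x) W)"
proof -
 obtain gm \<Phi> where E: "edge_system S s (letters (insert (x @ y) W)) gm"
  and F: "realizes_on (\<lambda>_. cball 0 1) std_loop S s (insert (x @ y) W) gm \<Phi>"
  using R by (auto simp: realizes_def)
 have lets: "letters (insert (y @ x) W) = letters (insert (x @ y) W)" by auto
 have nW: "y @ x ~: W" "x @ y ~: W"
  using new_word[of "y @ x" W] new_word[of "x @ y" W] W by auto
 define n where "n = length (x @ y)"
 have n: "0 < n" using W(2) by (simp add: n_def)
 define \<omega> where "\<omega> = cis (2 * pi * length x / n)"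
 have [simp]: "cmod \<omega> = 1" by (simp add: \<omega>_def)
 have w0: "\<omega> ~= 0" by (simp add: \<omega>_def)
 define \<Phi>' where "\<Phi>' = \<Phi>(y @ x := \<lambda>z. \<Phi> (x @ y) (\<omega> * z))"
 have f: "face_map S gm (x @ y) (cball 0 1) (std_loop (x @ y)) (\<Phi> (x @ y))" using F by (auto simp: realizes_on_def)
 have f1: "face_map S gm (y @ x) (cball 0 1) (std_loop (y @ x)) (\<lambda>z. \<Phi> (x @ y) (\<omega> * z))"
  unfolding face_map_def
 proof (intro conjI allI impI ballI)
  show "continuous_on (cball 0 1) (\<lambda>z. \<Phi> (x @ y) (\<omega> * z))"
   by (rule continuous_on_compose2[of "cball 0 1" "\<Phi> (x @ y)"])
    (use f in \<open>auto simp: face_map_def norm_mult intro!: continuous_intros\<close>)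
  show "(\<lambda>z. \<Phi> (x @ y) (\<omega> * z)) ` cball 0 1 <= S" using f by (auto simp: face_map_def norm_mult image_subset_iff)
  fix k t assume k: "k < length (y @ x)" and t: "t : {0..1::real}"
  have m: "\<omega> * std_loop (y @ x) (real k + t) = cis (2 * pi * (length x + (k + t)) / n)"
   unfolding \<omega>_def std_loop_def cis_mult n_def by (simp add: add_divide_distrib distrib_left add.commute)
  show "\<Phi> (x @ y) (\<omega> * std_loop (y @ x) (real k + t)) = gm ((y @ x) ! k) t"
  proof (cases "k < length y")
   case True
   have "\<omega> * std_loop (y @ x) (real k + t) = std_loop (x @ y) (real (length x + k) + t)"
    unfolding m by (simp add: std_loop_def n_def add.assoc)
   moreover have "\<Phi> (x @ y) (std_loop (x @ y) (real (length x + k) + t)) = gm ((x @ y) ! (length x + k)) t"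
    using f True t unfolding face_map_def by (metis add_less_cancel_left length_append)
   ultimately show ?thesis using True by (simp add: nth_append)
  next
   case False
   then obtain k' where k': "k = length y + k'" "k' < length x"
    using k by (metis add_less_cancel_left length_append le_iff_add linorder_not_less)
   \<comment> \<open>Beyond \<open>y\<close> the rotated parameter has passed a whole period and
     re-enters \<open>x\<close> after a full turn.\<close>
   have "2 * pi * (length x + (k + t)) / n = 2 * pi + 2 * pi * (k' + t) / n"
   proof -
    have e: "length x + (k + t) = n + (k' + t)" by (simp add: k' n_def)
    show ?thesis unfolding e using n by (simp add: add_divide_distrib distrib_left)
   qed
   hence "\<omega> * std_loop (y @ x) (real k + t) = std_loop (x @ y) (real k' + t)"
    unfolding m by (simp add: std_loop_def n_def flip: cis_mult)
   moreover have "\<Phi> (x @ y) (std_loop (x @ y) (real k' + t)) = gm ((x @ y) ! k') t"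
    using f k' t unfolding face_map_def by (metis length_append trans_less_add1)
   ultimately show ?thesis using k' by (simp add: nth_append)
  qed
 qed
 have f2: "face_map S gm w (cball 0 1) (std_loop w) (\<Phi>' w)" if "w : W" for w
 proof -
  have "w ~= y @ x" using that nW by auto
  thus ?thesis using F that by (auto simp: realizes_on_def \<Phi>'_def)
 qed
 define u where "u = (\<lambda>w. if w = y @ x then x @ y else w)"
 define q where "q = (\<lambda>w z. if w = y @ x then \<omega> * z else z)"
 have u: "u w : insert (x @ y) W" "\<Phi>' w z = \<Phi> (u w) (q w z)" "q w z : ball 0 1 \<longleftrightarrow> z : ball 0 1"
  if "w : insert (y @ x) W" for w z
  using that by (auto simp: u_def q_def \<Phi>'_def norm_mult)
 have uq: "w = w' & z = z'" if "w : insert (y @ x) W" "w' : insert (y @ x) W" "u w = u w'" "q w z = q w' z'" for w w' z z'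
  using that w0 nW by (auto simp: u_def q_def split: if_splits)
 have "realizes_on (\<lambda>_. cball 0 1) std_loop S s (insert (y @ x) W) gm \<Phi>'"
  unfolding realizes_on_def lets
 proof (intro conjI ballI impI)
  fix w assume w: "w : insert (y @ x) W"
  show "face_map S gm w (cball 0 1) (std_loop w) (\<Phi>' w)"
  proof (cases "w = y @ x")
   case True
   thus ?thesis using f1 by (simp add: \<Phi>'_def)
  qed (use w f2 in blast)
 next
  fix w w' and z z' :: complex assume h: "w : insert (y @ x) W" "w' : insert (y @ x) W" "z : interior (cball 0 1)"
   "z' : interior (cball 0 1)" "\<Phi>' w z = \<Phi>' w' z'"
  have inj: "v = v' & a = a'" if "v : insert (x @ y) W" "v' : insert (x @ y) W" "a : ball 0 1" "a' : ball 0 1"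
    "\<Phi> v a = \<Phi> v' a'" for v v' a a'
   using F that unfolding realizes_on_def interior_cball by blast
  have "u w = u w' & q w z = q w' z'"
   by (rule inj) (use h u[OF h(1)] u[OF h(2)] in \<open>simp_all only: interior_cball\<close>)
  thus "w = w'" "z = z'" using uq[OF h(1,2)] by auto
 next
  fix w d and z :: complex assume h: "w : insert (y @ x) W" "z : interior (cball 0 1)" "d : letters (insert (x @ y) W)"
  thus "\<Phi>' w z ~: gm d ` {0..1}"
   using F u(1)[OF h(1)] u(2,3)[OF h(1), of z] unfolding realizes_on_def interior_cball by metis
 qed
 thus ?thesis using E lets unfolding realizes_def by metis
qed

lemma realizes_rotate:
 assumes "set (x @ y) \<inter> letters W = {}"
 shows "realizes S s (insert (x @ y) W) \<longleftrightarrow> realizes S s (insert (y @ x) W)"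
 using realizes_rotate_imp[of S s x y W] realizes_rotate_imp[of S s y x W] assms by (cases "x @ y = []") auto

lemma pl_lo: "0 <= u ==> u <= a ==> pl a b u = u / a"
 by (simp add: pl_def)

lemma pl_hi: "0 < a ==> 0 <= u ==> pl a b (a + u) = 1 + u / b"
 by (auto simp: pl_def)

lemma face_map_append:
 "face_map S gm (x @ y) D \<beta> \<Phi> \<longleftrightarrow> continuous_on D \<Phi> & \<Phi> ` D <= S &
   (\<forall>k<length x. \<forall>t\<in>{0..1}. \<Phi> (\<beta> (real k + t)) = gm (x ! k) t) &
   (\<forall>k<length y. \<forall>t\<in>{0..1}. \<Phi> (\<beta> (real (length x) + (real k + t))) = gm (y ! k) t)"
proof -
 have "(\<forall>k<length (x @ y). P k ((x @ y) ! k)) \<longleftrightarrow>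
   (\<forall>k<length x. P k (x ! k)) & (\<forall>k<length y. P (length x + k) (y ! k))" for P
 proof (intro iffI conjI allI impI)
  fix k assume "(\<forall>k<length x. P k (x ! k)) & (\<forall>k<length y. P (length x + k) (y ! k))" "k < length (x @ y)"
  thus "P k ((x @ y) ! k)"
   by (cases "k < length x") (auto simp: nth_append dest: spec[of _ "k - length x"])
 next
  fix k assume h: "\<forall>k<length (x @ y). P k ((x @ y) ! k)"
  show "P k (x ! k)" if "k < length x" using h[rule_format, of k] that by (simp add: nth_append)
  show "P (length x + k) (y ! k)" if "k < length y" using h[rule_format, of "length x + k"] that by simp
 qed
 from this[of "\<lambda>k d. \<forall>t\<in>{0..1}. \<Phi> (\<beta> (real k + t)) = gm d t"] show ?thesis
  unfolding face_map_def by (simp add: add.assoc)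
qed

lemma half_loop_lo: "0 <= u ==> u <= 1 ==> half_loop u = cis (pi * u)"
 by (simp add: half_loop_def)

lemma half_loop_hi: "0 <= u ==> half_loop (1 + u) = complex_of_real (2 * u - 1)"
 by (auto simp: half_loop_def)

lemma nat_step_bounds:
 assumes "k < n" "t : {0..1::real}"
 shows "0 <= (real k + t) / real n" "(real k + t) / real n <= 1" "0 <= real k + t" "real k + t <= real n" "0 < real n"
proof -
 have "real k + 1 <= real n" using assms(1) by linarith
 thus "0 <= (real k + t) / real n" "(real k + t) / real n <= 1" "0 <= real k + t" "real k + t <= real n" "0 < real n"
  using assms by auto
qed

lemma ball_half_cases:
 assumes "z : ball 0 1"
 obtains "z : interior half_disc" | "z : interior (uminus ` half_disc)" | t where "t : {0<..<1}" "z = complex_of_real (2 * t - 1)"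
proof -
 consider "0 < Im z" | "Im z < 0" | "Im z = 0" by linarith
 thus ?thesis
 proof cases
  case 1 thus ?thesis using that(1) assms by (auto simp: interior_half_disc)
 next
  case 2
  hence "- z : interior half_disc" using assms by (auto simp: interior_half_disc)
  hence "z : uminus ` interior half_disc" by force
  thus ?thesis using that(2) by (simp add: interior_negations)
 next
  case 3
  hence z: "z = complex_of_real (Re z)" by (simp add: complex_eq_iff)
  have "\<bar>Re z\<bar> < 1" using assms abs_Re_le_cmod[of z] by auto
  hence "(Re z + 1) / 2 : {0<..<1}" by auto
  moreover have "z = complex_of_real (2 * ((Re z + 1) / 2) - 1)"
   by (subst z) (simp only: of_real_eq_iff, simp add: field_simps)
  ultimately show ?thesis using that(3) by blast
 qed
qed

lemma half_sub: "interior half_disc <= ball 0 1" "interior (uminus ` half_disc) <= ball 0 1"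
 "half_disc <= cball 0 1" "uminus ` half_disc <= cball 0 1" "interior half_disc \<inter> interior (uminus ` half_disc) = {}"
 unfolding interior_negations interior_half_disc by (auto simp: half_disc_def)

lemma half_int_im: "z : interior half_disc ==> 0 < Im z" "z : interior (uminus ` half_disc) ==> Im z < 0"
 unfolding interior_negations by (auto simp: interior_half_disc)

lemma cis_in_half_disc: "0 <= u ==> u <= 1 ==> cis (pi * u) : half_disc"
 by (simp add: half_disc_def sin_ge_zero mult_left_le)

lemma chord_props: "t : {0<..<1} ==> complex_of_real (2 * t - 1) : ball 0 1"
  "t : {0..1} ==> complex_of_real (2 * t - 1) : half_disc"
  "t : {0..1} ==> complex_of_real (2 * t - 1) : uminus ` half_disc"
proof -
 show "t : {0<..<1} ==> complex_of_real (2 * t - 1) : ball 0 1"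
  by (simp add: norm_of_real abs_less_iff del: of_real_diff of_real_mult)
 have h: "complex_of_real x : half_disc" if "\<bar>x\<bar> <= 1" for x
  using that by (simp add: half_disc_def norm_of_real)
 show "t : {0..1} ==> complex_of_real (2 * t - 1) : half_disc" by (rule h) auto
 show "t : {0..1} ==> complex_of_real (2 * t - 1) : uminus ` half_disc"
  using h[of "1 - 2 * t"] by (intro image_eqI[of _ _ "complex_of_real (1 - 2 * t)"]) auto
qed

text \<open>The unit disc is cut along its real diameter, which becomes the dart \<open>c\<close>:
  the upper arc with the diameter reads \<open>x\<close>, \<open>c\<close>, the lower arc with the
  reversed diameter reads \<open>y\<close>, \<open>rv c\<close>. The chord starts where
  \<open>y\<close> starts and ends where \<open>x\<close> starts, which forces the labels of
  \<open>c\<close> and \<open>rv c\<close>. Conversely the two half discs are glued along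
  \<open>c\<close>.\<close>

lemma realizes_split:
 fixes c :: "'a \<times> 'a" and S :: "'b::topological_space set"
 assumes xy: "x ~= []" "y ~= []" "set (x @ y) \<inter> letters W = {}"
  and c: "c ~: letters (insert (x @ y) W)" "rv c ~: letters (insert (x @ y) W)" "rv c ~= c"
  and sw: "rv ` letters (insert (x @ y) W) <= letters (insert (x @ y) W)"
  and s: "s c = s (hd y)" "s (rv c) = s (hd x)"
  and W: "[] ~: W"
 shows "realizes S s (insert (x @ y) W) \<longleftrightarrow> realizes S s (insert (x @ [c]) (insert (y @ [rv c]) W))"
proof -
 let ?c = "rv c" and ?L = "letters (insert (x @ y) W)"
 let ?w = "x @ y" and ?u = "x @ [c]" and ?v = "y @ [?c]"
 define W1 where "W1 = insert ?w W"
 define W2 where "W2 = insert ?u (insert ?v W)"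
 define a where "a = real (length x)"
 define b where "b = real (length y)"
 have ab: "0 < a" "0 < b" using xy by (auto simp: a_def b_def)
 have L2: "letters W2 = insert c (insert ?c ?L)" by (auto simp: W2_def)
 have nw: "?w ~: W" using new_word[of ?w W] xy by auto
 have nu: "?u ~: W" "?v ~: W" using c by (auto simp: letters_def)
 have uv: "?u ~= ?v" using c by auto
 define D1 where "D1 = (\<lambda>w::('a\<times>'a) list. cball (0::complex) 1)"
 define \<beta>1 where "\<beta>1 = (\<lambda>w. if w = ?w then (\<lambda>t. cis (pi * t)) \<circ> pl a b else std_loop w)"
 define D2 where "D2 = (\<lambda>w. if w = ?u then half_disc else if w = ?v then uminus ` half_disc else cball 0 1)"
 define \<beta>2 where "\<beta>2 = (\<lambda>w. if w = ?u then half_loop \<circ> pl a 1 else if w = ?v then (\<lambda>t. - half_loop t) \<circ> pl b 1 else std_loop w)"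
 have stdm: "disc_model (cball 0 1) (length w) (std_loop w)" if "w : W" for w :: "('a\<times>'a) list"
 proof -
  have "0 < real (length w)" using that W by auto
  hence "disc_model (cball 0 1) (length w) (\<lambda>t. cis (2 * pi * t / length w))" by (rule disc_model_std)
  thus ?thesis by (simp add: std_loop_def[abs_def])
 qed
 have m1: "disc_model (D1 w) (length w) (\<beta>1 w)" if "w : W1" for w
  using that stdm[of w] disc_model_pl[OF disc_model_circle ab] by (auto simp: W1_def D1_def \<beta>1_def a_def b_def)
 have m2: "disc_model (D2 w) (length w) (\<beta>2 w)" if "w : W2" for w
  using that stdm[of w] disc_model_pl[OF disc_model_half ab(1), of 1] disc_model_pl[OF disc_model_neg_half ab(2), of 1] uv
  by (auto simp: W2_def D2_def \<beta>2_def a_def b_def add.commute)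
 have b2: "\<beta>1 ?w = (\<lambda>t. cis (pi * t)) \<circ> pl a b" "\<beta>2 ?u = half_loop \<circ> pl a 1" "\<beta>2 ?v = (\<lambda>t. - half_loop t) \<circ> pl b 1"
  using uv by (simp_all only: \<beta>1_def \<beta>2_def refl if_True if_False not_sym[OF uv])
 have bu: "\<beta>1 ?w (real k + t) = cis (pi * ((real k + t) / a))" "\<beta>2 ?u (real k + t) = cis (pi * ((real k + t) / a))"
  if "k < length x" "t : {0..1}" for k t
  using nat_step_bounds[OF that] by (simp_all add: b2 pl_lo half_loop_lo a_def)
 have bv: "\<beta>1 ?w (a + (real k + t)) = - cis (pi * ((real k + t) / b))" "\<beta>2 ?v (real k + t) = - cis (pi * ((real k + t) / b))"
  if "k < length y" "t : {0..1}" for k t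
  using nat_step_bounds[OF that] ab
  by (simp_all add: b2 pl_lo pl_hi half_loop_lo b_def distrib_left flip: cis_mult)
 have bc: "\<beta>2 ?u (a + t) = complex_of_real (2 * t - 1)" "\<beta>2 ?v (b + t) = complex_of_real (2 * (1 - t) - 1)"
  if "t : {0..1}" for t
  using that ab by (simp_all add: b2 pl_hi half_loop_hi)
 have fu: "face_map S gm ?u half_disc (\<beta>2 ?u) \<Phi> \<longleftrightarrow> continuous_on half_disc \<Phi> & \<Phi> ` half_disc <= S &
   (\<forall>k<length x. \<forall>t\<in>{0..1}. \<Phi> (cis (pi * ((real k + t) / a))) = gm (x ! k) t) &
   (\<forall>t\<in>{0..1}. \<Phi> (complex_of_real (2 * t - 1)) = gm c t)" for gm and \<Phi> :: "complex => 'b"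
  unfolding face_map_append a_def[symmetric] using bu bc by simp
 have fv: "face_map S gm ?v (uminus ` half_disc) (\<beta>2 ?v) \<Phi> \<longleftrightarrow> continuous_on (uminus ` half_disc) \<Phi> & \<Phi> ` (uminus ` half_disc) <= S &
   (\<forall>k<length y. \<forall>t\<in>{0..1}. \<Phi> (- cis (pi * ((real k + t) / b))) = gm (y ! k) t) &
   (\<forall>t\<in>{0..1}. \<Phi> (complex_of_real (2 * (1 - t) - 1)) = gm ?c t)" for gm and \<Phi> :: "complex => 'b"
  unfolding face_map_append b_def[symmetric] using bv bc by simp
 have fw: "face_map S gm ?w (cball 0 1) (\<beta>1 ?w) \<Phi> \<longleftrightarrow> continuous_on (cball 0 1) \<Phi> & \<Phi> ` cball 0 1 <= S &
   (\<forall>k<length x. \<forall>t\<in>{0..1}. \<Phi> (cis (pi * ((real k + t) / a))) = gm (x ! k) t) &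
   (\<forall>k<length y. \<forall>t\<in>{0..1}. \<Phi> (- cis (pi * ((real k + t) / b))) = gm (y ! k) t)" for gm and \<Phi> :: "complex => 'b"
  unfolding face_map_append a_def[symmetric] using bu bv by simp
 have D2s: "D2 w = cball 0 1" "\<beta>2 w = std_loop w" "\<beta>1 w = std_loop w" if "w : W" for w
  using that nu nw by (auto simp: D2_def \<beta>2_def \<beta>1_def)
 have D2uv: "D2 ?u = half_disc" "D2 ?v = uminus ` half_disc" using uv by (auto simp: D2_def)
 have intD2: "interior (D2 w) <= ball 0 1" if "w : W2" for w
  using half_sub(1,2) by (auto simp: D2_def)
 have L1: "letters W1 = ?L" by (simp add: W1_def)
 have hdL: "hd x : ?L" "hd y : ?L" using xy by auto
 have swL: "rv d : ?L" if "d : ?L" for d using sw that by blast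
 have first: "realizes S s W2" if R: "realizes S s W1"
 proof -
  obtain gm \<Phi> where E: "edge_system S s ?L gm" and F: "realizes_on D1 \<beta>1 S s W1 gm \<Phi>"
   using R realizes_iff_models[of W1 D1 \<beta>1 S s] m1 L1 by auto
  have Fw: "face_map S gm ?w (cball 0 1) (\<beta>1 ?w) (\<Phi> ?w)" using F by (auto simp: realizes_on_def W1_def D1_def)
  have inj: "w = w' & z = z'" if "w : W1" "w' : W1" "z : ball 0 1" "z' : ball 0 1" "\<Phi> w z = \<Phi> w' z'" for w w' z z'
   using F that unfolding realizes_on_def D1_def by (metis interior_cball)
  have av: "\<Phi> w z ~= gm d t" if "w : W1" "z : ball 0 1" "d : ?L" "t : {0..1}" for w z d t
   using F that unfolding realizes_on_def D1_def L1 by (metis interior_cball image_eqI)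
  define g where "g = (\<lambda>t. \<Phi> ?w (complex_of_real (2 * t - 1)))"
  define gm' where "gm' = gm(c := g, ?c := \<lambda>t. g (1 - t))"
  have g0: "g 0 = gm (hd y) 0"
  proof -
   have "\<Phi> ?w (- cis (pi * ((real 0 + 0) / b))) = gm (y ! 0) 0"
    using Fw xy unfolding fw by (metis atLeastAtMost_iff length_greater_0_conv order_refl zero_le_one)
   thus ?thesis using xy by (simp add: g_def hd_conv_nth)
  qed
  have g1: "g 1 = gm (hd x) 0"
  proof -
   have "\<Phi> ?w (cis (pi * ((real 0 + 0) / a))) = gm (x ! 0) 0"
    using Fw xy unfolding fw by (metis atLeastAtMost_iff length_greater_0_conv order_refl zero_le_one)
   thus ?thesis using xy by (simp add: g_def hd_conv_nth)
  qed
  have wW: "?w : W1" by (simp add: W1_def)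
  have vert: "gm d 0 = gm d' 0 \<longleftrightarrow> s d = s d'" if "d : ?L" "d' : ?L" for d d' using E that by (simp add: edge_system_def)
  have E': "edge_system S s (letters W2) gm'"
   unfolding L2 gm'_def
  proof (rule edge_system_insert[OF E sw c])
   show "continuous_on {0..1} g" unfolding g_def
    by (rule continuous_on_compose2[of "cball 0 1" "\<Phi> ?w"])
     (use Fw chord_props(2) half_sub(3) in \<open>auto simp: fw intro!: continuous_intros\<close>)
   show "g ` {0..1} <= S" using Fw chord_props(2) half_sub(3) unfolding g_def fw by blast
   show "t = t'" if h: "t : {0<..<1}" "t' : {0..1}" "g t = g t'" for t t'
   proof (cases "t' : {0<..<1}")
    case True
    have "complex_of_real (2 * t - 1) = complex_of_real (2 * t' - 1)"
     using inj[OF wW wW chord_props(1)[OF h(1)] chord_props(1)[OF True]] h(3) by (simp add: g_def)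
    thus ?thesis by (simp only: of_real_eq_iff)
   next
    case False
    hence "t' = 0 \<or> t' = 1" using h by auto
    hence "g t' = gm (hd y) 0 \<or> g t' = gm (hd x) 0" using g0 g1 by auto
    thus ?thesis using av[OF wW chord_props(1)[OF h(1)]] hdL h(3) unfolding g_def
     by (metis atLeastAtMost_iff order_refl zero_le_one)
   qed
   show "g t ~: gm d ` {0..1}" if "t : {0<..<1}" "d : ?L" for t d
    using av[OF wW chord_props(1)[OF that(1)] that(2)] unfolding g_def by blast
   show "gm d t ~= g 0 & gm d t ~= g 1" if "t : {0<..<1}" "d : ?L" for t d
    unfolding g0 g1 using edge_interior_not_vertex[OF E that(2) _ _ that(1)] hdL swL by blast
   show "g 0 = gm d 0 \<longleftrightarrow> s c = s d" if "d : ?L" for d unfolding g0 s using vert hdL that by blast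
   show "g 1 = gm d 0 \<longleftrightarrow> s ?c = s d" if "d : ?L" for d unfolding g1 s using vert hdL that by blast
   show "g 0 = g 1 \<longleftrightarrow> s c = s ?c" unfolding g0 g1 s using vert hdL by blast
  qed
  have old: "gm' d = gm d" if "d : ?L" for d using that c by (auto simp: gm'_def)
  have gc: "gm' c = g" "gm' ?c = (\<lambda>t. g (1 - t))" using c by (auto simp: gm'_def)
  define \<Phi>' where "\<Phi>' = \<Phi>(?u := \<Phi> ?w, ?v := \<Phi> ?w)"
  have Phiuv: "\<Phi>' ?u = \<Phi> ?w" "\<Phi>' ?v = \<Phi> ?w" unfolding \<Phi>'_def fun_upd_apply by simp_all
  define u where "u = (\<lambda>w. if w = ?u \<or> w = ?v then ?w else w)"
  have u: "u w : W1" "\<Phi>' w = \<Phi> (u w)" if "w : W2" for w using that by (auto simp: u_def \<Phi>'_def W1_def W2_def)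
  have faces: "face_map S gm' w (D2 w) (\<beta>2 w) (\<Phi>' w)" if "w : W2" for w
  proof -
   have nx: "gm' (x ! k) = gm (x ! k)" if "k < length x" for k using old that by simp
   have ny: "gm' (y ! k) = gm (y ! k)" if "k < length y" for k using old that by simp
   consider "w = ?u" | "w = ?v" | "w : W" using \<open>w : W2\<close> by (auto simp: W2_def)
   thus ?thesis
   proof cases
    case 1
    have "face_map S gm' ?u half_disc (\<beta>2 ?u) (\<Phi> ?w)"
     unfolding fu gc using Fw half_sub(3) nx unfolding fw by (auto simp: g_def intro: continuous_on_subset)
    thus ?thesis unfolding 1 D2uv Phiuv .
   next
    case 2
    have "face_map S gm' ?v (uminus ` half_disc) (\<beta>2 ?v) (\<Phi> ?w)"
     unfolding fv gc
    proof (intro conjI)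
     show "continuous_on (uminus ` half_disc) (\<Phi> ?w)" using Fw half_sub(4) unfolding fw by (blast intro: continuous_on_subset)
     show "\<Phi> ?w ` uminus ` half_disc <= S" using Fw half_sub(4) unfolding fw by blast
    qed (use Fw ny in \<open>auto simp: fw g_def\<close>)
    thus ?thesis unfolding 2 D2uv Phiuv .
   next
    case 3
    have "face_map S gm w (cball 0 1) (std_loop w) (\<Phi> w)" using F 3 D2s(3)[OF 3] unfolding realizes_on_def W1_def D1_def by auto
    moreover have "gm' (w ! k) = gm (w ! k)" if "k < length w" for k
    proof (rule old)
     have "w ! k : letters W" using 3 nth_mem[OF that] unfolding letters_def by blast
     thus "w ! k : ?L" by simp
    qed
    moreover have "w ~= ?u" "w ~= ?v" using 3 nu by auto
    ultimately show ?thesis by (simp add: D2s[OF 3] \<Phi>'_def face_map_def)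
   qed
  qed
  have "realizes_on D2 \<beta>2 S s W2 gm' \<Phi>'"
   unfolding realizes_on_def
  proof (intro conjI ballI impI)
   fix w w' and z z' :: complex assume h: "w : W2" "w' : W2" "z : interior (D2 w)" "z' : interior (D2 w')" "\<Phi>' w z = \<Phi>' w' z'"
   have zb: "z : ball 0 1" "z' : ball 0 1" using h(3,4) intD2[OF h(1)] intD2[OF h(2)] by blast+
   have "u w = u w' & z = z'"
    using inj[OF u(1)[OF h(1)] u(1)[OF h(2)] zb] h(5) u(2)[OF h(1)] u(2)[OF h(2)] by simp
   thus "z = z'" by blast
   show "w = w'"
   proof (rule ccontr)
    assume "w ~= w'"
    hence "w = ?u & w' = ?v \<or> w = ?v & w' = ?u" using \<open>u w = u w' & z = z'\<close> h(1,2) nw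
     by (auto simp: u_def W2_def split: if_splits)
    thus False using h(3,4) \<open>u w = u w' & z = z'\<close> D2uv half_sub(5) by auto
   qed
  next
   fix w d and z :: complex assume h: "w : W2" "z : interior (D2 w)" "d : letters W2"
   have zb: "z : ball 0 1" using h intD2 by blast
   have key: "\<Phi> (u w) z ~= g t" if "t : {0..1}" for t
   proof
    assume e: "\<Phi> (u w) z = g t"
    show False
    proof (cases "t : {0<..<1}")
     case True
     hence "u w = ?w & z = complex_of_real (2 * t - 1)"
      using inj[OF u(1)[OF h(1)] wW zb chord_props(1)[OF True]] e by (simp add: g_def)
     moreover have "u w = ?w ==> w = ?u \<or> w = ?v" using h(1) nw by (auto simp: u_def W2_def split: if_splits)
     ultimately have "Im z = 0" "w = ?u \<or> w = ?v" by auto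
     thus False using h(2) D2uv half_int_im by force
    next
     case False
     hence "t = 0 \<or> t = 1" using that by auto
     hence "g t = gm (hd y) 0 \<or> g t = gm (hd x) 0" using g0 g1 by auto
     thus False using av[OF u(1)[OF h(1)] zb] hdL e by (metis atLeastAtMost_iff order_refl zero_le_one)
    qed
   qed
   have "\<Phi> (u w) z ~= gm' d t" if "t : {0..1}" for t
   proof -
    have "d = c \<or> d = ?c \<or> d : ?L" using h(3) L2 by blast
    thus ?thesis
    proof (elim disjE)
     assume "d = c" thus ?thesis using key[OF that] gc by simp
    next
     assume "d = ?c" thus ?thesis using key[of "1 - t"] that gc by simp
    next
     assume "d : ?L" thus ?thesis using old av[OF u(1)[OF h(1)] zb _ that] by simp
    qed
   qed
   thus "\<Phi>' w z ~: gm' d ` {0..1}" unfolding u(2)[OF h(1)] by blast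
  qed (use faces in blast)
  thus ?thesis using E' realizes_iff_models[of W2 D2 \<beta>2 S s] m2 by blast
 qed
 have second: "realizes S s W1" if R: "realizes S s W2"
 proof -
  obtain gm \<Phi> where E: "edge_system S s (letters W2) gm" and F: "realizes_on D2 \<beta>2 S s W2 gm \<Phi>"
   using R realizes_iff_models[of W2 D2 \<beta>2 S s] m2 by auto
  have E1: "edge_system S s ?L gm" by (rule edge_system_mono[OF E]) (auto simp: L2)
  have Fu: "face_map S gm ?u half_disc (\<beta>2 ?u) (\<Phi> ?u)" and Fv: "face_map S gm ?v (uminus ` half_disc) (\<beta>2 ?v) (\<Phi> ?v)"
   using F D2uv unfolding realizes_on_def W2_def by auto
  have inj: "w = w' & z = z'" if "w : W2" "w' : W2" "z : interior (D2 w)" "z' : interior (D2 w')" "\<Phi> w z = \<Phi> w' z'" for w w' z z'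
   using F that unfolding realizes_on_def by blast
  have av: "\<Phi> w z ~= gm d t" if "w : W2" "z : interior (D2 w)" "d : letters W2" "t : {0..1}" for w z d t
   using F that unfolding realizes_on_def by blast
  have cL: "c : letters W2" "?c : letters W2" by (auto simp: L2)
  have seg: "\<Phi> ?u (complex_of_real (2 * t - 1)) = gm c t" "\<Phi> ?v (complex_of_real (2 * t - 1)) = gm c t" if t: "t : {0..1}" for t
  proof -
   show "\<Phi> ?u (complex_of_real (2 * t - 1)) = gm c t" using Fu t unfolding fu by blast
   have "1 - t : {0..1}" using t by auto
   hence "\<Phi> ?v (complex_of_real (2 * (1 - (1 - t)) - 1)) = gm ?c (1 - t)" using Fv unfolding fv by blast
   also have "\<dots> = gm c (1 - (1 - t))" using E cL \<open>1 - t : {0..1}\<close> unfolding edge_system_def by blast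
   finally show "\<Phi> ?v (complex_of_real (2 * t - 1)) = gm c t" by simp
  qed
  \<comment> \<open>The real axis is given to the upper face; \<open>seg\<close> shows that the
    lower face takes the same values there, so both restrictions are continuous.\<close>
  define G where "G = (\<lambda>z. if 0 <= Im z then \<Phi> ?u z else \<Phi> ?v z)"
  have Gu: "G z = \<Phi> ?u z" if "z : half_disc" for z using that by (simp add: G_def half_disc_def)
  have Gv: "G z = \<Phi> ?v z" if z: "z : uminus ` half_disc" for z
  proof (cases "Im z = 0")
   case True
   have "- z : half_disc" using z by auto
   then obtain r where r: "- z = complex_of_real r" "-1 <= r" "r <= 1" using half_real[of "- z"] True by auto
   have z2: "z = complex_of_real (2 * ((1 - r) / 2) - 1)"
   proof -
    have "z = complex_of_real (- r)" using r(1) by (metis minus_minus of_real_minus)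
    also have "- r = 2 * ((1 - r) / 2) - 1" by (simp add: field_simps)
    finally show ?thesis .
   qed
   have "(1 - r) / 2 : {0..1}" using r by auto
   thus ?thesis using seg z2 True unfolding G_def by (metis order_refl)
  next
   case False
   thus ?thesis using z by (auto simp: G_def half_disc_def)
  qed
  have un: "half_disc \<union> uminus ` half_disc = cball 0 1"
  proof
   show "cball 0 1 <= half_disc \<union> uminus ` half_disc"
   proof
    fix z :: complex assume z: "z : cball 0 1"
    show "z : half_disc \<union> uminus ` half_disc"
    proof (cases "0 <= Im z")
     case True thus ?thesis using z by (simp add: half_disc_def)
    next
     case False
     hence "- z : half_disc" using z by (simp add: half_disc_def)
     thus ?thesis by force
    qed
   qed
  qed (use half_sub in auto)
  have cont: "continuous_on (cball 0 1) G"
  proof -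
   have "continuous_on (half_disc \<union> uminus ` half_disc) G"
   proof (rule continuous_on_closed_Un)
    show "closed half_disc" using disc_model_half compact_imp_closed by (auto simp: disc_model_def)
    show "closed (uminus ` half_disc)" using disc_model_neg_half compact_imp_closed by (auto simp: disc_model_def)
    show "continuous_on half_disc G" using Fu Gu unfolding fu by (simp cong: continuous_on_cong)
    show "continuous_on (uminus ` half_disc) G" using Fv Gv unfolding fv by (simp cong: continuous_on_cong)
   qed
   thus ?thesis using un by simp
  qed
  have GS: "G ` cball 0 1 <= S"
  proof
   fix p assume "p : G ` cball 0 1"
   then obtain z where z: "z : half_disc \<union> uminus ` half_disc" "p = G z" using un by blast
   thus "p : S" using Gu Gv Fu Fv unfolding fu fv by (metis UnE image_subset_iff)
  qed
  define \<Phi>' where "\<Phi>' = \<Phi>(?w := G)"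
  have arc: "cis (pi * ((real k + t) / a)) : half_disc" if "k < length x" "t : {0..1}" for k t
   using nat_step_bounds[OF that] by (intro cis_in_half_disc) (simp_all add: a_def)
  have arc': "- cis (pi * ((real k + t) / b)) : uminus ` half_disc" if "k < length y" "t : {0..1}" for k t
  proof -
   have "cis (pi * ((real k + t) / b)) : half_disc"
    using nat_step_bounds[OF that] by (intro cis_in_half_disc) (simp_all add: b_def)
   thus ?thesis by blast
  qed
  have Fw: "face_map S gm ?w (cball 0 1) (\<beta>1 ?w) G"
   unfolding fw using cont GS Gu[OF arc] Gv[OF arc'] Fu Fv unfolding fu fv by simp
  \<comment> \<open>A point of an open disc lies inside one of the two halves or on the open chord,
    so injectivity and disjointness reduce to those of the cut surface.\<close>
  have q: "\<exists>w'\<in>W2. (z : interior (D2 w') & \<Phi>' w z = \<Phi> w' z & (w' = w \<or> w = ?w & w' = ?u \<or> w = ?w & w' = ?v)) \<or>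
     (\<exists>t\<in>{0<..<1}. w = ?w & z = complex_of_real (2 * t - 1) & \<Phi>' w z = gm c t)"
   if w: "w : W1" and z: "z : ball 0 1" for w z
  proof (cases "w = ?w")
   case False
   hence "w : W" using w by (simp add: W1_def)
   thus ?thesis using False z D2s by (auto simp: W2_def \<Phi>'_def)
  next
   case True
   show ?thesis
   proof (rule ball_half_cases[OF z])
    assume h: "z : interior half_disc"
    hence "G z = \<Phi> ?u z" using Gu interior_subset by blast
    thus ?thesis using True h D2uv by (auto simp: W2_def \<Phi>'_def)
   next
    assume h: "z : interior (uminus ` half_disc)"
    hence "G z = \<Phi> ?v z" using Gv interior_subset by blast
    thus ?thesis using True h D2uv by (auto simp: W2_def \<Phi>'_def)
   next
    fix t assume t: "t : {0<..<1}" "z = complex_of_real (2 * t - 1)"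
    hence "t : {0..1}" by auto
    hence "G z = gm c t" using t seg(1) Gu chord_props(2) by metis
    moreover have "?u : W2" by (simp add: W2_def)
    ultimately show ?thesis using t True unfolding \<Phi>'_def by (metis fun_upd_same)
   qed
  qed
  have cinj: "t = t'" if "t : {0<..<1}" "t' : {0<..<1}" "gm c t = gm c t'" for t t'
  proof -
   have "t' : {0..1}" using that by auto
   hence "c = c & t' = t \<or> c = ?c & t' = 1 - t" using E cL that unfolding edge_system_def by blast
   thus ?thesis using c(3) by metis
  qed
  have "realizes_on D1 \<beta>1 S s W1 gm \<Phi>'"
   unfolding realizes_on_def D1_def interior_cball L1
  proof (intro conjI ballI impI)
   fix w assume w: "w : W1"
   show "face_map S gm w (cball 0 1) (\<beta>1 w) (\<Phi>' w)"
   proof (cases "w = ?w")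
    case True thus ?thesis using Fw by (simp add: \<Phi>'_def)
   next
    case False
    hence "w : W" using w by (simp add: W1_def)
    thus ?thesis using F D2s[of w] False unfolding realizes_on_def W2_def \<Phi>'_def by auto
   qed
  next
   fix w w' and z z' :: complex assume h: "w : W1" "w' : W1" "z : ball 0 1" "z' : ball 0 1" "\<Phi>' w z = \<Phi>' w' z'"
   have "c : set ?u" "?c : set ?v" "c ~: set ?w" "?c ~: set ?w" using c by auto
   hence "?u ~= ?w" "?v ~= ?w" by metis+
   hence nu': "?u ~: W1" "?v ~: W1" using nu by (auto simp: W1_def)
   have o: "t : {0<..<1} ==> t : {0..1::real}" for t by auto
   show "w = w'" using q[OF h(1,3)] q[OF h(2,4)] h(5) inj av cL cinj o nu' h(1,2)
    by (metis)
   show "z = z'" using q[OF h(1,3)] q[OF h(2,4)] h(5) inj av cL cinj o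
    by (metis)
  next
   fix w d and z :: complex assume h: "w : W1" "z : ball 0 1" "d : ?L"
   have dL: "d : letters W2" "d ~= c" "d ~= ?c" using h c L2 by auto
   have "\<Phi>' w z ~= gm d t" if t: "t : {0..1}" for t
   proof -
    consider w' where "w' : W2" "z : interior (D2 w')" "\<Phi>' w z = \<Phi> w' z"
     | t' where "t' : {0<..<1}" "\<Phi>' w z = gm c t'"
     using q[OF h(1,2)] by blast
    thus ?thesis
    proof cases
     case 1 thus ?thesis using av[OF _ _ dL(1) t] by simp
    next
     case 2 thus ?thesis using E cL dL t unfolding edge_system_def by metis
    qed
   qed
   thus "\<Phi>' w z ~: gm d ` {0..1}" by blast
  qed
  thus ?thesis using E1 realizes_iff_models[of W1 D1 \<beta>1 S s] m1 L1 by metis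
 qed
 show ?thesis using first second unfolding W1_def W2_def by blast
qed

lemma half_disc_square:
 assumes "z : half_disc"
 shows "z\<^sup>2 : cball 0 1" "z : interior half_disc ==> z\<^sup>2 : ball 0 1"
 using assms by (auto simp: half_disc_def interior_half_disc norm_power power_le_one power_less_one_iff abs_square_less_1)

lemma square_onto: "(\<lambda>z. z\<^sup>2) ` half_disc = cball 0 1"
proof
 show "(\<lambda>z. z\<^sup>2) ` half_disc <= cball 0 1" using half_disc_square by blast
 show "cball 0 1 <= (\<lambda>z. z\<^sup>2) ` half_disc"
 proof
  fix w :: complex assume w: "w : cball 0 1"
  define r where "r = (if 0 <= Im (csqrt w) then csqrt w else - csqrt w)"
  have "r\<^sup>2 = w" by (simp add: r_def)
  moreover have "(cmod r)\<^sup>2 <= 1" using w \<open>r\<^sup>2 = w\<close> by (metis mem_cball_0 norm_power)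
  hence "cmod r <= 1" by (simp add: power_le_one_iff abs_square_le_1)
  hence "r : half_disc" by (auto simp: half_disc_def r_def)
  ultimately show "w : (\<lambda>z. z\<^sup>2) ` half_disc" by blast
 qed
qed

lemma half_disc_square_eq:
 assumes "z : half_disc" "z' : half_disc" "z\<^sup>2 = z'\<^sup>2" "z ~= z'"
 shows "Im z = 0 & z' = - z"
proof -
 have "z' = - z" using assms by (auto simp: power2_eq_iff)
 thus ?thesis using assms by (auto simp: half_disc_def)
qed

text \<open>Squaring maps the half disc onto the disc. It wraps the arc once around the circle, so
  the arc reads \<open>x\<close>, and folds the diameter about \<open>0\<close>; the two halves of
  the diameter, which read \<open>c\<close> and \<open>rv c\<close>, become one radius travelled
  inwards and back.\<close>

lemma realizes_pendant:
 fixes c :: "'a \<times> 'a" and S :: "'b::t2_space set"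
 assumes x: "x ~= []" "set x \<inter> letters W = {}"
  and c: "c ~: letters (insert x W)" "rv c ~: letters (insert x W)" "rv c ~= c"
  and sw: "rv ` letters (insert x W) <= letters (insert x W)"
  and s: "s c = s (hd x)" "s (rv c) ~: s ` letters (insert x W)"
  and W: "[] ~: W"
 shows "realizes S s (insert x W) \<longleftrightarrow> realizes S s (insert (x @ [c, rv c]) W)"
proof -
 let ?c = "rv c" and ?L = "letters (insert x W)"
 let ?u = "x @ [c, ?c]"
 define W1 where "W1 = insert x W"
 define W2 where "W2 = insert ?u W"
 define a where "a = real (length x)"
 have a: "0 < a" using x by (auto simp: a_def)
 have L2: "letters W2 = insert c (insert ?c ?L)" by (auto simp: W2_def)
 have L1: "letters W1 = ?L" by (simp add: W1_def)
 have nx: "x ~: W" using new_word[of x W] x by auto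
 have nu: "?u ~: W" using c by (auto simp: letters_def)
 define D1 where "D1 = (\<lambda>w::('a\<times>'a) list. cball (0::complex) 1)"
 define D2 where "D2 = (\<lambda>w. if w = ?u then half_disc else cball 0 1)"
 define \<beta>2 where "\<beta>2 = (\<lambda>w. if w = ?u then half_loop \<circ> pl a 2 else std_loop w)"
 have stdm: "disc_model (cball 0 1) (length w) (std_loop w)" if "w : W1" for w :: "('a\<times>'a) list"
 proof -
  have "0 < real (length w)" using that W x by (auto simp: W1_def)
  hence "disc_model (cball 0 1) (length w) (\<lambda>t. cis (2 * pi * t / length w))" by (rule disc_model_std)
  thus ?thesis by (simp add: std_loop_def[abs_def])
 qed
 have m2: "disc_model (D2 w) (length w) (\<beta>2 w)" if "w : W2" for w
  using that stdm[of w] disc_model_pl[OF disc_model_half a, of 2]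
  by (auto simp: W1_def W2_def D2_def \<beta>2_def a_def add.commute)
 have D2u: "D2 ?u = half_disc" by (simp add: D2_def)
 have D2s: "D2 w = cball 0 1" "\<beta>2 w = std_loop w" if "w : W" for w
  using that nu by (auto simp: D2_def \<beta>2_def)
 have b1: "std_loop x (real k + t) = (cis (pi * ((real k + t) / a)))\<^sup>2" for k and t :: real
  unfolding std_loop_def power2_eq_square cis_mult a_def by (rule arg_cong[of _ _ cis]) (simp add: field_simps)
 have b2: "\<beta>2 ?u (real k + t) = cis (pi * ((real k + t) / a))" if "k < length x" "t : {0..1}" for k t
  using nat_step_bounds[OF that] by (simp add: \<beta>2_def pl_lo half_loop_lo a_def)
 have bc: "\<beta>2 ?u (a + t) = complex_of_real (t - 1)" "\<beta>2 ?u (a + (1 + t)) = complex_of_real t" if "t : {0..1}" for t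
 proof -
  have e: "2 * (t / 2) - 1 = t - 1" "2 * ((1 + t) / 2) - 1 = t" by (simp_all add: field_simps)
  have b: "\<beta>2 ?u = half_loop \<circ> pl a 2" by (simp add: \<beta>2_def)
  show "\<beta>2 ?u (a + t) = complex_of_real (t - 1)"
   unfolding b o_def using that a pl_hi[of a t 2] half_loop_hi[of "t/2"] e(1) by (metis atLeastAtMost_iff divide_nonneg_nonneg zero_le_numeral)
  have "0 <= 1 + t" "0 <= (1 + t) / 2" using that by auto
  thus "\<beta>2 ?u (a + (1 + t)) = complex_of_real t"
   unfolding b o_def using pl_hi[OF a, of "1 + t" 2] half_loop_hi[of "(1+t)/2"] e(2) by metis
 qed
 have fu: "face_map S gm ?u half_disc (\<beta>2 ?u) \<Phi> \<longleftrightarrow> continuous_on half_disc \<Phi> & \<Phi> ` half_disc <= S &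
   (\<forall>k<length x. \<forall>t\<in>{0..1}. \<Phi> (cis (pi * ((real k + t) / a))) = gm (x ! k) t) &
   (\<forall>t\<in>{0..1}. \<Phi> (complex_of_real (t - 1)) = gm c t) & (\<forall>t\<in>{0..1}. \<Phi> (complex_of_real t) = gm ?c t)" for gm and \<Phi> :: "complex => 'b"
 proof -
  have all2: "(\<forall>k<length [c,?c]. P k ([c,?c] ! k)) \<longleftrightarrow> P 0 c & P 1 ?c" for P
   by (simp add: less_Suc_eq all_conj_distrib)
  show ?thesis unfolding face_map_append a_def[symmetric]
   all2[of "\<lambda>k d. \<forall>t\<in>{0..1}. \<Phi> (\<beta>2 ?u (a + (real k + t))) = gm d t"] using b2 bc by simp
 qed
 have f1: "face_map S gm x (cball 0 1) (std_loop x) \<Phi> \<longleftrightarrow> continuous_on (cball 0 1) \<Phi> & \<Phi> ` cball 0 1 <= S &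
   (\<forall>k<length x. \<forall>t\<in>{0..1}. \<Phi> ((cis (pi * ((real k + t) / a)))\<^sup>2) = gm (x ! k) t)" for gm and \<Phi> :: "complex => 'b"
  unfolding face_map_def b1 by simp
 have intD2: "interior (D2 w) <= ball 0 1" for w
  using half_sub(1) by (auto simp: D2_def)
 have hdL: "hd x : ?L" using x by auto
 have swL: "rv d : ?L" if "d : ?L" for d using sw that by blast
 have xW: "x : W1" "?u : W2" by (auto simp: W1_def W2_def)
 have first: "realizes S s W2" if R: "realizes S s W1"
 proof -
  obtain gm \<Phi> where E: "edge_system S s ?L gm" and F: "realizes_on (\<lambda>_. cball 0 1) std_loop S s W1 gm \<Phi>"
   using R L1 unfolding realizes_def by auto
  have Fx: "face_map S gm x (cball 0 1) (std_loop x) (\<Phi> x)" using F by (auto simp: realizes_on_def W1_def)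
  have inj: "w = w' & z = z'" if "w : W1" "w' : W1" "z : ball 0 1" "z' : ball 0 1" "\<Phi> w z = \<Phi> w' z'" for w w' z z'
   using F that unfolding realizes_on_def interior_cball by blast
  have av: "\<Phi> w z ~= gm d t" if "w : W1" "z : ball 0 1" "d : ?L" "t : {0..1}" for w z d t
   using F that unfolding realizes_on_def L1 interior_cball by blast
  \<comment> \<open>The radius from the boundary point \<open>1\<close> to the centre; the square is
    the one of the folding map, whose diameter parameter is \<open>t - 1\<close>.\<close>
  define g where "g = (\<lambda>t. \<Phi> x (complex_of_real ((1 - t)\<^sup>2)))"
  define gm' where "gm' = gm(c := g, ?c := \<lambda>t. g (1 - t))"
  have g0: "g 0 = gm (hd x) 0"
  proof -
   have "\<Phi> x ((cis (pi * ((real 0 + 0) / a)))\<^sup>2) = gm (x ! 0) 0"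
    using Fx x unfolding f1 by (metis atLeastAtMost_iff length_greater_0_conv order_refl zero_le_one)
   thus ?thesis using x by (simp add: g_def hd_conv_nth)
  qed
  have gb: "complex_of_real ((1 - t)\<^sup>2) : ball 0 1" if "0 < t" "t <= 1" for t :: real
  proof -
   have "\<bar>1 - t\<bar> < 1" using that by auto
   hence "(1 - t)\<^sup>2 < 1" using abs_square_less_1 by blast
   thus ?thesis by (simp add: norm_of_real del: of_real_power of_real_diff)
  qed
  have gcb: "complex_of_real ((1 - t)\<^sup>2) : cball 0 1" if "0 <= t" "t <= 1" for t :: real
  proof -
   have "\<bar>1 - t\<bar> <= 1" using that by auto
   hence "(1 - t)\<^sup>2 <= 1" using abs_square_le_1 by blast
   thus ?thesis by (simp add: norm_of_real del: of_real_power of_real_diff)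
  qed
  have g1: "g 1 ~= gm d t" if "d : ?L" "t : {0..1}" for d t
   using av[OF xW(1) gb[of 1] that] by (simp add: g_def)
  have ginj: "t = t'" if "0 < t" "t <= 1" "0 < t'" "t' <= 1" "g t = g t'" for t t'
  proof -
   have "complex_of_real ((1 - t)\<^sup>2) = complex_of_real ((1 - t')\<^sup>2)"
    using inj[OF xW(1) xW(1) gb gb] that by (simp only: g_def)
   hence "(1 - t)\<^sup>2 = (1 - t')\<^sup>2" by (simp only: of_real_eq_iff)
   hence "1 - t = 1 - t'" using that by (simp add: power2_eq_iff_nonneg)
   thus ?thesis by simp
  qed
  have vert: "gm d 0 = gm d' 0 \<longleftrightarrow> s d = s d'" if "d : ?L" "d' : ?L" for d d' using E that by (simp add: edge_system_def)
  have sne: "s ?c ~= s d" if "d : ?L" for d using s(2) that by blast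
  have E': "edge_system S s (letters W2) gm'"
   unfolding L2 gm'_def
  proof (rule edge_system_insert[OF E sw c])
   show "continuous_on {0..1} g" unfolding g_def
   proof (rule continuous_on_compose2[of "cball 0 1" "\<Phi> x"])
    show "continuous_on (cball 0 1) (\<Phi> x)" using Fx unfolding f1 by blast
    show "(\<lambda>t. complex_of_real ((1 - t)\<^sup>2)) ` {0..1} <= cball 0 1" using gcb by fastforce
   qed (intro continuous_intros)
   show "g ` {0..1} <= S" using Fx gcb unfolding g_def f1 by fastforce
   show "t = t'" if h: "t : {0<..<1}" "t' : {0..1}" "g t = g t'" for t t'
   proof (cases "t' = 0")
    case True
    hence "\<Phi> x (complex_of_real ((1 - t)\<^sup>2)) = gm (hd x) 0" using h g0 unfolding g_def by simp
    thus ?thesis using av[OF xW(1) gb[of t] hdL, of 0] h by simp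
   next
    case False thus ?thesis using ginj h by simp
   qed
   show "g t ~: gm d ` {0..1}" if "t : {0<..<1}" "d : ?L" for t d
    using av[OF xW(1) gb[of t] that(2)] that(1) unfolding g_def by fastforce
   show "gm d t ~= g 0 & gm d t ~= g 1" if "t : {0<..<1}" "d : ?L" for t d
   proof
    show "gm d t ~= g 0" unfolding g0 using edge_interior_not_vertex[OF E that(2) hdL swL[OF hdL] that(1)] .
    show "gm d t ~= g 1" using g1[OF that(2), of t] that(1) by auto
   qed
   show "g 0 = gm d 0 \<longleftrightarrow> s c = s d" if "d : ?L" for d unfolding g0 s using vert hdL that by blast
   show "g 1 = gm d 0 \<longleftrightarrow> s ?c = s d" if "d : ?L" for d using sne[OF that] g1[OF that, of 0] by simp
   show "g 0 = g 1 \<longleftrightarrow> s c = s ?c" unfolding g0 s(1) using sne[OF hdL] g1[OF hdL, of 0] by auto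
  qed
  have old: "gm' d = gm d" if "d : ?L" for d using that c by (auto simp: gm'_def)
  have gc: "gm' c = g" "gm' ?c = (\<lambda>t. g (1 - t))" using c by (auto simp: gm'_def)
  define \<Phi>' where "\<Phi>' = \<Phi>(?u := \<lambda>z. \<Phi> x (z\<^sup>2))"
  define u where "u = (\<lambda>w. if w = ?u then x else w)"
  define q where "q = (\<lambda>w z::complex. if w = ?u then z\<^sup>2 else z)"
  have Phi: "\<Phi>' ?u = (\<lambda>z. \<Phi> x (z\<^sup>2))" "\<Phi>' w = \<Phi> w" if "w : W" for w using nu that by (auto simp: \<Phi>'_def)
  have u: "u w : W1" if "w : W2" for w using that by (auto simp: u_def W1_def W2_def)
  have Pu: "\<Phi>' w z = \<Phi> (u w) (q w z)" for w z by (auto simp: u_def q_def \<Phi>'_def)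
  have qb: "q w z : ball 0 1" if "z : interior (D2 w)" for w z
   using that half_disc_square(2)[of z] interior_subset[of half_disc] by (auto simp: q_def D2_def split: if_splits)
  have "face_map S gm' w (D2 w) (\<beta>2 w) (\<Phi>' w)" if "w : W2" for w
  proof -
   consider "w = ?u" | "w : W" using \<open>w : W2\<close> by (auto simp: W2_def)
   thus ?thesis
   proof cases
    case 1
    have "continuous_on half_disc (\<lambda>z. \<Phi> x (z\<^sup>2))"
     by (rule continuous_on_compose2[of "cball 0 1" "\<Phi> x"]) (use Fx square_onto in \<open>auto simp: f1 intro!: continuous_intros\<close>)
    moreover have "(\<lambda>z. \<Phi> x (z\<^sup>2)) ` half_disc <= S" using Fx half_disc_square(1) unfolding f1 by blast
    moreover have "\<Phi> x ((cis (pi * ((real k + t) / a)))\<^sup>2) = gm' (x ! k) t" if "k < length x" "t : {0..1}" for k t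
     using Fx that old[of "x ! k"] unfolding f1 by simp
    moreover have "(complex_of_real (t - 1))\<^sup>2 = complex_of_real ((1 - t)\<^sup>2)" "(complex_of_real t)\<^sup>2 = complex_of_real ((1 - (1 - t))\<^sup>2)" for t
     by (simp_all add: power2_commute)
    ultimately have "face_map S gm' ?u half_disc (\<beta>2 ?u) (\<lambda>z. \<Phi> x (z\<^sup>2))" unfolding fu gc g_def by metis
    thus ?thesis unfolding 1 D2u \<Phi>'_def by simp
   next
    case 2
    have "face_map S gm w (cball 0 1) (std_loop w) (\<Phi> w)" using F 2 unfolding realizes_on_def W1_def by auto
    moreover have "gm' (w ! k) = gm (w ! k)" if "k < length w" for k
    proof (rule old)
     have "w ! k : letters W" using 2 nth_mem[OF that] unfolding letters_def by blast
     thus "w ! k : ?L" by simp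
    qed
    ultimately show ?thesis using Phi(2)[OF 2] by (simp add: D2s[OF 2] face_map_def)
   qed
  qed
  moreover have "w = w' & z = z'" if h: "w : W2" "w' : W2" "z : interior (D2 w)" "z' : interior (D2 w')" "\<Phi>' w z = \<Phi>' w' z'" for w w' z z'
  proof -
   have e: "u w = u w' & q w z = q w' z'"
    using inj[OF u[OF h(1)] u[OF h(2)] qb[OF h(3)] qb[OF h(4)]] h(5) Pu by simp
   hence w: "w = w'" using h(1,2) nx by (auto simp: u_def W2_def split: if_splits)
   show ?thesis
   proof (cases "w = ?u")
    case True
    hence z: "z : interior half_disc" "z' : interior half_disc" "z\<^sup>2 = z'\<^sup>2" using e w h(3,4) D2u by (auto simp: q_def)
    thus ?thesis using half_disc_square_eq[of z z'] interior_subset[of half_disc] w half_int_im(1)[of z] by auto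
   next
    case False
    thus ?thesis using e w by (simp add: q_def)
   qed
  qed
  moreover have "\<Phi>' w z ~: gm' d ` {0..1}" if h: "w : W2" "z : interior (D2 w)" "d : letters W2" for w z d
  proof -
   have zb: "q w z : ball 0 1" using h qb by blast
   have key: "\<Phi> (u w) (q w z) ~= g t" if t: "t : {0..1}" for t
   proof
    assume e: "\<Phi> (u w) (q w z) = g t"
    show False
    proof (cases "t = 0")
     case True
     thus False using e g0 av[OF u[OF h(1)] zb hdL, of 0] by simp
    next
     case False
     hence eq: "u w = x" "q w z = complex_of_real ((1 - t)\<^sup>2)"
      using inj[OF u[OF h(1)] xW(1) zb gb[of t]] e t by (auto simp: g_def)
     hence w: "w = ?u" using h(1) nx by (auto simp: u_def W2_def split: if_splits)
     hence "z\<^sup>2 = (complex_of_real (1 - t))\<^sup>2" using eq(2) by (simp add: q_def)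
     hence "z = complex_of_real (1 - t) \<or> z = - complex_of_real (1 - t)" by (simp only: power2_eq_iff)
     hence "Im z = 0" by auto
     thus False using h(2) half_int_im(1)[of z] D2u w by auto
    qed
   qed
   have "\<Phi> (u w) (q w z) ~= gm' d t" if t: "t : {0..1}" for t
   proof -
    have "d = c \<or> d = ?c \<or> d : ?L" using h(3) L2 by blast
    thus ?thesis
    proof (elim disjE)
     assume "d = c" thus ?thesis using key[OF t] gc by simp
    next
     assume "d = ?c" thus ?thesis using key[of "1 - t"] t gc by simp
    next
     assume "d : ?L" thus ?thesis using old av[OF u[OF h(1)] zb _ t] by simp
    qed
   qed
   thus ?thesis unfolding Pu by blast
  qed
  ultimately have "realizes_on D2 \<beta>2 S s W2 gm' \<Phi>'" unfolding realizes_on_def by blast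
  thus ?thesis using E' realizes_iff_models[of W2 D2 \<beta>2 S s] m2 by blast
 qed
 have second: "realizes S s W1" if R: "realizes S s W2"
 proof -
  obtain gm \<Phi> where E: "edge_system S s (letters W2) gm" and F: "realizes_on D2 \<beta>2 S s W2 gm \<Phi>"
   using R realizes_iff_models[of W2 D2 \<beta>2 S s] m2 by auto
  have E1: "edge_system S s ?L gm" by (rule edge_system_mono[OF E]) (auto simp: L2)
  have Fu: "face_map S gm ?u half_disc (\<beta>2 ?u) (\<Phi> ?u)"
   using F D2u unfolding realizes_on_def W2_def by auto
  have inj: "w = w' & z = z'" if "w : W2" "w' : W2" "z : interior (D2 w)" "z' : interior (D2 w')" "\<Phi> w z = \<Phi> w' z'" for w w' z z'
   using F that unfolding realizes_on_def by blast
  have av: "\<Phi> w z ~= gm d t" if "w : W2" "z : interior (D2 w)" "d : letters W2" "t : {0..1}" for w z d t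
   using F that unfolding realizes_on_def by blast
  have cL: "c : letters W2" "?c : letters W2" by (auto simp: L2)
  have rev: "gm ?c t = gm c (1 - t)" if "t : {0..1}" for t using E cL that unfolding edge_system_def by blast
  have seg: "\<Phi> ?u (complex_of_real r) = gm c (1 - \<bar>r\<bar>)" if r: "-1 <= r" "r <= 1" for r
  proof (cases "0 <= r")
   case True
   thus ?thesis using Fu rev[of r] r unfolding fu by auto
  next
   case False
   hence "r + 1 : {0..1}" using r by auto
   hence "\<Phi> ?u (complex_of_real (r + 1 - 1)) = gm c (r + 1)" using Fu unfolding fu by blast
   thus ?thesis using False by (simp add: add.commute)
  qed
  \<comment> \<open>The square root in the half disc is ambiguous only on the diameter, between
    \<open>r\<close> and \<open>- r\<close>. By \<open>seg\<close> the face takes the same value at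
    both, so any choice yields the same continuous \<open>G\<close>.\<close>
  define rt where "rt = (\<lambda>w. SOME z. z : half_disc & z\<^sup>2 = w)"
  define G where "G = (\<lambda>w. \<Phi> ?u (rt w))"
  have rt: "rt w : half_disc" "(rt w)\<^sup>2 = w" if "w : cball 0 1" for w
  proof -
   have "\<exists>z. z : half_disc & z\<^sup>2 = w" using that unfolding square_onto[symmetric] by blast
   hence "rt w : half_disc & (rt w)\<^sup>2 = w" unfolding rt_def by (rule someI_ex)
   thus "rt w : half_disc" "(rt w)\<^sup>2 = w" by blast+
  qed
  have G: "G (z\<^sup>2) = \<Phi> ?u z" if z: "z : half_disc" for z
  proof (cases "rt (z\<^sup>2) = z")
   case True thus ?thesis by (simp add: G_def)
  next
   case False
   have r: "rt (z\<^sup>2) : half_disc" "(rt (z\<^sup>2))\<^sup>2 = z\<^sup>2" using rt[OF half_disc_square(1)[OF z]] by blast+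
   hence i: "Im z = 0 & rt (z\<^sup>2) = - z" using half_disc_square_eq[OF z r(1)] False by auto
   obtain y where y: "z = complex_of_real y" "-1 <= y" "y <= 1" using half_real[OF z] i by blast
   hence "rt (z\<^sup>2) = complex_of_real (- y)" using i by simp
   thus ?thesis using seg[of y] seg[of "- y"] y by (simp add: G_def)
  qed
  have Gc: "continuous_on (cball 0 1) G"
  proof -
   have "compact half_disc" using disc_model_half by (simp add: disc_model_def)
   moreover have "continuous_on half_disc (\<lambda>z. G (z\<^sup>2))" using Fu G unfolding fu by (simp cong: continuous_on_cong)
   moreover have "continuous_on half_disc (\<lambda>z::complex. z\<^sup>2)" by (intro continuous_intros)
   ultimately have "continuous_on ((\<lambda>z. z\<^sup>2) ` half_disc) G"
    using continuous_on_compact_factor[of half_disc "\<lambda>z. z\<^sup>2" G] by blast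
   thus ?thesis by (simp only: square_onto)
  qed
  have GS: "G ` cball 0 1 <= S" using Fu rt(1) unfolding fu G_def by blast
  have Gx: "face_map S gm x (cball 0 1) (std_loop x) G"
   unfolding f1
  proof (intro conjI allI impI ballI)
   fix k t assume k: "k < length x" "t : {0..1::real}"
   hence "cis (pi * ((real k + t) / a)) : half_disc"
    using nat_step_bounds[OF k] by (intro cis_in_half_disc) (simp_all add: a_def)
   thus "G ((cis (pi * ((real k + t) / a)))\<^sup>2) = gm (x ! k) t" using G Fu k unfolding fu by simp
  qed (use Gc GS in auto)
  define \<Phi>' where "\<Phi>' = \<Phi>(x := G)"
  \<comment> \<open>The value \<open>t = 1\<close> is included: the tip of the pendant edge is the
    centre of the disc and lies in its interior.\<close>
  have q: "(\<exists>w'\<in>W2. \<exists>z'\<in>interior (D2 w'). \<Phi>' w z = \<Phi> w' z' & (w = x & w' = ?u & z'\<^sup>2 = z \<or> w ~= x & w' = w & z' = z)) \<or>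
     (\<exists>t\<in>{0<..1}. w = x & z = complex_of_real ((1 - t)\<^sup>2) & \<Phi>' w z = gm c t)"
   if w: "w : W1" and z: "z : ball 0 1" for w z
  proof (cases "w = x")
   case False
   hence "w : W" using w by (simp add: W1_def)
   thus ?thesis using False z D2s by (auto simp: W2_def \<Phi>'_def)
  next
   case True
   have r: "rt z : half_disc" "(rt z)\<^sup>2 = z" using rt[of z] z by auto
   have P: "\<Phi>' w z = \<Phi> ?u (rt z)" using True by (simp add: \<Phi>'_def G_def)
   have n1: "cmod (rt z) < 1"
   proof -
    have "(cmod (rt z))\<^sup>2 < 1" using r(2) z by (metis mem_ball_0 norm_power)
    thus ?thesis by (simp add: abs_square_less_1)
   qed
   show ?thesis
   proof (cases "Im (rt z) = 0")
    case False
    have "0 <= Im (rt z)" using r(1) by (simp add: half_disc_def)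
    hence "rt z : interior half_disc" unfolding interior_half_disc using n1 False by auto
    thus ?thesis using True r(2) P xW(2) D2u by metis
   next
    case i: True
    obtain y where y: "rt z = complex_of_real y" "-1 <= y" "y <= 1" using half_real[OF r(1) i] by blast
    have "\<bar>y\<bar> < 1" using n1 y by (simp add: norm_of_real)
    hence t: "1 - \<bar>y\<bar> : {0<..1}" by auto
    have "z = complex_of_real ((1 - (1 - \<bar>y\<bar>))\<^sup>2)" using r(2) y by simp
    moreover have "\<Phi>' w z = gm c (1 - \<bar>y\<bar>)" using P y seg by simp
    ultimately show ?thesis using True t by blast
   qed
  qed
  have cmid: False if "t : {0<..1}" "d : ?L" "t' : {0..1}" "gm c t = gm d t'" for t d t'
  proof -
   have d: "d : letters W2" "d ~= c" "d ~= ?c" "rv d : letters W2" using that c L2 swL by auto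
   show False
   proof (cases "t = 1")
    case False
    thus False using E cL d that unfolding edge_system_def by (metis greaterThanAtMost_iff greaterThanLessThan_iff order_less_le)
   next
    \<comment> \<open>The tip carries a label that no old dart has, which separates it from all old
      vertices; old edge interiors never contain a vertex.\<close>
    case True
    have e: "gm ?c 0 = gm d t'" using rev[of 0] True that by simp
    consider "t' = 0" | "t' = 1" | "t' : {0<..<1}" using \<open>t' : {0..1}\<close> by fastforce
    thus False
    proof cases
     case 1
     hence "s ?c = s d" using e E cL d unfolding edge_system_def by blast
     thus False using s(2) that by blast
    next
     case 2
     have "gm (rv d) 0 = gm d (1 - 0)" using E d unfolding edge_system_def by (metis atLeastAtMost_iff order_refl zero_le_one)
     hence "s ?c = s (rv d)" using e E cL d 2 unfolding edge_system_def by (metis diff_zero)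
     thus False using s(2) swL that by blast
    next
     case 3
     thus False using edge_interior_not_vertex[OF E d(1) cL(2) _ 3] e cL by simp
    qed
   qed
  qed
  have cinj: "t = t'" if "t : {0<..1}" "t' : {0<..1}" "gm c t = gm c t'" for t t'
  proof -
   have a1: "r = r'" if "r : {0<..<1}" "r' : {0<..1}" "gm c r = gm c r'" for r r'
   proof -
    have "r' : {0..1}" using that by auto
    hence "c = c & r' = r \<or> c = ?c & r' = 1 - r" using E cL that unfolding edge_system_def by blast
    thus ?thesis using c(3) by metis
   qed
   show ?thesis using a1[of t t'] a1[of t' t] that by (cases "t = 1"; cases "t' = 1") auto
  qed
  have "realizes_on (\<lambda>_. cball 0 1) std_loop S s W1 gm \<Phi>'"
   unfolding realizes_on_def interior_cball L1
  proof (intro conjI ballI impI)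
   fix w assume w: "w : W1"
   show "face_map S gm w (cball 0 1) (std_loop w) (\<Phi>' w)"
   proof (cases "w = x")
    case True thus ?thesis using Gx by (simp add: \<Phi>'_def)
   next
    case False
    hence "w : W" using w by (simp add: W1_def)
    thus ?thesis using F D2s[of w] False unfolding realizes_on_def W2_def \<Phi>'_def by auto
   qed
  next
   fix w w' and z z' :: complex assume h: "w : W1" "w' : W1" "z : ball 0 1" "z' : ball 0 1" "\<Phi>' w z = \<Phi>' w' z'"
   have o: "t : {0<..1} ==> t : {0..1::real}" for t by auto
   have nu': "?u ~: W1" using nu by (auto simp: W1_def)
   have "w = w' & z = z'"
    using q[OF h(1,3)]
   proof
    assume "\<exists>v\<in>W2. \<exists>y\<in>interior (D2 v). \<Phi>' w z = \<Phi> v y & (w = x & v = ?u & y\<^sup>2 = z \<or> w ~= x & v = w & y = z)"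
    then obtain v y where v: "v : W2" "y : interior (D2 v)" "\<Phi>' w z = \<Phi> v y" "w = x & v = ?u & y\<^sup>2 = z \<or> w ~= x & v = w & y = z" by blast
    show ?thesis
     using q[OF h(2,4)]
    proof
     assume "\<exists>v\<in>W2. \<exists>y\<in>interior (D2 v). \<Phi>' w' z' = \<Phi> v y & (w' = x & v = ?u & y\<^sup>2 = z' \<or> w' ~= x & v = w' & y = z')"
     then obtain v' y' where v': "v' : W2" "y' : interior (D2 v')" "\<Phi>' w' z' = \<Phi> v' y'" "w' = x & v' = ?u & y'\<^sup>2 = z' \<or> w' ~= x & v' = w' & y' = z'" by blast
     have "v = v' & y = y'" using inj[OF v(1) v'(1) v(2) v'(2)] v(3) v'(3) h(5) by simp
     thus ?thesis using v(4) v'(4) nu' h(1,2) by metis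
    next
     assume "\<exists>t\<in>{0<..1}. w' = x & z' = complex_of_real ((1 - t)\<^sup>2) & \<Phi>' w' z' = gm c t"
     thus ?thesis using av[OF v(1,2) cL(1)] v(3) h(5) o by metis
    qed
   next
    assume "\<exists>t\<in>{0<..1}. w = x & z = complex_of_real ((1 - t)\<^sup>2) & \<Phi>' w z = gm c t"
    then obtain t where t: "t : {0<..1}" "w = x" "z = complex_of_real ((1 - t)\<^sup>2)" "\<Phi>' w z = gm c t" by blast
    show ?thesis
     using q[OF h(2,4)]
    proof
     assume "\<exists>v\<in>W2. \<exists>y\<in>interior (D2 v). \<Phi>' w' z' = \<Phi> v y & (w' = x & v = ?u & y\<^sup>2 = z' \<or> w' ~= x & v = w' & y = z')"
     thus ?thesis using av[OF _ _ cL(1) o[OF t(1)]] t(4) h(5) by metis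
    next
     assume "\<exists>t\<in>{0<..1}. w' = x & z' = complex_of_real ((1 - t)\<^sup>2) & \<Phi>' w' z' = gm c t"
     thus ?thesis using cinj t h(5) by metis
    qed
   qed
   thus "w = w'" "z = z'" by blast+
  next
   fix w d and z :: complex assume h: "w : W1" "z : ball 0 1" "d : ?L"
   have dL: "d : letters W2" using h L2 by auto
   have "\<Phi>' w z ~= gm d t" if t: "t : {0..1}" for t
   proof -
    consider v y where "v : W2" "y : interior (D2 v)" "\<Phi>' w z = \<Phi> v y" | t' where "t' : {0<..1}" "\<Phi>' w z = gm c t'"
     using q[OF h(1,2)] by blast
    thus ?thesis
    proof cases
     case 1 thus ?thesis using av[OF _ _ dL t] by simp
    next
     case 2 thus ?thesis using cmid[OF _ h(3) t] by auto
    qed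
   qed
   thus "\<Phi>' w z ~: gm d ` {0..1}" by blast
  qed
  thus ?thesis using E1 L1 unfolding realizes_def by metis
 qed
 show ?thesis using first second unfolding W1_def W2_def by blast
qed

section \<open>Classification of boundary words\<close>

text \<open>\<open>f\<close> is read as a labelling of initial vertices, so \<open>f (rv d)\<close>
  labels the end of \<open>d\<close> and must be the label of the next dart.\<close>

primrec walk :: "('a \<times> 'a => 'c) => 'c => ('a \<times> 'a) list => 'c => bool" where
 "walk f a [] b \<longleftrightarrow> a = b"
| "walk f a (d # w) b \<longleftrightarrow> f d = a & walk f (f (rv d)) w b"

lemma walk_append: "walk f a (x @ y) b \<longleftrightarrow> (\<exists>c. walk f a x c & walk f c y b)"
 by (induction x arbitrary: a) auto

lemma walk_hd: "walk f a x b ==> x ~= [] ==> f (hd x) = a"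
 by (cases x) auto

lemma walk_cong:
 "(\<And>d. d : set w ==> f d = g d & f (rv d) = g (rv d)) ==> walk f a w b \<longleftrightarrow> walk g a w b"
 by (induction w arbitrary: a) auto

lemma walk_const: "(\<And>d. d : set w ==> f d = a & f (rv d) = a) ==> walk f a w a"
 by (induction w) auto

definition cwalk :: "('a \<times> 'a => 'c) => ('a \<times> 'a) list => bool" where
 "cwalk f w \<longleftrightarrow> (\<exists>a. walk f a w a)"

lemma cwalk_rotate: "cwalk f (x @ y) \<longleftrightarrow> cwalk f (y @ x)"
 unfolding cwalk_def walk_append by blast

lemma cwalk_cong:
 "(\<And>d. d : set w ==> f d = g d & f (rv d) = g (rv d)) ==> cwalk f w \<longleftrightarrow> cwalk g w"
 unfolding cwalk_def using walk_cong[of w f g] by blast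

text \<open>
 The last condition says that the corners with a given label form a single cycle around that
 vertex: a labelling that is constant around each vertex cannot separate them.
\<close>

definition okmap :: "('a \<times> 'a => 'v) => ('a \<times> 'a) list set => bool" where
 "okmap s W \<longleftrightarrow> finite W & [] ~: W & (\<forall>w\<in>W. distinct w & cwalk s w) &
   (\<forall>v\<in>W. \<forall>w\<in>W. v ~= w --> set v \<inter> set w = {}) &
   (\<forall>d\<in>letters W. rv d : letters W & rv d ~= d) &
   (\<forall>f::'a \<times> 'a => bool. (\<forall>w\<in>W. cwalk f w) -->
    (\<forall>d\<in>letters W. \<forall>d'\<in>letters W. s d = s d' --> f d = f d'))"

text \<open>Twice the Euler characteristic.\<close>

definition euler2 :: "('a \<times> 'a => 'v) => ('a \<times> 'a) list set => int" where
 "euler2 s W = 2 * int (card (s ` letters W)) + 2 * int (card W) - int (card (letters W))"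

lemma okmap_finite_letters: "okmap s W ==> finite (letters W)"
 by (auto simp: okmap_def letters_def)

lemma okmap_swap: "okmap s W ==> rv ` letters W <= letters W"
 by (auto simp: okmap_def)

lemma okmap_swapD: "okmap s W ==> d : letters W ==> rv d : letters W & rv d ~= d"
 unfolding okmap_def by (elim conjE) (rule bspec)

lemma okmap_cwalk: "okmap s W ==> w : W ==> cwalk s w"
 unfolding okmap_def by (elim conjE) simp

lemma okmap_faithful:
 fixes f :: "'a \<times> 'a => bool"
 assumes "okmap s W" "\<And>w. w : W ==> cwalk f w" "d : letters W" "d' : letters W" "s d = s d'"
 shows "f d = f d'"
proof -
 have "\<forall>f::'a \<times> 'a => bool. (\<forall>w\<in>W. cwalk f w) --> (\<forall>d\<in>letters W. \<forall>d'\<in>letters W. s d = s d' --> f d = f d')"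
  using assms(1) unfolding okmap_def by (elim conjE)
 thus ?thesis using assms(2-5) by blast
qed

lemma okmap_disj:
 assumes "okmap s (insert w W)" "w ~: W"
 shows "set w \<inter> letters W = {}"
proof -
 have "set w \<inter> set v = {}" if "v : W" for v
  using assms that unfolding okmap_def by (metis insertI1 insertI2)
 thus ?thesis by (auto simp: letters_def)
qed

section \<open>The moves on the combinatorial side\<close>

lemma okmap_rotate:
 assumes ok: "okmap s (insert (x @ y) W)" and n: "x @ y ~: W"
 shows "okmap s (insert (y @ x) W)" "euler2 s (insert (y @ x) W) = euler2 s (insert (x @ y) W)" "y @ x ~: W"
proof -
 have L: "letters (insert (y @ x) W) = letters (insert (x @ y) W)" by auto
 have ne: "x @ y ~= []" using ok unfolding okmap_def by (metis insertI1)
 have d: "set (x @ y) \<inter> letters W = {}" by (rule okmap_disj[OF ok n])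
 thus n': "y @ x ~: W" using new_word[of "y @ x" W] ne by auto
 show "euler2 s (insert (y @ x) W) = euler2 s (insert (x @ y) W)"
  using n n' ok unfolding euler2_def L by (simp add: okmap_def)
 have disj: "set v \<inter> set w = {}" if "v : insert (y @ x) W" "w : insert (y @ x) W" "v ~= w" for v w
 proof -
  have *: "set u \<inter> set (x @ y) = {}" if "u : W" for u using d that by (auto simp: letters_def)
  have **: "set v \<inter> set w = {}" if "v : W" "w : W" using ok \<open>v ~= w\<close> that unfolding okmap_def by blast
  have "set (y @ x) = set (x @ y)" by auto
  thus ?thesis using that * ** by (metis Int_commute insertE)
 qed
 show "okmap s (insert (y @ x) W)"
  using ok disj unfolding okmap_def L by (auto simp: cwalk_rotate[of _ y x])
qed

lemma walk_split_iff:
 assumes "x ~= []" "y ~= []"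
 shows "cwalk f (x @ [c]) & cwalk f (y @ [rv c]) \<longleftrightarrow>
   cwalk f (x @ y) & f c = f (hd y) & f (rv c) = f (hd x)"
proof
 assume "cwalk f (x @ [c]) & cwalk f (y @ [rv c])"
 then obtain a b where ab: "walk f a x (f c)" "f (rv c) = a" "walk f b y (f (rv c))" "f c = b"
  unfolding cwalk_def walk_append by auto
 thus "cwalk f (x @ y) & f c = f (hd y) & f (rv c) = f (hd x)"
  using walk_hd assms unfolding cwalk_def walk_append by metis
next
 assume h: "cwalk f (x @ y) & f c = f (hd y) & f (rv c) = f (hd x)"
 then obtain a b where "walk f a x b" "walk f b y a" unfolding cwalk_def walk_append by auto
 moreover from this have "a = f (rv c)" "b = f c" using h walk_hd assms by metis+
 ultimately show "cwalk f (x @ [c]) & cwalk f (y @ [rv c])" unfolding cwalk_def walk_append by auto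
qed

text \<open>A cut adds one edge and one face. Every vertex labelling of the uncut system extends to
  \<open>c\<close> in exactly one way, by \<open>walk_split_iff\<close>, so faithfulness passes in
  both directions.\<close>

lemma okmap_split:
 fixes s :: "'a \<times> 'a => 'v"
 assumes xy: "x ~= []" "y ~= []" and n: "x @ y ~: W" "x @ [c] ~: W" "y @ [rv c] ~: W" "x @ [c] ~= y @ [rv c]"
  and c: "c ~: letters (insert (x @ y) W)" "rv c ~: letters (insert (x @ y) W)" "rv c ~= c"
  and s: "s c = s (hd y)" "s (rv c) = s (hd x)"
 shows "okmap s (insert (x @ y) W) \<longleftrightarrow> okmap s (insert (x @ [c]) (insert (y @ [rv c]) W))" (is "?A = ?B")
  and "finite W ==> euler2 s (insert (x @ y) W) = euler2 s (insert (x @ [c]) (insert (y @ [rv c]) W))"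
proof -
 let ?c = "rv c"
 define W1 where "W1 = insert (x @ y) W"
 define W2 where "W2 = insert (x @ [c]) (insert (y @ [?c]) W)"
 define L where "L = letters W1"
 have L2: "letters W2 = insert c (insert ?c L)" by (auto simp: W1_def W2_def L_def)
 have cL: "c ~: L" "?c ~: L" using c by (auto simp: L_def W1_def)
 have hd: "hd x : L" "hd y : L" using xy by (auto simp: L_def W1_def)
 have "s ` letters W2 = s ` L" unfolding L2 using s hd by auto
 moreover have "card (letters W2) = card L + 2" if "finite W"
 proof -
  have "finite L" using that by (auto simp: L_def W1_def letters_def)
  thus ?thesis unfolding L2 using cL c(3) by simp
 qed
 moreover have "card W2 = card W1 + 1" if "finite W" unfolding W1_def W2_def using n that by simp
 ultimately show "finite W ==> euler2 s (insert (x @ y) W) = euler2 s (insert (x @ [c]) (insert (y @ [?c]) W))"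
  unfolding euler2_def W1_def[symmetric] W2_def[symmetric] L_def[symmetric] by simp
 have swap_iff: "(\<forall>d\<in>letters W1. rv d : letters W1 & rv d ~= d) \<longleftrightarrow>
   (\<forall>d\<in>letters W2. rv d : letters W2 & rv d ~= d)" (is "?S1 \<longleftrightarrow> ?S2")
  unfolding L2 L_def[symmetric]
 proof
  assume h: "\<forall>d\<in>L. rv d : L & rv d ~= d"
  show "\<forall>d\<in>insert c (insert ?c L). rv d : insert c (insert ?c L) & rv d ~= d" using h c(3) by auto
 next
  assume h: "\<forall>d\<in>insert c (insert ?c L). rv d : insert c (insert ?c L) & rv d ~= d"
  show "\<forall>d\<in>L. rv d : L & rv d ~= d"
  proof
   fix d assume d: "d : L"
   hence "d ~= c" "d ~= ?c" using cL by auto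
   hence "rv d ~= ?c" "rv d ~= c" by (metis swap_swap)+
   thus "rv d : L & rv d ~= d" using h d by auto
  qed
 qed
 have disj_iff: "(\<forall>w\<in>W1. distinct w) & (\<forall>v\<in>W1. \<forall>w\<in>W1. v ~= w --> set v \<inter> set w = {}) \<longleftrightarrow>
   (\<forall>w\<in>W2. distinct w) & (\<forall>v\<in>W2. \<forall>w\<in>W2. v ~= w --> set v \<inter> set w = {})" (is "?D1 \<longleftrightarrow> ?D2")
 proof -
  have cw: "c ~: set w" "?c ~: set w" if "w : W" for w using cL that by (auto simp: L_def W1_def letters_def)
  have cx: "c ~: set x" "c ~: set y" "?c ~: set x" "?c ~: set y" using c by auto
  define Q where "Q \<longleftrightarrow> distinct x & distinct y & set x \<inter> set y = {} & (\<forall>w\<in>W. distinct w) &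
   (\<forall>w\<in>W. set x \<inter> set w = {} & set y \<inter> set w = {}) & (\<forall>v\<in>W. \<forall>w\<in>W. v ~= w --> set v \<inter> set w = {})"
  have a: "?D1 \<longleftrightarrow> Q"
  proof
   assume h: ?D1
   have "set (x @ y) \<inter> set w = {}" if "w : W" for w
   proof -
    have "x @ y ~= w" using n that by blast
    thus ?thesis using h that unfolding W1_def by blast
   qed
   thus Q using h unfolding Q_def W1_def by auto
  next
   assume Q
   thus ?D1 unfolding Q_def W1_def by auto
  qed
  have b: "?D2 \<longleftrightarrow> Q"
  proof
   assume h: ?D2
   have "set (x @ [c]) \<inter> set w = {}" "set (y @ [?c]) \<inter> set w = {}" if "w : W" for w
   proof -
    have "x @ [c] ~= w" "y @ [?c] ~= w" using n that by blast+
    thus "set (x @ [c]) \<inter> set w = {}" "set (y @ [?c]) \<inter> set w = {}" using h that unfolding W2_def by blast+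
   qed
   moreover have "set (x @ [c]) \<inter> set (y @ [?c]) = {}" using h n(4) unfolding W2_def by blast
   ultimately show Q using h unfolding Q_def W2_def by auto
  next
   assume Q
   thus ?D2 unfolding Q_def W2_def using cw cx c(3) by auto
  qed
  show ?thesis by (rule trans[OF a b[symmetric]])
 qed
 have cw_iff: "(\<forall>w\<in>W2. cwalk f w) \<longleftrightarrow> (\<forall>w\<in>W1. cwalk f w) & f c = f (hd y) & f ?c = f (hd x)" for f :: "'a \<times> 'a => 'z"
  using walk_split_iff[OF xy, of f c] unfolding W1_def W2_def by auto
 have faith: "(\<forall>f::'a \<times> 'a => bool. (\<forall>w\<in>W1. cwalk f w) --> (\<forall>d\<in>letters W1. \<forall>d'\<in>letters W1. s d = s d' --> f d = f d')) \<longleftrightarrow>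
   (\<forall>f::'a \<times> 'a => bool. (\<forall>w\<in>W2. cwalk f w) --> (\<forall>d\<in>letters W2. \<forall>d'\<in>letters W2. s d = s d' --> f d = f d'))" (is "?F1 \<longleftrightarrow> ?F2")
  if S: ?S1
 proof
  assume h: ?F1
  show ?F2
  proof (intro allI impI ballI)
   fix f :: "'a \<times> 'a => bool" and d d'
   assume f: "\<forall>w\<in>W2. cwalk f w" and d: "d : letters W2" "d' : letters W2" "s d = s d'"
   have f1: "\<forall>w\<in>W1. cwalk f w" "f c = f (hd y)" "f ?c = f (hd x)" using iffD1[OF cw_iff f] by blast+
   have old: "\<exists>e\<in>L. s e = s d & f e = f d" if dd: "d : letters W2" for d
   proof -
    consider "d = c" | "d = ?c" | "d : L" using dd L2 by blast
    thus ?thesis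
    proof cases
     case 1 thus ?thesis using f1(2) s(1) hd(2) by (auto intro!: bexI[of _ "hd y"])
    next
     case 2 thus ?thesis using f1(3) s(2) hd(1) by (auto intro!: bexI[of _ "hd x"])
    qed blast
   qed
   obtain e e' where e: "e : L" "s e = s d" "f e = f d" "e' : L" "s e' = s d'" "f e' = f d'" using old d(1,2) by metis
   hence "f e = f e'" using h f1(1) d(3) unfolding L_def by metis
   thus "f d = f d'" using e by simp
  qed
 next
  assume h: ?F2
  show ?F1
  proof (intro allI impI ballI)
   fix f :: "'a \<times> 'a => bool" and d d'
   assume f: "\<forall>w\<in>W1. cwalk f w" and d: "d : letters W1" "d' : letters W1" "s d = s d'"
   \<comment> \<open>The only values that let the two new faces close up.\<close>
   define g where "g = f(c := f (hd y), ?c := f (hd x))"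
   have gf: "g e = f e" if "e : L" for e using cL that by (auto simp: g_def)
   have "cwalk g w" if w: "w : W1" for w
   proof -
    have "g e = f e & g (rv e) = f (rv e)" if "e : set w" for e
    proof -
     have "e : L" using that w by (auto simp: L_def letters_def)
     thus ?thesis using gf S by (simp add: L_def)
    qed
    thus ?thesis using cwalk_cong[of w g f] f w by blast
   qed
   moreover have "g c = g (hd y)" "g ?c = g (hd x)" using gf hd c(3) by (simp_all add: g_def)
   ultimately have "\<forall>w\<in>W2. cwalk g w" using cw_iff[of g] by blast
   moreover have "d : letters W2" "d' : letters W2" using d L2 by (auto simp: L_def)
   ultimately have "g d = g d'" using h d(3) by blast
   thus "f d = f d'" using gf d by (simp add: L_def)
  qed
 qed
 have fin: "finite W1 \<longleftrightarrow> finite W2" "[] ~: W1 \<longleftrightarrow> [] ~: W2" using xy by (auto simp: W1_def W2_def)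
 have cs: "(\<forall>w\<in>W2. cwalk s w) \<longleftrightarrow> (\<forall>w\<in>W1. cwalk s w)" using cw_iff[of s] s by blast
 have expand: "okmap s V \<longleftrightarrow> (finite V & [] ~: V) & ((\<forall>w\<in>V. distinct w) & (\<forall>v\<in>V. \<forall>w\<in>V. v ~= w --> set v \<inter> set w = {})) &
   (\<forall>w\<in>V. cwalk s w) & (\<forall>d\<in>letters V. rv d : letters V & rv d ~= d) &
   (\<forall>f::'a \<times> 'a => bool. (\<forall>w\<in>V. cwalk f w) --> (\<forall>d\<in>letters V. \<forall>d'\<in>letters V. s d = s d' --> f d = f d'))" for V
  unfolding okmap_def ball_conj_distrib by (simp only: conj_ac)
 have "okmap s W1 \<longleftrightarrow> okmap s W2"
  unfolding expand using fin
  by (intro conj_cong disj_iff swap_iff cs[symmetric] faith) (simp_all only: fin swap_iff)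
 thus "?A = ?B" unfolding W1_def W2_def .
qed

text \<open>A dart followed at once by its reverse runs into a vertex of degree one. Deleting it
  loses one vertex and one edge and keeps the number of faces.\<close>

lemma okmap_pendant:
 fixes s :: "'a \<times> 'a => 'v"
 assumes x: "x ~= []" and ok: "okmap s (insert (x @ [c, rv c]) W)" and n: "x @ [c, rv c] ~: W"
 shows "okmap s (insert x W)" "x ~: W" "s c = s (hd x)" "s (rv c) ~: s ` letters (insert x W)"
  "euler2 s (insert x W) = euler2 s (insert (x @ [c, rv c]) W)"
  "c ~: letters (insert x W)" "rv c ~: letters (insert x W)" "rv c ~= c"
proof -
 let ?c = "rv c" and ?u = "x @ [c, rv c]"
 define W1 where "W1 = insert x W"
 define W2 where "W2 = insert ?u W"
 define L where "L = letters W1"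
 have ok2: "okmap s W2" using ok by (simp add: W2_def)
 have L2: "letters W2 = insert c (insert ?c L)" by (auto simp: W1_def W2_def L_def)
 have dj: "set ?u \<inter> letters W = {}" by (rule okmap_disj[OF ok n])
 have du: "distinct ?u" using ok by (auto simp: okmap_def)
 have cL: "c ~: L" "?c ~: L" "?c ~= c" using dj du by (auto simp: L_def W1_def)
 show "c ~: letters (insert x W)" "?c ~: letters (insert x W)" "?c ~= c" using cL by (auto simp: L_def W1_def)
 show nx: "x ~: W" using new_word[of x W] x dj by auto
 have swL: "rv d : L & rv d ~= d" if d: "d : L" for d
 proof -
  have "d ~= c" "d ~= ?c" using d cL by auto
  hence "rv d ~= ?c" "rv d ~= c" by (metis swap_swap)+
  moreover have "rv d : letters W2 & rv d ~= d" using okmap_swapD[OF ok2, of d] d L2 by simp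
  ultimately show ?thesis using L2 by auto
 qed
 have cw: "cwalk f ?u \<longleftrightarrow> cwalk f x & f c = f (hd x)" for f :: "'a \<times> 'a => 'z"
 proof -
  have "walk f b [c, ?c] a \<longleftrightarrow> f c = b & f c = a" for a b by auto
  hence "cwalk f ?u \<longleftrightarrow> walk f (f c) x (f c)" unfolding cwalk_def walk_append by metis
  thus ?thesis using x walk_hd[of f _ x] unfolding cwalk_def by metis
 qed
 have cw2: "(\<forall>w\<in>W2. cwalk f w) \<longleftrightarrow> (\<forall>w\<in>W1. cwalk f w) & f c = f (hd x)" for f :: "'a \<times> 'a => 'z"
  using cw[of f] by (auto simp: W1_def W2_def)
 have hdx: "hd x : L" using x by (auto simp: L_def W1_def)
 show sc: "s c = s (hd x)" using cw2[of s] okmap_cwalk[OF ok2] by blast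
 have wL: "set w <= L" if "w : W1" for w using that by (auto simp: L_def letters_def)
 show sn: "s ?c ~: s ` letters (insert x W)"
 proof
  assume "s ?c : s ` letters (insert x W)"
  then obtain d where d: "d : L" "s ?c = s d" by (auto simp: L_def W1_def)
  \<comment> \<open>The indicator of \<open>rv c\<close> is constant around every vertex, so
    faithfulness separates \<open>rv c\<close> from all old darts.\<close>
  define f where "f = (\<lambda>e. e = ?c)"
  have f0: "f e = False & f (rv e) = False" if "e : L" for e
   using cL swL[OF that] that by (auto simp: f_def)
  have "cwalk f w" if w: "w : W1" for w
   unfolding cwalk_def using walk_const[of w f False] f0 wL[OF w] by blast
  moreover have "f c = f (hd x)" using f0[OF hdx] cL by (auto simp: f_def)
  ultimately have "\<forall>w\<in>W2. cwalk f w" using cw2[of f] by blast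
  moreover have "?c : letters W2" "d : letters W2" using d L2 by auto
  ultimately have "f ?c = f d" using okmap_faithful[OF ok2, of f ?c d] d(2) by blast
  thus False using f0[OF d(1)] by (simp add: f_def)
 qed
 have finL: "finite L" using okmap_finite_letters[OF ok2] L2 by simp
 have "s ` letters W2 = insert (s ?c) (s ` L)" unfolding L2 using sc hdx by auto
 hence "card (s ` letters W2) = card (s ` L) + 1" using sn finL by (simp add: L_def W1_def)
 moreover have "card (letters W2) = card L + 2" unfolding L2 using cL finL by simp
 moreover have "card W2 = card W1" using n nx ok2 by (simp add: W1_def W2_def okmap_def)
 ultimately show "euler2 s (insert x W) = euler2 s (insert ?u W)"
  unfolding euler2_def W1_def[symmetric] W2_def[symmetric] L_def[symmetric] by simp
 have faith: "f d = f d'" if f: "\<forall>w\<in>W1. cwalk f w" and d: "d : L" "d' : L" "s d = s d'" for f :: "'a \<times> 'a => bool" and d d'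
 proof -
  define g where "g = f(c := f (hd x))"
  have gf: "g e = f e" if "e : L" for e using cL that by (auto simp: g_def)
  have "cwalk g w" if w: "w : W1" for w
   using cwalk_cong[of w g f] gf swL wL[OF w] f w by blast
  moreover have "g c = g (hd x)" using gf hdx by (simp add: g_def)
  ultimately have "\<forall>w\<in>W2. cwalk g w" using cw2[of g] by blast
  moreover have "d : letters W2" "d' : letters W2" using d L2 by auto
  ultimately have "g d = g d'" using okmap_faithful[OF ok2, of g d d'] d(3) by blast
  thus "f d = f d'" using gf d by simp
 qed
 have disj: "set v \<inter> set w = {}" if "v : W1" "w : W1" "v ~= w" for v w
 proof -
  have a: "set x \<inter> set u = {}" if "u : W" for u using dj that by (auto simp: letters_def)
  have b: "set v \<inter> set w = {}" if "v : W" "w : W" using ok2 \<open>v ~= w\<close> that unfolding okmap_def W2_def by blast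
  show ?thesis using that a b by (auto simp: W1_def)
 qed
 have dist: "distinct w" if "w : W1" for w using that ok2 du by (auto simp: W1_def W2_def okmap_def)
 have "\<forall>w\<in>W1. cwalk s w" using cw2[of s] okmap_cwalk[OF ok2] by blast
 moreover have "finite W1" "[] ~: W1" using ok2 x by (auto simp: W1_def W2_def okmap_def)
 ultimately have "okmap s W1" unfolding okmap_def L_def[symmetric] using disj dist swL faith by simp
 thus "okmap s (insert x W)" by (simp add: W1_def)
qed

lemma okmap_relabel:
 assumes "\<And>d. d : letters W ==> s d = s' d"
 shows "okmap s W \<longleftrightarrow> okmap s' W" "euler2 s W = euler2 s' W"
proof -
 have e: "s ` letters W = s' ` letters W" using assms by (intro image_cong) auto
 thus "euler2 s W = euler2 s' W" by (simp add: euler2_def)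
 have cw: "cwalk s w \<longleftrightarrow> cwalk s' w" if "w : W" and sw: "\<forall>d\<in>letters W. rv d : letters W & rv d ~= d" for w
 proof (rule cwalk_cong)
  fix d assume "d : set w"
  hence "d : letters W" using that by (auto simp: letters_def)
  thus "s d = s' d & s (rv d) = s' (rv d)" using assms sw by blast
 qed
 show "okmap s W \<longleftrightarrow> okmap s' W"
  unfolding okmap_def using assms cw by (auto simp: Ball_def)
qed

section \<open>Equivalence of surfaces with a single face\<close>

type_synonym space = "((real \<times> real) \<times> real) set"

text \<open>Moves introduce fresh letters whose labels depend on the old ones, hence the existential
  labelling. The \<open>itself\<close> argument fixes the type of labels, which does not occur in
  the words. The space \<open>S\<close> is quantified inside, so one new labelling serves all
  spaces.\<close>

definition weq :: "'v itself => ('a \<times> 'a) list => ('a \<times> 'a) list => bool" where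
 "weq _ w w' \<longleftrightarrow> (\<forall>s::'a \<times> 'a => 'v. okmap s {w} -->
   (\<exists>s'::'a \<times> 'a => 'v. okmap s' {w'} & euler2 s' {w'} = euler2 s {w} &
    (\<forall>S::space. realizes S s {w} \<longleftrightarrow> realizes S s' {w'})))"

lemma weq_refl: "weq T w w"
 unfolding weq_def by blast

lemma weq_trans: "weq T u v ==> weq T v w ==> weq T u w"
 unfolding weq_def by metis

lemma weq_rotate:
 fixes x y :: "('a \<times> 'a) list"
 shows "weq T (x @ y) (y @ x)"
 unfolding weq_def
proof (intro allI impI)
 fix s :: "'a \<times> 'a => 'v" assume ok: "okmap s {x @ y}"
 have r: "realizes S s {x @ y} \<longleftrightarrow> realizes S s {y @ x}" for S :: space
  using realizes_rotate[of x y "{}" S s] by (simp add: letters_def)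
 show "\<exists>s'::'a \<times> 'a => 'v. okmap s' {y @ x} & euler2 s' {y @ x} = euler2 s {x @ y} &
    (\<forall>S::space. realizes S s {x @ y} \<longleftrightarrow> realizes S s' {y @ x})"
 proof (intro exI[of _ s] conjI allI)
  show "okmap s {y @ x}" "euler2 s {y @ x} = euler2 s {x @ y}" using okmap_rotate[of s x y "{}"] ok by simp_all
 qed (rule r)
qed

lemma weq_pendant:
 fixes x :: "('a \<times> 'a) list"
 shows "x ~= [] ==> weq T (x @ [c, rv c]) x"
 unfolding weq_def
proof (intro allI impI)
 fix s :: "'a \<times> 'a => 'v" assume x: "x ~= []" and ok: "okmap s {x @ [c, rv c]}"
 have n: "x @ [c, rv c] ~: {}" by simp
 note p = okmap_pendant[OF x ok n]
 have r: "realizes S s {x @ [c, rv c]} \<longleftrightarrow> realizes S s {x}" for S :: space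
  using realizes_pendant[of x "{}" c s S] x p okmap_swap[OF p(1)] by (simp add: letters_def)
 show "\<exists>s'::'a \<times> 'a => 'v. okmap s' {x} & euler2 s' {x} = euler2 s {x @ [c, rv c]} &
    (\<forall>S::space. realizes S s {x @ [c, rv c]} \<longleftrightarrow> realizes S s' {x})"
 proof (intro exI[of _ s] conjI allI)
  show "okmap s {x}" "euler2 s {x} = euler2 s {x @ [c, rv c]}" using p by simp_all
 qed (rule r)
qed

lemma fresh_dart:
 assumes "infinite (UNIV :: 'a set)" "finite L"
 obtains c :: "'a \<times> 'a" where "c ~: L" "rv c ~: L" "rv c ~= c"
proof -
 have f: "finite (fst ` L \<union> snd ` L)" using assms by simp
 obtain p where p: "p ~: fst ` L \<union> snd ` L" using ex_new_if_finite[OF assms(1) f] by blast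
 obtain q where q: "q ~: insert p (fst ` L \<union> snd ` L)" using ex_new_if_finite[OF assms(1), of "insert p (fst ` L \<union> snd ` L)"] f by blast
 show ?thesis by (rule that[of "(p, q)"]) (use p q in force)+
qed

text \<open>Cutting along a new dart and regluing along \<open>z\<close> rotates both complementary arcs of \<open>z\<close>.\<close>

lemma weq_cut_paste:
 fixes z :: "'a \<times> 'a"
 assumes inf: "infinite (UNIV :: 'a set)"
 shows "\<exists>c. weq T ([z] @ P @ Q @ [rv z] @ R @ U) ([c] @ Q @ P @ [rv c] @ U @ R)"
proof -
 let ?z = "rv z"
 \<comment> \<open>The chord joins the corner between \<open>P\<close> and \<open>Q\<close> to the
   corner between \<open>R\<close> and \<open>U\<close>. Then \<open>z\<close> and its reverse lie
   in different halves, and the halves can be glued along \<open>z\<close> instead.\<close>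
 define x where "x = Q @ [?z] @ R"
 define y where "y = U @ [z] @ P"
 obtain c where c: "c ~: set (x @ y)" "rv c ~: set (x @ y)" "rv c ~= c"
  using fresh_dart[OF inf, of "set (x @ y)"] by blast
 let ?c = "rv c"
 define x' where "x' = P @ [?c] @ U"
 define y' where "y' = R @ [c] @ Q"
 have "weq T (x @ y) (x' @ y')"
  unfolding weq_def
 proof (intro allI impI)
  fix s0 :: "'a \<times> 'a => 'v" assume ok0: "okmap s0 {x @ y}"
  \<comment> \<open>On the fresh dart the given labelling is arbitrary; it is overwritten by the
    labels that the chord must have.\<close>
  define s where "s = s0(c := s0 (hd y), ?c := s0 (hd x))"
  have ss0: "s0 d = s d" if "d : letters {x @ y}" for d using that c by (auto simp: s_def letters_def)
  have ok: "okmap s {x @ y}" and e0: "euler2 s0 {x @ y} = euler2 s {x @ y}" using okmap_relabel[of "{x @ y}" s0 s] ss0 ok0 by blast+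
  have r0: "realizes S s0 {x @ y} \<longleftrightarrow> realizes S s {x @ y}" for S :: space
   by (rule realizes_relabel) (use ss0 in simp)
  have ne: "x ~= []" "y ~= []" by (auto simp: x_def y_def)
  have hxy: "hd x : letters {x @ y}" "hd y : letters {x @ y}" using ne by (auto simp: letters_def)
  have "s c = s0 (hd y)" "s ?c = s0 (hd x)" using c(3) by (simp_all add: s_def)
  hence sc: "s c = s (hd y)" "s ?c = s (hd x)" using ss0[OF hxy(1)] ss0[OF hxy(2)] by simp_all
  have ne2: "x @ [c] ~= y @ [?c]" using c by auto
  have L: "letters (insert (x @ y) {}) = set (x @ y)" by (simp add: letters_def)
  have ok2: "okmap s {x @ [c], y @ [?c]}" and e2: "euler2 s {x @ y} = euler2 s {x @ [c], y @ [?c]}"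
   using okmap_split[OF ne, of "{}" c s] ne2 c sc ok by (auto simp: letters_def)
  have r2: "realizes S s {x @ y} \<longleftrightarrow> realizes S s {x @ [c], y @ [?c]}" for S :: space
   using realizes_split[OF ne, of "{}" c s S] c sc okmap_swap[OF ok] unfolding L by (simp add: letters_def)
  have n2: "x @ [c] ~: {y @ [?c]}" using ne2 by simp
  have x1: "x @ [c] = Q @ ([?z] @ R @ [c])" "([?z] @ R @ [c]) @ Q = [?z] @ y'" by (auto simp: x_def y'_def)
  have y1: "y @ [?c] = (U @ [z]) @ (P @ [?c])" "(P @ [?c]) @ (U @ [z]) = x' @ [z]" by (auto simp: y_def x'_def)
  have A1: "okmap s {[?z] @ y', y @ [?c]}" "euler2 s {[?z] @ y', y @ [?c]} = euler2 s {x @ [c], y @ [?c]}" "[?z] @ y' ~: {y @ [?c]}"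
   using okmap_rotate[of s Q "[?z] @ R @ [c]" "{y @ [?c]}"] ok2 n2 unfolding x1 by auto
  have R1: "realizes S s {x @ [c], y @ [?c]} \<longleftrightarrow> realizes S s {[?z] @ y', y @ [?c]}" for S :: space
   using realizes_rotate[of Q "[?z] @ R @ [c]" "{y @ [?c]}" S s] okmap_disj[of s "x @ [c]" "{y @ [?c]}"] ok2 n2 unfolding x1 by simp
  have A2: "okmap s {y' @ [?z], y @ [?c]}" "euler2 s {y' @ [?z], y @ [?c]} = euler2 s {[?z] @ y', y @ [?c]}" "y' @ [?z] ~: {y @ [?c]}"
   using okmap_rotate[of s "[?z]" y' "{y @ [?c]}"] A1 by auto
  have R2: "realizes S s {[?z] @ y', y @ [?c]} \<longleftrightarrow> realizes S s {y' @ [?z], y @ [?c]}" for S :: space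
   using realizes_rotate[of "[?z]" y' "{y @ [?c]}" S s] okmap_disj[of s "[?z] @ y'" "{y @ [?c]}"] A1 by simp
  have A2': "okmap s (insert ((U @ [z]) @ (P @ [?c])) {y' @ [?z]})" "(U @ [z]) @ (P @ [?c]) ~: {y' @ [?z]}"
   using A2 unfolding y1 by (auto simp: insert_commute)
  have A3: "okmap s {x' @ [z], y' @ [?z]}" "euler2 s {x' @ [z], y' @ [?z]} = euler2 s {y' @ [?z], y @ [?c]}" "x' @ [z] ~: {y' @ [?z]}"
   using okmap_rotate[OF A2'] y1 by (auto simp: insert_commute)
  have R3: "realizes S s {y' @ [?z], y @ [?c]} \<longleftrightarrow> realizes S s {x' @ [z], y' @ [?z]}" for S :: space
  proof -
   have s1: "{y' @ [?z], y @ [?c]} = insert ((U @ [z]) @ (P @ [?c])) {y' @ [?z]}" unfolding y1(1)[symmetric] by blast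
   have s2: "{x' @ [z], y' @ [?z]} = insert ((P @ [?c]) @ (U @ [z])) {y' @ [?z]}" unfolding y1(2) by blast
   show ?thesis unfolding s1 s2 by (rule realizes_rotate[OF okmap_disj[OF A2']])
  qed
  have ne': "x' ~= []" "y' ~= []" by (auto simp: x'_def y'_def)
  have cw: "cwalk s (x' @ [z])" "cwalk s (y' @ [?z])" using A3(1) by (auto simp: okmap_def)
  hence sz: "s z = s (hd y')" "s ?z = s (hd x')" using walk_split_iff[OF ne', of s z] by auto
  have zz: "z ~: letters (insert (x' @ y') {})" "?z ~: letters (insert (x' @ y') {})" "?z ~= z"
  proof -
   have "distinct (x' @ [z])" "distinct (y' @ [?z])" "set (x' @ [z]) \<inter> set (y' @ [?z]) = {}"
    using A3(1,3) unfolding okmap_def by auto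
   thus "z ~: letters (insert (x' @ y') {})" "?z ~: letters (insert (x' @ y') {})" "?z ~= z" by (auto simp: letters_def)
  qed
  have ok4: "okmap s {x' @ y'}" and e4: "euler2 s {x' @ y'} = euler2 s {x' @ [z], y' @ [?z]}"
   using okmap_split[OF ne', of "{}" z s] zz sz A3 by auto
  have r4: "realizes S s {x' @ y'} \<longleftrightarrow> realizes S s {x' @ [z], y' @ [?z]}" for S :: space
   using realizes_split[OF ne', of "{}" z s S] zz sz okmap_swap[OF ok4] by (simp add: letters_def)
  show "\<exists>s'::'a \<times> 'a => 'v. okmap s' {x' @ y'} & euler2 s' {x' @ y'} = euler2 s0 {x @ y} &
    (\<forall>S::space. realizes S s0 {x @ y} \<longleftrightarrow> realizes S s' {x' @ y'})"
   using ok4 e0 e2 e4 A1(2) A2(2) A3(2) r0 r2 R1 R2 R3 r4 by (intro exI[of _ s]) simp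
 qed
 moreover have "weq T ([z] @ P @ Q @ [?z] @ R @ U) (x @ y)"
  using weq_rotate[of T "[z] @ P" "(Q @ [?z] @ R) @ U"] weq_rotate[of T "Q @ [?z] @ R" "U @ [z] @ P"]
  by (simp add: x_def y_def)
 moreover have "weq T (x' @ y') ([c] @ Q @ P @ [?c] @ U @ R)"
  using weq_rotate[of T "P @ [?c] @ U @ R" "[c] @ Q"] by (simp add: x'_def y'_def)
 ultimately show ?thesis using weq_trans by metis
qed

section \<open>Collecting linked pairs into commutators\<close>

definition comm :: "'a \<times> 'a => 'a \<times> 'a => ('a \<times> 'a) list" where
 "comm x y = [x, y, rv x, rv y]"

text \<open>The classical collection of a handle: the surface is reglued along \<open>x\<close>,
  then along \<open>y\<close>, then along the dart \<open>c\<close> created by the first cut; what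
  remains is a commutator of the last two fresh darts.\<close>

lemma weq_handle:
 fixes x y :: "'a \<times> 'a"
 assumes inf: "infinite (UNIV :: 'a set)"
 shows "\<exists>a b. weq T ([x] @ B @ [y] @ C @ [rv x] @ D @ [rv y] @ A) (comm a b @ A @ D @ C @ B)"
proof -
 obtain c where c: "weq T ([x] @ B @ ([y] @ C) @ [rv x] @ D @ ([rv y] @ A)) ([c] @ ([y] @ C) @ B @ [rv c] @ ([rv y] @ A) @ D)"
  using weq_cut_paste[OF inf] by blast
 obtain e where e: "weq T ([y] @ (C @ B) @ [rv c] @ [rv y] @ (A @ D @ [c]) @ []) ([e] @ [rv c] @ (C @ B) @ [rv e] @ [] @ (A @ D @ [c]))"
  using weq_cut_paste[OF inf] by blast
 obtain h where h: "weq T ([c] @ [e] @ [] @ [rv c] @ (C @ B) @ ([rv e] @ A @ D)) ([h] @ [] @ [e] @ [rv h] @ ([rv e] @ A @ D) @ (C @ B))"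
  using weq_cut_paste[OF inf] by blast
 have r1: "weq T ([c] @ ([y] @ C) @ B @ [rv c] @ ([rv y] @ A) @ D) ([y] @ (C @ B) @ [rv c] @ [rv y] @ (A @ D @ [c]) @ [])"
  using weq_rotate[of T "[c]" "[y] @ C @ B @ [rv c] @ [rv y] @ A @ D"] by simp
 have r2: "weq T ([e] @ [rv c] @ (C @ B) @ [rv e] @ [] @ (A @ D @ [c])) ([c] @ [e] @ [] @ [rv c] @ (C @ B) @ ([rv e] @ A @ D))"
  using weq_rotate[of T "[e] @ [rv c] @ C @ B @ [rv e] @ A @ D" "[c]"] by simp
 have "weq T ([x] @ B @ [y] @ C @ [rv x] @ D @ [rv y] @ A) (comm h e @ A @ D @ C @ B)"
  using weq_trans[OF weq_trans[OF weq_trans[OF weq_trans[OF c r1] e] r2] h] by (simp add: comm_def)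
 thus ?thesis by blast
qed

text \<open>Moves a commutator past a stretch of the word. One regluing along \<open>x\<close>
  dissolves it into a linked pair, with \<open>A\<close> and \<open>B\<close> on different sides;
  collecting that pair again returns a commutator and the two stretches in exchanged order.\<close>

lemma weq_slide:
 fixes x y :: "'a \<times> 'a"
 assumes inf: "infinite (UNIV :: 'a set)"
 shows "\<exists>a b. weq T (comm x y @ A @ B) (comm a b @ B @ A)"
proof -
 obtain c where c: "weq T ([x] @ [y] @ [] @ [rv x] @ ([rv y] @ A) @ B) ([c] @ [] @ [y] @ [rv c] @ B @ ([rv y] @ A))"
  using weq_cut_paste[OF inf] by blast
 have r: "weq T ([c] @ [] @ [y] @ [rv c] @ B @ ([rv y] @ A)) ([rv y] @ A @ [c] @ [] @ [y] @ [] @ [rv c] @ B)"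
  using weq_rotate[of T "[c] @ [y] @ [rv c] @ B" "[rv y] @ A"] by simp
 obtain a b where ab: "weq T ([rv y] @ A @ [c] @ [] @ [rv (rv y)] @ [] @ [rv c] @ B) (comm a b @ B @ [] @ [] @ A)"
  using weq_handle[OF inf] by blast
 have c': "weq T (comm x y @ A @ B) ([c] @ [] @ [y] @ [rv c] @ B @ ([rv y] @ A))" using c by (simp add: comm_def)
 have "weq T ([rv y] @ A @ [c] @ [] @ [y] @ [] @ [rv c] @ B) (comm a b @ B @ A)" using ab by simp
 thus ?thesis using weq_trans[OF weq_trans[OF c' r]] by blast
qed

definition blocks :: "(('a \<times> 'a) \<times> ('a \<times> 'a)) list => ('a \<times> 'a) list" where
 "blocks zs = concat (map (\<lambda>(x, y). comm x y) zs)"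

lemma blocks_Cons: "blocks ((x, y) # zs) = comm x y @ blocks zs"
 by (simp add: blocks_def)

lemma blocks_swap: "d : set (blocks zs) ==> rv d : set (blocks zs)"
proof (induction zs)
 case (Cons z zs)
 obtain x y where z: "z = (x, y)" by (cases z)
 have "rv d : set (comm x y)" if "d : set (comm x y)"
  using that unfolding comm_def by (simp only: list.set insert_iff empty_iff) (metis swap_swap)
 thus ?case using Cons unfolding z blocks_Cons set_append by blast
qed (simp add: blocks_def)

text \<open>A letter and its reverse at least distance. Two mutually reverse letters inside
  \<open>M\<close> would be closer, so every letter of \<open>M\<close> is linked with
  \<open>c\<close>; if \<open>M\<close> is empty, the pair cancels.\<close>

lemma minimal_pair:
 fixes u :: "('a \<times> 'a) list"
 assumes "u ~= []" "\<And>d. d : set u ==> rv d : set u & rv d ~= d"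
 obtains A c M E where "u = A @ [c] @ M @ [rv c] @ E" "\<And>y. y : set M ==> rv y ~: set M"
proof -
 define P where "P = (\<lambda>n. \<exists>A c M E. u = A @ [c] @ M @ [rv c] @ E & length M = n)"
 have "\<exists>n. P n"
 proof -
  obtain d u' where u: "u = d # u'" using assms(1) by (cases u) auto
  hence "rv d : set u'" using assms(2)[of d] by auto
  then obtain M E where "u' = M @ rv d # E" by (meson split_list)
  hence "u = [] @ [d] @ M @ [rv d] @ E" using u by simp
  thus ?thesis unfolding P_def by blast
 qed
 then obtain n where n: "P n" "\<And>m. m < n ==> \<not> P m" by (metis exists_least_iff)
 obtain A c M E where M: "u = A @ [c] @ M @ [rv c] @ E" "length M = n" using n(1) unfolding P_def by blast
 have "rv y ~: set M" if y: "y : set M" for y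
 proof
  assume y': "rv y : set M"
  obtain M1 M2 where M12: "M = M1 @ y # M2" using y by (meson split_list)
  have "y : set u" using M y by auto
  hence "rv y ~= y" using assms(2) by blast
  hence "rv y : set M1 \<or> rv y : set M2" using y' M12 by auto
  thus False
  proof
   assume "rv y : set M1"
   then obtain N1 N2 where "M1 = N1 @ rv y # N2" by (meson split_list)
   hence "u = (A @ [c] @ N1) @ [rv y] @ N2 @ [rv (rv y)] @ (M2 @ [rv c] @ E)" "length N2 < n"
    using M M12 by auto
   thus False using n(2) unfolding P_def by blast
  next
   assume "rv y : set M2"
   then obtain N1 N2 where "M2 = N1 @ rv y # N2" by (meson split_list)
   hence "u = (A @ [c] @ M1) @ [y] @ N1 @ [rv y] @ (N2 @ [rv c] @ E)" "length N1 < n"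
    using M M12 by auto
   thus False using n(2) unfolding P_def by blast
  qed
 qed
 thus ?thesis using that M(1) by blast
qed

text \<open>Induction on the part \<open>u\<close> that is not yet in commutators. An innermost pair
  either cancels, or is linked with another pair and both are turned into a commutator; the word
  \<open>[c, rv c]\<close>, which may not cancel to the empty word, is the sphere.\<close>

lemma weq_normal_form:
 fixes u :: "('a \<times> 'a) list" and s :: "'a \<times> 'a => 'v"
 assumes inf: "infinite (UNIV :: 'a set)" and "okmap s {u @ blocks zs}"
 shows "\<exists>w. weq TYPE('v) (u @ blocks zs) w & ((\<exists>zs'. zs' ~= [] & w = blocks zs') \<or> (\<exists>c. w = [c, rv c]))"
 using assms(2)
proof (induction "length u" arbitrary: u zs s rule: less_induct)
 case less
 let ?T = "TYPE('v)"
 show ?case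
 proof (cases "u = []")
  case True
  have "u @ blocks zs ~= []" using less.prems unfolding okmap_def by blast
  hence "zs ~= []" using True by (auto simp: blocks_def)
  thus ?thesis using True weq_refl[of ?T] by auto
 next
  case False
  have d: "distinct (u @ blocks zs)" using less.prems by (auto simp: okmap_def)
  have sw: "rv d : set u & rv d ~= d" if "d : set u" for d
  proof -
   have "d : letters {u @ blocks zs}" using that by (auto simp: letters_def)
   hence "rv d : letters {u @ blocks zs} & rv d ~= d" using less.prems unfolding okmap_def by blast
   moreover have "rv d ~: set (blocks zs)"
    using blocks_swap[of "rv d" zs] d that by auto
   ultimately show ?thesis by (auto simp: letters_def)
  qed
  obtain A c M E where u: "u = A @ [c] @ M @ [rv c] @ E" and M: "\<And>y. y : set M ==> rv y ~: set M"
   using minimal_pair[OF False sw] by blast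
  have step: "?thesis" if "weq ?T (u @ blocks zs) (u' @ blocks zs')" "length u' < length u" for u' zs'
  proof -
   have "\<exists>s'::'a \<times> 'a => 'v. okmap s' {u' @ blocks zs'}"
    using that(1)[unfolded weq_def, rule_format, OF less.prems] by blast
   then obtain s' :: "'a \<times> 'a => 'v" where "okmap s' {u' @ blocks zs'}" by blast
   thus ?thesis using less.hyps[OF that(2)] that(1) weq_trans by metis
  qed
  show ?thesis
  proof (cases M)
   case Nil
   show ?thesis
   proof (cases "E @ blocks zs @ A = []")
    case True
    hence e: "u @ blocks zs = [c, rv c]" using u Nil by auto
    show ?thesis unfolding e using weq_refl[of ?T "[c, rv c]"] by blast
   next
    case ne: False
    have "weq ?T (u @ blocks zs) ((E @ blocks zs @ A) @ [c, rv c])"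
     using weq_rotate[of ?T "A @ [c, rv c]" "E @ blocks zs"] u Nil by simp
    moreover have "weq ?T ((E @ blocks zs @ A) @ [c, rv c]) (E @ blocks zs @ A)" by (rule weq_pendant[OF ne])
    moreover have "weq ?T (E @ blocks zs @ A) ((A @ E) @ blocks zs)"
     using weq_rotate[of ?T "E @ blocks zs" A] by simp
    ultimately have "weq ?T (u @ blocks zs) ((A @ E) @ blocks zs)" using weq_trans by metis
    thus ?thesis by (rule step) (simp add: u)
   qed
  next
   case (Cons y M')
   have yu: "y : set u" using u Cons by auto
   hence "rv y : set u" using sw by blast
   moreover have "rv y ~: set M" using M Cons by auto
   moreover have "y ~= c" "y ~= rv c" using d u Cons by auto
   hence "rv y ~= c" "rv y ~= rv c" by (metis swap_swap)+
   ultimately have "rv y : set A \<or> rv y : set E" using u by auto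
   thus ?thesis
   proof
    assume "rv y : set E"
    then obtain D E2 where E: "E = D @ rv y # E2" by (meson split_list)
    let ?A = "E2 @ blocks zs @ A"
    have w1: "weq ?T (u @ blocks zs) ([c] @ [] @ [y] @ M' @ [rv c] @ D @ [rv y] @ ?A)"
     using weq_rotate[of ?T A "[c] @ [y] @ M' @ [rv c] @ D @ [rv y] @ E2 @ blocks zs"] by (simp add: u Cons E)
    obtain a b where "weq ?T ([c] @ [] @ [y] @ M' @ [rv c] @ D @ [rv y] @ ?A) (comm a b @ ?A @ D @ M' @ [])"
     using weq_handle[OF inf] by blast
    hence w2: "weq ?T ([c] @ [] @ [y] @ M' @ [rv c] @ D @ [rv y] @ ?A) (comm a b @ E2 @ (blocks zs @ A @ D @ M'))"
     by simp
    \<comment> \<open>\<open>E2\<close> stands between the new commutator and the old ones; sliding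
      removes it so that the commutators form one run.\<close>
    obtain a' b' where w3: "weq ?T (comm a b @ E2 @ (blocks zs @ A @ D @ M')) (comm a' b' @ (blocks zs @ A @ D @ M') @ E2)"
     using weq_slide[OF inf] by blast
    have w4: "weq ?T (comm a' b' @ (blocks zs @ A @ D @ M') @ E2) ((A @ D @ M' @ E2) @ blocks ((a', b') # zs))"
     using weq_rotate[of ?T "comm a' b' @ blocks zs" "A @ D @ M' @ E2"] by (simp add: blocks_Cons)
    have "weq ?T (u @ blocks zs) ((A @ D @ M' @ E2) @ blocks ((a', b') # zs))"
     by (rule weq_trans[OF weq_trans[OF weq_trans[OF w1 w2] w3] w4])
    thus ?thesis by (rule step) (simp add: u Cons E)
   next
    assume "rv y : set A"
    then obtain A1 D where A: "A = A1 @ rv y # D" by (meson split_list)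
    let ?A = "E @ blocks zs @ A1"
    \<comment> \<open>Here the linked pairs alternate starting with \<open>rv y\<close>, so
      \<open>rv y\<close> takes the first place in \<open>weq_handle\<close> and \<open>y\<close>
      has to be read as \<open>rv (rv y)\<close>.\<close>
    have w1: "weq ?T (u @ blocks zs) ([rv y] @ D @ [c] @ [] @ [rv (rv y)] @ M' @ [rv c] @ ?A)"
     using weq_rotate[of ?T A1 "[rv y] @ D @ [c] @ [y] @ M' @ [rv c] @ E @ blocks zs"] by (simp add: u Cons A)
    obtain a b where "weq ?T ([rv y] @ D @ [c] @ [] @ [rv (rv y)] @ M' @ [rv c] @ ?A) (comm a b @ ?A @ M' @ [] @ D)"
     using weq_handle[OF inf] by blast
    hence w2: "weq ?T ([rv y] @ D @ [c] @ [] @ [rv (rv y)] @ M' @ [rv c] @ ?A) (comm a b @ E @ (blocks zs @ A1 @ M' @ D))"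
     by simp
    obtain a' b' where w3: "weq ?T (comm a b @ E @ (blocks zs @ A1 @ M' @ D)) (comm a' b' @ (blocks zs @ A1 @ M' @ D) @ E)"
     using weq_slide[OF inf] by blast
    have w4: "weq ?T (comm a' b' @ (blocks zs @ A1 @ M' @ D) @ E) ((A1 @ M' @ D @ E) @ blocks ((a', b') # zs))"
     using weq_rotate[of ?T "comm a' b' @ blocks zs" "A1 @ M' @ D @ E"] by (simp add: blocks_Cons)
    have "weq ?T (u @ blocks zs) ((A1 @ M' @ D @ E) @ blocks ((a', b') # zs))"
     by (rule weq_trans[OF weq_trans[OF weq_trans[OF w1 w2] w3] w4])
    thus ?thesis by (rule step) (simp add: u Cons A)
   qed
  qed
 qed
qed

lemma blocks_length: "length (blocks zs) = 4 * length zs"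
 by (induction zs) (auto simp: blocks_def comm_def)

lemma blocks_nth:
 "k < length zs ==> blocks zs ! (4 * k) = fst (zs ! k) & blocks zs ! (4 * k + 1) = snd (zs ! k) &
   blocks zs ! (4 * k + 2) = rv (fst (zs ! k)) & blocks zs ! (4 * k + 3) = rv (snd (zs ! k))"
proof (induction zs arbitrary: k)
 case (Cons z zs)
 obtain x y where z: "z = (x, y)" by (cases z)
 have c: "blocks (z # zs) = x # y # rv x # rv y # blocks zs" by (simp add: z blocks_Cons comm_def)
 show ?case
 proof (cases k)
  case 0 thus ?thesis unfolding c by (simp add: z numeral_eq_Suc)
 next
  case (Suc k')
  have "blocks (z # zs) ! (4 + n) = blocks zs ! n" for n unfolding c by (simp add: numeral_eq_Suc)
  moreover have "4 * k = 4 + 4 * k'" "4 * k + 1 = 4 + (4 * k' + 1)" "4 * k + 2 = 4 + (4 * k' + 2)" "4 * k + 3 = 4 + (4 * k' + 3)" using Suc by auto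
  ultimately show ?thesis using Cons.IH[of k'] Cons.prems Suc by (metis Suc_less_eq length_Cons nth_Cons_Suc)
 qed
qed simp

text \<open>The corners of a commutator identify the origins of its four darts with each other and
  with its end. So a normal surface of positive genus has a single vertex.\<close>

lemma cwalk_blocks:
 assumes "cwalk s (blocks zs)" "d : set (blocks zs)" "d' : set (blocks zs)"
 shows "s d = s d'"
proof -
 have key: "walk s a (blocks zs) b ==> (\<forall>d\<in>set (blocks zs). s d = a) & a = b" for a b
 proof (induction zs arbitrary: a b)
  case (Cons z zs)
  obtain x y where z: "z = (x, y)" by (cases z)
  thus ?case using Cons by (auto simp: blocks_Cons comm_def)
 qed (simp add: blocks_def)
 obtain a where "walk s a (blocks zs) a" using assms(1) unfolding cwalk_def by blast
 thus ?thesis using key[of a a] assms(2,3) by simp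
qed

definition normal_word :: "nat => ('a \<times> 'a) list => bool" where
 "normal_word h w \<longleftrightarrow> (if h = 0 then \<exists>c. w = [c, rv c] else \<exists>zs. length zs = h & w = blocks zs)"

lemma okmap_pair_neq:
 assumes "okmap s {[c, rv c]}"
 shows "s c ~= s (rv c)"
proof
 assume e: "s c = s (rv c)"
 have sc: "rv c ~= c" using okmap_swapD[OF assms, of c] by (auto simp: letters_def)
 have "cwalk (\<lambda>d. d = c) [c, rv c]" unfolding cwalk_def using sc by (intro exI[of _ True]) simp
 thus False using okmap_faithful[OF assms, of "\<lambda>d. d = c" c "rv c"] e sc by (auto simp: letters_def)
qed

lemma normal_word_euler:
 assumes "normal_word h w" "okmap s {w}"
 shows "euler2 s {w} = 4 - 4 * int h"
proof (cases "h = 0")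
 case True
 then obtain c where w: "w = [c, rv c]" using assms(1) by (auto simp: normal_word_def)
 have "s c ~= s (rv c)" using okmap_pair_neq assms(2) w by blast
 hence "card {s c, s (rv c)} = 2" by simp
 moreover have "c ~= rv c" using assms(2) unfolding okmap_def w by auto
 hence "card {c, rv c} = 2" by simp
 moreover have "letters {w} = {c, rv c}" by (simp add: letters_def w)
 ultimately show ?thesis using True unfolding euler2_def by simp
next
 case False
 then obtain zs where zs: "length zs = h" "w = blocks zs" using assms(1) by (auto simp: normal_word_def)
 have L: "letters {w} = set (blocks zs)" by (simp add: letters_def zs)
 have ne: "blocks zs ~= []" using zs False blocks_length[of zs] by auto
 have "cwalk s (blocks zs)" using okmap_cwalk[OF assms(2)] zs by simp
 hence "s d = s (hd (blocks zs))" if "d : set (blocks zs)" for d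
  using cwalk_blocks that hd_in_set[OF ne] by blast
 hence "s ` set (blocks zs) = {s (hd (blocks zs))}" using hd_in_set[OF ne] by blast
 moreover have "card (set (blocks zs)) = 4 * h"
  using assms(2) zs blocks_length[of zs] by (simp add: okmap_def distinct_card)
 ultimately show ?thesis unfolding euler2_def L by simp
qed

lemma normal_word_exists:
 fixes s :: "'a \<times> 'a => 'v"
 assumes inf: "infinite (UNIV :: 'a set)" and ok: "okmap s {w}"
 shows "\<exists>w' h (s' :: 'a \<times> 'a => 'v). normal_word h w' & okmap s' {w'} & euler2 s' {w'} = euler2 s {w} &
   (\<forall>S::space. realizes S s {w} \<longleftrightarrow> realizes S s' {w'})"
proof -
 have "okmap s {w @ blocks []}" using ok by (simp add: blocks_def)
 from weq_normal_form[OF inf this] obtain w' where w': "weq TYPE('v) w w'"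
  "(\<exists>zs'. zs' ~= [] & w' = blocks zs') \<or> (\<exists>c. w' = [c, rv c])" by (auto simp: blocks_def)
 have "\<exists>h. normal_word h w'"
  using w'(2) by (metis length_0_conv normal_word_def)
 thus ?thesis using w'(1) ok unfolding weq_def by metis
qed

text \<open>The place of the reverse of a letter depends only on \<open>h\<close>. Hence renaming by
  position carries one normal word to another compatibly with reversal.\<close>

lemma normal_word_swap:
 assumes "normal_word h w1" "normal_word h w2" "k < length w1"
 shows "length w1 = length w2" "\<exists>l<length w1. w1 ! l = rv (w1 ! k) & w2 ! l = rv (w2 ! k)"
proof -
 show len: "length w1 = length w2" using assms(1,2) by (auto simp: normal_word_def blocks_length split: if_splits)
 show "\<exists>l<length w1. w1 ! l = rv (w1 ! k) & w2 ! l = rv (w2 ! k)"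
 proof (cases "h = 0")
  case True
  then obtain c1 c2 where w: "w1 = [c1, rv c1]" "w2 = [c2, rv c2]" using assms(1,2) by (auto simp: normal_word_def)
  hence "k = 0 \<or> k = 1" using assms(3) by auto
  thus ?thesis using w by (intro exI[of _ "1 - k"]) auto
 next
  case False
  then obtain z1 z2 where z: "length z1 = h" "w1 = blocks z1" "length z2 = h" "w2 = blocks z2" using assms(1,2) by (auto simp: normal_word_def)
  define q where "q = k div 4"
  have q: "q < h" using assms(3) z blocks_length[of z1] by (simp add: q_def less_mult_imp_div_less mult.commute)
  have len4: "length w1 = 4 * h" using z blocks_length[of z1] by simp
  note b = blocks_nth[of q z1] blocks_nth[of q z2]
  have "k = 4 * q + k mod 4" by (simp add: q_def)
  moreover have "k mod 4 < 4" by simp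
  hence "k mod 4 = 0 \<or> k mod 4 = 1 \<or> k mod 4 = 2 \<or> k mod 4 = 3" by linarith
  ultimately consider "k = 4 * q" | "k = 4 * q + 1" | "k = 4 * q + 2" | "k = 4 * q + 3" by linarith
  thus ?thesis
  proof cases
   case 1 thus ?thesis using b q z len4 by (intro exI[of _ "4 * q + 2"]) auto
  next
   case 2 thus ?thesis using b q z len4 by (intro exI[of _ "4 * q + 3"]) auto
  next
   case 3 thus ?thesis using b q z len4 by (intro exI[of _ "4 * q"]) auto
  next
   case 4 thus ?thesis using b q z len4 by (intro exI[of _ "4 * q + 1"]) auto
  qed
 qed
qed

lemma normal_word_transfer:
 fixes S :: space
 assumes n: "normal_word h w1" "normal_word h w2" and ok: "okmap s1 {w1}" "okmap s2 {w2}" and R: "realizes S s1 {w1}"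
 shows "realizes S s2 {w2}"
proof -
 have d: "distinct w1" "distinct w2" using ok by (auto simp: okmap_def)
 have L: "letters {w2} = set w2" "letters {w1} = set w1" by (simp_all add: letters_def)
 have len: "length w1 = length w2" using n by (auto simp: normal_word_def blocks_length split: if_splits)
 define \<theta> where "\<theta> = (\<lambda>d. w1 ! (THE k. k < length w2 & w2 ! k = d))"
 have th: "\<theta> (w2 ! k) = w1 ! k" if "k < length w2" for k
 proof -
  have "(THE k'. k' < length w2 & w2 ! k' = w2 ! k) = k"
   using that d(2) by (intro the_equality) (auto simp: nth_eq_iff_index_eq)
  thus ?thesis by (simp add: \<theta>_def)
 qed
 have m: "map \<theta> w2 = w1" using th len by (intro nth_equalityI) auto
 have "realizes S (s1 \<circ> \<theta>) {w2}"
 proof (rule realizes_rename[OF R])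
  show "{w1} = map \<theta> ` {w2}" using m by simp
  show "inj_on \<theta> (letters {w2})"
   using m d len unfolding L by (metis distinct_map)
  fix e assume e: "e : letters {w2}"
  then obtain k where k: "k < length w2" "w2 ! k = e" unfolding L by (metis in_set_conv_nth)
  obtain l where l: "l < length w1" "w1 ! l = rv (w1 ! k)" "w2 ! l = rv (w2 ! k)"
   using normal_word_swap(2)[OF n] k len by metis
  show "rv e : letters {w2} & \<theta> (rv e) = rv (\<theta> e)"
   using k l th[of l] th[of k] len okmap_swapD[OF ok(2) e] by simp
 qed
 moreover have "(s1 \<circ> \<theta>) e = (s1 \<circ> \<theta>) e' \<longleftrightarrow> s2 e = s2 e'" if e: "e : letters {w2}" "e' : letters {w2}" for e e'
 proof (cases "h = 0")
  case False
  then obtain z1 z2 where z: "w1 = blocks z1" "w2 = blocks z2" using n by (auto simp: normal_word_def)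
  have "\<theta> e : set w1" "\<theta> e' : set w1" using e m unfolding L by (metis image_eqI set_map)+
  thus ?thesis using cwalk_blocks[of s1 z1 "\<theta> e" "\<theta> e'"] cwalk_blocks[of s2 z2 e e'] e z okmap_cwalk[OF ok(1)] okmap_cwalk[OF ok(2)]
   unfolding L by simp
 next
  case True
  then obtain c1 c2 where w: "w1 = [c1, rv c1]" "w2 = [c2, rv c2]" using n by (auto simp: normal_word_def)
  have "\<theta> c2 = c1" "\<theta> (rv c2) = rv c1" using m w by auto
  moreover have "s1 c1 ~= s1 (rv c1)" "s2 c2 ~= s2 (rv c2)" using okmap_pair_neq ok w by blast+
  moreover have "e = c2 \<or> e = rv c2" "e' = c2 \<or> e' = rv c2" using e w unfolding L by auto
  ultimately show ?thesis by auto
 qed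
 ultimately show ?thesis using realizes_relabel[of "{w2}" "s1 \<circ> \<theta>" s2 S] by blast
qed

text \<open>Connectedness of the glued surface, stated on darts: only everything is closed under
  passing along a face and across an edge.\<close>

definition wconn :: "('a \<times> 'a) list set => bool" where
 "wconn W \<longleftrightarrow> (\<forall>C\<subseteq>letters W. C ~= {} --> (\<forall>w\<in>W. set w \<inter> C ~= {} --> set w <= C) --> rv ` C <= C --> C = letters W)"

lemma wconn_cong:
 assumes "set ` W = set ` W'"
 shows "wconn W \<longleftrightarrow> wconn W'"
proof -
 have L: "letters W = letters W'" unfolding letters_def using assms by simp
 have a: "(\<forall>w\<in>V. set w \<inter> C ~= {} --> set w <= C) \<longleftrightarrow> (\<forall>A\<in>set ` V. A \<inter> C ~= {} --> A <= C)" for C V by auto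
 show ?thesis unfolding wconn_def L a assms by (rule refl)
qed

text \<open>As long as there are two faces, connectedness yields an edge with different faces on its
  two sides. After rotating both words it stands at their ends, and \<open>realizes_split\<close>
  read backwards deletes it.\<close>

lemma merge_all:
 fixes s :: "'a \<times> 'a => 'v"
 assumes "okmap s W" "wconn W" "W ~= {}" "\<And>d. d : letters W ==> s d ~= s (rv d)"
 shows "\<exists>w. okmap s {w} & euler2 s {w} = euler2 s W & (\<forall>S::space. realizes S s W \<longleftrightarrow> realizes S s {w})"
 using assms
proof (induction "card W" arbitrary: W rule: less_induct)
 case less
 note ok = less.prems(1) and conn = less.prems(2) and nl = less.prems(4)
 obtain w1 where w1: "w1 : W" using less.prems(3) by blast
 show ?case
 proof (cases "W = {w1}")
  case True thus ?thesis using ok by blast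
 next
  case False
  then obtain w0 where w0: "w0 : W" "w0 ~= w1" using w1 by blast
  have fin: "finite W" using ok by (simp add: okmap_def)
  have disj: "set v \<inter> set w = {}" if "v : W" "w : W" "v ~= w" for v w using ok that unfolding okmap_def by blast
  have ne: "w ~= []" if "w : W" for w using ok that unfolding okmap_def by blast
  have "\<exists>d\<in>set w1. rv d ~: set w1"
  proof (rule ccontr)
   assume "\<not> ?thesis"
   hence "rv ` set w1 <= set w1" by auto
   moreover have "set w1 <= letters W" using w1 by (auto simp: letters_def)
   moreover have "\<forall>w\<in>W. set w \<inter> set w1 ~= {} --> set w <= set w1" using disj w1 by blast
   ultimately have "set w1 = letters W" using conn ne[OF w1] unfolding wconn_def by simp
   hence "set w0 <= set w1" using w0 by (auto simp: letters_def)
   thus False using disj[OF w0(1) w1 w0(2)] ne[OF w0(1)] by (cases w0) auto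
  qed
  then obtain c where c: "c : set w1" "rv c ~: set w1" by blast
  let ?c = "rv c"
  have cL: "c : letters W" using c w1 by (auto simp: letters_def)
  hence "?c : letters W" using okmap_swapD[OF ok] by blast
  then obtain w2 where w2: "w2 : W" "?c : set w2" by (auto simp: letters_def)
  have w12: "w1 ~= w2" using c w2 by auto
  obtain p q where pq: "w1 = p @ c # q" using c(1) by (meson split_list)
  obtain p' q' where pq': "w2 = p' @ ?c # q'" using w2(2) by (meson split_list)
  define W0 where "W0 = W - {w1, w2}"
  define x where "x = q @ p"
  define y where "y = q' @ p'"
  have W: "W = insert (p @ ([c] @ q)) (insert w2 W0)" using w1 w2 by (auto simp: W0_def pq)
  have n1: "p @ ([c] @ q) ~: insert w2 W0" using w12 by (auto simp: W0_def pq)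
  have W': "insert w2 W0 = insert (p' @ ([?c] @ q')) W0" by (simp add: pq')
  let ?W1 = "insert (([c] @ q) @ p) (insert w2 W0)"
  have a1: "okmap s ?W1" "euler2 s ?W1 = euler2 s W" "([c] @ q) @ p ~: insert w2 W0"
   using okmap_rotate[OF ok[unfolded W] n1] W by simp_all
  have b1: "realizes S s W \<longleftrightarrow> realizes S s ?W1" for S :: space
   unfolding W by (rule realizes_rotate[OF okmap_disj[OF ok[unfolded W] n1]])
  let ?W2 = "insert (x @ [c]) (insert w2 W0)"
  have e2: "([c] @ q) @ p = [c] @ x" by (simp add: x_def)
  have a2: "okmap s ?W2" "euler2 s ?W2 = euler2 s W" "x @ [c] ~: insert w2 W0"
   using okmap_rotate[of s "[c]" x "insert w2 W0"] a1 unfolding e2 by simp_all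
  have b2: "realizes S s ?W1 \<longleftrightarrow> realizes S s ?W2" for S :: space
   unfolding e2 by (rule realizes_rotate[OF okmap_disj[OF a1(1,3)[unfolded e2]]])
  have c2: "?W2 = insert (p' @ ([?c] @ q')) (insert (x @ [c]) W0)" by (auto simp: pq')
  have w2x: "p' @ ([?c] @ q') ~: insert (x @ [c]) W0"
  proof -
   have "w2 ~: W0" by (simp add: W0_def)
   moreover have "w2 ~= x @ [c]" using a2(3) by auto
   ultimately show ?thesis by (simp add: pq')
  qed
  let ?W3 = "insert (([?c] @ q') @ p') (insert (x @ [c]) W0)"
  have a3: "okmap s ?W3" "euler2 s ?W3 = euler2 s W" "([?c] @ q') @ p' ~: insert (x @ [c]) W0"
   using okmap_rotate[OF a2(1)[unfolded c2] w2x] a2(2) c2 by simp_all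
  have b3: "realizes S s ?W2 \<longleftrightarrow> realizes S s ?W3" for S :: space
   unfolding c2 by (rule realizes_rotate[OF okmap_disj[OF a2(1)[unfolded c2] w2x]])
  have e3: "([?c] @ q') @ p' = [?c] @ y" by (simp add: y_def)
  let ?W4 = "insert (y @ [?c]) (insert (x @ [c]) W0)"
  have a4: "okmap s ?W4" "euler2 s ?W4 = euler2 s W" "y @ [?c] ~: insert (x @ [c]) W0"
   using okmap_rotate[of s "[?c]" y "insert (x @ [c]) W0"] a3 unfolding e3 by simp_all
  have b4: "realizes S s ?W3 \<longleftrightarrow> realizes S s ?W4" for S :: space
   unfolding e3 by (rule realizes_rotate[OF okmap_disj[OF a3(1,3)[unfolded e3]]])
  have c4: "?W4 = insert (x @ [c]) (insert (y @ [?c]) W0)" by blast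
  have xW0: "x @ [c] ~: W0" using a2(3) by blast
  \<comment> \<open>A face consisting of \<open>c\<close> alone would make \<open>c\<close> a
    loop.\<close>
  have nx: "x ~= []"
  proof
   assume "x = []"
   hence "cwalk s [c]" using okmap_cwalk[OF a4(1), of "x @ [c]"] by simp
   thus False using nl[OF cL] by (auto simp: cwalk_def)
  qed
  have ny: "y ~= []"
  proof
   assume "y = []"
   hence "cwalk s [?c]" using okmap_cwalk[OF a4(1), of "y @ [?c]"] by simp
   thus False using nl[OF cL] by (auto simp: cwalk_def)
  qed
  have ne4: "x @ [c] ~= y @ [?c]" using a4(3) by auto
  have L4: "letters ?W4 = letters W"
   using W unfolding pq' x_def y_def by auto
  have d4: "set (x @ [c]) \<inter> letters (insert (y @ [?c]) W0) = {}"
   using okmap_disj[of s "x @ [c]" "insert (y @ [?c]) W0"] a4(1) ne4 xW0 unfolding c4 by blast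
  have d4': "set (y @ [?c]) \<inter> letters (insert (x @ [c]) W0) = {}" by (rule okmap_disj[OF a4(1,3)])
  have dd: "distinct (x @ [c])" "distinct (y @ [?c])" using a4(1) by (auto simp: okmap_def)
  have cf: "c ~: letters (insert (x @ y) W0)" "?c ~: letters (insert (x @ y) W0)" "?c ~= c"
   using d4 d4' dd by auto
  have xy0: "x @ y ~: W0"
  proof (rule new_word)
   show "set (x @ y) \<inter> letters W0 = {}" using d4 d4' by auto
  qed (use nx in simp)
  have cw: "cwalk s (x @ [c])" "cwalk s (y @ [?c])" using okmap_cwalk[OF a4(1)] by auto
  have sc: "s c = s (hd y)" "s ?c = s (hd x)" using walk_split_iff[OF nx ny, of s c] cw by auto
  have yW0: "y @ [?c] ~: W0" using a4(3) by blast
  let ?W5 = "insert (x @ y) W0"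
  have a5: "okmap s ?W5" using okmap_split(1)[OF nx ny xy0 xW0 yW0 ne4 cf sc] a4(1) c4 by simp
  have fin0: "finite W0" using fin by (simp add: W0_def)
  have e5: "euler2 s ?W5 = euler2 s W"
   using okmap_split(2)[OF nx ny xy0 xW0 yW0 ne4 cf sc fin0] a4(2) c4 by simp
  have b5: "realizes S s ?W4 \<longleftrightarrow> realizes S s ?W5" for S :: space
  proof -
   have "set (x @ y) \<inter> letters W0 = {}" using d4 d4' by auto
   moreover have "[] ~: W0" using ok by (auto simp: W0_def okmap_def)
   ultimately show ?thesis
    using realizes_split[OF nx ny _ cf okmap_swap[OF a5] sc, of S] c4 by simp
  qed
  have "card W = card W0 + 2"
  proof -
   have "card W0 = card W - 2" unfolding W0_def using card_Diff_subset[of "{w1, w2}" W] w1 w2 w12 by simp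
   moreover have "2 <= card W" using card_mono[OF fin, of "{w1, w2}"] w1 w2 w12 by simp
   ultimately show ?thesis by simp
  qed
  moreover have "card ?W5 = card W0 + 1" using xy0 fin0 by simp
  ultimately have lt: "card ?W5 < card W" by simp
  have L5: "letters W = insert c (insert ?c (letters ?W5))" using L4 by auto
  have conn5: "wconn ?W5"
   unfolding wconn_def
  proof (intro allI impI)
   fix C assume C: "C <= letters ?W5" "C ~= {}" "\<forall>w\<in>?W5. set w \<inter> C ~= {} --> set w <= C" "rv ` C <= C"
   \<comment> \<open>A closed set after the merge is lifted to one before it by adding the deleted
     edge exactly when the merged face belongs to it.\<close>
   define C' where "C' = (if set (x @ y) <= C then insert c (insert ?c C) else C)"
   have "wconn ?W4" using conn wconn_cong[of W ?W4] unfolding W pq' x_def y_def by auto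
   moreover have "C' <= letters ?W4" "C' ~= {}" using C(1,2) L5 L4 by (auto simp: C'_def)
   moreover have "set w <= C'" if "w : ?W4" "set w \<inter> C' ~= {}" for w
   proof -
    have cC: "c ~: C" "?c ~: C" using C(1) cf by auto
    consider "w = x @ [c]" | "w = y @ [?c]" | "w : W0" using \<open>w : ?W4\<close> by blast
    thus ?thesis
    proof cases
     case 1
     have "set (x @ y) <= C"
     proof (rule ccontr)
      assume n: "\<not> set (x @ y) <= C"
      hence "set (x @ y) \<inter> C = {}" using C(3) by blast
      thus False using that(2) n cC 1 by (auto simp: C'_def split: if_splits)
     qed
     thus ?thesis using 1 by (auto simp: C'_def)
    next
     case 2
     have "set (x @ y) <= C"
     proof (rule ccontr)
      assume n: "\<not> set (x @ y) <= C"
      hence "set (x @ y) \<inter> C = {}" using C(3) by blast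
      thus False using that(2) n cC 2 by (auto simp: C'_def split: if_splits)
     qed
     thus ?thesis using 2 by (auto simp: C'_def)
    next
     case 3
     hence "c ~: set w" "?c ~: set w" using cf by (auto simp: letters_def)
     hence "set w \<inter> C ~= {}" using that(2) by (auto simp: C'_def split: if_splits)
     hence "set w <= C" using C(3) 3 by blast
     thus ?thesis by (auto simp: C'_def)
    qed
   qed
   moreover have "rv ` C' <= C'" using C(4) by (auto simp: C'_def)
   ultimately have "C' = letters ?W4" unfolding wconn_def by blast
   hence "letters ?W5 <= C'" using L4 L5 by blast
   thus "C = letters ?W5" using C(1) cf by (auto simp: C'_def split: if_splits)
  qed
  have "\<exists>w. okmap s {w} & euler2 s {w} = euler2 s ?W5 & (\<forall>S::space. realizes S s ?W5 \<longleftrightarrow> realizes S s {w})"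
   by (rule less.hyps[OF lt a5 conn5]) (use nl L5 in auto)
  thus ?thesis using e5 b1 b2 b3 b4 b5 by metis
 qed
qed

theorem same_surface:
 fixes s1 :: "'a \<times> 'a => 'v" and s2 :: "'b \<times> 'b => 'u" and S :: space
 assumes "infinite (UNIV :: 'a set)" "infinite (UNIV :: 'b set)"
  and "okmap s1 W1" "wconn W1" "W1 ~= {}" "\<And>d. d : letters W1 ==> s1 d ~= s1 (rv d)"
  and "okmap s2 W2" "wconn W2" "W2 ~= {}" "\<And>d. d : letters W2 ==> s2 d ~= s2 (rv d)"
  and "euler2 s1 W1 = euler2 s2 W2" and "realizes S s1 W1"
 shows "realizes S s2 W2"
proof -
 obtain w1 where w1: "okmap s1 {w1}" "euler2 s1 {w1} = euler2 s1 W1" "\<And>S::space. realizes S s1 W1 \<longleftrightarrow> realizes S s1 {w1}"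
  using merge_all[OF assms(3-6)] by blast
 obtain w2 where w2: "okmap s2 {w2}" "euler2 s2 {w2} = euler2 s2 W2" "\<And>S::space. realizes S s2 W2 \<longleftrightarrow> realizes S s2 {w2}"
  using merge_all[OF assms(7-10)] by blast
 obtain v1 h1 and t1 :: "'a \<times> 'a => 'v" where n1: "normal_word h1 v1" "okmap t1 {v1}" "euler2 t1 {v1} = euler2 s1 {w1}"
   "\<And>S::space. realizes S s1 {w1} \<longleftrightarrow> realizes S t1 {v1}"
  using normal_word_exists[OF assms(1) w1(1)] by metis
 obtain v2 h2 and t2 :: "'b \<times> 'b => 'u" where n2: "normal_word h2 v2" "okmap t2 {v2}" "euler2 t2 {v2} = euler2 s2 {w2}"
   "\<And>S::space. realizes S s2 {w2} \<longleftrightarrow> realizes S t2 {v2}"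
  using normal_word_exists[OF assms(2) w2(1)] by metis
 have "h1 = h2" using normal_word_euler[OF n1(1,2)] normal_word_euler[OF n2(1,2)] n1(3) n2(3) w1(2) w2(2) assms(11) by simp
 thus ?thesis using normal_word_transfer[of h2 v1 v2 t1 t2 S] n1 n2 w1(3) w2(3) assms(12) by blast
qed

text \<open>Supplies the candidate genus of the quadrangular system as a natural number, without
  divisibility arguments on the closed formula.\<close>

lemma euler2_even_genus:
 fixes s :: "'a \<times> 'a => 'v"
 assumes "infinite (UNIV :: 'a set)" "okmap s W" "wconn W" "W ~= {}" "\<And>d. d : letters W ==> s d ~= s (rv d)"
 shows "\<exists>h::nat. euler2 s W = 4 - 4 * int h"
 using merge_all[OF assms(2-5)] normal_word_exists[OF assms(1)] normal_word_euler by metis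

section \<open>Lattice surfaces\<close>

text \<open>
 Boundaries of plates: a set of unit cells in the plane, without two cells that touch in
 a corner only, is thickened to height \<open>H\<close>; all boundary squares are oriented by the
 outward normal.
\<close>

definition quad :: "'p => 'p => 'p => 'p => ('p \<times> 'p) list" where
 "quad a b c d = [(a, b), (b, c), (c, d), (d, a)]"

definition left_of :: "int \<times> int => int \<times> int => int => int => bool" where
 "left_of p q i j \<longleftrightarrow> (p, q) : {((i, j), (i+1, j)), ((i+1, j), (i+1, j+1)), ((i+1, j+1), (i, j+1)), ((i, j+1), (i, j))}"

lemma left_of_unique: "left_of p q i j ==> left_of p q i' j' ==> i = i' & j = j'"
 by (auto simp: left_of_def)

lemma left_of_not_right: "left_of p q i j ==> left_of q p i j ==> False"
 by (auto simp: left_of_def)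

lemma cwalk_quad:
 "cwalk f (quad a b c d) \<longleftrightarrow> f (b, a) = f (b, c) & f (c, b) = f (c, d) & f (d, c) = f (d, a) & f (a, d) = f (a, b)"
 by (auto simp: cwalk_def quad_def)

text \<open>\<open>connected\<close> is edge-connectedness of the cells in the form of an invariance
  principle. The diagonal conditions make the boundary of the region a union of disjoint simple
  curves. \<open>corner\<close> exhibits one boundary edge, whose wall joins the top to the
  bottom.\<close>

locale plate =
 fixes cell :: "int => int => bool" and H :: int
 assumes H: "1 <= H"
  and fin: "finite {(i, j). cell i j}"
  and diag1: "cell x y ==> cell (x-1) (y-1) ==> cell (x-1) y \<or> cell x (y-1)"
  and diag2: "cell (x-1) y ==> cell x (y-1) ==> cell x y \<or> cell (x-1) (y-1)"
  and connected: "(\<And>i j. cell i j ==> cell (i+1) j ==> Q i j \<longleftrightarrow> Q (i+1) j) ==>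
    (\<And>i j. cell i j ==> cell i (j+1) ==> Q i j \<longleftrightarrow> Q i (j+1)) ==> cell i j ==> cell i' j' ==> Q i j \<longleftrightarrow> Q i' j'"
  and corner: "cell 0 0" "\<not> cell (-1) 0"
begin

definition lc :: "int \<times> int => int \<times> int => bool" where
 "lc p q \<longleftrightarrow> (\<exists>i j. left_of p q i j & cell i j)"

definition bd :: "int \<times> int => int \<times> int => bool" where
 "bd p q \<longleftrightarrow> lc p q & \<not> lc q p"

definition top where "top i j = quad ((i,j),H) ((i+1,j),H) ((i+1,j+1),H) ((i,j+1),H)"
definition bot where "bot i j = quad ((i,j),0::int) ((i,j+1),0) ((i+1,j+1),0) ((i+1,j),0)"
text \<open>Over the boundary dart from \<open>p\<close> to \<open>q\<close> the upper side runs
  from \<open>q\<close> to \<open>p\<close> and the lower side from \<open>p\<close> to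
  \<open>q\<close>, opposite to the top and bottom squares along that edge, as an orientation
  requires.\<close>

definition wall where "wall p q k = quad (q::int\<times>int,k+1::int) (p,k+1) (p,k) (q,k)"

definition B where "B = {(p, q). bd p q}"
definition P where "P = {(i, j). cell i j}"

definition W where
 "W = (\<lambda>(i, j). top i j) ` P \<union> ((\<lambda>(i, j). bot i j) ` P \<union> (\<lambda>((p, q), k). wall p q k) ` (B \<times> {0..<H}))"

lemma lc_simps:
 "lc (x,y) q \<longleftrightarrow> (q = (x+1,y) & cell x y) \<or> (q = (x,y+1) & cell (x-1) y) \<or> (q = (x-1,y) & cell (x-1) (y-1)) \<or> (q = (x,y-1) & cell x (y-1))"
 "lc q (x,y) \<longleftrightarrow> (q = (x+1,y) & cell x (y-1)) \<or> (q = (x,y+1) & cell x y) \<or> (q = (x-1,y) & cell (x-1) y) \<or> (q = (x,y-1) & cell (x-1) (y-1))"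
proof -
 show "lc (x,y) q \<longleftrightarrow> (q = (x+1,y) & cell x y) \<or> (q = (x,y+1) & cell (x-1) y) \<or> (q = (x-1,y) & cell (x-1) (y-1)) \<or> (q = (x,y-1) & cell x (y-1))" (is "_ \<longleftrightarrow> ?R")
 proof
  assume R: ?R
  have l: "left_of (x,y) (x+1,y) x y" "left_of (x,y) (x,y+1) (x-1) y" "left_of (x,y) (x-1,y) (x-1) (y-1)" "left_of (x,y) (x,y-1) x (y-1)"
   by (simp_all add: left_of_def)
  show "lc (x,y) q" using R l unfolding lc_def by metis
 qed (auto simp: lc_def left_of_def)
 show "lc q (x,y) \<longleftrightarrow> (q = (x+1,y) & cell x (y-1)) \<or> (q = (x,y+1) & cell x y) \<or> (q = (x-1,y) & cell (x-1) y) \<or> (q = (x,y-1) & cell (x-1) (y-1))" (is "_ \<longleftrightarrow> ?R")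
 proof
  assume R: ?R
  have l: "left_of (x+1,y) (x,y) x (y-1)" "left_of (x,y+1) (x,y) x y" "left_of (x-1,y) (x,y) (x-1) y" "left_of (x,y-1) (x,y) (x-1) (y-1)"
   by (simp_all add: left_of_def)
  show "lc q (x,y)" using R l unfolding lc_def by metis
 qed (auto simp: lc_def left_of_def)
qed

lemma bd_simps:
 "bd (x,y) q \<longleftrightarrow> (q = (x+1,y) & cell x y & \<not> cell x (y-1)) \<or> (q = (x,y+1) & cell (x-1) y & \<not> cell x y) \<or>
   (q = (x-1,y) & cell (x-1) (y-1) & \<not> cell (x-1) y) \<or> (q = (x,y-1) & cell x (y-1) & \<not> cell (x-1) (y-1))"
 "bd q (x,y) \<longleftrightarrow> (q = (x+1,y) & cell x (y-1) & \<not> cell x y) \<or> (q = (x,y+1) & cell x y & \<not> cell (x-1) y) \<or>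
   (q = (x-1,y) & cell (x-1) y & \<not> cell (x-1) (y-1)) \<or> (q = (x,y-1) & cell (x-1) (y-1) & \<not> cell x (y-1))"
 unfolding bd_def lc_simps by auto

text \<open>The diagonal conditions enter here: two cells that touch only in a corner would give
  that corner two outgoing boundary darts.\<close>

lemma bd_out_unique:
 assumes "bd p q" "bd p q'"
 shows "q = q'"
proof -
 obtain x y where p: "p = (x, y)" by (cases p)
 show ?thesis using assms diag1[of x y] diag2[of x y] unfolding p bd_simps
  by (cases "cell x y"; cases "cell (x-1) y"; cases "cell x (y-1)"; cases "cell (x-1) (y-1)") simp_all
qed

lemma bd_in_unique:
 assumes "bd q p" "bd q' p"
 shows "q = q'"
proof -
 obtain x y where p: "p = (x, y)" by (cases p)
 show ?thesis using assms diag1[of x y] diag2[of x y] unfolding p bd_simps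
  by (cases "cell x y"; cases "cell (x-1) y"; cases "cell x (y-1)"; cases "cell (x-1) (y-1)") simp_all
qed

lemma bd_next:
 assumes "bd p q"
 shows "\<exists>r. bd q r"
proof -
 obtain x y where q: "q = (x, y)" by (cases q)
 have e: "cell x y & \<not> cell x (y-1) ==> bd (x,y) (x+1,y)" "cell (x-1) y & \<not> cell x y ==> bd (x,y) (x,y+1)"
  "cell (x-1) (y-1) & \<not> cell (x-1) y ==> bd (x,y) (x-1,y)" "cell x (y-1) & \<not> cell (x-1) (y-1) ==> bd (x,y) (x,y-1)"
  by (simp_all add: bd_simps)
 show ?thesis using assms e unfolding q bd_simps(2)[of p] by metis
qed

lemma bd_prev:
 assumes "bd p q"
 shows "\<exists>r. bd r p"
proof -
 obtain x y where p: "p = (x, y)" by (cases p)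
 have e: "cell x (y-1) & \<not> cell x y ==> bd (x+1,y) (x,y)" "cell x y & \<not> cell (x-1) y ==> bd (x,y+1) (x,y)"
  "cell (x-1) y & \<not> cell (x-1) (y-1) ==> bd (x-1,y) (x,y)" "cell (x-1) (y-1) & \<not> cell x (y-1) ==> bd (x,y-1) (x,y)"
  by (simp_all add: bd_simps(2))
 show ?thesis using assms e unfolding p bd_simps(1)[of _ _ q] by metis
qed

lemma bd_neq: "bd p q ==> p ~= q"
 by (cases p) (auto simp: bd_simps)

lemma bd_asym: "bd p q ==> \<not> bd q p"
 by (auto simp: bd_def)

lemma in_top: "((p,z),(q,z')) : set (top i j) \<longleftrightarrow> z = H & z' = H & left_of p q i j"
 by (auto simp: top_def quad_def left_of_def)

lemma in_bot: "((p,z),(q,z')) : set (bot i j) \<longleftrightarrow> z = 0 & z' = 0 & left_of q p i j"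
 by (auto simp: bot_def quad_def left_of_def)

lemma in_wall: "((p,z),(q,z')) : set (wall p0 q0 k) \<longleftrightarrow>
  (z = k+1 & z' = k+1 & p = q0 & q = p0) \<or> (z = k & z' = k & p = p0 & q = q0) \<or>
  (z = k+1 & z' = k & p = p0 & q = p0) \<or> (z = k & z' = k+1 & p = q0 & q = q0)"
 by (auto simp: wall_def quad_def)

lemma W_cases:
 assumes "w : W"
 obtains (top) i j where "w = top i j" "cell i j" | (bot) i j where "w = bot i j" "cell i j"
  | (wall) p q k where "w = wall p q k" "bd p q" "0 <= k" "k < H"
 using assms unfolding W_def P_def B_def by auto

lemma top_in: "cell i j ==> top i j : W" and bot_in: "cell i j ==> bot i j : W"
 and wall_in: "bd p q ==> 0 <= k ==> k < H ==> wall p q k : W"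
 by (force simp: W_def P_def B_def)+

lemma lcI: "left_of p q i j ==> cell i j ==> lc p q"
 by (auto simp: lc_def)

text \<open>A horizontal dart is determined by the cell beside it or by its boundary edge; a
  vertical dart belongs to the wall of the unique boundary dart out of its foot, if it points down,
  or into its foot, if it points up.\<close>

lemma word_unique:
 assumes "w : W" "w' : W" "d : set w" "d : set w'"
 shows "w = w'"
proof -
 obtain p z q z' where d: "d = ((p,z),(q,z'))" by (metis prod.collapse)
 show ?thesis
  using assms(1)
 proof (cases rule: W_cases)
  case (top i j)
  hence h: "z = H" "z' = H" "left_of p q i j" using assms(3) unfolding d top in_top by auto
  show ?thesis using assms(2)
  proof (cases rule: W_cases)
   case (top i' j')
   hence "left_of p q i' j'" using assms(4) unfolding d top in_top by auto
   thus ?thesis using left_of_unique h(3) top \<open>w = local.top i j\<close> by blast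
  next
   case (bot i' j')
   thus ?thesis using assms(4) h H unfolding d bot in_bot by auto
  next
   case (wall p0 q0 k)
   hence "bd q p" using assms(4) h unfolding d wall in_wall by auto
   thus ?thesis using lcI[OF h(3)] top by (auto simp: bd_def)
  qed
 next
  case (bot i j)
  hence h: "z = 0" "z' = 0" "left_of q p i j" using assms(3) unfolding d bot in_bot by auto
  show ?thesis using assms(2)
  proof (cases rule: W_cases)
   case (top i' j')
   thus ?thesis using assms(4) h H unfolding d top in_top by auto
  next
   case (bot i' j')
   hence "left_of q p i' j'" using assms(4) unfolding d bot in_bot by auto
   thus ?thesis using left_of_unique h(3) bot \<open>w = local.bot i j\<close> by blast
  next
   case (wall p0 q0 k)
   hence "bd p q" using assms(4) h unfolding d wall in_wall by auto
   thus ?thesis using lcI[OF h(3)] bot by (auto simp: bd_def)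
  qed
 next
  case (wall p0 q0 k)
  have h: "((p,z),(q,z')) : set (wall p0 q0 k)" using assms(3) wall d by simp
  show ?thesis using assms(2)
  proof (cases rule: W_cases)
   case (top i' j')
   hence t: "z = H" "z' = H" "left_of p q i' j'" using assms(4) unfolding d top in_top by auto
   hence "bd q p" using h wall unfolding in_wall by auto
   thus ?thesis using lcI[OF t(3)] top by (auto simp: bd_def)
  next
   case (bot i' j')
   hence t: "z = 0" "z' = 0" "left_of q p i' j'" using assms(4) unfolding d bot in_bot by auto
   hence "bd p q" using h wall unfolding in_wall by auto
   thus ?thesis using lcI[OF t(3)] bot by (auto simp: bd_def)
  next
   case (wall p1 q1 l)
   have h': "((p,z),(q,z')) : set (wall p1 q1 l)" using assms(4) wall d by simp
   have n: "p0 ~= q0" "p1 ~= q1" using bd_neq wall \<open>bd p0 q0\<close> by auto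
   have "p0 = p1 & q0 = q1 & k = l"
   proof (cases "z = z'")
    case True
    thus ?thesis using h h' n bd_asym[OF wall(2)] \<open>bd p0 q0\<close> unfolding in_wall by auto
   next
    case False
    hence "(p0 = p1 \<or> q0 = q1) & k = l" using h h' unfolding in_wall by auto
    thus ?thesis using bd_out_unique bd_in_unique wall(2) \<open>bd p0 q0\<close> by blast
   qed
   thus ?thesis using wall \<open>w = local.wall p0 q0 k\<close> by simp
  qed
 qed
qed

lemma hor_letter:
 "((p,H),(q,H)) : letters W" "((q,H),(p,H)) : letters W"
 "((p,0),(q,0)) : letters W" "((q,0),(p,0)) : letters W" if pq: "lc p q"
proof -
 obtain i j where ij: "left_of p q i j" "cell i j" using pq by (auto simp: lc_def)
 have "((p,H),(q,H)) : set (top i j)" using ij in_top by simp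
 thus "((p,H),(q,H)) : letters W" using top_in[OF ij(2)] by (auto simp: letters_def)
 have "((q,0),(p,0)) : set (bot i j)" using ij in_bot by simp
 thus "((q,0),(p,0)) : letters W" using bot_in[OF ij(2)] by (auto simp: letters_def)
 have "((q,H),(p,H)) : letters W & ((p,0),(q,0)) : letters W"
 proof (cases "lc q p")
  case True
  then obtain i j where ij: "left_of q p i j" "cell i j" by (auto simp: lc_def)
  have "((q,H),(p,H)) : set (top i j)" "((p,0),(q,0)) : set (bot i j)" using ij in_top in_bot by simp_all
  thus ?thesis using top_in[OF ij(2)] bot_in[OF ij(2)] by (auto simp: letters_def)
 next
  case False
  hence b: "bd p q" using pq by (simp add: bd_def)
  have "((q,H),(p,H)) : set (wall p q (H-1))" "((p,0),(q,0)) : set (wall p q 0)" using in_wall by simp_all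
  thus ?thesis using wall_in[OF b, of "H-1"] wall_in[OF b, of 0] H by (auto simp: letters_def)
 qed
 thus "((q,H),(p,H)) : letters W" "((p,0),(q,0)) : letters W" by auto
qed

lemma wall_letters:
 assumes "bd p q" "0 <= k" "k < H"
 shows "set (wall p q k) <= letters W"
 using wall_in[OF assms] by (auto simp: letters_def)

lemma swap_letters:
 assumes "d : letters W"
 shows "rv d : letters W & rv d ~= d"
proof -
 obtain p z q z' where d: "d = ((p,z),(q,z'))" by (metis prod.collapse)
 obtain w where w: "w : W" "d : set w" using assms by (auto simp: letters_def)
 show ?thesis using w(1)
 proof (cases rule: W_cases)
  case (top i j)
  hence h: "z = H" "z' = H" "left_of p q i j" using w(2) unfolding d top in_top by auto
  hence "lc p q" using top by (auto simp: lc_def)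
  thus ?thesis using hor_letter h left_of_not_right[of p q i j] unfolding d by auto
 next
  case (bot i j)
  hence h: "z = 0" "z' = 0" "left_of q p i j" using w(2) unfolding d bot in_bot by auto
  hence "lc q p" using bot by (auto simp: lc_def)
  thus ?thesis using hor_letter h left_of_not_right[of q p i j] unfolding d by auto
 next
  case (wall p0 q0 k)
  have n: "p0 ~= q0" using bd_neq wall by auto
  have lc0: "lc p0 q0" using wall by (simp add: bd_def)
  have h: "((p,z),(q,z')) : set (wall p0 q0 k)" using w(2) wall d by simp
  then consider "z = k+1" "z' = k+1" "p = q0" "q = p0" | "z = k" "z' = k" "p = p0" "q = q0"
   | "z = k+1" "z' = k" "p = p0" "q = p0" | "z = k" "z' = k+1" "p = q0" "q = q0" unfolding in_wall by blast
  hence "rv d : letters W"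
  proof cases
   case 1
   show ?thesis
   proof (cases "k + 1 = H")
    case True thus ?thesis using hor_letter(1)[OF lc0] 1 d by simp
   next
    case False
    have "((p0,k+1),(q0,k+1)) : set (wall p0 q0 (k+1))" using in_wall by simp
    thus ?thesis using wall_letters[OF wall(2), of "k+1"] wall False 1 d by auto
   qed
  next
   case 2
   show ?thesis
   proof (cases "k = 0")
    case True thus ?thesis using hor_letter(4)[OF lc0] 2 d by simp
   next
    case False
    have "((q0,k),(p0,k)) : set (wall p0 q0 (k-1))" using in_wall by simp
    thus ?thesis using wall_letters[OF wall(2), of "k-1"] wall False 2 d by auto
   qed
  next
   case 3
   obtain r where r: "bd r p0" using bd_prev wall by blast
   have "((p0,k),(p0,k+1)) : set (wall r p0 k)" using in_wall by simp
   thus ?thesis using wall_letters[OF r wall(3,4)] 3 d by auto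
  next
   case 4
   obtain r where r: "bd q0 r" using bd_next wall by blast
   have "((q0,k+1),(q0,k)) : set (wall q0 r k)" using in_wall by simp
   thus ?thesis using wall_letters[OF r wall(3,4)] 4 d by auto
  qed
  moreover have "rv d ~= d" using h n unfolding in_wall d by auto
  ultimately show ?thesis by blast
 qed
qed

lemma W_props:
 assumes "w : W"
 shows "length w = 4" "distinct w" "cwalk fst w"
proof -
 show "length w = 4" "cwalk fst w" using assms by (cases rule: W_cases; simp add: top_def bot_def wall_def cwalk_quad; simp add: quad_def)+
 show "distinct w" using assms
 proof (cases rule: W_cases)
  case (wall p q k)
  thus ?thesis using bd_neq[of p q] by (auto simp: wall_def quad_def)
 qed (auto simp: top_def bot_def quad_def)
qed

definition PV where "PV = {(x, y). cell x y \<or> cell (x-1) y \<or> cell x (y-1) \<or> cell (x-1) (y-1)}"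

lemma finite_PV: "finite PV"
proof -
 let ?f = "\<lambda>a b (i, j). (i + a, j + b :: int)"
 have "PV <= ?f 0 0 ` P \<union> ?f 1 0 ` P \<union> ?f 0 1 ` P \<union> ?f 1 1 ` P"
  unfolding PV_def P_def by force
 thus ?thesis using fin finite_subset unfolding P_def by blast
qed

lemma lc_PV: "lc p q ==> p : PV & q : PV"
 by (cases p; cases q) (auto simp: lc_def left_of_def PV_def)

lemma PV_lc: "p : PV ==> \<exists>q. lc p q"
 by (cases p) (auto simp: PV_def lc_simps)

lemma finite_B: "finite B"
proof -
 have "B <= PV \<times> PV" using lc_PV by (auto simp: B_def bd_def)
 thus ?thesis using finite_PV finite_subset by blast
qed

lemma finite_W: "finite W"
proof -
 have "finite P" using fin by (simp add: P_def)
 thus ?thesis unfolding W_def using finite_B by simp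
qed

lemma nonempty_W: "W ~= {}"
 using corner top_in by blast

lemma card_W: "card W = 2 * card P + nat H * card B"
proof -
 let ?A = "(\<lambda>(i, j). top i j) ` P" and ?B = "(\<lambda>(i, j). bot i j) ` P" and ?C = "(\<lambda>((p, q), k). wall p q k) ` (B \<times> {0..<H})"
 note W = W_def
 have fP: "finite P" using fin by (simp add: P_def)
 have i1: "inj_on (\<lambda>(i, j). top i j) P" "inj_on (\<lambda>(i, j). bot i j) P" by (auto simp: inj_on_def top_def bot_def quad_def)
 have i2: "inj_on (\<lambda>((p, q), k). wall p q k) (B \<times> {0..<H})" by (auto simp: inj_on_def wall_def quad_def)
 have d1: "?A \<inter> (?B \<union> ?C) = {}" using H bd_neq by (auto simp: top_def bot_def wall_def quad_def B_def)
 have d2: "?B \<inter> ?C = {}" using H bd_neq by (auto simp: top_def bot_def wall_def quad_def B_def)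
 have "card W = card ?A + (card ?B + card ?C)"
  unfolding W using d1 d2 fP finite_B by (subst card_Un_disjoint; simp)+
 thus ?thesis using i1 i2 by (simp add: card_image card_cartesian_product)
qed

lemma vertices: "fst ` letters W = PV \<times> {0, H} \<union> fst ` B \<times> {1..H - 1}"
proof
 show "fst ` letters W <= PV \<times> {0, H} \<union> fst ` B \<times> {1..H - 1}"
 proof
  fix v assume "v : fst ` letters W"
  then obtain w d where w: "w : W" "d : set w" "v = fst d" by (auto simp: letters_def)
  obtain p z q z' where d: "d = ((p,z),(q,z'))" by (metis prod.collapse)
  have v: "v = (p, z)" using w d by simp
  show "v : PV \<times> {0, H} \<union> fst ` B \<times> {1..H - 1}"
   using w(1)
  proof (cases rule: W_cases)
   case (top i j)
   thus ?thesis using w(2) lcI[of p q i j] lc_PV[of p q] unfolding d v top in_top by auto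
  next
   case (bot i j)
   thus ?thesis using w(2) lcI[of q p i j] lc_PV[of q p] unfolding d v bot in_bot by auto
  next
   case (wall p0 q0 k)
   obtain r where r: "bd q0 r" using bd_next wall by blast
   have "(p0, q0) : B" "(q0, r) : B" using wall r by (simp_all add: B_def)
   hence pb: "p0 : fst ` B" "q0 : fst ` B" by (metis fst_conv image_eqI)+
   have "lc p0 q0" using wall by (simp add: bd_def)
   hence "p0 : PV" "q0 : PV" using lc_PV by auto
   moreover have "(p = p0 \<or> p = q0) & (z = k \<or> z = k + 1)" using w(2) unfolding d wall in_wall by auto
   moreover have "z = 0 \<or> z = H \<or> z : {1..H-1}" using calculation(3) wall by auto
   ultimately show ?thesis using pb unfolding v by auto
  qed
 qed
 have s1: "(p, z) : fst ` letters W" if pz: "p : PV" "z = 0 \<or> z = H" for p z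
 proof -
  obtain q where "lc p q" using PV_lc pz by blast
  hence "((p,z),(q,z)) : letters W" using hor_letter(1,3) pz(2) by blast
  thus ?thesis by force
 qed
 have s2: "(p, z) : fst ` letters W" if pz: "p : fst ` B" "z : {1..H-1}" for p z
 proof -
  obtain q where b: "bd p q" using pz by (auto simp: B_def)
  have "((p,z),(q,z)) : set (wall p q z)" by (simp add: in_wall)
  hence "((p,z),(q,z)) : letters W" using wall_letters[OF b, of z] pz by auto
  thus ?thesis by force
 qed
 show "PV \<times> {0, H} \<union> fst ` B \<times> {1..H - 1} <= fst ` letters W"
 proof
  fix v assume "v : PV \<times> {0, H} \<union> fst ` B \<times> {1..H - 1}"
  hence "(fst v : PV & (snd v = 0 \<or> snd v = H)) \<or> (fst v : fst ` B & snd v : {1..H - 1})" by (cases v) simp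
  thus "v : fst ` letters W" using s1[of "fst v" "snd v"] s2[of "fst v" "snd v"] unfolding prod.collapse by blast
 qed
qed

lemma card_vertices: "int (card (fst ` letters W)) = 2 * int (card PV) + (H - 1) * int (card B)"
proof -
 have "inj_on fst B" using bd_out_unique by (auto simp: inj_on_def B_def)
 hence cB: "card (fst ` B) = card B" by (rule card_image)
 have "card (PV \<times> {0, H} \<union> fst ` B \<times> {1..H - 1}) = card (PV \<times> {0, H}) + card (fst ` B \<times> {1..H - 1})"
  using finite_PV finite_B H by (intro card_Un_disjoint) auto
 thus ?thesis unfolding vertices using H by (simp add: card_cartesian_product cB algebra_simps)
qed

lemma card_letters: "card (letters W) = 4 * card W"
proof -
 have "card (\<Union> (set ` W)) = (\<Sum>w\<in>W. card (set w))"
  using finite_W word_unique by (intro card_UN_disjoint) auto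
 also have "\<dots> = (\<Sum>w\<in>W. 4)" using W_props by (intro sum.cong) (auto simp: distinct_card)
 finally show ?thesis by (simp add: letters_def)
qed

text \<open>A further layer of walls adds \<open>card B\<close> vertices, \<open>2 * card B\<close>
  edges and \<open>card B\<close> faces, so the height cancels.\<close>

lemma euler: "euler2 fst W = 4 * int (card PV) - 4 * int (card P) - 2 * int (card B)"
proof -
 have "int (card W) = 2 * int (card P) + H * int (card B)" using card_W H by simp
 thus ?thesis unfolding euler2_def card_vertices card_letters by (simp add: algebra_simps)
qed

lemma wconn: "wconn W"
 unfolding wconn_def
proof (intro allI impI)
 fix C assume C: "C <= letters W" "C ~= {}" "\<forall>w\<in>W. set w \<inter> C ~= {} --> set w <= C" "rv ` C <= C"
 define I where "I = (\<lambda>w. set w <= C)"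
 have adj: "I w \<longleftrightarrow> I w'" if w: "w : W" "w' : W" "d : set w" "rv d : set w'" for w w' d
 proof
  assume "I w"
  hence "d : C" using w by (auto simp: I_def)
  hence "rv d : C" using C(4) by blast
  thus "I w'" using C(3) w unfolding I_def by blast
 next
  assume "I w'"
  hence "rv d : C" using w by (auto simp: I_def)
  hence "rv (rv d) : C" using C(4) by blast
  thus "I w" using C(3) w unfolding I_def by auto
 qed
 have wallk: "I (wall p q k) \<longleftrightarrow> I (wall p q 0)" if "bd p q" "0 <= k" "k < H" for p q k
  using that(2,3)
 proof (induction k rule: int_ge_induct)
  case (step k)
  have "I (wall p q k) \<longleftrightarrow> I (wall p q (k+1))"
   by (rule adj[OF wall_in wall_in, of p q k p q "k+1" "((q,k+1),(p,k+1))"])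
    (use that step.prems step.hyps in \<open>auto simp: in_wall\<close>)
  thus ?case using step by auto
 qed simp
 have wt: "I (wall p q 0) \<longleftrightarrow> I (top i j)" if b: "bd p q" "left_of p q i j" "cell i j" for p q i j
 proof -
  have "I (wall p q (H-1)) \<longleftrightarrow> I (top i j)"
   by (rule adj[OF wall_in top_in, of p q "H-1" i j "((q,H),(p,H))"]) (use b H in \<open>auto simp: in_wall in_top\<close>)
  thus ?thesis using wallk[OF b(1), of "H-1"] H by auto
 qed
 have wb: "I (wall p q 0) \<longleftrightarrow> I (bot i j)" if b: "bd p q" "left_of p q i j" "cell i j" for p q i j
  by (rule adj[OF wall_in bot_in, of p q 0 i j "((p,0),(q,0))"]) (use b H in \<open>auto simp: in_wall in_bot\<close>)
 have tt: "I (top i j) \<longleftrightarrow> I (top 0 0)" if "cell i j" for i j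
 proof (rule connected[OF _ _ that corner(1)])
  fix i j assume c: "cell i j"
  show "I (top i j) \<longleftrightarrow> I (top (i+1) j)" if "cell (i+1) j"
   by (rule adj[OF top_in top_in, of _ _ _ _ "(((i+1,j),H),((i+1,j+1),H))"]) (use c that in \<open>auto simp: in_top left_of_def\<close>)
  show "I (top i j) \<longleftrightarrow> I (top i (j+1))" if "cell i (j+1)"
   by (rule adj[OF top_in top_in, of _ _ _ _ "(((i+1,j+1),H),((i,j+1),H))"]) (use c that in \<open>auto simp: in_top left_of_def\<close>)
 qed
 have bb: "I (bot i j) \<longleftrightarrow> I (bot 0 0)" if "cell i j" for i j
 proof (rule connected[OF _ _ that corner(1)])
  fix i j assume c: "cell i j"
  show "I (bot i j) \<longleftrightarrow> I (bot (i+1) j)" if "cell (i+1) j"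
   by (rule adj[OF bot_in bot_in, of _ _ _ _ "(((i+1,j+1),0),((i+1,j),0))"]) (use c that in \<open>auto simp: in_bot left_of_def\<close>)
  show "I (bot i j) \<longleftrightarrow> I (bot i (j+1))" if "cell i (j+1)"
   by (rule adj[OF bot_in bot_in, of _ _ _ _ "(((i,j+1),0),((i+1,j+1),0))"]) (use c that in \<open>auto simp: in_bot left_of_def\<close>)
 qed
 have bd0: "bd (0,1) (0,0)" "left_of (0,1) (0,0) 0 0" using corner by (auto simp: bd_simps left_of_def)
 \<comment> \<open>The wall at the corner of the region is the bridge between the top and the bottom
   sheet.\<close>
 have tb: "I (top 0 0) \<longleftrightarrow> I (bot 0 0)" using wt[OF bd0 corner(1)] wb[OF bd0 corner(1)] by blast
 have all: "I w \<longleftrightarrow> I (top 0 0)" if "w : W" for w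
  using that
 proof (cases rule: W_cases)
  case (top i j) thus ?thesis using tt by auto
 next
  case (bot i j) thus ?thesis using bb tb by auto
 next
  case (wall p q k)
  then obtain i j where "left_of p q i j" "cell i j" by (auto simp: bd_def lc_def)
  thus ?thesis using wallk[OF wall(2-4)] wt[OF wall(2)] tt wall by auto
 qed
 obtain d where "d : C" using C(2) by blast
 then obtain w where "w : W" "d : set w" using C(1) by (auto simp: letters_def)
 hence "I w" using C(3) \<open>d : C\<close> unfolding I_def by blast
 hence "I v" if "v : W" for v using all that \<open>w : W\<close> by blast
 thus "C = letters W" using C(1) by (auto simp: letters_def I_def)
qed

text \<open>At height one a vertex has at most four horizontal darts and one vertical dart. A
  present cell equates the two horizontal darts at its corner, and a wall equates a horizontal dart
  with the vertical one; without diagonal contacts this links all darts that exist.\<close>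

lemma faithful:
 assumes H1: "H = 1" and f: "\<And>w. w : W ==> cwalk f w" and d: "d : letters W" "d' : letters W" "fst d = fst d'"
 shows "f d = (f d' :: bool)"
proof -
 obtain x y z where v: "fst d = ((x,y),z)" by (metis prod.collapse)
 define A1 where "A1 = cell x y"
 define A2 where "A2 = cell (x-1) y"
 define A3 where "A3 = cell (x-1) (y-1)"
 define A4 where "A4 = cell x (y-1)"
 note Adef = A1_def A2_def A3_def A4_def
 \<comment> \<open>The height of the other end of the vertical dart at this vertex.\<close>
 define V where "V = (if z = 0 then 1 else 0::int)"
 have z01: "z = 0 \<or> z = 1"
 proof -
  have "fst d : fst ` letters W" using d(1) by blast
  hence "((x,y),z) : fst ` letters W" unfolding v .
  thus ?thesis unfolding vertices by (simp add: H1)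
 qed
 define e1 where "e1 = f (((x,y),z),((x+1,y),z))"
 define e2 where "e2 = f (((x,y),z),((x,y+1),z))"
 define e3 where "e3 = f (((x,y),z),((x-1,y),z))"
 define e4 where "e4 = f (((x,y),z),((x,y-1),z))"
 define ev where "ev = f (((x,y),z),((x,y),V))"
 note edef = e1_def e2_def e3_def e4_def ev_def
 have tops: "cell i j ==> cwalk f (top i j)" "cell i j ==> cwalk f (bot i j)" "bd p q ==> cwalk f (wall p q 0)" for i j p q
  using f top_in bot_in wall_in[of p q 0] H1 by auto
 have wl: "f (((x,y),z),(q,z)) = ev" if "bd (x,y) q \<or> bd q (x,y)" for q
  using that tops(3)[of "(x,y)" q] tops(3)[of q "(x,y)"] z01 unfolding wall_def cwalk_quad ev_def V_def by auto
 have c1: "A1 ==> e1 = e2" using tops(1,2)[of x y] z01 H1 unfolding top_def bot_def cwalk_quad edef Adef by auto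
 have c2: "A2 ==> e2 = e3" using tops(1,2)[of "x-1" y] z01 H1 unfolding top_def bot_def cwalk_quad edef Adef by auto
 have c3: "A3 ==> e3 = e4" using tops(1,2)[of "x-1" "y-1"] z01 H1 unfolding top_def bot_def cwalk_quad edef Adef by auto
 have c4: "A4 ==> e4 = e1" using tops(1,2)[of x "y-1"] z01 H1 unfolding top_def bot_def cwalk_quad edef Adef by auto
 have w1: "A1 ~= A4 ==> e1 = ev" using wl[of "(x+1,y)"] unfolding bd_simps edef Adef by auto
 have w2: "A1 ~= A2 ==> e2 = ev" using wl[of "(x,y+1)"] unfolding bd_simps edef Adef by auto
 have w3: "A2 ~= A3 ==> e3 = ev" using wl[of "(x-1,y)"] unfolding bd_simps edef Adef by auto
 have w4: "A3 ~= A4 ==> e4 = ev" using wl[of "(x,y-1)"] unfolding bd_simps edef Adef by auto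
 have dg: "A1 & A3 --> A2 \<or> A4" "A2 & A4 --> A1 \<or> A3" using diag1[of x y] diag2[of x y] unfolding Adef by auto
 have out: "(f e = e1 & (A1 \<or> A4)) \<or> (f e = e2 & (A1 \<or> A2)) \<or> (f e = e3 & (A2 \<or> A3)) \<or> (f e = e4 & (A3 \<or> A4)) \<or>
   (f e = ev & \<not> (A1 = A2 & A2 = A3 & A3 = A4))" if e: "e : letters W" "fst e = ((x,y),z)" for e
 proof -
  obtain q z' where eq: "e = (((x,y),z),(q,z'))" using e(2) by (metis prod.collapse)
  obtain w where w: "w : W" "e : set w" using e(1) by (auto simp: letters_def)
  have hor: ?thesis if "z' = z" "lc (x,y) q \<or> lc q (x,y)"
   using that unfolding eq lc_simps edef Adef by auto
  show ?thesis using w(1)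
  proof (cases rule: W_cases)
   case (top i j)
   hence "z' = z" "left_of (x,y) q i j" using w(2) unfolding top eq in_top by auto
   thus ?thesis using hor lcI top(2) by blast
  next
   case (bot i j)
   hence "z' = z" "left_of q (x,y) i j" using w(2) unfolding bot eq in_bot by auto
   thus ?thesis using hor lcI bot(2) by blast
  next
   case (wall p0 q0 k)
   have k: "k = 0" using wall H1 by auto
   have l0: "lc p0 q0" using wall by (simp add: bd_def)
   have in0: "(((x,y),z),(q,z')) : set (wall p0 q0 0)" using w(2) unfolding wall eq k .
   show ?thesis
   proof (cases "z' = z")
    case True
    moreover have "lc (x,y) q \<or> lc q (x,y)" using True in0 l0 unfolding in_wall by auto
    ultimately show ?thesis by (rule hor)
   next
    case False
    hence "q = (x,y)" "z' = V" "p0 = (x,y) \<or> q0 = (x,y)" using in0 unfolding in_wall V_def by auto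
    hence "f e = ev" "bd (x,y) q0 \<or> bd p0 (x,y)" using wall unfolding eq ev_def by auto
    thus ?thesis unfolding bd_simps Adef by auto
   qed
  qed
 qed
 have o1: "(f d = e1 & (A1 \<or> A4)) \<or> (f d = e2 & (A1 \<or> A2)) \<or> (f d = e3 & (A2 \<or> A3)) \<or> (f d = e4 & (A3 \<or> A4)) \<or>
   (f d = ev & \<not> (A1 = A2 & A2 = A3 & A3 = A4))" using out[OF d(1) v] .
 have "fst d' = ((x,y),z)" using d(3) v by simp
 hence o2: "(f d' = e1 & (A1 \<or> A4)) \<or> (f d' = e2 & (A1 \<or> A2)) \<or> (f d' = e3 & (A2 \<or> A3)) \<or> (f d' = e4 & (A3 \<or> A4)) \<or>
   (f d' = ev & \<not> (A1 = A2 & A2 = A3 & A3 = A4))" by (rule out[OF d(2)])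
 show ?thesis
  using o1 o2 c1 c2 c3 c4 w1 w2 w3 w4 dg
  by sat
qed

lemma okmap_W: "H = 1 ==> okmap fst W"
 unfolding okmap_def
proof (intro conjI ballI allI impI)
 show "[] ~: W" using W_props(1) by force
next
 fix f :: "_ => bool" and d d' assume "H = 1" "\<forall>w\<in>W. cwalk f w" "d : letters W" "d' : letters W" "fst d = fst d'"
 thus "f d = f d'" using faithful by blast
next
 fix v w assume "v : W" "w : W" "v ~= w"
 thus "set v \<inter> set w = {}" using word_unique by blast
next
 fix w assume "w : W"
 thus "distinct w" "cwalk fst w" by (rule W_props(2), rule W_props(3))
next
 fix d assume "d : letters W"
 thus "rv d : letters W" "rv d ~= d" using swap_letters by blast+
qed (rule finite_W)

end

text \<open>Convex corners of a region count \<open>1\<close>, reflex corners \<open>- 1\<close>; the arguments are the four cells around a lattice point.\<close>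

definition corner_sign :: "bool => bool => bool => bool => int" where
 "corner_sign a b c d = (let k = of_bool a + of_bool b + of_bool c + of_bool d :: int in if k = 1 then 1 else if k = 3 then -1 else 0)"

text \<open>A combinatorial Gauss--Bonnet formula. Each cell is counted at its four corners and each
  boundary dart at both ends; the resulting local sum \<open>4 - n - out - in\<close> is the corner
  sign in every configuration that the diagonal conditions allow.\<close>

lemma (in plate) euler_local:
 "euler2 fst W = (\<Sum>(x, y)\<in>PV. corner_sign (cell x y) (cell (x-1) y) (cell (x-1) (y-1)) (cell x (y-1)))"
proof -
 define outd where "outd v \<longleftrightarrow> (\<exists>q. bd v q)" for v
 define ind where "ind v \<longleftrightarrow> (\<exists>q. bd q v)" for v
 have out: "outd (x, y) \<longleftrightarrow> cell x y & \<not> cell x (y-1) \<or> cell (x-1) y & \<not> cell x y \<or> cell (x-1) (y-1) & \<not> cell (x-1) y \<or> cell x (y-1) & \<not> cell (x-1) (y-1)"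
  and "in": "ind (x, y) \<longleftrightarrow> cell x (y-1) & \<not> cell x y \<or> cell x y & \<not> cell (x-1) y \<or> cell (x-1) y & \<not> cell (x-1) (y-1) \<or> cell (x-1) (y-1) & \<not> cell x (y-1)" for x y
  unfolding outd_def ind_def bd_simps by blast+
 let ?n = "\<lambda>x y. of_bool (cell x y) + of_bool (cell (x-1) y) + of_bool (cell (x-1) (y-1)) + of_bool (cell x (y-1)) :: int"
 have l: "corner_sign (cell x y) (cell (x-1) y) (cell (x-1) (y-1)) (cell x (y-1)) = 4 - ?n x y - of_bool (outd (x, y)) - of_bool (ind (x, y))"
  if "(x, y) : PV" for x y
  using that diag1[of x y] diag2[of x y] unfolding out "in" PV_def corner_sign_def
  by (cases "cell x y"; cases "cell (x-1) y"; cases "cell (x-1) (y-1)"; cases "cell x (y-1)") simp_all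
 have sh: "(\<Sum>(x, y)\<in>PV. of_bool (cell (x-s) (y-t))) = int (card P)" if "s : {0, 1}" "t : {0, 1}" for s t
 proof -
  have e: "{v : PV. case v of (x, y) => cell (x-s) (y-t)} = (\<lambda>(x, y). (x+s, y+t)) ` P"
  proof (intro set_eqI iffI)
   fix v assume v: "v : {v : PV. case v of (x, y) => cell (x-s) (y-t)}"
   obtain x y where "v = (x, y)" by (cases v)
   thus "v : (\<lambda>(x, y). (x+s, y+t)) ` P" using v by (intro image_eqI[of _ _ "(x-s, y-t)"]) (auto simp: P_def)
  qed (use that in \<open>auto simp: P_def PV_def\<close>)
  have "inj_on (\<lambda>(x, y). (x+s, y+t)) P" by (auto simp: inj_on_def)
  hence "card {v : PV. case v of (x, y) => cell (x-s) (y-t)} = card P" unfolding e by (rule card_image)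
  thus ?thesis using finite_PV by (simp add: case_prod_beta of_bool_def sum.If_cases Int_def)
 qed
 have "{v : PV. outd v} = fst ` B" using lc_PV by (force simp: outd_def B_def bd_def)
 moreover have "card (fst ` B) = card B" using bd_out_unique by (intro card_image) (auto simp: inj_on_def B_def)
 ultimately have so: "(\<Sum>v\<in>PV. of_bool (outd v)) = int (card B)" using finite_PV by (simp add: of_bool_def sum.If_cases Int_def)
 have "{v : PV. ind v} = snd ` B" using lc_PV by (force simp: ind_def B_def bd_def)
 moreover have "card (snd ` B) = card B" using bd_in_unique by (intro card_image) (auto simp: inj_on_def B_def)
 ultimately have si: "(\<Sum>v\<in>PV. of_bool (ind v)) = int (card B)" using finite_PV by (simp add: of_bool_def sum.If_cases Int_def)
 have "(\<Sum>(x, y)\<in>PV. corner_sign (cell x y) (cell (x-1) y) (cell (x-1) (y-1)) (cell x (y-1))) = (\<Sum>(x, y)\<in>PV. 4 - ?n x y - of_bool (outd (x, y)) - of_bool (ind (x, y)))"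
  using l by (intro sum.cong) auto
 also have "\<dots> = 4 * int (card PV) - 4 * int (card P) - int (card B) - int (card B)"
  using sh[of 0 0] sh[of 1 0] sh[of 1 1] sh[of 0 1] so si by (simp add: case_prod_beta sum_subtractf sum.distrib)
 finally show ?thesis unfolding euler by simp
qed

section \<open>The lattice structure of the handle surface\<close>

text \<open>The top face of the box as \<open>2 g + 1\<close> by \<open>3\<close> unit cells; the
  cells left out are \<open>square k\<close>, at \<open>a = 2 k + 1\<close> and
  \<open>b = 1\<close>.\<close>

definition coarse :: "nat => int => int => bool" where
 "coarse g a b \<longleftrightarrow> 0 <= a & a <= 2 * int g & 0 <= b & b <= 2 & \<not> (odd a & b = 1)"

text \<open>The same region with each unit cell divided into \<open>N\<close> by \<open>N\<close>;
  it is used as a plate of height \<open>N\<close>, so the whole picture is scaled by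
  \<open>N\<close>.\<close>

definition hcell :: "nat => nat => int => int => bool" where
 "hcell g N i j \<longleftrightarrow> coarse g (i div int N) (j div int N)"

lemma pred_div:
 assumes "1 <= N"
 shows "(y - 1) div int N = (if y mod int N = 0 then y div int N - 1 else y div int N)"
proof -
 have N: "0 < int N" using assms by simp
 have y: "y = int N * (y div int N) + y mod int N" by simp
 have b: "0 <= y mod int N" "y mod int N < int N" using N by auto
 show ?thesis
 proof (cases "y mod int N = 0")
  case True
  have q: "y - 1 = int N * (y div int N - 1) + (int N - 1)" using y True by (simp add: algebra_simps)
  have "(y - 1) div int N = y div int N - 1"
   by (rule int_div_pos_eq[OF q]) (use N in auto)
  thus ?thesis using True by simp
 next
  case False
  have q: "y - 1 = int N * (y div int N) + (y mod int N - 1)" using y by linarith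
  have "0 <= y mod int N - 1" "y mod int N - 1 < int N" using False b by linarith+
  hence "(y - 1) div int N = y div int N" by (rule int_div_pos_eq[OF q])
  thus ?thesis using False by simp
 qed
qed

lemma less_mult_iff_div_less:
 fixes a b n :: int
 assumes "0 < n"
 shows "a < b * n \<longleftrightarrow> a div n < b"
proof -
 have a: "a = n * (a div n) + a mod n" "0 <= a mod n" "a mod n < n" using assms by simp_all
 show ?thesis
 proof
  assume "a < b * n"
  show "a div n < b"
  proof (rule ccontr)
   assume "\<not> a div n < b"
   hence "n * b <= n * (a div n)" using assms by simp
   thus False using a \<open>a < b * n\<close> mult.commute[of b n] by linarith
  qed
 next
  assume "a div n < b"
  hence "n * (a div n + 1) <= n * b" using assms by simp
  thus "a < b * n" using a distrib_left[of n "a div n" 1] mult.commute[of b n] by linarith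
 qed
qed

context
 fixes g N :: nat
 assumes N: "1 <= N"
begin
lemma finite_hP: "finite {(i, j). hcell g N i j}"
proof -
 have "{(i, j). hcell g N i j} <= {0..<(2 * int g + 1) * int N} \<times> {0..<3 * int N}"
  using N by (auto simp: hcell_def coarse_def less_mult_iff_div_less pos_imp_zdiv_nonneg_iff)
 thus ?thesis by (rule finite_subset) simp
qed

lemma hcell_diag1: "hcell g N x y ==> hcell g N (x-1) (y-1) ==> hcell g N (x-1) y \<or> hcell g N x (y-1)"
 by (auto simp: hcell_def coarse_def)

lemma hcell_diag2: "hcell g N (x-1) y ==> hcell g N x (y-1) ==> hcell g N x y \<or> hcell g N (x-1) (y-1)"
 by (auto simp: hcell_def coarse_def)

text \<open>In the outer rows of cells one can walk along the row to the first column and then down.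
  In the middle row the holes block the way, so the walk goes down first, in a column of even index,
  and then along the bottom row.\<close>

lemma hcell_connected:
 assumes h: "\<And>i j. hcell g N i j ==> hcell g N (i+1) j ==> Q i j \<longleftrightarrow> Q (i+1) j"
  and v: "\<And>i j. hcell g N i j ==> hcell g N i (j+1) ==> Q i j \<longleftrightarrow> Q i (j+1)"
  and c: "hcell g N i j"
 shows "Q i j \<longleftrightarrow> Q 0 0"
proof -
 have Np: "0 < int N" using N by simp
 have mono: "a div int N <= b div int N" if "a <= b" for a b using that Np by (simp add: zdiv_mono1)
 have pos: "0 <= a" if "0 <= a div int N" for a using that Np by (simp add: pos_imp_zdiv_nonneg_iff)
 have row: "Q i j \<longleftrightarrow> Q 0 j" if "0 <= i" "\<And>i'. 0 <= i' ==> i' <= i ==> hcell g N i' j" for i j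
  using that
 proof (induction i rule: int_ge_induct)
  case (step i)
  thus ?case using h[of i j] by auto
 qed simp
 have col: "Q i j \<longleftrightarrow> Q i 0" if "0 <= j" "\<And>j'. 0 <= j' ==> j' <= j ==> hcell g N i j'" for i j
  using that
 proof (induction j rule: int_ge_induct)
  case (step j)
  thus ?case using v[of i j] by auto
 qed simp
 have "0 <= i div int N" "0 <= j div int N" using c by (simp_all add: hcell_def coarse_def)
 hence ij: "0 <= i" "0 <= j" using pos by blast+
 have z: "0 <= a div int N" if "0 <= a" for a using that Np by (simp add: pos_imp_zdiv_nonneg_iff)
 show ?thesis
 proof (cases "j div int N = 1")
  case False
  have "Q i j \<longleftrightarrow> Q 0 j"
  proof (rule row[OF ij(1)])
   fix i' assume "0 <= i'" "i' <= i"
   thus "hcell g N i' j" using c False mono[of i' i] z[of i'] by (auto simp: hcell_def coarse_def)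
  qed
  also have "\<dots> \<longleftrightarrow> Q 0 0"
  proof (rule col[OF ij(2)])
   fix j' assume "0 <= j'" "j' <= j"
   thus "hcell g N 0 j'" using c mono[of j' j] z[of j'] by (auto simp: hcell_def coarse_def)
  qed
  finally show ?thesis .
 next
  case True
  hence ev: "even (i div int N)" using c by (auto simp: hcell_def coarse_def)
  have "Q i j \<longleftrightarrow> Q i 0"
  proof (rule col[OF ij(2)])
   fix j' assume "0 <= j'" "j' <= j"
   thus "hcell g N i j'" using c ev mono[of j' j] z[of j'] by (auto simp: hcell_def coarse_def)
  qed
  also have "\<dots> \<longleftrightarrow> Q 0 0"
  proof (rule row[OF ij(1)])
   fix i' assume "0 <= i'" "i' <= i"
   thus "hcell g N i' 0" using c mono[of i' i] z[of i'] by (auto simp: hcell_def coarse_def)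
  qed
  finally show ?thesis .
 qed
qed

lemma hcell_corner: "hcell g N 0 0" "\<not> hcell g N (-1) 0"
proof -
 have "(-1::int) div int N < 0" using N by (simp add: div_eq_minus1)
 thus "hcell g N 0 0" "\<not> hcell g N (-1) 0" by (auto simp: hcell_def coarse_def)
qed

lemma plate_hcell: "plate (hcell g N) (int N)"
proof
 fix Q i j i' j'
 assume "\<And>i j. hcell g N i j ==> hcell g N (i+1) j ==> Q i j \<longleftrightarrow> Q (i+1) j"
  "\<And>i j. hcell g N i j ==> hcell g N i (j+1) ==> Q i j \<longleftrightarrow> Q i (j+1)" "hcell g N i j" "hcell g N i' j'"
 thus "Q i j \<longleftrightarrow> Q i' j'" using hcell_connected[of Q i j] hcell_connected[of Q i' j'] by blast
qed (use N finite_hP hcell_diag1 hcell_diag2 hcell_corner in auto)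

interpretation plate "hcell g N" "int N" by (rule plate_hcell)

text \<open>Away from the multiples of \<open>N\<close> two neighbouring cells agree and the sign is
  \<open>0\<close>. Each of the two outermost lines \<open>a = 0\<close> and
  \<open>a = 2 g + 1\<close> carries two convex corners, and each of the \<open>2 g\<close> lines
  between them carries two reflex corners of a hole.\<close>

lemma euler_handle: "euler2 fst W = 4 - 4 * int g"
proof -
 let ?c = "\<lambda>f x y. corner_sign (f x y) (f (x-1) y) (f (x-1) (y-1)) (f x (y-1 :: int))"
 let ?X = "{0..2 * int g + 1} \<times> {0..3}"
 let ?m = "\<lambda>(a, b). (int N * a, int N * b)"
 have np: "0 < int N" using N by simp
 have mult: "?c (hcell g N) (int N * a) (int N * b) = ?c (coarse g) a b" for a b
  using np by (simp add: hcell_def pred_div[OF N])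
 have out: "?c (coarse g) a b = 0" if "(a, b) ~: ?X" for a b
 proof -
  have "a < 0 \<or> 2 * int g + 1 < a \<or> b < 0 \<or> 3 < b" using that by auto
  hence "\<not> coarse g a b" "\<not> coarse g (a-1) b" "\<not> coarse g (a-1) (b-1)" "\<not> coarse g a (b-1)" by (auto simp: coarse_def)
  thus ?thesis by (simp add: corner_sign_def)
 qed
 have zero: "?c (hcell g N) x y = 0" if "(x, y) ~: ?m ` ?X" for x y
 proof (cases "x mod int N = 0 & y mod int N = 0")
  case True
  hence "int N dvd x" "int N dvd y" by (simp_all add: dvd_eq_mod_eq_0)
  then obtain a b where ab: "x = int N * a" "y = int N * b" unfolding dvd_def by blast
  hence "(a, b) ~: ?X" using that by force
  thus ?thesis using out mult ab by simp
 next
  case nz: False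
  have hx: "hcell g N (x-1) t = hcell g N x t" if "x mod int N ~= 0" for t using that by (simp add: hcell_def pred_div[OF N])
  have hy: "hcell g N t (y-1) = hcell g N t y" if "y mod int N ~= 0" for t using that by (simp add: hcell_def pred_div[OF N])
  have cs: "corner_sign p p q q = 0" "corner_sign p q q p = 0" for p q by (cases p; cases q; simp add: corner_sign_def)+
  show ?thesis
  proof (cases "x mod int N = 0")
   case True
   hence "y mod int N ~= 0" using nz by simp
   thus ?thesis by (simp only: hy cs not_False_eq_True)
  next
   case False
   thus ?thesis by (simp only: hx cs not_False_eq_True)
  qed
 qed
 have "euler2 fst W = (\<Sum>(x, y)\<in>?m ` ?X. ?c (hcell g N) x y)"
  unfolding euler_local
 proof (rule sum.mono_neutral_cong)
  fix v assume "v : ?m ` ?X - PV"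
  thus "(case v of (x, y) => ?c (hcell g N) x y) = 0" by (cases v) (auto simp: PV_def corner_sign_def)
 next
  fix v assume "v : PV - ?m ` ?X"
  thus "(case v of (x, y) => ?c (hcell g N) x y) = 0" using zero by (cases v) auto
 qed (use finite_PV in auto)
 also have "\<dots> = (\<Sum>v\<in>?X. case ?m v of (x, y) => ?c (hcell g N) x y)"
  using np by (intro sum.reindex_cong[of ?m]) (auto simp: inj_on_def)
 also have "\<dots> = (\<Sum>(a, b)\<in>?X. ?c (coarse g) a b)" using mult by (intro sum.cong) auto
 also have "\<dots> = (\<Sum>a\<in>{0..2 * int g + 1}. \<Sum>b\<in>{0..3}. ?c (coarse g) a b)" by (rule sum.cartesian_product[symmetric])
 also have "\<dots> = (\<Sum>a\<in>{0..2 * int g + 1}. - 2 + (if a = 0 then 4 else 0) + (if a = 2 * int g + 1 then 4 else 0))"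
 proof (rule sum.cong[OF refl])
  fix a assume a: "a : {0..2 * int g + 1}"
  have "{0..3::int} = {0, 1, 2, 3}" by auto
  hence "(\<Sum>b\<in>{0..3}. ?c (coarse g) a b) = ?c (coarse g) a 0 + ?c (coarse g) a 1 + ?c (coarse g) a 2 + ?c (coarse g) a 3" by simp
  also have "\<dots> = - 2 + (if a = 0 then 4 else 0) + (if a = 2 * int g + 1 then 4 else 0)"
   using a by (cases "even a") (auto simp: coarse_def corner_sign_def)
  finally show "(\<Sum>b\<in>{0..3}. ?c (coarse g) a b) = - 2 + (if a = 0 then 4 else 0) + (if a = 2 * int g + 1 then 4 else 0)" .
 qed
 also have "\<dots> = (\<Sum>a\<in>{0..2 * int g + 1}. - 2) + (\<Sum>a\<in>{0..2 * int g + 1}. if a = 0 then 4 else 0) + (\<Sum>a\<in>{0..2 * int g + 1}. if a = 2 * int g + 1 then 4 else 0)"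
  by (simp only: sum.distrib)
 also have "(\<Sum>a\<in>{0..2 * int g + 1}. if a = 0 then 4 else 0) = (4::int)" by simp
 also have "(\<Sum>a\<in>{0..2 * int g + 1}. if a = 2 * int g + 1 then 4 else 0) = (4::int)" by simp
 also have "(\<Sum>a\<in>{0..2 * int g + 1}. - 2) + 4 + 4 = 4 - 4 * int g" by simp
 finally show ?thesis .
qed

end

definition hW :: "nat => nat => (((int \<times> int) \<times> int) \<times> ((int \<times> int) \<times> int)) list set" where
 "hW g N = plate.W (hcell g N) (int N)"

section \<open>Lattice squares as subsets of space, and how they tile the handle surface\<close>

definition rpt :: "nat => (int \<times> int) \<times> int => (real \<times> real) \<times> real" where
 "rpt N = (\<lambda>((x, y), z). ((x / N, y / N), z / N))"

text \<open>Unordered bounds, because opposite corners of a lattice square may decrease in a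
  coordinate.\<close>

definition btw :: "int => int => real => bool" where
 "btw a c r \<longleftrightarrow> real_of_int (min a c) <= r & r <= real_of_int (max a c)"

lemma btw_simps [simp]: "btw i (i + 1) r \<longleftrightarrow> real_of_int i <= r & r <= real_of_int i + 1"
 "btw (i + 1) i r \<longleftrightarrow> real_of_int i <= r & r <= real_of_int i + 1" "btw i i r \<longleftrightarrow> r = real_of_int i"
 by (auto simp: btw_def)

text \<open>The closed lattice square of a face at scale \<open>1/N\<close>, recovered from the
  opposite corners \<open>w ! 0\<close> and \<open>w ! 2\<close>.\<close>

definition cellbox :: "nat => (((int \<times> int) \<times> int) \<times> ((int \<times> int) \<times> int)) list => ((real \<times> real) \<times> real) set" where
 "cellbox N w = {((X, Y), Z). btw (fst (fst (fst (w ! 0)))) (fst (fst (fst (w ! 2)))) (N * X) &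
   btw (snd (fst (fst (w ! 0)))) (snd (fst (fst (w ! 2)))) (N * Y) & btw (snd (fst (w ! 0))) (snd (fst (w ! 2))) (N * Z)}"

lemma cellbox_quad:
 "((X, Y), Z) : cellbox N (quad ((a1,a2),a3) b ((c1,c2),c3) d) \<longleftrightarrow> btw a1 c1 (N * X) & btw a2 c2 (N * Y) & btw a3 c3 (N * Z)"
 by (simp add: cellbox_def quad_def)

text \<open>The ground plan of the holed top and bottom faces. Its boundary, on which the vertical
  walls stand, is \<open>pd\<close> below.\<close>

definition pc :: "nat => real => real => bool" where
 "pc g X Y \<longleftrightarrow> 0 <= X & X <= 2 * real g + 1 & 0 <= Y & Y <= 3 &
   (\<forall>k<g. \<not> (2 * real k + 1 < X & X < 2 * real k + 2 & 1 < Y & Y < 2))"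

definition pd :: "nat => real => real => bool" where
 "pd g X Y \<longleftrightarrow> (0 <= X & X <= 2 * real g + 1 & 0 <= Y & Y <= 3 & (X = 0 \<or> X = 2 * real g + 1 \<or> Y = 0 \<or> Y = 3)) \<or>
   (\<exists>k<g. 2 * real k + 1 <= X & X <= 2 * real k + 2 & 1 <= Y & Y <= 2 & (X = 2 * real k + 1 \<or> X = 2 * real k + 2 \<or> Y = 1 \<or> Y = 2))"

lemma frontier_block: "frontier (block g) = {((X, Y), Z). 0 <= X & X <= 2 * real g + 1 & 0 <= Y & Y <= 3 & 0 <= Z & Z <= 1 &
  (X = 0 \<or> X = 2 * real g + 1 \<or> Y = 0 \<or> Y = 3 \<or> Z = 0 \<or> Z = 1)}"
proof -
 have c: "closed (block g)" unfolding block_def by (intro closed_Times) auto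
 have i: "interior (block g) = ({0<..<2 * real g + 1} \<times> {0<..<3}) \<times> {0<..<1}"
  unfolding block_def interior_Times by (simp add: interior_atLeastAtMost_real)
 show ?thesis unfolding frontier_def closure_closed[OF c] i by (auto simp: block_def)
qed

lemma frontier_square: "frontier (square k) = {(X, Y). 2 * real k + 1 <= X & X <= 2 * real k + 2 & 1 <= Y & Y <= 2 &
  (X = 2 * real k + 1 \<or> X = 2 * real k + 2 \<or> Y = 1 \<or> Y = 2)}"
proof -
 have "open (square k)" unfolding square_def by (intro open_Times) auto
 moreover have "closure (square k) = {2 * real k + 1..2 * real k + 2} \<times> {1..2}"
  unfolding square_def closure_Times by simp
 ultimately show ?thesis unfolding frontier_def by (auto simp: interior_open square_def)
qed

lemma mem_handle: "((X, Y), Z) : handle_surface g \<longleftrightarrow> (pc g X Y & (Z = 0 \<or> Z = 1)) \<or> (pd g X Y & 0 <= Z & Z <= 1)"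
proof -
 have ne: "\<not> (2 * real k + 1 < 2 * real g + 1 & 2 * real g + 1 < 2 * real k + 2)" if "k < g" for k using that by linarith
 show ?thesis
 proof
  assume "((X, Y), Z) : handle_surface g"
  thus "(pc g X Y & (Z = 0 \<or> Z = 1)) \<or> (pd g X Y & 0 <= Z & Z <= 1)"
   unfolding handle_surface_def frontier_block frontier_square pc_def pd_def by (auto simp: square_def)
 next
  assume h: "(pc g X Y & (Z = 0 \<or> Z = 1)) \<or> (pd g X Y & 0 <= Z & Z <= 1)"
  show "((X, Y), Z) : handle_surface g"
  proof (cases "\<exists>k<g. (X, Y) : frontier (square k) & 0 <= Z & Z <= 1")
   case True thus ?thesis unfolding handle_surface_def by auto
  next
   case False
   have "((X, Y), Z) : frontier (block g)"
    using h False unfolding frontier_block frontier_square pc_def pd_def by auto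
   moreover have "(X, Y) ~: square k" if "k < g" "Z = 0 \<or> Z = 1" for k
   proof
    assume s: "(X, Y) : square k"
    hence "pd g X Y" using h that unfolding pc_def by (auto simp: square_def)
    hence "X = 2 * real g + 1 \<or> X = 0 \<or> Y = 0 \<or> Y = 3" using False that unfolding pd_def frontier_square by auto
    thus False using s ne[OF that(1)] by (auto simp: square_def)
   qed
   ultimately show ?thesis unfolding handle_surface_def by auto
  qed
 qed
qed

lemma coarse_cover:
 assumes "pc g X Y"
 obtains a b where "coarse g a b" "real_of_int a <= X" "X <= real_of_int a + 1" "real_of_int b <= Y" "Y <= real_of_int b + 1"
proof -
 \<comment> \<open>The middle row is chosen only for \<open>Y\<close> strictly inside it; points on
   the horizontal sides of a hole go to the outer rows.\<close>
 have b: "\<exists>b::int. 0 <= b & b <= 2 & real_of_int b <= Y & Y <= real_of_int b + 1 & (b = 1 --> 1 < Y & Y < 2)"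
 proof (cases "Y <= 1")
  case True thus ?thesis using assms by (intro exI[of _ 0]) (auto simp: pc_def)
 next
  case False
  show ?thesis
  proof (cases "Y < 2")
   case True thus ?thesis using False by (intro exI[of _ 1]) auto
  next
   case F2: False thus ?thesis using assms by (intro exI[of _ 2]) (auto simp: pc_def)
  qed
 qed
 then obtain b :: int where b: "0 <= b" "b <= 2" "real_of_int b <= Y" "Y <= real_of_int b + 1" "b = 1 --> 1 < Y & Y < 2" by blast
 have fl: "0 <= \<lfloor>X\<rfloor>" "real_of_int \<lfloor>X\<rfloor> <= X" "X < real_of_int \<lfloor>X\<rfloor> + 1" using assms unfolding pc_def by linarith+
 have g1: "X <= 2 * real g + 1" using assms by (simp add: pc_def)
 have fg: "\<lfloor>X\<rfloor> <= 2 * int g + 1" using g1 fl(2) by linarith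
 have "\<exists>a::int. 0 <= a & a <= 2 * int g & real_of_int a <= X & X <= real_of_int a + 1 & \<not> (odd a & b = 1)"
 \<comment> \<open>In the exceptional cases \<open>X\<close> is an odd integer, the left side of a
   hole or the right side of the box, and the cell to its left is taken.\<close>
 proof (cases "odd \<lfloor>X\<rfloor> & b = 1 \<or> \<lfloor>X\<rfloor> = 2 * int g + 1")
  case False
  thus ?thesis using fl fg by (intro exI[of _ "\<lfloor>X\<rfloor>"]) auto
 next
  case True
  hence od: "odd \<lfloor>X\<rfloor>" by auto
  then obtain k where k: "\<lfloor>X\<rfloor> = 2 * k + 1" by (auto elim: oddE)
  have k0: "0 <= k" using fl k by auto
  have "X = 2 * real_of_int k + 1"
  proof (cases "k = int g")
   case True
   hence "real_of_int \<lfloor>X\<rfloor> = 2 * real g + 1" using k by simp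
   thus ?thesis using fl(2) g1 True by simp
  next
   case kg: False
   hence kl: "nat k < g" and b1: "b = 1" using True fg k k0 by auto
   hence "\<not> (2 * real (nat k) + 1 < X & X < 2 * real (nat k) + 2)" using assms b(5) unfolding pc_def by blast
   moreover have "real (nat k) = real_of_int k" using k0 by simp
   ultimately show ?thesis using fl k by auto
  qed
  thus ?thesis using fl k k0 fg by (intro exI[of _ "2 * k"]) auto
 qed
 then obtain a :: int where "0 <= a" "a <= 2 * int g" "real_of_int a <= X" "X <= real_of_int a + 1" "\<not> (odd a & b = 1)" by blast
 thus ?thesis using that[of a b] b by (auto simp: coarse_def)
qed

lemma unit_interval_cover:
 assumes "0 <= (Y::real)" "Y <= 3"
 obtains b :: int where "0 <= b" "b <= 2" "real_of_int b <= Y" "Y <= real_of_int b + 1"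
proof -
 have "Y <= 1 \<or> (1 <= Y & Y <= 2) \<or> 2 <= Y" by linarith
 thus ?thesis using that[of 0] that[of 1] that[of 2] assms by auto
qed

lemma pd_cover:
 fixes X Y :: real
 assumes "pd g X Y"
 shows "(\<exists>a b::int. X = a & real_of_int b <= Y & Y <= real_of_int b + 1 & coarse g a b ~= coarse g (a-1) b) \<or>
  (\<exists>a b::int. Y = b & real_of_int a <= X & X <= real_of_int a + 1 & coarse g a b ~= coarse g a (b-1))" (is "?V \<or> ?H")
 using assms unfolding pd_def
proof (elim disjE exE conjE)
 assume h: "0 <= Y" "Y <= 3"
 obtain b where b: "0 <= b" "b <= 2" "real_of_int b <= Y" "Y <= real_of_int b + 1" using unit_interval_cover[OF h] .
 show ?thesis if "X = 0" using that b by (intro disjI1 exI[of _ 0] exI[of _ b]) (auto simp: coarse_def)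
 show ?thesis if "X = 2 * real g + 1" using that b by (intro disjI1 exI[of _ "2 * int g + 1"] exI[of _ b]) (auto simp: coarse_def)
next
 assume h: "0 <= X" "X <= 2 * real g + 1"
 have "\<exists>a::int. 0 <= a & a <= 2 * int g & real_of_int a <= X & X <= real_of_int a + 1"
 proof (cases "X = 2 * real g + 1")
  case True thus ?thesis by (intro exI[of _ "2 * int g"]) auto
 next
  case False
  have "\<lfloor>X\<rfloor> <= 2 * int g" using h False by linarith
  moreover have "X <= real_of_int \<lfloor>X\<rfloor> + 1" "real_of_int \<lfloor>X\<rfloor> <= X" by linarith+
  ultimately show ?thesis using h by (intro exI[of _ "\<lfloor>X\<rfloor>"]) auto
 qed
 then obtain a :: int where a: "0 <= a" "a <= 2 * int g" "real_of_int a <= X" "X <= real_of_int a + 1" by blast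
 show ?thesis if "Y = 0" using that a by (intro disjI2 exI[of _ a] exI[of _ 0]) (auto simp: coarse_def)
 show ?thesis if "Y = 3" using that a by (intro disjI2 exI[of _ a] exI[of _ 3]) (auto simp: coarse_def)
next
 fix k assume h: "k < g" "1 <= Y" "Y <= 2"
 show ?thesis if "X = 2 * real k + 1" using that h by (intro disjI1 exI[of _ "2 * int k + 1"] exI[of _ 1]) (auto simp: coarse_def)
 show ?thesis if "X = 2 * real k + 2" using that h by (intro disjI1 exI[of _ "2 * int k + 2"] exI[of _ 1]) (auto simp: coarse_def)
next
 fix k assume h: "k < g" "2 * real k + 1 <= X" "X <= 2 * real k + 2"
 show ?thesis if "Y = 1" using that h by (intro disjI2 exI[of _ "2 * int k + 1"] exI[of _ 1]) (auto simp: coarse_def)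
 show ?thesis if "Y = 2" using that h by (intro disjI2 exI[of _ "2 * int k + 1"] exI[of _ 2]) (auto simp: coarse_def)
qed

lemma fine_index:
 fixes X :: real
 assumes N: "1 <= N" and X: "real_of_int a <= X" "X <= real_of_int a + 1"
 obtains i :: int where "i div int N = a" "real_of_int i <= N * X" "N * X <= real_of_int i + 1"
proof -
 \<comment> \<open>The cap serves \<open>X = a + 1\<close>, where the floor would already belong to
   the next coarse cell.\<close>
 define i where "i = min \<lfloor>N * X\<rfloor> (int N * a + int N - 1)"
 have "real N * a <= N * X" using X(1) by (simp add: mult_left_mono)
 hence lo: "int N * a <= \<lfloor>N * X\<rfloor>" by (simp add: le_floor_iff)
 have "N * X <= real N * (a + 1)" using X(2) by (intro mult_left_mono) auto
 hence hi: "N * X <= int N * a + int N" by (simp add: distrib_left)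
 have q: "i = int N * a + (i - int N * a)" by simp
 have "0 <= i - int N * a" "i - int N * a < int N" using lo N by (auto simp: i_def)
 hence "i div int N = a" by (rule int_div_pos_eq[OF q])
 moreover have "real_of_int i <= N * X" unfolding i_def by (metis min.cobounded1 of_int_le_iff of_int_floor_le order_trans)
 moreover have "N * X <= real_of_int i + 1" unfolding i_def using hi by (auto simp: min_def)
 ultimately show ?thesis using that by blast
qed

lemma handle_cover:
 assumes N: "1 <= N" and v: "v : handle_surface g"
 shows "\<exists>w\<in>hW g N. v : cellbox N w"
proof -
 interpret plate "hcell g N" "int N" by (rule plate_hcell[OF N])
 obtain X Y Z where V: "v = ((X, Y), Z)" by (metis prod.collapse)
 have Np: "0 < real N" using N by simp
 show ?thesis
 proof (cases "pc g X Y & (Z = 0 \<or> Z = 1)")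
  case True
  then obtain a b where ab: "coarse g a b" "real_of_int a <= X" "X <= real_of_int a + 1" "real_of_int b <= Y" "Y <= real_of_int b + 1"
   using coarse_cover by blast
  obtain i where i: "i div int N = a" "real_of_int i <= N * X" "N * X <= real_of_int i + 1" using fine_index[OF N ab(2,3)] .
  obtain j where j: "j div int N = b" "real_of_int j <= N * Y" "N * Y <= real_of_int j + 1" using fine_index[OF N ab(4,5)] .
  have c: "hcell g N i j" using ab i j by (simp add: hcell_def)
  show ?thesis
  proof (cases "Z = 1")
   case True
   have "v : cellbox N (top i j)" unfolding V top_def cellbox_quad using i j True by simp
   thus ?thesis using top_in[OF c] by (auto simp: hW_def)
  next
   case False
   hence "Z = 0" using \<open>pc g X Y & (Z = 0 \<or> Z = 1)\<close> by simp
   hence "v : cellbox N (bot i j)" unfolding V bot_def cellbox_quad using i j by simp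
   thus ?thesis using bot_in[OF c] by (auto simp: hW_def)
  qed
 next
  case False
  hence P: "pd g X Y" "0 <= Z" "Z <= 1" using v unfolding V mem_handle by auto
  obtain k where k: "k div int N = 0" "real_of_int k <= N * Z" "N * Z <= real_of_int k + 1" using fine_index[OF N, of 0 Z] P by auto
  have "k = k mod int N" using div_mult_mod_eq[of k "int N"] unfolding k(1) by simp
  hence k0: "0 <= k" "k < int N" using N pos_mod_sign[of "int N" k] pos_mod_bound[of "int N" k] by linarith+
  have w: "v : cellbox N (wall (p1,p2) (q1,q2) k)" if "btw p1 q1 (N * X)" "btw p2 q2 (N * Y)" for p1 p2 q1 q2
   using that k unfolding V wall_def cellbox_quad by (auto simp: btw_def min.commute max.commute)
  from pd_cover[OF P(1)] show ?thesis
  proof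
   assume "\<exists>a b::int. X = a & real_of_int b <= Y & Y <= real_of_int b + 1 & coarse g a b ~= coarse g (a-1) b"
   then obtain a b :: int where ab: "X = a" "real_of_int b <= Y" "Y <= real_of_int b + 1" "coarse g a b ~= coarse g (a-1) b" by blast
   obtain j where j: "j div int N = b" "real_of_int j <= N * Y" "N * Y <= real_of_int j + 1" using fine_index[OF N ab(2,3)] .
   define x where "x = a * int N"
   have x: "x div int N = a" "(x - 1) div int N = a - 1" "N * X = x" using N by (simp_all add: x_def pred_div ab)
   have "bd (x, j) (x, j+1) \<or> bd (x, j+1) (x, j)" using ab(4) x(1,2) j(1) by (auto simp: bd_simps hcell_def)
   thus ?thesis
   proof
    assume "bd (x, j) (x, j+1)"
    thus ?thesis using w[of x x j "j+1"] wall_in[of _ _ k] k0 j x by (auto simp: hW_def)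
   next
    assume "bd (x, j+1) (x, j)"
    thus ?thesis using w[of x x "j+1" j] wall_in[of _ _ k] k0 j x by (auto simp: hW_def)
   qed
  next
   assume "\<exists>a b::int. Y = b & real_of_int a <= X & X <= real_of_int a + 1 & coarse g a b ~= coarse g a (b-1)"
   then obtain a b :: int where ab: "Y = b" "real_of_int a <= X" "X <= real_of_int a + 1" "coarse g a b ~= coarse g a (b-1)" by blast
   obtain i where i: "i div int N = a" "real_of_int i <= N * X" "N * X <= real_of_int i + 1" using fine_index[OF N ab(2,3)] .
   define y where "y = b * int N"
   have y: "y div int N = b" "(y - 1) div int N = b - 1" "N * Y = y" using N by (simp_all add: y_def pred_div ab)
   have "bd (i, y) (i+1, y) \<or> bd (i+1, y) (i, y)" using ab(4) y(1,2) i(1) by (auto simp: bd_simps hcell_def)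
   thus ?thesis
   proof
    assume "bd (i, y) (i+1, y)"
    thus ?thesis using w[of i "i+1" y y] wall_in[of _ _ k] k0 i y by (auto simp: hW_def)
   next
    assume "bd (i+1, y) (i, y)"
    thus ?thesis using w[of "i+1" i y y] wall_in[of _ _ k] k0 i y by (auto simp: hW_def)
   qed
  qed
 qed
qed

lemma cellbox_subset_handle:
 assumes w: "w : hW g 1"
 shows "cellbox 1 w <= handle_surface g"
proof
 interpret plate "hcell g 1" "int 1" by (rule plate_hcell) simp
 fix v assume v: "v : cellbox 1 w"
 obtain X Y Z where V: "v = ((X, Y), Z)" by (metis prod.collapse)
 have pcI: "pc g X Y" if h: "hcell g 1 i j" "real_of_int i <= X" "X <= real_of_int i + 1" "real_of_int j <= Y" "Y <= real_of_int j + 1" for i j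
  unfolding pc_def
 proof (intro conjI allI impI notI)
  have c: "0 <= i" "i <= 2 * int g" "0 <= j" "j <= 2" "\<not> (odd i & j = 1)" using h(1) by (auto simp: hcell_def coarse_def)
  show "0 <= X" "0 <= Y" using c h by linarith+
  show "Y <= 3" using c h by linarith
  show "X <= 2 * real g + 1" using c h by linarith
  fix k assume k: "2 * real k + 1 < X & X < 2 * real k + 2 & 1 < Y & Y < 2"
  hence "i = 2 * int k + 1" "j = 1" using h by linarith+
  thus False using c by simp
 qed
 show "v : handle_surface g"
  using w[unfolded hW_def]
 proof (cases rule: W_cases)
  case (top i j)
  thus ?thesis using v pcI[of i j] unfolding V top top_def cellbox_quad mem_handle by simp
 next
  case (bot i j)
  thus ?thesis using v pcI[of i j] unfolding V bot bot_def cellbox_quad mem_handle by simp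
 next
  case (wall p q k)
  obtain x y where p: "p = (x, y)" by (cases p)
  obtain x' y' where q: "q = (x', y')" by (cases q)
  have vv: "btw x' x X" "btw y' y Y" "btw (k+1) k Z" using v unfolding V wall p q wall_def cellbox_quad by simp_all
  have "k = 0" using wall by simp
  moreover have "real_of_int k <= Z & Z <= real_of_int k + 1" using vv(3) by simp
  ultimately have Z: "0 <= Z" "Z <= 1" by simp_all
  have V1: "pd g X Y" if h: "X = x" "real_of_int j <= Y" "Y <= real_of_int j + 1" "coarse g x j ~= coarse g (x-1) j" for j
  proof -
   have "x = 0 \<or> x = 2 * int g + 1 \<or> (j = 1 & 0 < x & x <= 2 * int g)" and j: "0 <= j" "j <= 2" using h(4) by (auto simp: coarse_def)
   then consider "x = 0" | "x = 2 * int g + 1" | "j = 1" "0 < x" "x <= 2 * int g" "even x" | "j = 1" "0 < x" "x <= 2 * int g" "odd x" by blast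
   thus ?thesis
   proof cases
    case 3
    then obtain m where "x = 2 * m" by (auto elim: evenE)
    hence "nat (m - 1) < g" "X = 2 * real (nat (m-1)) + 2" using 3 h by auto
    thus ?thesis using h 3 unfolding pd_def by (intro disjI2 exI[of _ "nat (m-1)"]) auto
   next
    case 4
    then obtain m where "x = 2 * m + 1" by (auto elim: oddE)
    hence "nat m < g" "X = 2 * real (nat m) + 1" using 4 h by auto
    thus ?thesis using h 4 unfolding pd_def by (intro disjI2 exI[of _ "nat m"]) auto
   qed (use h j in \<open>auto simp: pd_def\<close>)
  qed
  have H1: "pd g X Y" if h: "Y = y" "real_of_int i <= X" "X <= real_of_int i + 1" "coarse g i y ~= coarse g i (y-1)" for i
  proof -
   have "y = 0 \<or> y = 3 \<or> (odd i & (y = 1 \<or> y = 2))" and i: "0 <= i" "i <= 2 * int g" using h(4) by (auto simp: coarse_def)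
   then consider "y = 0" | "y = 3" | "odd i" "y = 1 \<or> y = 2" by blast
   thus ?thesis
   proof cases
    case 3
    then obtain m where "i = 2 * m + 1" by (auto elim: oddE)
    hence "nat m < g" "2 * real (nat m) + 1 = i" using 3 i by auto
    thus ?thesis using h 3 unfolding pd_def by (intro disjI2 exI[of _ "nat m"]) auto
   qed (use h i in \<open>auto simp: pd_def\<close>)
  qed
  have "(x' = x + 1 & y' = y & coarse g x y & \<not> coarse g x (y-1)) \<or> (x' = x & y' = y + 1 & coarse g (x-1) y & \<not> coarse g x y) \<or>
   (x' = x - 1 & y' = y & coarse g (x-1) (y-1) & \<not> coarse g (x-1) y) \<or> (x' = x & y' = y - 1 & coarse g x (y-1) & \<not> coarse g (x-1) (y-1))"
   using wall(2) unfolding p bd_simps q hcell_def by auto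
  hence "pd g X Y"
  proof (elim disjE conjE)
   assume "x' = x + 1" "y' = y" "coarse g x y" "\<not> coarse g x (y-1)"
   thus ?thesis using vv H1[of x] by simp
  next
   assume "x' = x" "y' = y + 1" "coarse g (x-1) y" "\<not> coarse g x y"
   thus ?thesis using vv V1[of y] by simp
  next
   assume "x' = x - 1" "y' = y" "coarse g (x-1) (y-1)" "\<not> coarse g (x-1) y"
   thus ?thesis using vv H1[of "x-1"] btw_simps(1)[of "x-1" X] by simp
  next
   assume "x' = x" "y' = y - 1" "coarse g x (y-1)" "\<not> coarse g (x-1) (y-1)"
   thus ?thesis using vv V1[of "y-1"] btw_simps(1)[of "y-1" Y] by simp
  qed
  thus ?thesis using Z unfolding V mem_handle by blast
 qed
qed

section \<open>Faces against components modulo two\<close>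


lemma walk_count:
 "walk f a w b ==> length (filter (\<lambda>d. f d : U) w) + of_bool (b : U) = length (filter (\<lambda>d. f (rv d) : U) w) + of_bool (a : U)"
 by (induction w arbitrary: a) auto

lemma cwalk_count:
 assumes "cwalk f w" "distinct w"
 shows "card {d : set w. f d : U} = card {d : set w. f (rv d) : U}"
proof -
 have "length (filter (\<lambda>d. f d : U) w) = length (filter (\<lambda>d. f (rv d) : U) w)"
  using assms(1) walk_count unfolding cwalk_def by (metis add_right_cancel)
 moreover have "card (set (filter P w)) = length (filter P w)" for P
  using assms(2) by (intro distinct_card) simp
 ultimately show ?thesis by (simp add: Collect_conj_eq)
qed

lemma walk_invariant:
 assumes "walk f a w b" "\<And>d. d : set w ==> f d : X \<longleftrightarrow> f (rv d) : X" "d : set w"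
 shows "f d : X \<longleftrightarrow> a : X"
 using assms by (induction w arbitrary: a) auto

lemma even_card_involution:
 assumes "finite X" "\<And>x. x : X ==> h x : X & h x ~= x & h (h x) = x"
 shows "even (card X)"
 using assms
proof (induction "card X" arbitrary: X rule: less_induct)
 case less
 show ?case
 proof (cases "X = {}")
  case False
  then obtain x where x: "x : X" by blast
  let ?Y = "X - {x, h x}"
  have hx: "h x : X" "h x ~= x" "h (h x) = x" using less.prems(2)[OF x] by auto
  have c: "card X = card ?Y + 2"
  proof -
   have "card {x, h x} = 2" using hx by (simp add: card_insert_if)
   moreover have "card ?Y = card X - card {x, h x}" using x hx by (intro card_Diff_subset) auto
   moreover have "card {x, h x} <= card X" using x hx less.prems(1) by (intro card_mono) auto
   ultimately show ?thesis by linarith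
  qed
  have "even (card ?Y)"
  proof (rule less.hyps)
   show "card ?Y < card X" using c by simp
   show "finite ?Y" using less.prems(1) by simp
   fix y assume y: "y : ?Y"
   thus "h y : ?Y & h y ~= y & h (h y) = y" using less.prems(2)[of y] hx by auto
  qed
  thus ?thesis using c by simp
 qed simp
qed

text \<open>From one edge the even degrees lead to a second edge at each of its ends and then to a
  fourth edge at \<open>u'\<close>. The vertices \<open>v'\<close> and \<open>v''\<close> may
  coincide; the four edges are distinct in any case.\<close>

lemma even_bipartite_card:
 fixes X :: "('n \<times> 'n) set"
 assumes f: "finite X" and ne: "X ~= {}"
  and a: "\<And>u. even (card {e : X. fst e = u})" and b: "\<And>v. even (card {e : X. snd e = v})"
 shows "4 <= card X"
proof -
 have oth: "\<exists>e'\<in>A. e' ~= e" if "even (card A)" "e : A" for A and e :: "'n \<times> 'n"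
 proof (rule ccontr)
  assume "\<not> ?thesis"
  hence "A = {e}" using that(2) by blast
  thus False using that(1) by simp
 qed
 obtain u v where e1: "(u, v) : X" using ne by auto
 obtain v' where e2: "(u, v') : X" "v' ~= v" using oth[OF a[of u], of "(u, v)"] e1 by auto
 obtain u' where e3: "(u', v) : X" "u' ~= u" using oth[OF b[of v], of "(u, v)"] e1 by auto
 obtain v'' where e4: "(u', v'') : X" "v'' ~= v" using oth[OF a[of u'], of "(u', v)"] e3 by auto
 have "card {(u,v), (u,v'), (u',v), (u',v'')} = 4" using e2 e3 e4 by (simp add: card_insert_if)
 moreover have "card {(u,v), (u,v'), (u',v), (u',v'')} <= card X" using e1 e2 e3 e4 f by (intro card_mono) auto
 ultimately show ?thesis by simp
qed

text \<open>Symmetric difference is addition over the field with two elements; the hypothesis says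
  that \<open>X\<close> has index at most two in \<open>Y\<close>.\<close>

lemma card_half:
 assumes f: "finite Y" and s: "X <= Y" and d: "\<And>x y. x : Y - X ==> y : Y - X ==> (x - y) \<union> (y - x) : X"
 shows "card Y <= 2 * card X"
proof (cases "Y - X = {}")
 case True
 hence "Y = X" using s by auto
 thus ?thesis by simp
next
 case False
 then obtain y where y: "y : Y - X" by blast
 have "inj_on (\<lambda>x. (x - y) \<union> (y - x)) (Y - X)"
  by (rule inj_on_inverseI[of _ "\<lambda>z. (z - y) \<union> (y - z)"]) auto
 hence "card (Y - X) <= card X" using d y f s by (intro card_inj_on_le) (auto intro: finite_subset)
 moreover have "card Y = card X + card (Y - X)" using f s by (metis card_Diff_subset card_mono finite_subset le_add_diff_inverse)
 ultimately show ?thesis by simp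
qed

text \<open>What the counting argument asks of a lattice; it holds at every fineness, while
  \<open>okmap\<close> is established for plates of height one.\<close>

locale cellular =
 fixes s :: "'a \<times> 'a => 'v" and W :: "('a \<times> 'a) list set"
 assumes finite_words: "finite W" and words_nonempty: "W ~= {}" and nil: "[] ~: W"
  and word: "w : W ==> distinct w" "w : W ==> cwalk s w"
  and word_unique: "w : W ==> w' : W ==> d : set w ==> d : set w' ==> w = w'"
  and swap: "d : letters W ==> rv d : letters W & rv d ~= d"
  and wconn: "wconn W"
begin

section \<open>Boundaries of face sets against cuts of vertex sets\<close>

definition fc :: "'a \<times> 'a => ('a \<times> 'a) list" where "fc d = (THE w. w : W & d : set w)"

text \<open>The mod-2 boundary of the face set \<open>c\<close>, as a predicate on darts; in the
  dual complex it is a coboundary.\<close>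

definition cob :: "('a \<times> 'a) list set => 'a \<times> 'a => bool" where
 "cob c d \<longleftrightarrow> (fc d : c) ~= (fc (rv d) : c)"

lemma fc_eq: "w : W ==> d : set w ==> fc d = w"
 unfolding fc_def using word_unique by blast

lemma lettersI: "w : W ==> d : set w ==> d : letters W"
 by (auto simp: letters_def)

lemma fc_in:
 assumes "d : letters W"
 shows "fc d : W & d : set (fc d)"
proof -
 obtain w where "w : W" "d : set w" using assms unfolding letters_def by blast
 thus ?thesis using fc_eq by simp
qed

lemma finite_L: "finite (letters W)"
 using finite_words by (auto simp: letters_def)

lemma cob_swap: "cob c (rv d) \<longleftrightarrow> cob c d"
 by (auto simp: cob_def)

text \<open>A mod-2 boundary is a cycle and crosses every vertex cut evenly. Each face in
  \<open>c\<close> has as many darts starting in \<open>U\<close> as ending in \<open>U\<close>; the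
  darts with both ends in \<open>U\<close> cancel against their reverses.\<close>

lemma parity:
 assumes c: "c <= W"
 shows "even (card {d : letters W. s d : U & s (rv d) ~: U & cob c d})"
proof -
 let ?L = "letters W"
 let ?A = "{d : ?L. s d : U & fc d : c}" and ?B = "{d : ?L. s d : U & fc (rv d) : c}"
 let ?B' = "{d : ?L. s (rv d) : U & fc d : c}"
 have fc: "finite c" using c finite_words finite_subset by blast
 have un: "{d : ?L. Q d & fc d : c} = (\<Union>w\<in>c. {d : set w. Q d})" for Q
  using fc_in fc_eq c by (auto simp: letters_def)
 have cd: "card {d : ?L. Q d & fc d : c} = (\<Sum>w\<in>c. card {d : set w. Q d})" for Q
  unfolding un
 proof (intro card_UN_disjoint ballI impI)
  fix w w' assume "w : c" "w' : c" "w ~= w'"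
  thus "{d : set w. Q d} \<inter> {d : set w'. Q d} = {}" using c word_unique[of w w'] by blast
 qed (use fc in auto)
 have AB: "card ?A = card ?B'" unfolding cd
 proof (intro sum.cong refl)
  fix w assume "w : c"
  hence "w : W" using c by blast
  thus "card {d : set w. s d : U} = card {d : set w. s (rv d) : U}" by (intro cwalk_count word)
 qed
 have "?B = rv ` ?B'"
 proof (intro set_eqI iffI)
  fix d assume "d : ?B" thus "d : rv ` ?B'" using swap by (intro image_eqI[of _ _ "rv d"]) auto
 qed (use swap in auto)
 hence BB: "card ?B = card ?B'" by (metis (no_types, lifting) card_image inj_on_subset inj_swap subset_UNIV)
 have f: "finite ?A" "finite ?B" using finite_L by auto
 let ?X = "{d : ?L. s d : U & cob c d}"
 have u: "?A \<union> ?B = ?X \<union> (?A \<inter> ?B)" by (auto simp: cob_def)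
 have cu: "card (?A \<union> ?B) = card ?X + card (?A \<inter> ?B)" unfolding u using finite_L by (intro card_Un_disjoint) (auto simp: cob_def)
 have ev: "even x" if "a + b = (x + i) + i" "a = b" for a b x i :: nat using that by presburger
 have e: "even (card ?X)"
  by (rule ev[of "card ?A" "card ?B" _ "card (?A \<inter> ?B)"]) (use card_Un_Int[OF f] cu AB BB in simp_all)
 let ?Y = "{d : ?L. s d : U & s (rv d) : U & cob c d}"
 let ?Z = "{d : ?L. s d : U & s (rv d) ~: U & cob c d}"
 have "even (card ?Y)" using finite_L swap by (intro even_card_involution[of _ rv]) (auto simp: cob_swap)
 moreover have "?X = ?Y \<union> ?Z" by auto
 moreover have "card (?Y \<union> ?Z) = card ?Y + card ?Z" using finite_L by (intro card_Un_disjoint) auto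
 ultimately show ?thesis using e by simp
qed

text \<open>An edge of a boundary cannot be its only edge across a cut, by
  \<open>parity\<close>.\<close>

lemma not_cob:
 assumes c: "c <= W" and d: "d : letters W" and U: "s d : U" "s (rv d) ~: U"
  and o: "\<And>d'. d' : letters W ==> cob c d' ==> d' ~= d ==> d' ~= rv d ==> s d' : U \<longleftrightarrow> s (rv d') : U"
 shows "\<not> cob c d"
proof
 assume b: "cob c d"
 have "{d : letters W. s d : U & s (rv d) ~: U & cob c d} = {d}"
 proof (intro equalityI subsetI)
  fix d' assume d': "d' : {d : letters W. s d : U & s (rv d) ~: U & cob c d}"
  hence "d' ~= rv d" using U by auto
  thus "d' : {d}" using o[of d'] d' by blast
 qed (use b d U in auto)
 thus False using parity[OF c, of U] by simp
qed

text \<open>The face sets with boundary inside \<open>X\<close>: a space over two elements whose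
  dimension is the number of regions that the subgraph \<open>X\<close> leaves.\<close>

definition CC :: "('a \<times> 'a) set => ('a \<times> 'a) list set set" where
 "CC X = {c. c <= W & (\<forall>d\<in>letters W - X. \<not> cob c d)}"

text \<open>The vertex sets that no edge of \<open>X\<close> leaves; the dimension is the number of
  components of the subgraph \<open>X\<close> on all vertices.\<close>

definition KK :: "('a \<times> 'a) set => 'v set set" where
 "KK X = {U. U <= s ` letters W & (\<forall>d\<in>X. s d : U \<longleftrightarrow> s (rv d) : U)}"

lemma finite_CC: "finite (CC X)"
 by (rule finite_subset[of _ "Pow W"]) (use finite_words in \<open>auto simp: CC_def\<close>)

lemma finite_KK: "finite (KK X)"
 by (rule finite_subset[of _ "Pow (s ` letters W)"]) (use finite_L in \<open>auto simp: KK_def\<close>)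

lemma word_closed:
 assumes w: "w : W" and X: "\<And>d. d : letters W ==> s d : X \<longleftrightarrow> s (rv d) : X" and d: "d : set w" "d' : set w" "s d : X"
 shows "s d' : X"
proof -
 obtain a where a: "walk s a w a" using word(2)[OF w] by (auto simp: cwalk_def)
 have x: "s e : X \<longleftrightarrow> s (rv e) : X" if "e : set w" for e using X[OF lettersI[OF w that]] .
 show ?thesis using walk_invariant[OF a x d(1)] walk_invariant[OF a x d(2)] d(3) by simp
qed

lemma KK_full: "card (KK (letters W)) <= 2"
proof -
 have "U = {} \<or> U = s ` letters W" if U: "U : KK (letters W)" for U
 proof (cases "U = {}")
  case False
  let ?C = "{d : letters W. s d : U}"
  have K: "s d : U \<longleftrightarrow> s (rv d) : U" if "d : letters W" for d using U that by (auto simp: KK_def)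
  have "?C = letters W"
  proof (rule wconn[unfolded wconn_def, rule_format])
   show "?C <= letters W" by auto
   show "?C ~= {}" using U False by (auto simp: KK_def)
   show "set w <= ?C" if "w : W" "set w \<inter> ?C ~= {}" for w
    using that word_closed[OF that(1) K] by (auto simp: letters_def)
   show "rv ` ?C <= ?C" using K swap by auto
  qed
  thus ?thesis using U by (auto simp: KK_def)
 qed simp
 hence "KK (letters W) <= {{}, s ` letters W}" by blast
 hence "card (KK (letters W)) <= card {{}, s ` letters W}" by (intro card_mono) auto
 also have "\<dots> <= 2" by (simp add: card_insert_if)
 finally show ?thesis .
qed

lemma CC_full: "card (CC (letters W)) = 2 ^ card W"
proof -
 have "CC (letters W) = Pow W" by (auto simp: CC_def)
 thus ?thesis using finite_words by (simp add: card_Pow)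
qed

lemma CC_half:
 assumes e: "e : X" "X <= letters W" and sw: "rv ` X <= X"
 shows "card (CC X) <= 2 * card (CC (X - {e, rv e}))"
proof (rule card_half[OF finite_CC])
 show "CC (X - {e, rv e}) <= CC X" by (auto simp: CC_def)
 fix x y assume x: "x : CC X - CC (X - {e, rv e})" and y: "y : CC X - CC (X - {e, rv e})"
 have ce: "cob z e" if z: "z : CC X - CC (X - {e, rv e})" for z
 proof -
  obtain d where d: "d : letters W - (X - {e, rv e})" "cob z d" using z unfolding CC_def by blast
  hence "d : {e, rv e}" using z unfolding CC_def by blast
  thus ?thesis using d(2) cob_swap[of z e] by auto
 qed
 have "\<not> cob ((x - y) \<union> (y - x)) e" using ce[OF x] ce[OF y] unfolding cob_def by blast
 hence ne: "\<not> cob ((x - y) \<union> (y - x)) e" "\<not> cob ((x - y) \<union> (y - x)) (rv e)" by (simp_all add: cob_swap)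
 have "\<not> cob ((x - y) \<union> (y - x)) d" if "d : letters W - X" for d
 proof -
  have "\<not> cob x d" "\<not> cob y d" using x y that unfolding CC_def by blast+
  thus ?thesis unfolding cob_def by blast
 qed
 hence "\<not> cob ((x - y) \<union> (y - x)) d" if "d : letters W - (X - {e, rv e})" for d
  using that ne by blast
 moreover have "(x - y) \<union> (y - x) <= W" using x y unfolding CC_def by blast
 ultimately show "(x - y) \<union> (y - x) : CC (X - {e, rv e})" unfolding CC_def by blast
qed

lemma KK_half:
 assumes e: "e : X"
 shows "card (KK (X - {e, rv e})) <= 2 * card (KK X)"
proof (rule card_half[OF finite_KK])
 show "KK X <= KK (X - {e, rv e})" by (auto simp: KK_def)
 fix x y assume x: "x : KK (X - {e, rv e}) - KK X" and y: "y : KK (X - {e, rv e}) - KK X"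
 have kn: "(s e : z) ~= (s (rv e) : z)" if z: "z : KK (X - {e, rv e}) - KK X" for z
 proof -
  obtain d where d: "d : X" "(s d : z) ~= (s (rv d) : z)" using z unfolding KK_def by blast
  hence "d : {e, rv e}" using z unfolding KK_def by blast
  thus ?thesis using d(2) by auto
 qed
 have ks: "z <= s ` letters W" "\<And>d. d : X - {e, rv e} ==> (s d : z) = (s (rv d) : z)"
  if "z : KK (X - {e, rv e}) - KK X" for z
  using that unfolding KK_def by blast+
 let ?z = "(x - y) \<union> (y - x)"
 have e: "s e : ?z \<longleftrightarrow> s (rv e) : ?z" using kn[OF x] kn[OF y] by blast
 have "s d : ?z \<longleftrightarrow> s (rv d) : ?z" if "d : X" for d
 proof (cases "d : {e, rv e}")
  case True
  thus ?thesis using e by (metis insertE singletonD swap_swap)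
 next
  case False
  hence "d : X - {e, rv e}" using that by blast
  thus ?thesis using ks(2)[OF x] ks(2)[OF y] by blast
 qed
 thus "?z : KK X" using ks(1)[OF x] ks(1)[OF y] unfolding KK_def by blast
qed

text \<open>If deleting \<open>e\<close> enlarges \<open>KK\<close>, then \<open>e\<close> is a
  bridge of \<open>X\<close>, so by \<open>not_cob\<close> it lies on no boundary inside
  \<open>X\<close>.\<close>

lemma CC_same:
 assumes e: "e : X" "X <= letters W" and K: "KK (X - {e, rv e}) ~= KK X"
 shows "CC (X - {e, rv e}) = CC X"
proof
 show "CC (X - {e, rv e}) <= CC X" by (auto simp: CC_def)
 have "KK X <= KK (X - {e, rv e})" by (auto simp: KK_def)
 then obtain U where U: "U : KK (X - {e, rv e})" "U ~: KK X" using K by auto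
 have "s e : U \<longleftrightarrow> s (rv e) ~: U" using U by (auto simp: KK_def)
 then obtain d where d: "d : {e, rv e}" "s d : U" "s (rv d) ~: U"
  by (metis insertCI swap_swap)
 show "CC X <= CC (X - {e, rv e})"
 proof
  fix c assume c: "c : CC X"
  have "\<not> cob c d"
  proof (rule not_cob)
   show "c <= W" "d : letters W" "s d : U" "s (rv d) ~: U" using c d e swap[of e] by (auto simp: CC_def)
   fix d' assume "d' : letters W" "cob c d'" "d' ~= d" "d' ~= rv d"
   hence "d' : X - {e, rv e}" using c d(1) by (auto simp: CC_def)
   thus "s d' : U \<longleftrightarrow> s (rv d') : U" using U(1) by (auto simp: KK_def)
  qed
  hence "\<not> cob c e" "\<not> cob c (rv e)" using d(1) cob_swap[of c e] by (metis insertE singletonD)+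
  thus "c : CC (X - {e, rv e})" using c by (auto simp: CC_def)
 qed
qed

text \<open>Rank--nullity: deleting an edge either merges two faces or disconnects, never both.\<close>

lemma CC_KK:
 assumes "R <= letters W" "rv ` R <= R" "card R = 2 * r"
 shows "2 ^ card W * card (KK (letters W - R)) <= 2 * card (CC (letters W - R)) * 2 ^ r"
 using assms
proof (induction r arbitrary: R)
 case 0
 hence "R = {}" using finite_L finite_subset by fastforce
 thus ?case using KK_full by (simp add: CC_full)
next
 case (Suc r)
 have fR: "finite R" using Suc.prems(1) finite_L finite_subset by blast
 have "R ~= {}" using Suc.prems(3) by auto
 then obtain e where e: "e : R" by blast
 let ?e = "{e, rv e}"
 let ?R = "R - ?e" and ?X = "letters W - (R - ?e)"
 have se: "rv e : R" "rv e ~= e" using e Suc.prems(1,2) swap[of e] by blast+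
 have "card ?e = 2" using se by (simp add: card_insert_if)
 moreover have "card ?R = card R - card ?e" using e se by (intro card_Diff_subset) auto
 ultimately have cR: "card ?R = 2 * r" using Suc.prems(3) by simp
 have swR: "rv ` ?R <= ?R"
 proof
  fix d assume "d : rv ` ?R"
  then obtain d' where d': "d' : R" "d' ~: ?e" "d = rv d'" by blast
  hence "d : R" using Suc.prems(2) by blast
  moreover have "d ~: ?e" using d' by (metis insert_iff singletonD swap_swap)
  ultimately show "d : ?R" by blast
 qed
 have IH: "2 ^ card W * card (KK ?X) <= 2 * card (CC ?X) * 2 ^ r"
  using Suc.IH[OF _ swR cR] Suc.prems(1) by auto
 have X: "letters W - R = ?X - ?e" using e se by auto
 have eX: "e : ?X" "?X <= letters W" using e Suc.prems(1) by auto
 have swX: "rv ` ?X <= ?X"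
 proof
  fix d assume "d : rv ` ?X"
  then obtain d' where d': "d' : letters W" "d' ~: ?R" "d = rv d'" by auto
  hence "d ~: ?R" using swR by (metis imageI subsetD swap_swap)
  thus "d : ?X" using d' swap by auto
 qed
 show ?case
 proof (cases "KK (?X - ?e) = KK ?X")
  case True
  have "2 ^ card W * card (KK (?X - ?e)) <= 2 * card (CC ?X) * 2 ^ r" using True IH by simp
  also have "\<dots> <= 2 * (2 * card (CC (?X - ?e))) * 2 ^ r" using CC_half[OF eX swX] by simp
  finally show ?thesis unfolding X by simp
 next
  case False
  have "2 ^ card W * card (KK (?X - ?e)) <= 2 ^ card W * (2 * card (KK ?X))" by (rule mult_le_mono2[OF KK_half[OF eX(1)]])
  also have "\<dots> = 2 * (2 ^ card W * card (KK ?X))" by simp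
  also have "\<dots> <= 2 * (2 * card (CC ?X) * 2 ^ r)" by (rule mult_le_mono2[OF IH])
  finally show ?thesis unfolding X CC_same[OF eX False] by simp
 qed
qed

text \<open>The region of the complement of \<open>X\<close> that contains \<open>w\<close>: an atom
  of the Boolean algebra \<open>CC X\<close>.\<close>

definition same_class :: "('a \<times> 'a) set => ('a \<times> 'a) list => ('a \<times> 'a) list set" where
 "same_class X w = {w' : W. \<forall>c\<in>CC X. w : c \<longleftrightarrow> w' : c}"

lemma same_class_CC: "same_class X w : CC X"
proof -
 have "\<not> cob (same_class X w) d" if d: "d : letters W - X" for d
 proof -
  have "fc d : c \<longleftrightarrow> fc (rv d) : c" if "c : CC X" for c using that d by (auto simp: CC_def cob_def)
  moreover have "fc d : W" "fc (rv d) : W" using d fc_in swap by auto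
  ultimately show ?thesis by (auto simp: same_class_def cob_def)
 qed
 thus ?thesis by (auto simp: CC_def same_class_def)
qed

text \<open>Every member of \<open>CC X\<close> is a union of classes and is therefore determined by
  the set of its classes.\<close>

lemma card_CC: "card (CC X) <= 2 ^ card (same_class X ` W)"
proof -
 let ?h = "\<lambda>c. same_class X ` c"
 have eq: "c = {w : W. same_class X w : ?h c}" if c: "c : CC X" for c
 proof (intro set_eqI iffI)
  fix w assume "w : {w : W. same_class X w : ?h c}"
  then obtain w' where w: "w : W" "w' : c" "same_class X w = same_class X w'" by auto
  have "w : same_class X w" using w(1) by (auto simp: same_class_def)
  hence "w : same_class X w'" using w by simp
  thus "w : c" using w(2) c unfolding same_class_def by blast
 next
  fix w assume "w : c"
  thus "w : {w : W. same_class X w : ?h c}" using c unfolding CC_def by blast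
 qed
 have "inj_on ?h (CC X)"
 proof (rule inj_onI)
  fix c c' assume c: "c : CC X" "c' : CC X" "?h c = ?h c'"
  show "c = c'" by (subst eq[OF c(1)], subst eq[OF c(2)]) (simp only: c(3))
 qed
 moreover have "?h ` CC X <= Pow (same_class X ` W)" by (auto simp: CC_def)
 ultimately have "card (CC X) <= card (Pow (same_class X ` W))" using finite_words by (intro card_inj_on_le) auto
 thus ?thesis using finite_words by (simp add: card_Pow)
qed

lemma cob_none:
 assumes c: "c <= W" "c ~= {}" and n: "\<And>d. d : letters W ==> \<not> cob c d"
 shows "c = W"
proof -
 let ?C = "{d : letters W. fc d : c}"
 have "?C = letters W"
 proof (rule wconn[unfolded wconn_def, rule_format])
  show "?C <= letters W" by blast
  obtain w where w: "w : c" using c by auto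
  hence wW: "w : W" using c by blast
  then obtain d where d: "d : set w" using nil by (cases w) auto
  hence "d : ?C" using w fc_eq[OF wW d] lettersI[OF wW d] by simp
  thus "?C ~= {}" by blast
  show "set w <= ?C" if w: "w : W" "set w \<inter> ?C ~= {}" for w
  proof
   fix d assume d: "d : set w"
   obtain d' where "d' : set w" "fc d' : c" using w(2) by blast
   hence "fc d : c" using fc_eq[OF w(1)] d by simp
   thus "d : ?C" using lettersI[OF w(1) d] by simp
  qed
  show "rv ` ?C <= ?C" using n swap by (auto simp: cob_def)
 qed
 have "w : c" if w: "w : W" for w
 proof -
  obtain d where d: "d : set w" using w nil by (cases w) auto
  have "fc d : c" using \<open>?C = letters W\<close> lettersI[OF w d] by blast
  thus ?thesis using fc_eq[OF w d] by simp
 qed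
 thus ?thesis using c by auto
qed

section \<open>Branch sets, spanning trees and the edge bound for minors\<close>

definition conn :: "'v set => bool" where
 "conn B \<longleftrightarrow> B ~= {} & (\<forall>X. X \<inter> B ~= {} -->
   (\<forall>d\<in>letters W. s d : X \<inter> B --> s (rv d) : B --> s (rv d) : X) --> B <= X)"

text \<open>\<open>T\<close> holds both darts of each edge, so its count is twice
  \<open>card B - 1\<close>. Acyclicity is expressed by a cut for every edge that no other tree edge
  crosses, the form that \<open>not_cob\<close> consumes.\<close>

definition tree :: "'v set => ('a \<times> 'a) set => bool" where
 "tree B T \<longleftrightarrow> T <= letters W & rv ` T <= T & s ` T <= B & card T + 2 = 2 * card B &
   (\<forall>t\<in>T. \<exists>U. s t : U & s (rv t) ~: U & (\<forall>t'\<in>T. t' ~= t --> t' ~= rv t --> (s t' : U \<longleftrightarrow> s (rv t') : U)))"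

lemma tree_cut:
 assumes "tree B T" "t : T"
 obtains U where "s t : U" "s (rv t) ~: U"
  "\<And>t'. t' : T ==> t' ~= t ==> t' ~= rv t ==> s t' : U \<longleftrightarrow> s (rv t') : U"
proof -
 have "\<forall>t\<in>T. \<exists>U. s t : U & s (rv t) ~: U & (\<forall>t'\<in>T. t' ~= t --> t' ~= rv t --> (s t' : U \<longleftrightarrow> s (rv t') : U))"
  by (rule iffD1[OF tree_def assms(1), THEN conjunct2, THEN conjunct2, THEN conjunct2, THEN conjunct2])
 from bspec[OF this assms(2)] show thesis using that by blast
qed

lemma tree_extend:
 assumes T: "tree B T" and f: "finite B" and d: "d : letters W" "s d : B" "s (rv d) ~: B"
 shows "tree (insert (s (rv d)) B) (insert d (insert (rv d) T))"
 unfolding tree_def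
proof (intro conjI ballI)
 let ?T = "insert d (insert (rv d) T)"
 have TL: "T <= letters W" "rv ` T <= T" "s ` T <= B" using T by (auto simp: tree_def)
 have sT: "s t : B" "s (rv t) : B" if "t : T" for t using that TL by auto
 show "?T <= letters W" "rv ` ?T <= ?T" using T d swap by (auto simp: tree_def)
 show "s ` ?T <= insert (s (rv d)) B" using T d by (auto simp: tree_def)
 have "finite T" using TL finite_L finite_subset by blast
 moreover have "rv d ~: T" "d ~: T" "d ~= rv d" using TL d sT swap[OF d(1)] by (force+)
 ultimately show "card ?T + 2 = 2 * card (insert (s (rv d)) B)"
  using T f d by (simp add: tree_def)
 fix t assume t: "t : ?T"
 consider "t = d" | "t = rv d" | "t : T" using t by auto
 thus "\<exists>U. s t : U & s (rv t) ~: U & (\<forall>t'\<in>?T. t' ~= t --> t' ~= rv t --> (s t' : U \<longleftrightarrow> s (rv t') : U))"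
 proof cases
  case 1
  thus ?thesis using d sT by (intro exI[of _ B]) auto
 next
  case 2
  thus ?thesis using d sT by (intro exI[of _ "- B"]) auto
 next
  case 3
  obtain U where U: "s t : U" "s (rv t) ~: U" "\<And>t'. t' : T ==> t' ~= t ==> t' ~= rv t ==> (s t' : U \<longleftrightarrow> s (rv t') : U)"
   using tree_cut[OF T 3] by blast
  let ?x = "s (rv d)"
  \<comment> \<open>The new leaf is put on the side of its neighbour, so that the new edge does not
    cross the cut of \<open>t\<close>.\<close>
  let ?U = "if s d : U then insert ?x U else U - {?x}"
  have B: "z : ?U \<longleftrightarrow> z : U" if "z : B" for z using that d by auto
  have "s d : ?U \<longleftrightarrow> ?x : ?U" using d by auto
  hence "s t' : ?U \<longleftrightarrow> s (rv t') : ?U" if "t' : ?T" "t' ~= t" "t' ~= rv t" for t'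
   using that U(3)[of t'] B[OF sT(1)[of t']] B[OF sT(2)[of t']] by (cases "t' : T") auto
  moreover have "s t : ?U" "s (rv t) ~: ?U" using B[OF sT(1)[OF 3]] B[OF sT(2)[OF 3]] U by auto
  ultimately show ?thesis by blast
 qed
qed

lemma spanning_tree:
 assumes c: "conn B" and f: "finite B"
 shows "\<exists>T. tree B T"
proof -
 let ?P = "\<lambda>B'. B' <= B & B' ~= {} & (\<exists>T. tree B' T)"
 obtain b where b: "b : B" using c by (auto simp: conn_def)
 have "?P {b}" using b by (auto simp: tree_def intro!: exI[of _ "{}"])
 moreover have "\<forall>B'. ?P B' --> card B' < Suc (card B)" using f by (auto simp: card_mono less_Suc_eq_le)
 ultimately obtain B' where B': "?P B'" and mx: "\<And>B''. ?P B'' ==> card B'' <= card B'"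
  using ex_has_greatest_nat[of ?P "{b}" card "Suc (card B)"] by blast
 obtain T where T: "tree B' T" using B' by blast
 have fB': "finite B'" using B' f finite_subset by blast
 have "B <= B'"
 proof (rule ccontr)
  assume "\<not> B <= B'"
  moreover have "B' \<inter> B ~= {}" using B' by auto
  ultimately obtain d where d: "d : letters W" "s d : B'" "s (rv d) : B" "s (rv d) ~: B'"
   using c unfolding conn_def by blast
  have "?P (insert (s (rv d)) B')" using tree_extend[OF T fB' d(1,2,4)] B' d by blast
  hence "card (insert (s (rv d)) B') <= card B'" by (rule mx)
  thus False using fB' d by simp
 qed
 hence "B = B'" using B' by auto
 thus ?thesis using T by auto
qed

text \<open>\<open>H\<close> consists of a spanning tree of each branch set and one lattice edge for
  each edge of the graph; contracting the trees gives back the graph. With \<open>F\<close> regions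
  of \<open>H\<close> one has \<open>E <= V + F - 2 + 2 g\<close>, and when \<open>F\<close> is at
  least \<open>2\<close>, each region has at least four edges of \<open>E\<close> on its boundary
  while each edge borders at most two regions, so \<open>2 F <= E\<close>.\<close>

theorem minor_bound:
 fixes V :: "'n set" and E :: "('n \<times> 'n) set" and B :: "'n => 'v set" and g :: nat
 assumes V: "finite V" "3 <= card V" and E: "E <= {u : V. p u} \<times> {v : V. \<not> p v}"
  and B: "\<And>v. v : V ==> conn (B v)" "\<And>v. v : V ==> B v <= s ` letters W"
  and disj: "\<And>u v. u : V ==> v : V ==> u ~= v ==> B u \<inter> B v = {}"
  and join: "\<And>u v. (u, v) : E ==> \<exists>d\<in>letters W. s d : B u & s (rv d) : B v"
  and eul: "euler2 s W = 4 - 4 * int g"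
 shows "card E + 4 <= 2 * card V + 4 * g"
proof -
 let ?L = "letters W"
 have fB: "finite (B v)" if "v : V" for v using B(2)[OF that] finite_L finite_subset by blast
 have "\<forall>v\<in>V. \<exists>T. tree (B v) T" using spanning_tree B(1) fB by blast
 then obtain T where T: "\<And>v. v : V ==> tree (B v) (T v)" using bchoice[of V "\<lambda>v. tree (B v)"] by blast
 obtain \<epsilon> where \<epsilon>: "\<And>u v. (u, v) : E ==> \<epsilon> (u, v) : ?L & s (\<epsilon> (u, v)) : B u & s (rv (\<epsilon> (u, v))) : B v"
 proof -
  have "\<forall>e\<in>E. \<exists>d. d : ?L & s d : B (fst e) & s (rv d) : B (snd e)" using join by fastforce
  then obtain \<epsilon> where "\<forall>e\<in>E. \<epsilon> e : ?L & s (\<epsilon> e) : B (fst e) & s (rv (\<epsilon> e)) : B (snd e)" by metis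
  thus ?thesis using that[of \<epsilon>] by force
 qed
 have EV: "u : V & v : V & p u & \<not> p v & u ~= v" if "(u, v) : E" for u v using E that by auto
 have fE: "finite E" by (rule finite_subset[OF E]) (use V in auto)
 have vx: "u = v" if "u : V" "v : V" "x : B u" "x : B v" for u v x using disj[of u v] that by auto
 define H where "H = (\<Union>v\<in>V. T v) \<union> (\<epsilon> ` E \<union> rv ` \<epsilon> ` E)"
 have TL: "T v <= ?L" "rv ` T v <= T v" "s ` T v <= B v" if "v : V" for v using T[OF that] by (auto simp: tree_def)
 have sT: "s t : B v" "s (rv t) : B v" "t : ?L" "rv t : T v" if "v : V" "t : T v" for v t
  using TL[OF that(1)] that(2) by auto
 have s\<epsilon>: "s (\<epsilon> e) : B (fst e)" "s (rv (\<epsilon> e)) : B (snd e)" "\<epsilon> e : ?L" "fst e : V" "snd e : V" "p (fst e)" "\<not> p (snd e)" if "e : E" for e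
  using that \<epsilon>[of "fst e" "snd e"] EV[of "fst e" "snd e"] by auto
 have inj\<epsilon>: "inj_on \<epsilon> E"
 proof (rule inj_onI)
  fix e e' assume e: "e : E" "e' : E" "\<epsilon> e = \<epsilon> e'"
  have "fst e = fst e'" using vx s\<epsilon>(1,4)[OF e(1)] s\<epsilon>(1,4)[OF e(2)] e(3) by metis
  moreover have "snd e = snd e'" using vx s\<epsilon>(2,5)[OF e(1)] s\<epsilon>(2,5)[OF e(2)] e(3) by metis
  ultimately show "e = e'" by (rule prod_eqI)
 qed
 have HL: "H <= ?L"
 proof
  fix d assume "d : H"
  then consider v where "v : V" "d : T v" | e where "e : E" "d = \<epsilon> e" | e where "e : E" "d = rv (\<epsilon> e)"
   unfolding H_def by blast
  thus "d : ?L" by cases (use sT(3) s\<epsilon>(3) swap in blast)+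
 qed
 have Hs: "rv ` H <= H" using sT(4) by (force simp: H_def)
 let ?BB = "\<Union>v\<in>V. B v"
 have fBB: "finite ?BB" using V fB by auto
 have cB: "card ?BB = (\<Sum>v\<in>V. card (B v))" using V fB disj by (intro card_UN_disjoint) auto
 have fT: "finite (T v)" if "v : V" for v using TL(1)[OF that] finite_L finite_subset by blast
 have cT: "card (\<Union>v\<in>V. T v) = (\<Sum>v\<in>V. card (T v))" using V(1) fT vx sT(1) by (intro card_UN_disjoint) (auto, metis)
 have "2 * card ?BB = (\<Sum>v\<in>V. card (T v) + 2)" unfolding cB sum_distrib_left using T by (intro sum.cong) (auto simp: tree_def)
 hence c1: "card (\<Union>v\<in>V. T v) + 2 * card V = 2 * card ?BB" unfolding cT by (simp only: sum.distrib) simp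
 have "card (\<epsilon> ` E \<union> rv ` \<epsilon> ` E) = card (\<epsilon> ` E) + card (rv ` \<epsilon> ` E)"
 proof (rule card_Un_disjoint)
  have False if e: "e : E" "e' : E" "\<epsilon> e = rv (\<epsilon> e')" for e e'
  proof -
   have "fst e = snd e'" using vx s\<epsilon>(1,4)[OF e(1)] s\<epsilon>(2,5)[OF e(2)] e(3) by metis
   thus False using s\<epsilon>(6)[OF e(1)] s\<epsilon>(7)[OF e(2)] by simp
  qed
  thus "\<epsilon> ` E \<inter> rv ` \<epsilon> ` E = {}" by blast
 qed (use fE in auto)
 hence c2: "card (\<epsilon> ` E \<union> rv ` \<epsilon> ` E) = 2 * card E"
  using inj\<epsilon> by (simp add: card_image)
 have T\<epsilon>: "False" if t: "v : V" "t : T v" "e : E" "t = \<epsilon> e \<or> t = rv (\<epsilon> e)" for v t e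
 proof -
  have "s (\<epsilon> e) : B v" "s (rv (\<epsilon> e)) : B v" using sT(1,2)[OF t(1,2)] t(4) by auto
  hence "v = fst e" "v = snd e" using vx[OF t(1)] s\<epsilon>[OF t(3)] by auto
  thus False using s\<epsilon>(6,7)[OF t(3)] by simp
 qed
 have "card H = card (\<Union>v\<in>V. T v) + card (\<epsilon> ` E \<union> rv ` \<epsilon> ` E)"
  unfolding H_def
 proof (intro card_Un_disjoint)
  show "(\<Union>v\<in>V. T v) \<inter> (\<epsilon> ` E \<union> rv ` \<epsilon> ` E) = {}" using T\<epsilon> by blast
 qed (use fE V(1) fT in auto)
 hence cH: "card H + 2 * card V = 2 * card ?BB + 2 * card E" using c1 c2 by simp
 define F where "F = card (same_class H ` W)"
 \<comment> \<open>Vertices outside the branch sets are isolated in \<open>H\<close> and may be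
   chosen freely; the union of all branch sets is taken entirely or not at all.\<close>
 have cK: "2 ^ (card (s ` ?L - ?BB) + 1) <= card (KK H)"
 proof -
  let ?f = "\<lambda>(Y, Z). Y \<union> Z"
  have BBs: "?BB <= s ` ?L" using B(2) by auto
  obtain v where "v : V" using V(2) by fastforce
  hence BBne: "?BB ~= {}" using B(1) by (auto simp: conn_def)
  have sH: "s d : ?BB & s (rv d) : ?BB" if "d : H" for d
  proof -
   consider v where "v : V" "d : T v" | e where "e : E" "d = \<epsilon> e" | e where "e : E" "d = rv (\<epsilon> e)"
    using \<open>d : H\<close> unfolding H_def by blast
   thus ?thesis
   proof cases
    case 1
    thus ?thesis using sT(1,2) by blast
   next
    case 2
    thus ?thesis using s\<epsilon>(1,2,4,5) by blast
   next
    case 3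
    hence "s d : B (snd e)" "s (rv d) : B (fst e)" using s\<epsilon>(1,2) by simp_all
    thus ?thesis using s\<epsilon>(4,5)[OF 3(1)] by blast
   qed
  qed
  have "inj_on ?f (Pow (s ` ?L - ?BB) \<times> {{}, ?BB})"
  proof (rule inj_on_inverseI[of _ "\<lambda>X. (X - ?BB, X \<inter> ?BB)"])
   fix q assume "q : Pow (s ` ?L - ?BB) \<times> {{}, ?BB}"
   thus "(?f q - ?BB, ?f q \<inter> ?BB) = q" by (cases q) auto
  qed
  moreover have "?f ` (Pow (s ` ?L - ?BB) \<times> {{}, ?BB}) <= KK H"
  proof
   fix X assume "X : ?f ` (Pow (s ` ?L - ?BB) \<times> {{}, ?BB})"
   then obtain Y Z where X: "X = Y \<union> Z" "Y <= s ` ?L - ?BB" "Z = {} \<or> Z = ?BB" by auto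
   have "(s d : X) = (Z = ?BB)" "(s (rv d) : X) = (Z = ?BB)" if "d : H" for d using sH[OF that] X BBne by blast+
   moreover have "X <= s ` ?L" using X BBs by auto
   ultimately show "X : KK H" by (auto simp: KK_def)
  qed
  ultimately have "card (Pow (s ` ?L - ?BB) \<times> {{}, ?BB}) <= card (KK H)" using finite_KK by (rule card_inj_on_le)
  moreover have "card {{}, ?BB} = 2" using BBne by (simp add: card_insert_if)
  ultimately show ?thesis using finite_L by (simp add: card_cartesian_product card_Pow)
 qed
 define R where "R = ?L - H"
 have fH: "finite H" using HL finite_L finite_subset by blast
 have "even (card R)"
 proof (rule even_card_involution[of _ rv])
  show "finite R" using finite_L by (simp add: R_def)
  fix d assume d: "d : R"
  hence "rv d ~: H" using Hs by (metis DiffD2 R_def imageI subsetD swap_swap)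
  thus "rv d : R & rv d ~= d & rv (rv d) = d" using d swap by (auto simp: R_def)
 qed
 then obtain r where r: "card R = 2 * r" by (auto elim: evenE)
 have LR: "?L - R = H" using HL by (auto simp: R_def)
 have "rv ` R <= R"
 proof
  fix d assume "d : rv ` R"
  hence "rv d : R" by auto
  hence "d : ?L" "d ~: H" using swap[of "rv d"] Hs by (auto simp: R_def)
  thus "d : R" by (simp add: R_def)
 qed
 hence "2 ^ card W * card (KK H) <= 2 * card (CC H) * 2 ^ r" using CC_KK[of R r] r LR by (auto simp: R_def)
 hence "2 ^ card W * 2 ^ (card (s ` ?L - ?BB) + 1) <= (2::nat) * 2 ^ F * 2 ^ r"
  using cK card_CC[of H] unfolding F_def
  by (meson le_trans mult_le_mono mult_le_mono1 mult_le_mono2 order_refl)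
 hence "(2::nat) ^ (card W + (card (s ` ?L - ?BB) + 1)) <= 2 ^ (1 + F + r)" by (simp add: power_add)
 hence i1: "card W + card (s ` ?L - ?BB) <= F + r" by (subst (asm) power_increasing_iff) auto
 have BBs: "?BB <= s ` ?L" using B(2) by auto
 hence i2: "card (s ` ?L - ?BB) + card ?BB = card (s ` ?L)"
  using finite_L fBB by (metis card_Diff_subset card_mono finite_imageI le_add_diff_inverse2)
 have i3: "card ?L = card H + 2 * r" using r HL fH finite_L by (metis R_def card_Diff_subset card_mono le_add_diff_inverse)
 have key: "2 - 2 * int g + int (card E) <= int F + int (card V)"
  using i1 i2 i3 cH eul unfolding euler2_def by linarith
 show ?thesis
 proof (cases "F <= 1")
  \<comment> \<open>With a single region there may be no boundary to count; the assumption of three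
    vertices covers this case.\<close>
  case True
  thus ?thesis using key V(2) by linarith
 next
  case False
  define EK where "EK = (\<lambda>K. {e : E. cob K (\<epsilon> e)})"
  have four: "4 <= card (EK K)" if K: "K : same_class H ` W" for K
  proof -
   have KC: "K : CC H" using K same_class_CC by auto
   hence KW: "K <= W" by (auto simp: CC_def)
   have cH: "d : H" if "d : ?L" "cob K d" for d using KC that by (auto simp: CC_def)
   \<comment> \<open>Otherwise the boundary of \<open>K\<close> would lie in the trees. There every
     edge is a bridge, so the boundary would be empty, \<open>K\<close> would contain all faces, and
     there would be only one region.\<close>
   have ne: "EK K ~= {}"
   proof
    assume n: "EK K = {}"
    have "\<not> cob K d" if d: "d : ?L" for d
    proof
     assume b: "cob K d"
     have noE: "e : E ==> \<not> cob K (\<epsilon> e) & \<not> cob K (rv (\<epsilon> e))" for e using n cob_swap[of K "\<epsilon> e"] unfolding EK_def by blast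
     have inT: "\<exists>v\<in>V. d' : T v" if "d' : ?L" "cob K d'" for d' using cH[OF that] noE that(2) by (auto simp: H_def)
     obtain v where v: "v : V" "d : T v" using inT[OF d b] by auto
     obtain U where U: "s d : U" "s (rv d) ~: U" "\<And>t'. t' : T v ==> t' ~= d ==> t' ~= rv d ==> (s t' : U \<longleftrightarrow> s (rv t') : U)"
      using tree_cut[OF T[OF v(1)] v(2)] by blast
     have "\<not> cob K d"
     proof (rule not_cob[OF KW d])
      show "s d : U \<inter> B v" "s (rv d) ~: U \<inter> B v" using U sT v by auto
      fix d' assume d': "d' : ?L" "cob K d'" "d' ~= d" "d' ~= rv d"
      obtain v' where v': "v' : V" "d' : T v'" using inT[OF d'(1,2)] by auto
      show "s d' : U \<inter> B v \<longleftrightarrow> s (rv d') : U \<inter> B v"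
      proof (cases "v' = v")
       case True
       thus ?thesis using U(3)[of d'] d' v' sT by auto
      next
       case False
       thus ?thesis using vx v v' sT by blast
      qed
     qed
     thus False using b by simp
    qed
    moreover obtain w where w: "w : W" "K = same_class H w" using K by auto
    hence wK: "w : K" by (auto simp: same_class_def)
    ultimately have "K = W" using cob_none[OF KW] by blast
    have "same_class H w' = K" if "w' : W" for w'
    proof -
     have "w' : same_class H w" using that w \<open>K = W\<close> by simp
     thus ?thesis unfolding w(2) by (auto simp: same_class_def)
    qed
    hence "same_class H ` W <= {K}" by auto
    hence "F <= card {K}" unfolding F_def by (intro card_mono) auto
    thus False using False by simp
   qed
   \<comment> \<open>Parity for the cut around a branch set: after contraction the boundary of
     \<open>K\<close> has even degree at \<open>u\<close>.\<close>
   have ev: "even (card {d : ?L. s d : B u & s (rv d) ~: B u & cob K d})" for u by (rule parity[OF KW])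
   have fEK: "finite (EK K)" using fE by (auto simp: EK_def)
   show ?thesis
   proof (rule even_bipartite_card[OF fEK ne])
    fix u
    have outT: "v : V ==> d : T v ==> u : V ==> s d : B u ==> s (rv d) : B u" for d v using vx sT by blast
    have out: "d : \<epsilon> ` E \<or> d : rv ` \<epsilon> ` E" if "d : ?L" "u : V" "s d : B u" "s (rv d) ~: B u" "cob K d" for d
    proof -
     have "\<And>v. v : V ==> d ~: T v" using outT that(2,3,4) by blast
     thus ?thesis using cH[OF that(1,5)] unfolding H_def by blast
    qed
    show "even (card {e : EK K. fst e = u})"
    proof (cases "u : V & p u")
     case True
     have "{d : ?L. s d : B u & s (rv d) ~: B u & cob K d} = \<epsilon> ` {e : EK K. fst e = u}"
     proof (intro set_eqI iffI)
      fix d assume d: "d : {d : ?L. s d : B u & s (rv d) ~: B u & cob K d}"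
      then consider e where "e : E" "d = \<epsilon> e" | e where "e : E" "d = rv (\<epsilon> e)" using out True by blast
      thus "d : \<epsilon> ` {e : EK K. fst e = u}"
      proof cases
       case 1
       hence "fst e = u" using d vx s\<epsilon> True by blast
       thus ?thesis using 1 d by (auto simp: EK_def)
      next
       case 2
       hence "snd e = u" using d vx s\<epsilon> True by blast
       thus ?thesis using 2 s\<epsilon> True by blast
      qed
     next
      fix d assume "d : \<epsilon> ` {e : EK K. fst e = u}"
      then obtain e where e: "e : E" "cob K (\<epsilon> e)" "fst e = u" "d = \<epsilon> e" by (auto simp: EK_def)
      have "s (rv d) ~: B u"
      proof
       assume "s (rv d) : B u"
       hence "snd e = u" using e vx s\<epsilon> True by blast
       thus False using s\<epsilon>(7)[OF e(1)] True by simp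
      qed
      thus "d : {d : ?L. s d : B u & s (rv d) ~: B u & cob K d}" using e s\<epsilon>[OF e(1)] by auto
     qed
     moreover have "inj_on \<epsilon> {e : EK K. fst e = u}" by (rule inj_on_subset[OF inj\<epsilon>]) (auto simp: EK_def)
     ultimately show ?thesis using ev[of u] by (simp add: card_image)
    next
     case False
     hence em: "{e : EK K. fst e = u} = {}" using s\<epsilon> unfolding EK_def by blast
     show ?thesis unfolding em by simp
    qed
    show "even (card {e : EK K. snd e = u})"
    proof (cases "u : V & \<not> p u")
     case True
     have eq: "{d : ?L. s d : B u & s (rv d) ~: B u & cob K d} = (rv \<circ> \<epsilon>) ` {e : EK K. snd e = u}"
     proof (intro set_eqI iffI)
      fix d assume d: "d : {d : ?L. s d : B u & s (rv d) ~: B u & cob K d}"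
      then consider e where "e : E" "d = \<epsilon> e" | e where "e : E" "d = rv (\<epsilon> e)" using out True by blast
      thus "d : (rv \<circ> \<epsilon>) ` {e : EK K. snd e = u}"
      proof cases
       case 1
       hence "fst e = u" using d vx s\<epsilon> True by blast
       thus ?thesis using 1 s\<epsilon> True by blast
      next
       case 2
       hence "snd e = u" using d vx s\<epsilon> True by blast
       thus ?thesis using 2 d by (auto simp: EK_def cob_swap)
      qed
     next
      fix d assume "d : (rv \<circ> \<epsilon>) ` {e : EK K. snd e = u}"
      then obtain e where e: "e : E" "cob K (\<epsilon> e)" "snd e = u" "d = rv (\<epsilon> e)" by (auto simp: EK_def)
      have "s (rv d) ~: B u"
      proof
       assume "s (rv d) : B u"
       hence "s (\<epsilon> e) : B u" using e(4) by simp
       hence "fst e = u" using vx s\<epsilon>[OF e(1)] True by blast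
       thus False using s\<epsilon>(6)[OF e(1)] True by simp
      qed
      thus "d : {d : ?L. s d : B u & s (rv d) ~: B u & cob K d}" using e s\<epsilon>[OF e(1)] swap by (auto simp: cob_swap)
     qed
     have ij: "inj_on (rv \<circ> \<epsilon>) {e : EK K. snd e = u}"
      by (intro comp_inj_on inj_on_subset[OF inj\<epsilon>]) (auto simp: EK_def)
     show ?thesis using ev[of u] unfolding eq card_image[OF ij] .
    next
     case False
     hence em: "{e : EK K. snd e = u} = {}" using s\<epsilon> unfolding EK_def by blast
     show ?thesis unfolding em by simp
    qed
   qed
  qed
  let ?cl = "same_class H ` W"
  have fcl: "finite ?cl" using finite_words by auto
  have "4 * F = (\<Sum>K\<in>?cl. 4)" by (simp add: F_def)
  also have "\<dots> <= (\<Sum>K\<in>?cl. card (EK K))" using four by (intro sum_mono) auto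
  also have "\<dots> = (\<Sum>K\<in>?cl. \<Sum>e\<in>E. of_bool (cob K (\<epsilon> e)))"
   using fE by (intro sum.cong) (auto simp: EK_def sum.If_cases of_bool_def Int_def)
  also have "\<dots> = (\<Sum>e\<in>E. \<Sum>K\<in>?cl. of_bool (cob K (\<epsilon> e)))" by (rule sum.swap)
  also have "\<dots> = (\<Sum>e\<in>E. card {K : ?cl. cob K (\<epsilon> e)})"
   using fcl by (intro sum.cong) (auto simp: sum.If_cases of_bool_def Int_def)
  also have "\<dots> <= (\<Sum>e\<in>E. 2)"
  proof (rule sum_mono)
   fix e assume e: "e : E"
   let ?d = "\<epsilon> e"
   \<comment> \<open>Only the regions of the two faces along the edge can have it on their
     boundary.\<close>
   have "{K : ?cl. cob K ?d} <= {same_class H (fc ?d), same_class H (fc (rv ?d))}"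
   proof
    fix K assume "K : {K : ?cl. cob K ?d}"
    then obtain w where w: "K = same_class H w" "fc ?d : K \<or> fc (rv ?d) : K" by (auto simp: cob_def)
    have "same_class H w' = same_class H w" if "w' : same_class H w" for w' using that by (auto simp: same_class_def)
    thus "K : {same_class H (fc ?d), same_class H (fc (rv ?d))}" using w by auto
   qed
   hence "card {K : ?cl. cob K ?d} <= card {same_class H (fc ?d), same_class H (fc (rv ?d))}" by (intro card_mono) auto
   also have "\<dots> <= 2" by (simp add: card_insert_if)
   finally show "card {K : ?cl. cob K ?d} <= 2" .
  qed
  finally have "2 * F <= card E" by simp
  thus ?thesis using key by linarith
 qed
qed

end

section \<open>Embedded graphs as minors of lattice surfaces\<close>

lemma cellular_hW:
 assumes N: "1 <= N"
 shows "cellular fst (hW g N)"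
proof -
 interpret p: plate "hcell g N" "int N" by (rule plate_hcell[OF N])
 have l: "length w = 4" "distinct w" "cwalk fst w" if "w : p.W" for w using p.W_props[OF that] by auto
 show ?thesis unfolding hW_def
 proof
  show "[] ~: p.W" using l(1)[of "[]"] by auto
 qed (use l p.finite_W p.nonempty_W p.word_unique p.swap_letters p.wconn in blast)+
qed

definition cube :: "int => int => int => int => int => int => ((int \<times> int) \<times> int) set" where
 "cube a1 c1 a2 c2 a3 c3 = ({a1, c1} \<times> {a2, c2}) \<times> {a3, c3}"

lemma hW_box:
 assumes N: "1 <= N" and w: "w : hW g N"
 obtains a1 c1 a2 c2 a3 c3 :: int where "fst ` set w = cube a1 c1 a2 c2 a3 c3"
  "\<bar>a1 - c1\<bar> <= 1" "\<bar>a2 - c2\<bar> <= 1" "\<bar>a3 - c3\<bar> <= 1"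
  "\<forall>X Y Z. ((X, Y), Z) : cellbox N w \<longleftrightarrow> btw a1 c1 (real N * X) & btw a2 c2 (real N * Y) & btw a3 c3 (real N * Z)"
proof -
 interpret p: plate "hcell g N" "int N" by (rule plate_hcell[OF N])
 have "w : p.W" using w by (simp add: hW_def)
 thus ?thesis
 proof (cases rule: p.W_cases)
  case (top i j)
  show ?thesis by (rule that[of i "i+1" j "j+1" "int N" "int N"]) (auto simp: top p.top_def cellbox_quad, auto simp: cube_def quad_def)
 next
  case (bot i j)
  show ?thesis by (rule that[of i "i+1" j "j+1" 0 0]) (auto simp: bot p.bot_def cellbox_quad, auto simp: cube_def quad_def)
 next
  case (wall a b k)
  obtain x y x' y' where ab: "a = (x, y)" "b = (x', y')" by (cases a; cases b)
  have "(\<bar>x' - x\<bar> = 1 & y = y') \<or> (\<bar>y' - y\<bar> = 1 & x = x')" using wall(2) unfolding ab p.bd_simps by auto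
  thus ?thesis
   by (intro that[of x' x y' y "k+1" k]) (auto simp: wall p.wall_def ab cellbox_quad, auto simp: cube_def quad_def)
 qed
qed

text \<open>The intervals have integer ends and length at most one, so the floor or the ceiling of
  the common point \<open>r\<close> is an end of both.\<close>

lemma btw_common:
 assumes "btw a c r" "btw a' c' r" "\<bar>a - c\<bar> <= 1" "\<bar>a' - c'\<bar> <= 1"
 shows "\<exists>x. x : {a, c} & x : {a', c'}"
proof -
 have "min a c <= \<lfloor>r\<rfloor>" "\<lceil>r\<rceil> <= max a c" "min a' c' <= \<lfloor>r\<rfloor>" "\<lceil>r\<rceil> <= max a' c'"
  using assms(1,2) unfolding btw_def le_floor_iff ceiling_le_iff by auto
 moreover have "\<lfloor>r\<rfloor> <= \<lceil>r\<rceil>" by (rule floor_le_ceiling)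
 ultimately have "\<lfloor>r\<rfloor> : {a, c} & \<lfloor>r\<rfloor> : {a', c'} \<or> \<lceil>r\<rceil> : {a, c} & \<lceil>r\<rceil> : {a', c'}"
  using assms(3,4) by (simp add: min_def max_def split: if_splits) linarith+
 thus ?thesis by blast
qed

text \<open>\<open>btw_common\<close> in each coordinate: closed lattice squares that touch share a
  lattice vertex. Hence topological contact is visible in the vertex sets.\<close>

lemma cellbox_common:
 assumes N: "1 <= N" and w: "w : hW g N" "w' : hW g N" and v: "v : cellbox N w" "v : cellbox N w'"
 shows "fst ` set w \<inter> fst ` set w' ~= {}"
proof -
 obtain X Y Z where V: "v = ((X, Y), Z)" by (metis prod.collapse)
 obtain a1 c1 a2 c2 a3 c3 where a: "fst ` set w = cube a1 c1 a2 c2 a3 c3" "\<bar>a1 - c1\<bar> <= 1" "\<bar>a2 - c2\<bar> <= 1" "\<bar>a3 - c3\<bar> <= 1"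
  "\<forall>X Y Z. ((X, Y), Z) : cellbox N w \<longleftrightarrow> btw a1 c1 (real N * X) & btw a2 c2 (real N * Y) & btw a3 c3 (real N * Z)"
  using hW_box[OF N w(1)] .
 obtain a1' c1' a2' c2' a3' c3' where b: "fst ` set w' = cube a1' c1' a2' c2' a3' c3'" "\<bar>a1' - c1'\<bar> <= 1" "\<bar>a2' - c2'\<bar> <= 1" "\<bar>a3' - c3'\<bar> <= 1"
  "\<forall>X Y Z. ((X, Y), Z) : cellbox N w' \<longleftrightarrow> btw a1' c1' (real N * X) & btw a2' c2' (real N * Y) & btw a3' c3' (real N * Z)"
  using hW_box[OF N w(2)] .
 have i: "btw a1 c1 (real N * X)" "btw a2 c2 (real N * Y)" "btw a3 c3 (real N * Z)" using v(1) unfolding V a(5)[rule_format] by auto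
 have j: "btw a1' c1' (real N * X)" "btw a2' c2' (real N * Y)" "btw a3' c3' (real N * Z)" using v(2) unfolding V b(5)[rule_format] by auto
 obtain x where x: "x : {a1, c1}" "x : {a1', c1'}" using btw_common[OF i(1) j(1) a(2) b(2)] by blast
 obtain y where y: "y : {a2, c2}" "y : {a2', c2'}" using btw_common[OF i(2) j(2) a(3) b(3)] by blast
 obtain z where z: "z : {a3, c3}" "z : {a3', c3'}" using btw_common[OF i(3) j(3) a(4) b(4)] by blast
 have "((x, y), z) : fst ` set w \<inter> fst ` set w'" unfolding a(1) b(1) cube_def using x y z by blast
 thus ?thesis by blast
qed

lemma btw_near:
 assumes N: "1 <= N" and "btw a c (real N * X)" "\<bar>a - c\<bar> <= 1" "x : {a, c}"
 shows "\<bar>real_of_int x / N - X\<bar> <= 1 / N"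
proof -
 have c: "\<bar>real_of_int a - real_of_int c\<bar> <= 1" using assms(3) by linarith
 have "\<bar>real_of_int x - N * X\<bar> <= 1" using assms(2,4) c by (auto simp: btw_def min_def max_def split: if_splits)
 moreover have "real_of_int x / N - X = (real_of_int x - N * X) / N" using N by (simp add: field_simps)
 ultimately show ?thesis using N by (simp add: abs_divide divide_right_mono)
qed

lemma cellbox_near:
 assumes N: "1 <= N" and w: "w : hW g N" and v: "v : cellbox N w" and u: "u : fst ` set w"
 shows "dist (rpt N u) v <= 3 / N"
proof -
 obtain X Y Z where V: "v = ((X, Y), Z)" by (metis prod.collapse)
 obtain x y z where U: "u = ((x, y), z)" by (metis prod.collapse)
 obtain a1 c1 a2 c2 a3 c3 where a: "fst ` set w = cube a1 c1 a2 c2 a3 c3" "\<bar>a1 - c1\<bar> <= 1" "\<bar>a2 - c2\<bar> <= 1" "\<bar>a3 - c3\<bar> <= 1"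
  "\<forall>X Y Z. ((X, Y), Z) : cellbox N w \<longleftrightarrow> btw a1 c1 (real N * X) & btw a2 c2 (real N * Y) & btw a3 c3 (real N * Z)"
  using hW_box[OF N w] .
 have i: "btw a1 c1 (real N * X)" "btw a2 c2 (real N * Y)" "btw a3 c3 (real N * Z)" using v unfolding V a(5)[rule_format] by auto
 have x: "x : {a1, c1}" "y : {a2, c2}" "z : {a3, c3}" using u unfolding a(1) U cube_def by auto
 have "dist (rpt N u) v = norm ((x / N - X, y / N - Y), z / N - Z)" by (simp add: U V rpt_def dist_norm)
 also have "\<dots> <= norm (x / N - X, y / N - Y) + norm (z / N - Z)" by (rule norm_Pair_le)
 also have "\<dots> <= norm (x / N - X) + norm (y / N - Y) + norm (z / N - Z)" using norm_Pair_le[of "x / N - X" "y / N - Y"] by simp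
 also have "\<dots> <= 1 / N + 1 / N + 1 / N"
  using btw_near[OF N i(1) a(2) x(1)] btw_near[OF N i(2) a(3) x(2)] btw_near[OF N i(3) a(4) x(3)] by (intro add_mono) auto
 finally show ?thesis by simp
qed

lemma closed_cellbox: "closed (cellbox N w)"
proof -
 have "cellbox N w = {v. real_of_int (min (fst (fst (fst (w ! 0)))) (fst (fst (fst (w ! 2))))) <= N * fst (fst v)} \<inter>
   {v. N * fst (fst v) <= real_of_int (max (fst (fst (fst (w ! 0)))) (fst (fst (fst (w ! 2)))))} \<inter>
   {v. real_of_int (min (snd (fst (fst (w ! 0)))) (snd (fst (fst (w ! 2))))) <= N * snd (fst v)} \<inter>
   {v. N * snd (fst v) <= real_of_int (max (snd (fst (fst (w ! 0)))) (snd (fst (fst (w ! 2)))))} \<inter>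
   {v. real_of_int (min (snd (fst (w ! 0))) (snd (fst (w ! 2)))) <= N * snd v} \<inter>
   {v. N * snd v <= real_of_int (max (snd (fst (w ! 0))) (snd (fst (w ! 2))))}"
  by (auto simp: cellbox_def btw_def)
 also have "closed \<dots>" by (intro closed_Int closed_Collect_le continuous_intros)
 finally show ?thesis .
qed

text \<open>The lattice neighbourhood of a point set. It inherits connectedness from
  \<open>A\<close>, meets the neighbourhood of every set that meets \<open>A\<close> on the surface,
  and on a fine lattice keeps disjoint compact sets apart.\<close>

definition blob :: "nat => nat => ((real \<times> real) \<times> real) set => ((int \<times> int) \<times> int) set" where
 "blob g N A = {v. \<exists>w\<in>hW g N. v : fst ` set w & cellbox N w \<inter> A ~= {}}"

lemma blob_meet:
 assumes N: "1 <= N" and A: "x : A" "x : A'" "x : handle_surface g"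
 shows "blob g N A \<inter> blob g N A' ~= {}"
proof -
 obtain w where w: "w : hW g N" "x : cellbox N w" using handle_cover[OF N A(3)] by blast
 obtain v where "v : fst ` set w" using cellbox_common[OF N w(1) w(1) w(2) w(2)] by blast
 hence "v : blob g N A" "v : blob g N A'" unfolding blob_def using w A by blast+
 thus ?thesis by blast
qed

lemma blob_letters: "blob g N A <= fst ` letters (hW g N)"
 by (force simp: blob_def letters_def)

lemma blob_disjoint:
 assumes c: "compact A" "compact A'" and d: "A \<inter> A' = {}"
 shows "\<forall>\<^sub>F N in sequentially. blob g N A \<inter> blob g N A' = {}"
proof -
 obtain \<delta> where \<delta>: "\<delta> > 0" "\<And>x y. x : A ==> y : A' ==> \<delta> <= dist x y"
  using separate_compact_closed[OF c(1) compact_imp_closed[OF c(2)] d] by blast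
 \<comment> \<open>The constant is \<open>3 + 3\<close>: a common vertex is within
   \<open>3 / N\<close> of a point of either set.\<close>
 obtain N0 :: nat where N0: "6 / \<delta> < N0" using reals_Archimedean2 by blast
 have "blob g N A \<inter> blob g N A' = {}" if N: "max 1 N0 <= N" for N
 proof (rule ccontr)
  have N1: "1 <= N" using N by simp
  assume "blob g N A \<inter> blob g N A' ~= {}"
  then obtain v w w' x x' where v: "w : hW g N" "v : fst ` set w" "x : cellbox N w" "x : A"
    "w' : hW g N" "v : fst ` set w'" "x' : cellbox N w'" "x' : A'" unfolding blob_def by blast
  have "dist x x' <= dist (rpt N v) x + dist (rpt N v) x'" by (rule dist_triangle3)
  also have "\<dots> <= 3 / N + 3 / N" using cellbox_near[OF N1 v(1,3,2)] cellbox_near[OF N1 v(5,7,6)] by simp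
  finally have "\<delta> <= 6 / N" using \<delta>(2)[OF v(4,8)] by simp
  hence "\<delta> * N <= 6" using N1 by (simp add: field_simps)
  moreover have "6 < \<delta> * N0" using N0 \<delta>(1) by (simp add: field_simps)
  moreover have "\<delta> * N0 <= \<delta> * N" using N \<delta>(1) by simp
  ultimately show False by linarith
 qed
 thus ?thesis unfolding eventually_sequentially by blast
qed

lemma walk_swap: "walk f a w b ==> d : set w ==> f (rv d) : insert b (f ` set w)"
proof (induction w arbitrary: a)
 case (Cons c w)
 have w: "walk f (f (rv c)) w b" using Cons.prems(1) by simp
 show ?case
 proof (cases "d : set w")
  case True
  thus ?thesis using Cons.IH[OF w] by auto
 next
  case False
  hence d: "d = c" using Cons.prems(2) by simp
  show ?thesis
  proof (cases "w = []")
   case True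
   thus ?thesis using w d by simp
  next
   case False
   hence "f (hd w) = f (rv d)" "hd w : set w" using walk_hd[OF w] d by simp_all
   hence "f (rv d) : f ` set w" by (metis imageI)
   thus ?thesis by auto
  qed
 qed
qed simp

lemma cwalk_swap:
 assumes "cwalk f w" "d : set w"
 shows "f (rv d) : f ` set w"
proof -
 obtain a where a: "walk f a w a" using assms(1) unfolding cwalk_def by blast
 have "w ~= []" using assms(2) by auto
 hence "hd w : set w" "f (hd w) = a" using walk_hd[OF a] by simp_all
 hence "a : f ` set w" by blast
 thus ?thesis using walk_swap[OF a assms(2)] by blast
qed

text \<open>Suppose \<open>X\<close> swallows some but not all of the squares that meet
  \<open>A\<close>. The two kinds of squares form two closed sets that cover \<open>A\<close>, and
  on \<open>A\<close> they are disjoint because touching squares share a vertex; this contradicts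
  the connectedness of \<open>A\<close>.\<close>

lemma blob_conn:
 assumes N: "1 <= N" and A: "connected A" "A ~= {}" "A <= handle_surface g"
 shows "cellular.conn fst (hW g N) (blob g N A)"
proof -
 interpret cellular fst "hW g N" by (rule cellular_hW[OF N])
 let ?B = "blob g N A"
 obtain x where "x : A" using A(2) by blast
 hence ne: "?B ~= {}" using blob_meet[OF N, of x A A] A(3) by blast
 have "?B <= X" if X: "X \<inter> ?B ~= {}"
  "\<forall>d\<in>letters (hW g N). fst d : X \<inter> ?B --> fst (rv d) : ?B --> fst (rv d) : X" for X
 proof -
  let ?M = "{w : hW g N. cellbox N w \<inter> A ~= {}}"
  have inB: "fst d : ?B" if "w : ?M" "d : set w" for w d using that unfolding blob_def by blast
  have all: "fst ` set w <= X" if w: "w : ?M" "fst ` set w \<inter> X ~= {}" for w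
  proof -
   have wW: "w : hW g N" using w by blast
   have sB: "fst (rv d) : ?B" if "d : set w" for d
    using cwalk_swap[OF word(2)[OF wW] that] inB[OF w(1)] by auto
   have inv: "fst d : X \<longleftrightarrow> fst (rv d) : X" if d: "d : set w" for d
   proof -
    have L: "d : letters (hW g N)" using lettersI[OF wW d] .
    have L': "rv d : letters (hW g N)" using swap[OF L] by blast
    show ?thesis using X(2)[rule_format, OF L] X(2)[rule_format, OF L'] inB[OF w(1) d] sB[OF d] by auto
   qed
   obtain a where a: "walk fst a w a" using word(2)[OF wW] unfolding cwalk_def by blast
   have "fst d : X \<longleftrightarrow> a : X" if "d : set w" for d by (rule walk_invariant[OF a inv that])
   thus ?thesis using w(2) by blast
  qed
  let ?M1 = "{w : ?M. fst ` set w <= X}"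
  let ?M2 = "{w : ?M. \<not> fst ` set w <= X}"
  have fM: "finite ?M1" "finite ?M2" using finite_words by auto
  have cl: "closed (\<Union>w\<in>?M1. cellbox N w)" "closed (\<Union>w\<in>?M2. cellbox N w)"
   using fM closed_cellbox by (auto intro!: closed_UN)
  have cov: "A <= (\<Union>w\<in>?M1. cellbox N w) \<union> (\<Union>w\<in>?M2. cellbox N w)"
  proof
   fix y assume y: "y : A"
   then obtain w where "w : hW g N" "y : cellbox N w" using handle_cover[OF N, of y g] A(3) by blast
   thus "y : (\<Union>w\<in>?M1. cellbox N w) \<union> (\<Union>w\<in>?M2. cellbox N w)" using y by blast
  qed
  have dj: "(\<Union>w\<in>?M1. cellbox N w) \<inter> (\<Union>w\<in>?M2. cellbox N w) \<inter> A = {}"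
  proof (rule ccontr)
   assume "\<not> ?thesis"
   then obtain y w w' where y: "w : ?M1" "w' : ?M2" "y : cellbox N w" "y : cellbox N w'" by blast
   have "fst ` set w \<inter> fst ` set w' ~= {}" using cellbox_common[OF N _ _ y(3,4)] y(1,2) by blast
   hence "fst ` set w' \<inter> X ~= {}" using y(1) by blast
   hence "fst ` set w' <= X" using all[of w'] y(2) by blast
   thus False using y(2) by blast
  qed
  obtain v where "v : X" "v : ?B" using X(1) by blast
  then obtain w where w: "w : ?M" "v : fst ` set w" "v : X" unfolding blob_def by blast
  hence "w : ?M1" using all[OF w(1)] by blast
  hence "(\<Union>w\<in>?M1. cellbox N w) \<inter> A ~= {}" by blast
  hence "(\<Union>w\<in>?M2. cellbox N w) \<inter> A = {}"
   using connected_closedD[OF A(1) dj cov cl] by blast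
  hence "?M2 = {}" by blast
  thus ?thesis unfolding blob_def by blast
 qed
 thus ?thesis using ne unfolding conn_def by blast
qed

section \<open>Growing a branch set along a connected vertex set\<close>

context cellular
begin

lemma conn_Union:
 assumes c: "\<And>A. A : \<C> ==> conn A" and x: "x : \<Inter>\<C>" and ne: "\<C> ~= {}"
 shows "conn (\<Union>\<C>)"
 unfolding conn_def
proof (intro conjI allI impI)
 show "\<Union>\<C> ~= {}" using x ne by blast
 fix X assume X: "X \<inter> \<Union>\<C> ~= {}"
  "\<forall>d\<in>letters W. s d : X \<inter> \<Union>\<C> --> s (rv d) : \<Union>\<C> --> s (rv d) : X"
 have sub: "A <= X" if A: "A : \<C>" "X \<inter> A ~= {}" for A
 proof -
  have "\<forall>d\<in>letters W. s d : X \<inter> A --> s (rv d) : A --> s (rv d) : X" using X(2) A(1) by blast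
  thus ?thesis using c[OF A(1)] A(2) unfolding conn_def by blast
 qed
 obtain A where "A : \<C>" "X \<inter> A ~= {}" using X(1) by blast
 hence "x : X" using sub x by blast
 thus "\<Union>\<C> <= X" using sub x by blast
qed

definition step :: "'v set => ('v \<times> 'v) set" where
 "step Q = {(x, y). x : Q & y : Q & (\<exists>d\<in>letters W. s d = x & s (rv d) = y)}"

text \<open>The union of the components of \<open>Q\<close> that meet \<open>B\<close>.\<close>

definition reach :: "'v set => 'v set => 'v set" where
 "reach Q B = {y. \<exists>x\<in>Q \<inter> B. (x, y) : (step Q)\<^sup>*}"

lemma step_sym: "(x, y) : step Q ==> (y, x) : step Q"
proof -
 assume "(x, y) : step Q"
 then obtain d where d: "x : Q" "y : Q" "d : letters W" "s d = x" "s (rv d) = y" unfolding step_def by blast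
 have "rv d : letters W" "s (rv (rv d)) = x" using swap[OF d(3)] d(4) by auto
 thus "(y, x) : step Q" unfolding step_def using d by blast
qed

lemma reach_subset: "reach Q B <= Q"
proof -
 have "y : Q" if "(x, y) : (step Q)\<^sup>*" "x : Q" for x y using that by (induction) (auto simp: step_def)
 thus ?thesis unfolding reach_def by blast
qed

lemma reach_step: "x : reach Q B ==> (x, y) : step Q ==> y : reach Q B"
 unfolding reach_def by (auto intro: rtrancl_into_rtrancl)

lemma conn_reach:
 assumes B: "conn B"
 shows "conn (B \<union> reach Q B)"
 unfolding conn_def
proof (intro conjI allI impI)
 show "B \<union> reach Q B ~= {}" using B unfolding conn_def by blast
 let ?B = "B \<union> reach Q B"
 fix X assume X: "X \<inter> ?B ~= {}"
  "\<forall>d\<in>letters W. s d : X \<inter> ?B --> s (rv d) : ?B --> s (rv d) : X"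
 have stp: "y : X" if xy: "(x, y) : step Q" "x : X" "x : reach Q B" for x y
 proof -
  have "y : reach Q B" by (rule reach_step[OF xy(3,1)])
  moreover obtain d where d: "d : letters W" "s d = x" "s (rv d) = y" using xy(1) unfolding step_def by auto
  ultimately show ?thesis using X(2)[rule_format, OF d(1)] d(2,3) xy(2,3) by blast
 qed
 have fwd: "y : X" if "(x, y) : (step Q)\<^sup>*" "x : X" "x : reach Q B" for x y
 proof -
  have "y : X & y : reach Q B" using that by (induction) (use stp reach_step in blast)+
  thus ?thesis by blast
 qed
 have rr: "x : reach Q B" if "x : Q \<inter> B" for x using that unfolding reach_def by blast
 have "X \<inter> B ~= {}"
 proof (cases "X \<inter> B = {}")
  case True
  then obtain y where y: "y : X" "y : reach Q B" using X(1) by blast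
  then obtain x where x: "x : Q \<inter> B" "(x, y) : (step Q)\<^sup>*" unfolding reach_def by blast
  have "sym (step Q)" using step_sym by (auto intro: symI)
  hence "(y, x) : (step Q)\<^sup>*" using x(2) by (meson sym_rtrancl symD)
  hence "x : X" using fwd y by blast
  thus ?thesis using x by blast
 qed
 moreover have "\<forall>d\<in>letters W. s d : X \<inter> B --> s (rv d) : B --> s (rv d) : X" using X(2) by blast
 ultimately have BX: "B <= X" using B unfolding conn_def by blast
 have "reach Q B <= X"
 proof
  fix y assume "y : reach Q B"
  then obtain x where x: "x : Q \<inter> B" "(x, y) : (step Q)\<^sup>*" unfolding reach_def by blast
  thus "y : X" using fwd rr BX by blast
 qed
 thus "?B <= X" using BX by blast
qed

text \<open>A walk in \<open>Q\<close> from \<open>B\<close> towards \<open>B'\<close> has a last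
  vertex before it first hits \<open>B'\<close>. Formally, if no dart led from the reached set into
  \<open>B'\<close>, that set would be closed in the connected \<open>Q\<close> and so contain a
  vertex of \<open>B'\<close>.\<close>

lemma reach_dart:
 assumes Q: "conn Q" and m: "Q \<inter> B ~= {}" "Q \<inter> B' ~= {}" and d: "B \<inter> B' = {}"
 shows "\<exists>d\<in>letters W. s d : reach (Q - B') B & s (rv d) : B'"
proof (rule ccontr)
 assume n: "\<not> ?thesis"
 let ?C = "reach (Q - B') B"
 have sub: "?C <= Q - B'" by (rule reach_subset)
 obtain x where x: "x : Q" "x : B" using m by blast
 hence "x : (Q - B') \<inter> B" using d by blast
 hence "x : ?C" unfolding reach_def by blast
 hence "?C \<inter> Q ~= {}" using x by blast
 moreover have "\<forall>d\<in>letters W. s d : ?C \<inter> Q --> s (rv d) : Q --> s (rv d) : ?C"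
 proof (intro ballI impI)
  fix d assume d: "d : letters W" "s d : ?C \<inter> Q" "s (rv d) : Q"
  hence "s (rv d) ~: B'" using n by blast
  hence "(s d, s (rv d)) : step (Q - B')" using d sub unfolding step_def by blast
  thus "s (rv d) : ?C" using reach_step d(2) by blast
 qed
 ultimately have "Q <= ?C" using Q unfolding conn_def by blast
 thus False using sub m(2) by blast
qed

end

text \<open>Every arc is cut into thirds. The outer thirds are joined to stars \<open>T x\<close>
  around the vertices, the middle thirds are the sets \<open>A e\<close>; two of these compact sets
  meet only if they belong to a vertex and an edge at it. Their lattice neighbourhoods behave alike
  on a fine lattice, and branch sets arise by adding to a star the initial parts of its outgoing
  middle thirds.\<close>

theorem embedding_bound:
 fixes G :: "'n graph" and E :: "('n \<times> 'n) set"
 assumes V: "finite (verts G)" "3 <= card (verts G)"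
  and E: "E <= {u : verts G. p u} \<times> {v : verts G. \<not> p v}" and EG: "edges G = (\<lambda>(u, v). {u, v}) ` E"
  and emb: "embeds_in G (handle_surface g)"
 shows "card E + 4 <= 2 * card (verts G) + 4 * g"
proof -
 let ?V = "verts G"
 let ?S = "handle_surface g"
 obtain f gm where f: "inj_on f ?V" "f ` ?V <= ?S"
  and gm: "\<forall>e\<in>edges G. arc (gm e) & path_image (gm e) <= ?S & {pathstart (gm e), pathfinish (gm e)} = f ` e & path_image (gm e) \<inter> f ` ?V = f ` e"
  and cross: "\<forall>e\<in>edges G. \<forall>e'\<in>edges G. e ~= e' --> path_image (gm e) \<inter> path_image (gm e') <= f ` (e \<inter> e')"
  using emb unfolding embeds_in_def by (elim exE conjE) (rule that)
 have EV: "fst e : ?V" "snd e : ?V" "p (fst e)" "\<not> p (snd e)" "{fst e, snd e} : edges G" if "e : E" for e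
 proof -
  have m: "e : {u : ?V. p u} \<times> {v : ?V. \<not> p v}" using E that by blast
  thus "fst e : ?V" "snd e : ?V" "p (fst e)" "\<not> p (snd e)" by (auto simp: mem_Times_iff)
  show "{fst e, snd e} : edges G" unfolding EG by (rule image_eqI[OF _ that]) (simp add: case_prod_beta)
 qed
 have einj: "e = e'" if "e : E" "e' : E" "{fst e, snd e} = {fst e', snd e'}" for e e'
 proof -
  have "fst e ~= snd e'" "fst e' ~= snd e" using EV(3,4)[OF that(1)] EV(3,4)[OF that(2)] by auto
  thus ?thesis using that(3) by (auto simp: doubleton_eq_iff prod_eq_iff)
 qed
 have fE: "finite E" by (rule finite_subset[OF E]) (use V in auto)
 \<comment> \<open>The arc of each edge, directed from the end in class \<open>p\<close> to the
   other.\<close>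
 define \<alpha> where "\<alpha> = (\<lambda>e. if pathstart (gm {fst e, snd e}) = f (fst e) then gm {fst e, snd e} else reversepath (gm {fst e, snd e}))"
 have arc: "arc (\<alpha> e)" and \<alpha>im: "path_image (\<alpha> e) = path_image (gm {fst e, snd e})"
  and ends: "\<alpha> e 0 = f (fst e)" "\<alpha> e 1 = f (snd e)" if e: "e : E" for e
 proof -
  have g: "arc (gm {fst e, snd e})" "{pathstart (gm {fst e, snd e}), pathfinish (gm {fst e, snd e})} = {f (fst e), f (snd e)}"
   using gm EV(5)[OF e] by auto
  show "arc (\<alpha> e)" "path_image (\<alpha> e) = path_image (gm {fst e, snd e})" using g(1) by (auto simp: \<alpha>_def arc_reversepath)
  have "f (fst e) ~= f (snd e)" using EV[OF e] f(1) by (metis inj_onD)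
  thus "\<alpha> e 0 = f (fst e)" "\<alpha> e 1 = f (snd e)"
   using g(2) by (auto simp: \<alpha>_def doubleton_eq_iff pathstart_def pathfinish_def reversepath_def)
 qed
 have cont: "continuous_on {0..1} (\<alpha> e)" and inj: "inj_on (\<alpha> e) {0..1}" if "e : E" for e
  using arc[OF that] by (auto simp: arc_def path_def)
 have inS: "\<alpha> e t : ?S" if "e : E" "0 <= t" "t <= 1" for e t
 proof -
  have "\<alpha> e t : path_image (\<alpha> e)" using that by (auto simp: path_image_def)
  thus ?thesis using \<alpha>im[OF that(1)] gm EV(5)[OF that(1)] by auto
 qed
 have NV: "\<alpha> e t ~: f ` ?V" if e: "e : E" and t: "0 < t" "t < 1" for e t
 proof
  assume a: "\<alpha> e t : f ` ?V"
  have "\<alpha> e t : path_image (gm {fst e, snd e})" unfolding \<alpha>im[OF e, symmetric] using t by (auto simp: path_image_def)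
  hence "\<alpha> e t : f ` {fst e, snd e}" using a gm EV(5)[OF e] by blast
  hence "\<alpha> e t = \<alpha> e 0 \<or> \<alpha> e t = \<alpha> e 1" using ends[OF e] by auto
  thus False using inj_onD[OF inj[OF e], of t 0] inj_onD[OF inj[OF e], of t 1] t by auto
 qed
 have NE: "e = e' & t = t'" if e: "e : E" "e' : E" and t: "0 < t" "t < 1" "0 <= t'" "t' <= 1" and eq: "\<alpha> e t = \<alpha> e' t'" for e e' t t'
 proof -
  have "\<alpha> e t : path_image (gm {fst e, snd e})" unfolding \<alpha>im[OF e(1), symmetric] using t by (auto simp: path_image_def)
  moreover have "\<alpha> e t : path_image (gm {fst e', snd e'})" unfolding \<alpha>im[OF e(2), symmetric] eq using t by (auto simp: path_image_def)
  moreover have "f ` ({fst e, snd e} \<inter> {fst e', snd e'}) <= f ` ?V" using EV[OF e(1)] by auto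
  ultimately have "{fst e, snd e} = {fst e', snd e'}"
   using cross[rule_format, OF EV(5)[OF e(1)] EV(5)[OF e(2)]] NV[OF e(1) t(1,2)] by blast
  hence "e = e'" by (rule einj[OF e])
  thus ?thesis using eq inj_onD[OF inj[OF e(1)], of t t'] t by auto
 qed
 \<comment> \<open>A family of connected compact sets through \<open>f x\<close>, so that its union
   is connected and compact.\<close>
 define TF where "TF = (\<lambda>x. insert {f x} ((\<lambda>e. \<alpha> e ` {0..1/3}) ` {e : E. fst e = x} \<union> (\<lambda>e. \<alpha> e ` {2/3..1}) ` {e : E. snd e = x}))"
 define T where "T = (\<lambda>x. \<Union>(TF x))"
 define A where "A = (\<lambda>e. \<alpha> e ` {1/3..2/3})"
 have sub: "continuous_on {a..b} (\<alpha> e)" if "e : E" "0 <= a" "b <= 1" for e a b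
  by (rule continuous_on_subset[OF cont[OF that(1)]]) (use that in auto)
 have TFp: "connected K & compact K & f x : K" if "K : TF x" for K x
  using that unfolding TF_def
 proof (elim insertE UnE imageE)
  fix e assume "K = \<alpha> e ` {0..1/3}" "e : {e : E. fst e = x}"
  thus ?thesis using ends(1)[of e] sub[of e 0 "1/3"] by (auto intro!: connected_continuous_image compact_continuous_image image_eqI[of _ _ 0])
 next
  fix e assume "K = \<alpha> e ` {2/3..1}" "e : {e : E. snd e = x}"
  thus ?thesis using ends(2)[of e] sub[of e "2/3" 1] by (auto intro!: connected_continuous_image compact_continuous_image image_eqI[of _ _ 1])
 qed auto
 have Tc: "connected (T x)" "compact (T x)" "f x : T x" for x
 proof -
  show "connected (T x)" unfolding T_def using TFp by (intro connected_Union) blast+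
  have "finite (TF x)" using fE by (auto simp: TF_def)
  thus "compact (T x)" unfolding T_def using TFp by (intro compact_Union) blast+
  show "f x : T x" by (auto simp: T_def TF_def)
 qed
 have Ac: "connected (A e)" "compact (A e)" "A e ~= {}" "A e <= ?S" if e: "e : E" for e
  using sub[OF e, of "1/3" "2/3"] inS[OF e] unfolding A_def
  by (auto intro!: connected_continuous_image compact_continuous_image)
 have TD: "z = f x \<or> (\<exists>e\<in>E. \<exists>t. z = \<alpha> e t & (fst e = x & 0 <= t & t <= 1/3 \<or> snd e = x & 2/3 <= t & t <= 1))" if "z : T x" for z x
  using that unfolding T_def TF_def by fastforce
 have TS: "T x <= ?S" if "x : ?V" for x
 proof
  fix z assume "z : T x"
  thus "z : ?S" using TD[of z x] inS f(2) that by force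
 qed
 have TI: "z = f x \<or> (\<exists>e\<in>E. \<exists>t. z = \<alpha> e t & (fst e = x & 0 < t & t <= 1/3 \<or> snd e = x & 2/3 <= t & t < 1))" if z: "z : T x" for z x
 proof (cases "z = f x")
  case False
  then obtain e t where e: "e : E" "z = \<alpha> e t" "fst e = x & 0 <= t & t <= 1/3 \<or> snd e = x & 2/3 <= t & t <= 1" using TD[OF z] by blast
  hence "\<not> (fst e = x & t = 0)" "\<not> (snd e = x & t = 1)" using ends[OF e(1)] False by auto
  hence "fst e = x & 0 < t & t <= 1/3 \<or> snd e = x & 2/3 <= t & t < 1" using e(3) by auto
  thus ?thesis using e(1,2) by blast
 qed simp
 have TT: "T x \<inter> T y = {}" if xy: "x : ?V" "y : ?V" "x ~= y" for x y
 proof (rule ccontr)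
  assume "T x \<inter> T y ~= {}"
  then obtain z where z: "z : T x" "z : T y" by blast
  have fxy: "f x ~= f y" using f(1) xy by (metis inj_onD)
  show False
  proof (cases "z : f ` ?V")
   case True
   have "z = f u" if zu: "z : T u" for u
   proof (rule ccontr)
    assume "z ~= f u"
    then obtain e t where "e : E" "z = \<alpha> e t" "0 < t" "t < 1" using TI[OF zu] by fastforce
    thus False using NV True by blast
   qed
   thus False using z fxy by blast
  next
   case False
   obtain e t where e: "e : E" "z = \<alpha> e t" "fst e = x & 0 < t & t <= 1/3 \<or> snd e = x & 2/3 <= t & t < 1" using TI[OF z(1)] False xy by blast
   obtain e' t' where e': "e' : E" "z = \<alpha> e' t'" "fst e' = y & 0 < t' & t' <= 1/3 \<or> snd e' = y & 2/3 <= t' & t' < 1" using TI[OF z(2)] False xy by blast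
   have "e = e' & t = t'" using e e' by (intro NE) auto
   thus False using e(3) e'(3) xy(3) by auto
  qed
 qed
 have AA: "A e \<inter> A e' = {}" if "e : E" "e' : E" "e ~= e'" for e e'
 proof (rule ccontr)
  assume "A e \<inter> A e' ~= {}"
  then obtain t t' where "t : {1/3..2/3}" "t' : {1/3..2/3}" "\<alpha> e t = \<alpha> e' t'" unfolding A_def by blast
  thus False using NE[OF that(1,2), of t t'] that(3) by auto
 qed
 have AT: "A e \<inter> T x = {}" if e: "e : E" and x: "x : ?V" "x ~= fst e" "x ~= snd e" for e x
 proof (rule ccontr)
  assume "A e \<inter> T x ~= {}"
  then obtain t where t: "t : {1/3..2/3}" "\<alpha> e t : T x" unfolding A_def by blast
  have "\<alpha> e t ~= f x" using NV[OF e, of t] t x(1) by auto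
  then obtain e' t' where e': "e' : E" "\<alpha> e t = \<alpha> e' t'" "fst e' = x & 0 < t' & t' <= 1/3 \<or> snd e' = x & 2/3 <= t' & t' < 1" using TI[OF t(2)] by blast
  hence "e = e'" using NE[OF e e'(1), of t t'] t by auto
  thus False using e'(3) x by auto
 qed
 \<comment> \<open>A finite family has finitely many disjoint pairs, so a single \<open>N\<close>
   separates all of them.\<close>
 define \<S> where "\<S> = T ` ?V \<union> A ` E"
 have "finite \<S>" using V fE by (auto simp: \<S>_def)
 hence "finite (\<S> \<times> \<S>)" by simp
 hence fin: "finite {(X, Y). X : \<S> & Y : \<S> & X \<inter> Y = {}}" by (rule rev_finite_subset) auto
 have cS: "compact X" if "X : \<S>" for X using that Tc Ac by (auto simp: \<S>_def)
 have "\<forall>\<^sub>F N in sequentially. \<forall>P\<in>{(X, Y). X : \<S> & Y : \<S> & X \<inter> Y = {}}. blob g N (fst P) \<inter> blob g N (snd P) = {}"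
  by (rule eventually_ball_finite[OF fin]) (auto intro!: blob_disjoint cS)
 hence "\<forall>\<^sub>F N in sequentially. 1 <= N & (\<forall>P\<in>{(X, Y). X : \<S> & Y : \<S> & X \<inter> Y = {}}. blob g N (fst P) \<inter> blob g N (snd P) = {})"
  by (rule eventually_conj[OF eventually_ge_at_top])
 then obtain N where N: "1 <= N" and bd: "\<And>X Y. X : \<S> ==> Y : \<S> ==> X \<inter> Y = {} ==> blob g N X \<inter> blob g N Y = {}"
  unfolding eventually_sequentially by force
 interpret cellular fst "hW g N" by (rule cellular_hW[OF N])
 \<comment> \<open>The part of the middle third that is attached to the star of the first end,
   without the star of the second; by \<open>reach_dart\<close> a dart leads from it into that
   second star.\<close>
 define C where "C = (\<lambda>e. reach (blob g N (A e) - blob g N (T (snd e))) (blob g N (T (fst e))))"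
 define B where "B = (\<lambda>x. \<Union>(insert (blob g N (T x)) ((\<lambda>e. blob g N (T x) \<union> C e) ` {e : E. fst e = x})))"
 have Tconn: "conn (blob g N (T x))" if "x : ?V" for x using blob_conn[OF N Tc(1)] Tc(3) TS[OF that] by blast
 have Bmem: "z : B x \<longleftrightarrow> z : blob g N (T x) \<or> (\<exists>e\<in>E. fst e = x & z : C e)" for z x
  unfolding B_def by blast
 have Csub: "C e <= blob g N (A e) - blob g N (T (snd e))" for e unfolding C_def by (rule reach_subset)
 show ?thesis
 proof (rule minor_bound[OF V E, of B])
  fix x assume x: "x : ?V"
  obtain z where z: "z : blob g N (T x)" using Tconn[OF x] unfolding conn_def by blast
  show "conn (B x)" unfolding B_def
  proof (rule conn_Union)
   fix K assume "K : insert (blob g N (T x)) ((\<lambda>e. blob g N (T x) \<union> C e) ` {e : E. fst e = x})"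
   thus "conn K" using Tconn[OF x] conn_reach[OF Tconn[OF x]] unfolding C_def by blast
   next
    show "z : \<Inter> (insert (blob g N (T x)) ((\<lambda>e. blob g N (T x) \<union> C e) ` {e : E. fst e = x}))" using z by blast
  qed simp
  show "B x <= fst ` letters (hW g N)"
  proof
   fix v assume "v : B x"
   hence "\<exists>A. v : blob g N A" using Bmem Csub by blast
   thus "v : fst ` letters (hW g N)" using blob_letters by blast
  qed
 next
  fix x y assume xy: "x : ?V" "y : ?V" "x ~= y"
  have TC: False if "v : blob g N (T y)" "e : E" "fst e = x" "v : C e" "x : ?V" "y : ?V" "x ~= y" for x y v e
  proof (cases "y = snd e")
   case True
   thus False using that Csub by blast
  next
   case False
   hence "blob g N (A e) \<inter> blob g N (T y) = {}" using that by (intro bd AT) (auto simp: \<S>_def)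
   thus False using that Csub by blast
  qed
  have TB: "blob g N (T x) \<inter> blob g N (T y) = {}" using xy by (intro bd TT) (auto simp: \<S>_def)
  have CC: False if "e : E" "e' : E" "fst e = x" "fst e' = y" "v : C e" "v : C e'" for v e e'
  proof -
   have "blob g N (A e) \<inter> blob g N (A e') = {}" using that xy by (intro bd AA) (auto simp: \<S>_def)
   thus False using that Csub by blast
  qed
  show "B x \<inter> B y = {}"
  proof (rule ccontr)
   assume "B x \<inter> B y ~= {}"
   then obtain v where "v : B x" "v : B y" by blast
   thus False unfolding Bmem using TB TC[of v y] TC[of v x] CC[of _ _ v] xy by blast
  qed
 next
  fix u v assume uv: "(u, v) : E"
  let ?e = "(u, v)"
  have uV: "u : ?V" "v : ?V" "u ~= v" using EV[OF uv] by auto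
  have m: "\<alpha> ?e (1/3) : A ?e" "\<alpha> ?e (2/3) : A ?e" by (auto simp: A_def)
  have m1: "\<alpha> ?e (1/3) : T u" unfolding T_def TF_def by (rule UnionI[of "\<alpha> ?e ` {0..1/3}"]) (use uv in force)+
  have m2: "\<alpha> ?e (2/3) : T v" unfolding T_def TF_def by (rule UnionI[of "\<alpha> ?e ` {2/3..1}"]) (use uv in force)+
  have "\<exists>d\<in>letters (hW g N). fst d : C ?e & fst (rv d) : blob g N (T v)"
   unfolding C_def fst_conv snd_conv
  proof (rule reach_dart)
   show "conn (blob g N (A ?e))" using Ac[OF uv] by (intro blob_conn[OF N])
   show "blob g N (A ?e) \<inter> blob g N (T u) ~= {}" by (rule blob_meet[OF N m(1) m1]) (use inS[OF uv] in auto)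
   show "blob g N (A ?e) \<inter> blob g N (T v) ~= {}" by (rule blob_meet[OF N m(2) m2]) (use inS[OF uv] in auto)
   show "blob g N (T u) \<inter> blob g N (T v) = {}" using uV by (intro bd TT) (auto simp: \<S>_def)
  qed
  then obtain d where d: "d : letters (hW g N)" "fst d : C ?e" "fst (rv d) : blob g N (T v)" by blast
  hence "fst d : B u" "fst (rv d) : B v" unfolding Bmem using uv by force+
  thus "\<exists>d\<in>letters (hW g N). fst d : B u & fst (rv d) : B v" using d(1) by blast
 next
  show "euler2 fst (hW g N) = 4 - 4 * int g" unfolding hW_def by (rule euler_handle[OF N])
 qed
qed

section \<open>The handle surface is realized by unit squares\<close>

text \<open>Clamping yields all four sides in one expression, and continuity follows
  directly.\<close>

definition sq_loop :: "real => complex" where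
 "sq_loop t = Complex (max 0 (min 1 (min t (3 - t)))) (max 0 (min 1 (min (t - 1) (4 - t))))"

lemma sq_loop_eq:
 "0 <= t ==> t <= 1 ==> sq_loop t = Complex t 0"
 "1 <= t ==> t <= 2 ==> sq_loop t = Complex 1 (t - 1)"
 "2 <= t ==> t <= 3 ==> sq_loop t = Complex (3 - t) 1"
 "3 <= t ==> t <= 4 ==> sq_loop t = Complex 0 (4 - t)"
 by (auto simp: sq_loop_def max_def min_def)

lemma frontier_unit_square:
 "frontier (cbox 0 (Complex 1 1)) = {z. 0 <= Re z & Re z <= 1 & 0 <= Im z & Im z <= 1 & (Re z = 0 \<or> Re z = 1 \<or> Im z = 0 \<or> Im z = 1)}"
 unfolding frontier_def by (auto simp: in_cbox_complex_iff in_box_complex_iff)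

lemma disc_model_square: "disc_model (cbox 0 (Complex 1 1)) 4 sq_loop"
 unfolding disc_model_def
proof (intro conjI)
 have "Complex (1/2) (1/2) : box 0 (Complex 1 1)" by (simp add: in_box_complex_iff)
 thus "interior (cbox 0 (Complex 1 1)) ~= {}" unfolding interior_cbox by blast
 have "continuous_on {0..4} (\<lambda>t::real. complex_of_real (max 0 (min 1 (min t (3 - t)))) + \<i> * complex_of_real (max 0 (min 1 (min (t - 1) (4 - t)))))"
  by (intro continuous_intros)
 thus "continuous_on {0..4} sq_loop" unfolding sq_loop_def Complex_eq .
 show "inj_on sq_loop {0..<4}"
 proof (rule inj_onI)
  fix s t assume st: "s : {0..<4}" "t : {0..<4}" "sq_loop s = sq_loop t"
  have "(0 <= s & s <= 1) \<or> (1 <= s & s <= 2) \<or> (2 <= s & s <= 3) \<or> (3 <= s & s <= 4)"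
   "(0 <= t & t <= 1) \<or> (1 <= t & t <= 2) \<or> (2 <= t & t <= 3) \<or> (3 <= t & t <= 4)" using st by auto
  thus "s = t" using st by (elim disjE) (auto simp: sq_loop_eq)
 qed
 show "sq_loop ` {0..4} = frontier (cbox 0 (Complex 1 1))" unfolding frontier_unit_square
 proof (intro equalityI subsetI)
  fix z assume "z : sq_loop ` {0..4}"
  then obtain t where t: "0 <= t" "t <= 4" "z = sq_loop t" by auto
  have "t <= 1 \<or> (1 <= t & t <= 2) \<or> (2 <= t & t <= 3) \<or> 3 <= t" by linarith
  thus "z : {z. 0 <= Re z & Re z <= 1 & 0 <= Im z & Im z <= 1 & (Re z = 0 \<or> Re z = 1 \<or> Im z = 0 \<or> Im z = 1)}"
   using t by (elim disjE) (auto simp: sq_loop_eq)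
 next
  fix z assume z: "z : {z. 0 <= Re z & Re z <= 1 & 0 <= Im z & Im z <= 1 & (Re z = 0 \<or> Re z = 1 \<or> Im z = 0 \<or> Im z = 1)}"
  then consider "Im z = 0" | "Re z = 1" | "Im z = 1" | "Re z = 0" by auto
  thus "z : sq_loop ` {0..4}"
  proof cases
   case 1
   hence "z = sq_loop (Re z)" using z by (simp add: sq_loop_eq complex_eq_iff)
   thus ?thesis using z by (intro image_eqI[of _ _ "Re z"]) auto
  next
   case 2
   hence "z = sq_loop (1 + Im z)" using z by (simp add: sq_loop_eq complex_eq_iff)
   thus ?thesis using z by (intro image_eqI[of _ _ "1 + Im z"]) auto
  next
   case 3
   hence "z = sq_loop (3 - Re z)" using z by (simp add: sq_loop_eq complex_eq_iff)
   thus ?thesis using z by (intro image_eqI[of _ _ "3 - Re z"]) auto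
  next
   case 4
   hence "z = sq_loop (4 - Im z)" using z by (simp add: sq_loop_eq complex_eq_iff)
   thus ?thesis using z by (intro image_eqI[of _ _ "4 - Im z"]) auto
  qed
 qed
qed (auto simp: sq_loop_def intro: compact_cbox convex_box)

lemma of_int_add_frac_notin_Ints:
 assumes "0 < t" "t < (1::real)"
 shows "real_of_int i + t ~: \<int>" "real_of_int i - t ~: \<int>"
proof -
 have f: False if "real_of_int i + u = real_of_int k" "-1 < u" "u < 1" "u ~= 0" for u k
 proof -
  have "real_of_int (k - i) = u" using that(1) by simp
  hence "real_of_int (k - i) < 1" "- 1 < real_of_int (k - i)" "real_of_int (k - i) ~= 0" using that(2-4) by argo+
  hence "k - i = 0" "k - i ~= 0" by linarith+
  thus False by simp
 qed
 show "real_of_int i + t ~: \<int>" using f[of t] assms by (auto elim!: Ints_cases)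
 show "real_of_int i - t ~: \<int>" using f[of "- t"] assms by (auto elim!: Ints_cases)
qed

text \<open>An interior point of a unit interval with integer ends determines the interval, up to
  its direction. The case \<open>e' = 0\<close> is impossible, since the point is not an
  integer.\<close>

lemma unit_step_eq:
 fixes p p' e e' :: int and t t' :: real
 assumes eq: "p + t * e = p' + t' * e'" and t: "0 < t" "t < 1" "0 <= t'" "t' <= 1"
  and e: "e = 1 \<or> e = -1" "e' = 0 \<or> e' = 1 \<or> e' = -1"
 shows "e' = e & p' = p & t' = t \<or> e' = - e & p' = p + e & t' = 1 - t"
proof -
 consider "e' = 0" | "e = 1" "e' = 1" | "e = 1" "e' = -1" | "e = -1" "e' = 1" | "e = -1" "e' = -1" using e by blast
 thus ?thesis
 proof cases
  case 1
  hence "p + t * e : \<int>" using eq by simp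
  thus ?thesis using of_int_add_frac_notin_Ints[OF t(1,2)] e(1) by auto
 next
  case 2
  hence "real_of_int p < p' + 1" "real_of_int p' < p + 1" using eq t by auto
  hence "p = p'" by linarith
  thus ?thesis using 2 eq by simp
 next
  case 3
  hence "real_of_int p < p'" "real_of_int p' < p + 2" using eq t by auto
  hence "p' = p + 1" by linarith
  thus ?thesis using 3 eq by simp
 next
  case 4
  hence "real_of_int p' < p" "real_of_int p < p' + 2" using eq t by auto
  hence "p' = p - 1" by linarith
  thus ?thesis using 4 eq by simp
 next
  case 5
  hence "real_of_int p < p' + 1" "real_of_int p' < p + 1" using eq t by auto
  hence "p = p'" by linarith
  thus ?thesis using 5 eq by simp
 qed
qed

definition adj3 :: "(int \<times> int) \<times> int => (int \<times> int) \<times> int => bool" where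
 "adj3 = (\<lambda>((x, y), z) ((x', y'), z'). (\<bar>x' - x\<bar> = 1 & y' = y & z' = z) \<or> (x' = x & \<bar>y' - y\<bar> = 1 & z' = z) \<or> (x' = x & y' = y & \<bar>z' - z\<bar> = 1))"

definition ipt :: "(int \<times> int) \<times> int => (real \<times> real) \<times> real" where
 "ipt = (\<lambda>((x, y), z). ((of_int x, of_int y), of_int z))"

definition seg :: "((int \<times> int) \<times> int) \<times> ((int \<times> int) \<times> int) => real => (real \<times> real) \<times> real" where
 "seg d t = ipt (fst d) + t *\<^sub>R (ipt (snd d) - ipt (fst d))"

lemma seg_coords: "seg (((x, y), z), ((x', y'), z')) t = ((x + t * of_int (x' - x), y + t * of_int (y' - y)), z + t * of_int (z' - z))"
 by (simp add: seg_def ipt_def)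

lemma seg_eq:
 assumes d: "adj3 (fst d) (snd d)" "adj3 (fst d') (snd d')" and t: "0 < t" "t < 1" "0 <= t'" "t' <= 1"
  and eq: "seg d t = seg d' t'"
 shows "d' = d & t' = t \<or> d' = rv d & t' = 1 - t"
proof -
 obtain x y z u v w where D: "d = (((x, y), z), ((u, v), w))" by (metis prod.collapse)
 obtain x' y' z' u' v' w' where D': "d' = (((x', y'), z'), ((u', v'), w'))" by (metis prod.collapse)
 have eqs: "x + t * of_int (u - x) = x' + t' * of_int (u' - x')" "y + t * of_int (v - y) = y' + t' * of_int (v' - y')"
  "z + t * of_int (w - z) = z' + t' * of_int (w' - z')" using eq unfolding D D' seg_coords by auto
 have a': "\<bar>u' - x'\<bar> = 1 & v' = y' & w' = z' \<or> u' = x' & \<bar>v' - y'\<bar> = 1 & w' = z' \<or> u' = x' & v' = y' & \<bar>w' - z'\<bar> = 1"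
  using d(2) by (simp add: D' adj3_def)
 have r: "u' - x' = 0 \<or> u' - x' = 1 \<or> u' - x' = -1" "v' - y' = 0 \<or> v' - y' = 1 \<or> v' - y' = -1" "w' - z' = 0 \<or> w' - z' = 1 \<or> w' - z' = -1"
  using a' by linarith+
 have "\<bar>u - x\<bar> = 1 & v = y & w = z \<or> u = x & \<bar>v - y\<bar> = 1 & w = z \<or> u = x & v = y & \<bar>w - z\<bar> = 1"
  using d(1) by (simp add: D adj3_def)
 thus ?thesis
 proof (elim disjE conjE)
  assume h: "\<bar>u - x\<bar> = 1" "v = y" "w = z"
  hence e: "u - x = 1 \<or> u - x = -1" by linarith
  note s = unit_step_eq[OF eqs(1) t e r(1)]
  hence "v' = y'" "w' = z'" using a' e by linarith+
  thus ?thesis using s eqs(2,3) h by (auto simp: D D')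
 next
  assume h: "u = x" "\<bar>v - y\<bar> = 1" "w = z"
  hence e: "v - y = 1 \<or> v - y = -1" by linarith
  note s = unit_step_eq[OF eqs(2) t e r(2)]
  hence "u' = x'" "w' = z'" using a' e by linarith+
  thus ?thesis using s eqs(1,3) h by (auto simp: D D')
 next
  assume h: "u = x" "v = y" "\<bar>w - z\<bar> = 1"
  hence e: "w - z = 1 \<or> w - z = -1" by linarith
  note s = unit_step_eq[OF eqs(3) t e r(3)]
  hence "u' = x'" "v' = y'" using a' e by linarith+
  thus ?thesis using s eqs(1,2) h by (auto simp: D D')
 qed
qed

text \<open>On a lattice edge two of the three coordinates are integers, while an interior point of
  a lattice square has only one integer coordinate; this keeps open faces off the edges.\<close>

lemma seg_Ints:
 assumes "adj3 (fst d) (snd d)" "seg d t = ((X, Y), Z)"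
 shows "X : \<int> \<or> Y : \<int>" "X : \<int> \<or> Z : \<int>" "Y : \<int> \<or> Z : \<int>"
proof -
 obtain x y z u v w where D: "d = (((x, y), z), ((u, v), w))" by (metis prod.collapse)
 show "X : \<int> \<or> Y : \<int>" "X : \<int> \<or> Z : \<int>" "Y : \<int> \<or> Z : \<int>"
  using assms unfolding D seg_coords by (auto simp: adj3_def)
qed

definition patch :: "(((int \<times> int) \<times> int) \<times> ((int \<times> int) \<times> int)) list => complex => (real \<times> real) \<times> real" where
 "patch w z = ipt (fst (w ! 0)) + Re z *\<^sub>R (ipt (fst (w ! 1)) - ipt (fst (w ! 0))) + Im z *\<^sub>R (ipt (fst (w ! 3)) - ipt (fst (w ! 0)))"

lemma frac_unique:
 fixes i i' :: int and t t' :: real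
 assumes "i + t = i' + t'" "0 < t" "t < 1" "0 < t'" "t' < 1"
 shows "i = i' & t = t'"
proof -
 have "real_of_int i < i' + 1" "real_of_int i' < i + 1" using assms by auto
 hence "i = i'" by linarith
 thus ?thesis using assms(1) by auto
qed

context
 fixes g :: nat
begin

interpretation p: plate "hcell g 1" "int 1" by (rule plate_hcell) simp

private lemma patch_top: "patch (p.top i j) z = ((i + Re z, j + Im z), 1)"
 unfolding patch_def p.top_def quad_def ipt_def by simp

private lemma patch_bot: "patch (p.bot i j) z = ((i + Im z, j + Re z), 0)"
 unfolding patch_def p.bot_def quad_def ipt_def by simp

private lemma patch_wall: "patch (p.wall a b 0) z = (fst (seg ((b, 0), (a, 0)) (Re z)), 1 - Im z)"
 unfolding patch_def p.wall_def quad_def by (cases a; cases b) (simp add: ipt_def seg_coords)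

private lemma W1_cases:
 assumes "w : p.W"
 obtains (top) i j where "w = p.top i j" "hcell g 1 i j" | (bot) i j where "w = p.bot i j" "hcell g 1 i j"
  | (wall) a b where "w = p.wall a b 0" "p.bd a b"
 using assms
proof (cases rule: p.W_cases)
 case (wall a b k)
 hence "k = 0" by simp
 thus ?thesis using wall that(3) by blast
qed (use that in blast)+

private lemma bd_adj3:
 assumes "p.bd a b"
 shows "adj3 (a, k) (b, k) & adj3 (b, k) (a, k)"
proof -
 obtain x y x' y' where ab: "a = (x, y)" "b = (x', y')" by (cases a; cases b)
 have "(x' = x + 1 & y' = y) \<or> (x' = x - 1 & y' = y) \<or> (y' = y + 1 & x' = x) \<or> (y' = y - 1 & x' = x)"
  using assms unfolding ab p.bd_simps by auto
 thus ?thesis unfolding ab by (elim disjE conjE) (simp_all add: adj3_def)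
qed

private lemma letters_adj3:
 assumes "d : letters p.W"
 shows "adj3 (fst d) (snd d)"
proof -
 obtain w where w: "w : p.W" "d : set w" using assms by (auto simp: letters_def)
 show ?thesis using w(1)
 proof (cases rule: W1_cases)
  case (wall a b)
  have "d : set (quad (b, 1) (a, 1) (a, 0) (b, 0))" using w(2) unfolding wall(1) p.wall_def by simp
  hence "d = ((b, 1), (a, 1)) \<or> d = ((a, 1), (a, 0)) \<or> d = ((a, 0), (b, 0)) \<or> d = ((b, 0), (b, 1))"
   by (simp add: quad_def)
  moreover have "adj3 (q, 1) (q, 0)" "adj3 (q, 0) (q, 1)" for q by (cases q; simp add: adj3_def)+
  ultimately show ?thesis using bd_adj3[OF wall(2), of 0] bd_adj3[OF wall(2), of 1] by (elim disjE) simp_all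
 next
  case (top i j)
  thus ?thesis using w(2) unfolding top(1) p.top_def by (auto simp: quad_def adj3_def)
 next
  case (bot i j)
  thus ?thesis using w(2) unfolding bot(1) p.bot_def by (auto simp: quad_def adj3_def)
 qed
qed

private lemma patch_mem:
 assumes w: "w : p.W" and z: "z : cbox 0 (Complex 1 1)"
 shows "patch w z : handle_surface g"
proof -
 have z': "0 <= Re z" "Re z <= 1" "0 <= Im z" "Im z <= 1" using z by (auto simp: in_cbox_complex_iff)
 have "patch w z : cellbox 1 w" using w
 proof (cases rule: W1_cases)
  case (top i j)
  show ?thesis unfolding top(1) patch_top unfolding p.top_def cellbox_quad using z' by simp
 next
  case (bot i j)
  show ?thesis unfolding bot(1) patch_bot unfolding p.bot_def cellbox_quad using z' by simp
 next
  case (wall a b)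
  obtain x y x' y' where ab: "a = (x, y)" "b = (x', y')" by (cases a; cases b)
  have "(x' = x + 1 & y = y') \<or> (x' = x - 1 & y = y') \<or> (y' = y + 1 & x = x') \<or> (y' = y - 1 & x = x')"
   using wall(2) unfolding ab p.bd_simps by auto
  thus ?thesis unfolding wall(1) patch_wall unfolding p.wall_def ab seg_coords fst_conv cellbox_quad
   using z' by (elim disjE conjE) (simp_all add: btw_def)
 qed
 thus ?thesis using cellbox_subset_handle[of w g] w unfolding hW_def by blast
qed

private lemma patch_boundary:
 assumes w: "w : p.W" and k: "k < length w" and t: "0 <= t" "t <= 1"
 shows "patch w (sq_loop (real k + t)) = seg (w ! k) t"
proof -
 have k4: "k = 0 \<or> k = 1 \<or> k = 2 \<or> k = 3" using k p.W_props(1)[OF w] by auto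
 have l: "k = 0 ==> sq_loop (real k + t) = Complex t 0" "k = 1 ==> sq_loop (real k + t) = Complex 1 t"
  "k = 2 ==> sq_loop (real k + t) = Complex (1 - t) 1" "k = 3 ==> sq_loop (real k + t) = Complex 0 (1 - t)"
  using t by (simp_all add: sq_loop_eq)
 have "\<exists>z. sq_loop (real k + t) = z & (k = 0 & z = Complex t 0 \<or> k = 1 & z = Complex 1 t \<or> k = 2 & z = Complex (1 - t) 1 \<or> k = 3 & z = Complex 0 (1 - t))"
  using k4 l by blast
 then obtain z where z: "sq_loop (real k + t) = z" "k = 0 & z = Complex t 0 \<or> k = 1 & z = Complex 1 t \<or> k = 2 & z = Complex (1 - t) 1 \<or> k = 3 & z = Complex 0 (1 - t)" by blast
 show ?thesis using w
 proof (cases rule: W1_cases)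
  case (top i j)
  show ?thesis unfolding top(1) z(1) patch_top unfolding p.top_def using z(2)
   by (elim disjE conjE) (simp_all add: quad_def seg_coords numeral_2_eq_2 numeral_3_eq_3)
 next
  case (bot i j)
  show ?thesis unfolding bot(1) z(1) patch_bot unfolding p.bot_def using z(2)
   by (elim disjE conjE) (simp_all add: quad_def seg_coords numeral_2_eq_2 numeral_3_eq_3)
 next
  case (wall a b)
  obtain x y x' y' where ab: "a = (x, y)" "b = (x', y')" by (cases a; cases b)
  show ?thesis unfolding wall(1) z(1) patch_wall unfolding p.wall_def ab using z(2)
   by (elim disjE conjE) (simp_all add: quad_def seg_coords numeral_2_eq_2 numeral_3_eq_3 algebra_simps)
 qed
qed

private lemma patch_inj:
 assumes w: "w : p.W" "w' : p.W" and z: "z : box 0 (Complex 1 1)" "z' : box 0 (Complex 1 1)"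
  and eq: "patch w z = patch w' z'"
 shows "w = w' & z = z'"
proof -
 have z1: "0 < Re z" "Re z < 1" "0 < Im z" "Im z < 1" and z2: "0 < Re z'" "Re z' < 1" "0 < Im z'" "Im z' < 1"
  using z by (auto simp: in_box_complex_iff)
 show ?thesis using w(1)
 proof (cases rule: W1_cases)
  case c: (top i j)
  show ?thesis using w(2)
  proof (cases rule: W1_cases)
   case d: (top i' j')
   have "i + Re z = i' + Re z'" "j + Im z = j' + Im z'" using eq unfolding c(1) d(1) patch_top by auto
   hence "i = i' & Re z = Re z'" "j = j' & Im z = Im z'" using frac_unique z1 z2 by blast+
   thus ?thesis unfolding c(1) d(1) by (simp add: complex_eq_iff)
  next
   case d: (bot i' j')
   thus ?thesis using eq unfolding c(1) d(1) patch_top patch_bot by simp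
  next
   case d: (wall a b)
   thus ?thesis using eq z2 unfolding c(1) d(1) patch_top patch_wall by simp
  qed
 next
  case c: (bot i j)
  show ?thesis using w(2)
  proof (cases rule: W1_cases)
   case d: (bot i' j')
   have "i + Im z = i' + Im z'" "j + Re z = j' + Re z'" using eq unfolding c(1) d(1) patch_bot by auto
   hence "i = i' & Im z = Im z'" "j = j' & Re z = Re z'" using frac_unique z1 z2 by blast+
   thus ?thesis unfolding c(1) d(1) by (simp add: complex_eq_iff)
  next
   case d: (top i' j')
   thus ?thesis using eq unfolding c(1) d(1) patch_top patch_bot by simp
  next
   case d: (wall a b)
   thus ?thesis using eq z2 unfolding c(1) d(1) patch_bot patch_wall by simp
  qed
 next
  case c: (wall a b)
  show ?thesis using w(2)
  proof (cases rule: W1_cases)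
   case d: (top i' j')
   thus ?thesis using eq z1 unfolding c(1) d(1) patch_top patch_wall by simp
  next
   case d: (bot i' j')
   thus ?thesis using eq z1 unfolding c(1) d(1) patch_bot patch_wall by simp
  next
   case d: (wall a' b')
   have i: "Im z = Im z'" and f: "fst (seg ((b, 0), (a, 0)) (Re z)) = fst (seg ((b', 0), (a', 0)) (Re z'))"
    using eq unfolding c(1) d(1) patch_wall by auto
   have "snd (seg ((b, 0), (a, 0)) (Re z)) = snd (seg ((b', 0), (a', 0)) (Re z'))" by (simp add: seg_def ipt_def case_prod_beta)
   hence "seg ((b, 0), (a, 0)) (Re z) = seg ((b', 0), (a', 0)) (Re z')" using f by (simp add: prod_eq_iff)
   hence "((b', 0::int), (a', 0::int)) = ((b, 0), (a, 0)) & Re z' = Re z \<or> ((b', 0::int), (a', 0::int)) = rv ((b, 0), (a, 0)) & Re z' = 1 - Re z"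
    using bd_adj3[OF c(2)] bd_adj3[OF d(2)] z1 z2 by (intro seg_eq) auto
   \<comment> \<open>\<open>seg_eq\<close> leaves the reversed edge as an alternative; it is
     excluded because boundary edges have only one direction.\<close>
   moreover have "\<not> (b' = a & a' = b)" using p.bd_asym[OF c(2)] d(2) by auto
   ultimately show ?thesis unfolding c(1) d(1) using i by (auto simp: complex_eq_iff)
  qed
 qed
qed

private lemma patch_not_seg:
 assumes w: "w : p.W" and z: "z : box 0 (Complex 1 1)" and d: "d : letters p.W"
 shows "patch w z ~= seg d t"
proof
 assume eq: "patch w z = seg d t"
 have z1: "0 < Re z" "Re z < 1" "0 < Im z" "Im z < 1" using z by (auto simp: in_box_complex_iff)
 note fr = of_int_add_frac_notin_Ints[OF z1(1,2)] of_int_add_frac_notin_Ints[OF z1(3,4)]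
 obtain X Y Z where XYZ: "seg d t = ((X, Y), Z)" by (metis prod.collapse)
 note si = seg_Ints[OF letters_adj3[OF d] XYZ]
 show False using w
 proof (cases rule: W1_cases)
  case (top i j)
  have "X = i + Re z" "Y = j + Im z" using eq unfolding top(1) patch_top XYZ by auto
  thus False using si(1) fr by auto
 next
  case (bot i j)
  have "X = i + Im z" "Y = j + Re z" using eq unfolding bot(1) patch_bot XYZ by auto
  thus False using si(1) fr by auto
 next
  case (wall a b)
  obtain x y x' y' where ab: "a = (x, y)" "b = (x', y')" by (cases a; cases b)
  have c: "X = x' + Re z * of_int (x - x')" "Y = y' + Re z * of_int (y - y')" "Z = of_int 1 - Im z"
   using eq unfolding wall(1) patch_wall XYZ ab seg_coords by auto
  have Z: "Z ~: \<int>" unfolding c(3) by (rule fr)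
  have "(x - x' = 1 \<or> x - x' = -1) \<or> (y - y' = 1 \<or> y - y' = -1)" using wall(2) unfolding ab p.bd_simps by auto
  hence "X = x' + Re z \<or> X = x' - Re z \<or> Y = y' + Re z \<or> Y = y' - Re z" unfolding c by (elim disjE) (simp_all del: of_int_diff)
  hence "X ~: \<int> \<or> Y ~: \<int>" using fr by blast
  thus False using si Z by blast
 qed
qed

lemma realizes_handle_surface: "realizes (handle_surface g) fst (hW g 1)"
proof -
 let ?D = "\<lambda>_. cbox 0 (Complex 1 1)"
 have W: "hW g 1 = p.W" unfolding hW_def by (rule refl)
 have m: "disc_model (cbox 0 (Complex 1 1)) (length w) sq_loop" if "w : p.W" for w
  using disc_model_square p.W_props(1)[OF that] by simp
 have inS: "seg d t : handle_surface g" if d: "d : letters p.W" and t: "0 <= t" "t <= 1" for d t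
 proof -
  obtain w where w: "w : p.W" "d : set w" using d by (auto simp: letters_def)
  then obtain k where k: "k < length w" "d = w ! k" by (metis in_set_conv_nth)
  have "sq_loop (real k + t) : sq_loop ` {0..4}" using k(1) p.W_props(1)[OF w(1)] t by (intro imageI) auto
  also have "\<dots> = frontier (cbox 0 (Complex 1 1))" using disc_model_square by (simp add: disc_model_def)
  also have "\<dots> <= cbox 0 (Complex 1 1)" by (rule frontier_subset_closed[OF closed_cbox])
  finally show ?thesis using patch_mem[OF w(1)] patch_boundary[OF w(1) k(1) t] k(2) by metis
 qed
 have sw: "seg (rv d) t = seg d (1 - t)" for d t
  by (simp add: seg_def algebra_simps)
 have s0: "seg d 0 = ipt (fst d)" for d by (simp add: seg_def)
 have inj: "u = v" if "ipt u = ipt v" for u v using that by (auto simp: ipt_def split: prod.splits)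
 have "edge_system (handle_surface g) fst (letters p.W) seg"
  unfolding edge_system_def
 proof (intro conjI ballI impI)
  fix d assume "d : letters p.W"
  show "continuous_on {0..1} (seg d)" unfolding seg_def by (intro continuous_intros)
 next
  fix d assume d: "d : letters p.W"
  show "seg d ` {0..1} <= handle_surface g" using inS[OF d] by auto
 next
  fix d t show "seg (rv d) t = seg d (1 - t)" by (rule sw)
 next
  fix d d' t t' assume h: "d : letters p.W" "d' : letters p.W" "t : {0<..<1::real}" "t' : {0..1::real}" "seg d t = seg d' t'"
  show "d' = d & t' = t \<or> d' = rv d & t' = 1 - t"
   using h(3,4) by (intro seg_eq[OF letters_adj3[OF h(1)] letters_adj3[OF h(2)] _ _ _ _ h(5)]) auto
 next
  fix d d' show "seg d 0 = seg d' 0 \<longleftrightarrow> fst d = fst d'" unfolding s0 using inj[of "fst d" "fst d'"] by auto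
 qed
 moreover have "realizes_on ?D (\<lambda>_. sq_loop) (handle_surface g) fst p.W seg patch"
  unfolding realizes_on_def face_map_def interior_cbox
 proof (intro conjI ballI allI impI)
  fix w show "continuous_on (cbox 0 (Complex 1 1)) (patch w)" unfolding patch_def by (intro continuous_intros)
 next
  fix w assume "w : p.W"
  thus "patch w ` cbox 0 (Complex 1 1) <= handle_surface g" using patch_mem by blast
 next
  fix w k t assume "w : p.W" "k < length w" "t : {0..1::real}"
  thus "patch w (sq_loop (real k + t)) = seg (w ! k) t" using patch_boundary[of w k t] by simp
 next
  fix w w' z z' assume "w : p.W" "w' : p.W" "z : box 0 (Complex 1 1)" "z' : box 0 (Complex 1 1)" "patch w z = patch w' z'"
  thus "w = w'" "z = z'" using patch_inj by blast+
 next
  fix w z d assume "w : p.W" "z : box 0 (Complex 1 1)" "d : letters p.W"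
  thus "patch w z ~: seg d ` {0..1}" using patch_not_seg by blast
 qed
 ultimately show ?thesis unfolding W using realizes_iff_models[of p.W ?D "\<lambda>_. sq_loop", OF m] by blast
qed

end

section \<open>Quadrangular rotation systems\<close>

text \<open>Only the edge curves of the realization are kept; an undirected edge is drawn along one
  of its two darts, selected by \<open>ch\<close>.\<close>

lemma embeds_in_of_realizes:
 fixes S :: "'b::topological_space set"
 assumes r: "realizes S fst W" and sw: "\<And>d. d : letters W ==> rv d : letters W" and nl: "\<And>d. d : letters W ==> fst d ~= snd d"
  and V: "verts G = fst ` letters W" and E: "edges G = (\<lambda>(u, v). {u, v}) ` letters W"
 shows "embeds_in G S"
proof -
 let ?L = "letters W"
 obtain gm \<Phi> where es: "edge_system S fst ?L gm" using r unfolding realizes_def by blast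
 have c: "continuous_on {0..1} (gm d)" "gm d ` {0..1} <= S" and rev: "t : {0..1} ==> gm (rv d) t = gm d (1 - t)" if "d : ?L" for d t
  using es that unfolding edge_system_def by blast+
 have int: "d' = d & t' = t \<or> d' = rv d & t' = 1 - t" if "d : ?L" "d' : ?L" "t : {0<..<1}" "t' : {0..1}" "gm d t = gm d' t'" for d d' t t'
  using es that unfolding edge_system_def by blast
 have st: "gm d 0 = gm d' 0 \<longleftrightarrow> fst d = fst d'" if "d : ?L" "d' : ?L" for d d'
  using es that unfolding edge_system_def by blast
 define f where "f = (\<lambda>v. gm (SOME d. d : ?L & fst d = v) 0)"
 have f: "f (fst d) = gm d 0" if "d : ?L" for d
 proof -
  have "(SOME d'. d' : ?L & fst d' = fst d) : ?L & fst (SOME d'. d' : ?L & fst d' = fst d) = fst d"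
   by (rule someI[of _ d]) (use that in blast)
  thus ?thesis unfolding f_def using st that by blast
 qed
 have f1: "f (snd d) = gm d 1" if d: "d : ?L" for d
  using f[OF sw[OF d]] rev[OF d, of 0] by simp
 have finj: "u = v" if uv: "u : fst ` ?L" "v : fst ` ?L" "f u = f v" for u v
 proof -
  obtain d d' where "d : ?L" "d' : ?L" "u = fst d" "v = fst d'" using uv by blast
  thus ?thesis using uv(3) f st by metis
 qed
 have sndV: "snd d : fst ` ?L" if "d : ?L" for d using sw[OF that] by (force intro: image_eqI[of _ _ "rv d"])
 define ch where "ch = (\<lambda>e. SOME d. d : ?L & {fst d, snd d} = e)"
 have ch: "ch e : ?L & {fst (ch e), snd (ch e)} = e" if e: "e : edges G" for e
 proof -
  obtain d where "d : ?L & {fst d, snd d} = e" using e unfolding E by (auto simp: case_prod_beta)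
  thus ?thesis unfolding ch_def by (rule someI)
 qed
 have endp: "gm d t : f ` {fst d, snd d}" if "d : ?L" "t : {0..1}" "t ~: {0<..<1}" for d t
 proof -
  have "t = 0 \<or> t = 1" using that by auto
  thus ?thesis using f[OF that(1)] f1[OF that(1)] by auto
 qed
 have novert: "gm d t ~: f ` fst ` ?L" if d: "d : ?L" and t: "t : {0<..<1}" for d t
 proof
  assume "gm d t : f ` fst ` ?L"
  then obtain d' where d': "d' : ?L" "gm d t = gm d' 0" using f by auto
  thus False using edge_interior_not_vertex[OF es d d'(1) sw[OF d'(1)] t] by simp
 qed
 have ie: "d = rv d ==> d : ?L ==> False" for d using nl[of d] by (metis fst_swap)
 have inj: "inj_on (gm d) {0..1}" if d: "d : ?L" for d
 proof (rule inj_onI)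
  fix x y assume xy: "x : {0..1::real}" "y : {0..1}" "gm d x = gm d y"
  show "x = y"
  proof (cases "x : {0<..<1}")
   case True
   thus ?thesis using int[OF d d True xy(2,3)] ie d by blast
  next
   case x: False
   show ?thesis
   proof (cases "y : {0<..<1}")
    case True
    thus ?thesis using int[OF d d True xy(1) xy(3)[symmetric]] ie d by blast
   next
    case False
    have "gm d 0 ~= gm d 1"
    proof
     assume "gm d 0 = gm d 1"
     hence "f (fst d) = f (snd d)" using f[OF d] f1[OF d] by simp
     thus False using finj[OF _ sndV[OF d], of "fst d"] nl[OF d] d by blast
    qed
    moreover have "(x = 0 \<or> x = 1) & (y = 0 \<or> y = 1)" using x False xy by auto
    ultimately show ?thesis using xy(3) by auto
   qed
  qed
 qed
 show ?thesis unfolding embeds_in_def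
 proof (rule exI[of _ f], rule exI[of _ "\<lambda>e. gm (ch e)"], intro conjI ballI impI)
  show "inj_on f (verts G)" unfolding V using finj by (auto intro!: inj_onI)
  have "gm d 0 : S" if "d : ?L" for d using c(2)[OF that] by auto
  thus "f ` verts G <= S" unfolding V using f by auto
 next
  fix e assume e: "e : edges G"
  have d: "ch e : ?L" "{fst (ch e), snd (ch e)} = e" using ch[OF e] by auto
  show "arc (gm (ch e))" unfolding arc_def path_def using c(1)[OF d(1)] inj[OF d(1)] by blast
  show "path_image (gm (ch e)) <= S" unfolding path_image_def by (rule c(2)[OF d(1)])
  have pe: "{pathstart (gm (ch e)), pathfinish (gm (ch e))} = f ` {fst (ch e), snd (ch e)}" unfolding pathstart_def pathfinish_def using f[OF d(1)] f1[OF d(1)] by auto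
  thus "{pathstart (gm (ch e)), pathfinish (gm (ch e))} = f ` e" unfolding d(2) .
  have "f ` {fst (ch e), snd (ch e)} <= path_image (gm (ch e))"
   unfolding pe[symmetric] using pathstart_in_path_image pathfinish_in_path_image by auto
  moreover have "{fst (ch e), snd (ch e)} <= fst ` ?L" using d(1) sndV by auto
  moreover have "path_image (gm (ch e)) \<inter> f ` fst ` ?L <= f ` {fst (ch e), snd (ch e)}"
   unfolding path_image_def using novert[OF d(1)] endp[OF d(1)] by blast
  ultimately show "path_image (gm (ch e)) \<inter> f ` verts G = f ` e" unfolding V d(2) by blast
 next
  fix e e' assume e: "e : edges G" "e' : edges G" "e ~= e'"
  have d: "ch e : ?L" "{fst (ch e), snd (ch e)} = e" using ch[OF e(1)] by auto
  have d': "ch e' : ?L" "{fst (ch e'), snd (ch e')} = e'" using ch[OF e(2)] by auto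
  have ne: "ch e' ~= ch e" "ch e' ~= rv (ch e)" "ch e ~= rv (ch e')"
  proof -
   show "ch e' ~= ch e" using d(2) d'(2) e(3) by metis
   show "ch e' ~= rv (ch e)" using d(2) d'(2) e(3) by (metis fst_swap snd_swap insert_commute)
   show "ch e ~= rv (ch e')" using d(2) d'(2) e(3) by (metis fst_swap snd_swap insert_commute)
  qed
  show "path_image (gm (ch e)) \<inter> path_image (gm (ch e')) <= f ` (e \<inter> e')"
  proof
   fix z assume "z : path_image (gm (ch e)) \<inter> path_image (gm (ch e'))"
   then obtain t t' where t: "t : {0..1}" "z = gm (ch e) t" "t' : {0..1}" "z = gm (ch e') t'" unfolding path_image_def by blast
   have "t ~: {0<..<1}" using int[OF d(1) d'(1) _ t(3)] t(2,4) ne by metis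
   hence z: "z : f ` e" using endp[OF d(1) t(1)] t(2) d(2) by simp
   have "t' ~: {0<..<1}" using int[OF d'(1) d(1) _ t(1)] t(2,4) ne by metis
   hence z': "z : f ` e'" using endp[OF d'(1) t(3)] t(4) d'(2) by simp
   obtain u u' where u: "u : e" "u' : e'" "z = f u" "z = f u'" using z z' by blast
   have "e <= fst ` ?L" "e' <= fst ` ?L" using d d' sndV by blast+
   hence "u = u'" using finj[of u u'] u by auto
   thus "z : f ` (e \<inter> e')" using u by blast
  qed
 qed
qed

text \<open>An edge-coloured bipartite graph: \<open>nb k\<close> moves along colour
  \<open>k\<close>, \<open>sc x\<close> is the cyclic order of the colours at \<open>x\<close>, and
  \<open>p\<close> is the bipartition. \<open>square\<close> says that consecutive colours commute
  and remain consecutive at the neighbours. The order is used in opposite directions in the two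
  classes of \<open>p\<close>, so a face alternates between the colours \<open>k\<close> and
  \<open>sc x k\<close> and closes after four steps.\<close>

locale rotation =
 fixes V :: "'v set" and col :: "'v => 'k set" and nb :: "'k => 'v => 'v" and sc :: "'v => 'k => 'k" and p :: "'v => bool"
 assumes finV: "finite V" "V ~= {}"
  and finC: "x : V ==> finite (col x) & col x ~= {}"
  and nb: "x : V ==> k : col x ==> nb k x : V & k : col (nb k x) & nb k (nb k x) = x & p (nb k x) ~= p x"
  and nb_inj: "x : V ==> k : col x ==> k' : col x ==> nb k x = nb k' x ==> k = k'"
  and sc: "x : V ==> k : col x ==> sc x k : col x & sc x k ~= k"
  and sc_inj: "x : V ==> inj_on (sc x) (col x)"
  and sc_cycle: "x : V ==> A <= col x ==> A ~= {} ==> (\<And>k. k : A ==> sc x k : A) ==> A = col x"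
  and square: "x : V ==> k : col x ==> sc x k = k' ==>
   k' : col (nb k x) & sc (nb k x) k = k' & k : col (nb k' x) & sc (nb k' x) k = k' & nb k' (nb k x) = nb k (nb k' x)"
  and connected: "X <= V ==> X ~= {} ==> (\<And>x k. x : X ==> k : col x ==> nb k x : X) ==> X = V"
begin

definition fw :: "'v => 'k => ('v \<times> 'v) list" where
 "fw x k = quad (nb k x) x (nb (sc x k) x) (nb k (nb (sc x k) x))"

definition FW :: "('v \<times> 'v) list set" where
 "FW = {fw x k | x k. x : V & p x & k : col x}"

text \<open>A quadrilateral is produced by \<open>fw\<close> from either of its two vertices in
  class \<open>p\<close>, as two different lists with the same darts. One list per dart set is
  selected, so that no face is counted twice.\<close>

definition rp :: "('v \<times> 'v) set => ('v \<times> 'v) list" where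
 "rp C = (SOME w. w : FW & set w = C)"

definition Q :: "('v \<times> 'v) list set" where
 "Q = rp ` set ` FW"

definition darts :: "('v \<times> 'v) set" where
 "darts = {(x, nb k x) | x k. x : V & k : col x}"

lemma rp: "w : FW ==> rp (set w) : FW & set (rp (set w)) = set w"
 unfolding rp_def by (rule someI[of _ w]) simp

lemma Q_rep: "w : FW ==> \<exists>w'\<in>Q. set w' = set w"
 unfolding Q_def using rp by blast

lemma Q_FW: "w : Q ==> w : FW"
 unfolding Q_def using rp by blast

lemma Q_unique:
 assumes "w : Q" "w' : Q" "set w = set w'"
 shows "w = w'"
proof -
 have "w = rp (set w)" if w: "w : Q" for w
 proof -
  obtain u where "u : FW" "w = rp (set u)" using w unfolding Q_def by blast
  thus ?thesis using rp[of u] by simp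
 qed
 from this[OF assms(1)] this[OF assms(2)] show ?thesis unfolding assms(3) by simp
qed

lemma letters_Q: "letters Q = \<Union> (set ` FW)"
 unfolding letters_def using Q_FW Q_rep by blast

lemma fw_props:
 assumes x: "x : V" "p x" "k : col x"
 defines "k' \<equiv> sc x k"
 shows "nb k x : V" "nb k' x : V" "nb k (nb k' x) : V" "\<not> p (nb k x)" "\<not> p (nb k' x)" "p (nb k (nb k' x))"
  "nb k x ~= nb k' x" "nb k (nb k' x) ~= x" "k' : col x" "k : col (nb k' x)" "sc (nb k' x) k = k'" "k : col (nb k (nb k' x))"
  "sc (nb k (nb k' x)) k = k'" "nb k (nb k (nb k' x)) = nb k' x" "nb k' (nb k (nb k' x)) = nb k x"
proof -
 note k' = sc[OF x(1,3), folded k'_def]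
 note a = nb[OF x(1,3)] nb[OF x(1) conjunct1[OF k']]
 note s = square[OF x(1,3), of k', folded k'_def, OF refl]
 have u: "nb k' x : V" "k : col (nb k' x)" using a s by auto
 note b = nb[OF u]
 show "nb k x : V" "nb k' x : V" "nb k (nb k' x) : V" "\<not> p (nb k x)" "\<not> p (nb k' x)" "p (nb k (nb k' x))" "k' : col x" "k : col (nb k' x)"
  "sc (nb k' x) k = k'" "k : col (nb k (nb k' x))" "nb k (nb k (nb k' x)) = nb k' x"
  using a b s x k' by auto
 show "nb k x ~= nb k' x" using nb_inj[OF x(1,3), of k'] k' by auto
 have s': "sc (nb k' x) k = k'" using s by blast
 note t = square[OF u s']
 show "sc (nb k (nb k' x)) k = k'" using t by blast
 show "nb k (nb k' x) ~= x"
 proof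
  assume "nb k (nb k' x) = x"
  moreover have "nb k' (nb k' x) = x" "k' : col (nb k' x)" using a by auto
  ultimately have "k = k'" using nb_inj[OF u, of k'] by auto
  thus False using k' by auto
 qed
 have "nb k' (nb k (nb k' x)) = nb k' (nb k' (nb k x))" using s by simp
 also have "\<dots> = nb k x" using nb[of "nb k x" k'] a s by blast
 finally show "nb k' (nb k (nb k' x)) = nb k x" .
qed

lemma set_fw: "set (fw x k) = {(nb k x, x), (x, nb (sc x k) x), (nb (sc x k) x, nb k (nb (sc x k) x)), (nb k (nb (sc x k) x), nb k x)}"
 by (simp add: fw_def quad_def)

lemma fw_even:
 assumes x: "x : V" "p x" "k : col x" and u: "u = x \<or> u = nb k (nb (sc x k) x)"
 shows "set (fw x k) = set (fw u k)" "u : V" "p u" "k : col u" "sc u k = sc x k"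
proof -
 note f = fw_props[OF x]
 have "set (fw x k) = set (fw u k) & u : V & p u & k : col u & sc u k = sc x k" using u
 proof
  assume u: "u = nb k (nb (sc x k) x)"
  have sx: "nb k (nb k x) = x" using nb[OF x(1,3)] by blast
  have "set (fw u k) = set (fw x k)" unfolding set_fw u f(13,14,15) sx by blast
  thus ?thesis using f u by auto
 qed (use x in auto)
 thus "set (fw x k) = set (fw u k)" "u : V" "p u" "k : col u" "sc u k = sc x k" by auto
qed

text \<open>Every dart leads back to its face. If it starts in class \<open>p\<close>, its colour is
  \<open>sc u k\<close>; if it ends there, its colour is \<open>k\<close>. In both cases
  \<open>k\<close> is determined by the vertex in class \<open>p\<close>.\<close>

lemma fw_dart:
 assumes x: "x : V" "p x" "k : col x" and d: "(u, v) : set (fw x k)"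
 shows "if p u then set (fw x k) = set (fw u k) & u : V & k : col u & v = nb (sc u k) u & \<not> p v
  else set (fw x k) = set (fw v k) & v : V & k : col v & u = nb k v & p v"
proof -
 note f = fw_props[OF x] and e = fw_even[OF x]
 consider "(u, v) = (nb k x, x)" | "(u, v) = (x, nb (sc x k) x)" | "(u, v) = (nb (sc x k) x, nb k (nb (sc x k) x))" | "(u, v) = (nb k (nb (sc x k) x), nb k x)"
  using d unfolding set_fw by blast
 thus ?thesis
 proof cases
  case 1
  thus ?thesis using f(4) x by simp
 next
  case 2
  thus ?thesis using f x by simp
 next
  case 3
  hence "\<not> p u" "v = nb k (nb (sc x k) x)" using f by auto
  thus ?thesis using e[of v] 3 f(14) by simp
 next
  case 4
  hence "p u" "u = nb k (nb (sc x k) x)" using f by auto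
  moreover have "v = nb (sc x k) u" using 4 f(15) by simp
  moreover have "\<not> p v" using 4 f(4) by simp
  ultimately show ?thesis using e[of u] by simp
 qed
qed

lemma FW_unique:
 assumes "w : FW" "w' : FW" "d : set w" "d : set w'"
 shows "set w = set w'"
proof -
 obtain x k where w: "w = fw x k" "x : V" "p x" "k : col x" using assms(1) unfolding FW_def by blast
 obtain x' k' where w': "w' = fw x' k'" "x' : V" "p x'" "k' : col x'" using assms(2) unfolding FW_def by blast
 obtain u v where d: "d = (u, v)" by (cases d)
 note a = fw_dart[OF w(2-4), of u v] and b = fw_dart[OF w'(2-4), of u v]
 show ?thesis
 proof (cases "p u")
  case True
  have a': "set w = set (fw u k)" "u : V" "k : col u" "v = nb (sc u k) u" using a True assms(3) unfolding w d by auto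
  have b': "set w' = set (fw u k')" "k' : col u" "v = nb (sc u k') u" using b True assms(4) unfolding w' d by auto
  have "sc u k = sc u k'" using nb_inj[OF a'(2)] sc[OF a'(2)] a'(3,4) b'(2,3) by metis
  hence "k = k'" using sc_inj[OF a'(2)] a'(3) b'(2) by (meson inj_onD)
  thus ?thesis using a' b' by simp
 next
  case False
  have a': "set w = set (fw v k)" "v : V" "k : col v" "u = nb k v" using a False assms(3) unfolding w d by auto
  have b': "set w' = set (fw v k')" "k' : col v" "u = nb k' v" using b False assms(4) unfolding w' d by auto
  have "k = k'" using nb_inj[OF a'(2,3) b'(2)] a'(4) b'(3) by simp
  thus ?thesis using a' b' by simp
 qed
qed

lemma sc_surj: "x : V ==> c : col x ==> \<exists>k\<in>col x. sc x k = c"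
 using endo_inj_surj[of "col x" "sc x"] finC sc sc_inj by (metis imageE image_subsetI)

lemma letters_darts: "letters Q = darts"
proof
 show "letters Q <= darts"
 proof
  fix d assume "d : letters Q"
  then obtain x k where x: "x : V" "p x" "k : col x" "d : set (fw x k)" unfolding letters_Q FW_def by blast
  obtain u v where d: "d = (u, v)" by (cases d)
  note f = fw_dart[OF x(1-3) x(4)[unfolded d]]
  show "d : darts"
  proof (cases "p u")
   case True
   hence "u : V" "sc u k : col u" "v = nb (sc u k) u" using f sc[of u k] by auto
   thus ?thesis unfolding d darts_def by blast
  next
   case False
   hence v: "v : V" "k : col v" "u = nb k v" using f by auto
   hence "u : V" "k : col u" "v = nb k u" using nb[OF v(1,2)] by auto
   thus ?thesis unfolding d darts_def by blast
  qed
 qed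
 show "darts <= letters Q"
 proof
  fix d assume "d : darts"
  then obtain x c where x: "x : V" "c : col x" "d = (x, nb c x)" unfolding darts_def by blast
  show "d : letters Q"
  proof (cases "p x")
   case True
   obtain k where k: "k : col x" "sc x k = c" using sc_surj x by blast
   have "fw x k : FW" unfolding FW_def using x True k by blast
   moreover have "d : set (fw x k)" unfolding set_fw x(3) k(2) by blast
   ultimately show ?thesis unfolding letters_Q by blast
  next
   case False
   let ?v = "nb c x"
   have v: "?v : V" "c : col ?v" "p ?v" "nb c ?v = x" using nb[OF x(1,2)] False by auto
   hence "fw ?v c : FW" unfolding FW_def by blast
   moreover have "d : set (fw ?v c)" unfolding set_fw x(3) v(4) by blast
   ultimately show ?thesis unfolding letters_Q by blast
  qed
 qed
qed

lemma corner:
 assumes u: "u : V" "k : col u"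
 defines "k' \<equiv> sc u k"
 obtains w where "w : Q" "if p u then (nb k u, u) : set w & (u, nb k' u) : set w else (nb k' u, u) : set w & (u, nb k u) : set w"
proof (cases "p u")
 case True
 have "fw u k : FW" unfolding FW_def using u True by blast
 then obtain w where "w : Q" "set w = set (fw u k)" using Q_rep by blast
 thus ?thesis using that True unfolding set_fw k'_def by auto
next
 case False
 let ?x = "nb k' u"
 have k': "k' : col u" using sc[OF u] by (simp add: k'_def)
 have x: "?x : V" "p ?x" "nb k' ?x = u" using nb[OF u(1) k'] False by auto
 have s: "k : col ?x" "sc ?x k = k'" using square[OF u, of k'] by (auto simp: k'_def)
 have "fw ?x k : FW" unfolding FW_def using x s by blast
 then obtain w where "w : Q" "set w = set (fw ?x k)" using Q_rep by blast
 thus ?thesis using that False unfolding set_fw s(2) x(3) by auto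
qed

lemma darts_swap: "d : darts ==> rv d : darts & fst d ~= snd d"
proof -
 assume "d : darts"
 then obtain x c where x: "x : V" "c : col x" "d = (x, nb c x)" unfolding darts_def by blast
 have "nb c x : V" "c : col (nb c x)" "nb c (nb c x) = x" "x ~= nb c x" using nb[OF x(1,2)] by auto
 thus ?thesis unfolding darts_def x(3) by force
qed

lemma FW_word:
 assumes "w : FW"
 shows "distinct w" "length w = 4" "cwalk fst w"
  "cwalk f w ==> (v, u) : set w ==> (u, t) : set w ==> f (u, v) = f (u, t)"
proof -
 obtain x k where w: "w = fw x k" and x: "x : V" "p x" "k : col x" using assms(1) unfolding FW_def by blast
 note f = fw_props[OF x]
 let ?a = "nb k x" and ?c = "nb (sc x k) x" and ?d = "nb k (nb (sc x k) x)"
 have ne: "?a ~= x" "?a ~= ?c" "?a ~= ?d" "x ~= ?c" "x ~= ?d" "?c ~= ?d" using f x by metis+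
 show "distinct w" "length w = 4" "cwalk fst w" using ne by (auto simp: w fw_def quad_def cwalk_def)
 assume "cwalk f w"
 hence c: "f (x, ?a) = f (x, ?c)" "f (?c, x) = f (?c, ?d)" "f (?d, ?c) = f (?d, ?a)" "f (?a, ?d) = f (?a, x)"
  unfolding w fw_def cwalk_quad by auto
 assume h: "(v, u) : set w" "(u, t) : set w"
 then consider "u = x" | "u = ?c" | "u = ?d" | "u = ?a" unfolding w set_fw by blast
 thus "f (u, v) = f (u, t)"
  using h c ne unfolding w set_fw by cases auto
qed

lemma okmap_Q: "okmap fst Q"
 unfolding okmap_def
proof (intro conjI ballI allI impI)
 have "FW <= (\<lambda>(x, k). fw x k) ` (Sigma V col)" unfolding FW_def by auto
 moreover have "finite (Sigma V col)" using finV finC by blast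
 ultimately have "finite FW" using finite_surj by blast
 thus "finite Q" unfolding Q_def by blast
 show "[] ~: Q" using FW_word(2) Q_FW by fastforce
next
 fix w assume "w : Q"
 thus "distinct w" "cwalk fst w" using FW_word Q_FW by blast+
next
 fix v w assume "v : Q" "w : Q" "v ~= w"
 thus "set v \<inter> set w = {}" using FW_unique[OF Q_FW Q_FW] Q_unique by blast
next
 fix d assume "d : letters Q"
 thus "rv d : letters Q" "rv d ~= d" unfolding letters_darts using darts_swap[of d] by (auto simp: prod_eq_iff)
next
 fix f :: "'v \<times> 'v => bool" and d d'
 assume f: "\<forall>w\<in>Q. cwalk f w" and d: "d : letters Q" "d' : letters Q" "fst d = fst d'"
 obtain x c where x: "x : V" "c : col x" "d = (x, nb c x)" using d(1) unfolding letters_darts darts_def by blast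
 obtain x' c' where x': "x' : V" "c' : col x'" "d' = (x', nb c' x')" using d(2) unfolding letters_darts darts_def by blast
 have "x' = x" using d(3) x(3) x'(3) by simp
 hence c': "c' : col x" "d' = (x, nb c' x)" using x' by simp_all
 have st: "f (x, nb k x) = f (x, nb (sc x k) x)" if k: "k : col x" for k
 proof (rule corner[OF x(1) k])
  fix w assume w: "w : Q" and c: "if p x then (nb k x, x) : set w & (x, nb (sc x k) x) : set w else (nb (sc x k) x, x) : set w & (x, nb k x) : set w"
  have cw: "cwalk f w" using f w by blast
  show ?thesis
  proof (cases "p x")
   case True
   thus ?thesis using FW_word(4)[OF Q_FW[OF w] cw, of "nb k x" x "nb (sc x k) x"] c by simp
  next
   case False
   thus ?thesis using FW_word(4)[OF Q_FW[OF w] cw, of "nb (sc x k) x" x "nb k x"] c by simp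
  qed
 qed
 \<comment> \<open>Corners at \<open>x\<close> connect a colour with its successor, and the
   successors form a single cycle; hence a labelling that respects the corners is constant on the
   darts at \<open>x\<close>.\<close>
 have "{k : col x. f (x, nb k x) = f (x, nb c x)} = col x"
 proof (rule sc_cycle[OF x(1)])
  fix k assume k: "k : {k : col x. f (x, nb k x) = f (x, nb c x)}"
  thus "sc x k : {k : col x. f (x, nb k x) = f (x, nb c x)}" using st[of k] sc[OF x(1), of k] by simp
 qed (use x(2) in blast)+
 hence "f (x, nb c' x) = f (x, nb c x)" using c' by blast
 thus "f d = f d'" using x c' by simp
qed

lemma wconn_Q: "wconn Q"
 unfolding wconn_def
proof (intro allI impI)
 fix C assume C: "C <= letters Q" "C ~= {}" "\<forall>w\<in>Q. set w \<inter> C ~= {} --> set w <= C" "rv ` C <= C"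
 have sw: "(b, a) : C" if "(a, b) : C" for a b using C(4) that by force
 have st: "(x, nb (sc x k) x) : C" if x: "x : V" "k : col x" "(x, nb k x) : C" for x k
 proof (rule corner[OF x(1,2)])
  fix w assume w: "w : Q" and c: "if p x then (nb k x, x) : set w & (x, nb (sc x k) x) : set w else (nb (sc x k) x, x) : set w & (x, nb k x) : set w"
  show ?thesis
  proof (cases "p x")
   case True
   hence "(nb k x, x) : set w \<inter> C" "(x, nb (sc x k) x) : set w" using c sw x(3) by auto
   thus ?thesis using C(3) w by blast
  next
   case False
   hence "(x, nb k x) : set w \<inter> C" "(nb (sc x k) x, x) : set w" using c x(3) by auto
   hence "(nb (sc x k) x, x) : C" using C(3) w by blast
   thus ?thesis by (rule sw)
  qed
 qed
 have all: "(x, nb k' x) : C" if x: "x : V" "k : col x" "(x, nb k x) : C" "k' : col x" for x k k'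
 proof -
  have "{k : col x. (x, nb k x) : C} = col x"
  proof (rule sc_cycle[OF x(1)])
   fix k assume k: "k : {k : col x. (x, nb k x) : C}"
   thus "sc x k : {k : col x. (x, nb k x) : C}" using st[OF x(1), of k] sc[OF x(1), of k] by simp
  qed (use x in blast)+
  thus ?thesis using x(4) by blast
 qed
 let ?X = "{x : V. \<forall>k\<in>col x. (x, nb k x) : C}"
 have "?X = V"
 proof (rule connected)
  obtain d where d: "d : C" using C(2) by blast
  then obtain x c where "x : V" "c : col x" "d = (x, nb c x)" using C(1) unfolding letters_darts darts_def by blast
  hence "x : ?X" using d all by blast
  thus "?X ~= {}" by blast
  fix x k assume x: "x : ?X" "k : col x"
  have n: "nb k x : V" "k : col (nb k x)" "nb k (nb k x) = x" using nb[of x k] x by auto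
  have "(nb k x, x) : C" using sw x by blast
  hence "(nb k x, nb k (nb k x)) : C" using n(3) by simp
  thus "nb k x : ?X" using all[OF n(1,2)] n(1) by blast
 qed blast
 hence "darts <= C" unfolding darts_def by blast
 thus "C = letters Q" using C(1) letters_darts by blast
qed

lemma fst_letters_Q: "fst ` letters Q = V"
proof -
 have "x : fst ` darts" if x: "x : V" for x
 proof -
  obtain k where "k : col x" using finC[OF x] by blast
  hence "(x, nb k x) : darts" unfolding darts_def using x by blast
  thus ?thesis by force
 qed
 thus ?thesis unfolding letters_darts darts_def by force
qed

lemma Q_nonempty: "Q ~= {}"
 using fst_letters_Q finV(2) by (auto simp: letters_def)

lemma card_darts: "card (letters Q) = (\<Sum>x\<in>V. card (col x))"
proof -
 have "darts = (\<lambda>(x, k). (x, nb k x)) ` Sigma V col" unfolding darts_def by auto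
 moreover have "inj_on (\<lambda>(x, k). (x, nb k x)) (Sigma V col)" using nb_inj by (auto simp: inj_on_def)
 ultimately have "card darts = card (Sigma V col)" by (simp add: card_image)
 thus ?thesis unfolding letters_darts using finV finC by simp
qed

lemma card_letters_Q: "card (letters Q) = 4 * card Q"
proof -
 have ok: "finite Q" "\<And>v w. v : Q ==> w : Q ==> v ~= w ==> set v \<inter> set w = {}" using okmap_Q unfolding okmap_def by blast+
 have "card (letters Q) = (\<Sum>w\<in>Q. card (set w))"
  unfolding letters_def using ok by (intro card_UN_disjoint) auto
 also have "\<dots> = (\<Sum>w\<in>Q. 4)" using FW_word(1,2)[OF Q_FW] by (intro sum.cong) (auto simp: distinct_card)
 finally show ?thesis by simp
qed

text \<open>Four darts per face cancel the face count; doubling keeps the identity in the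
  integers.\<close>

lemma euler_Q: "2 * euler2 fst Q = 4 * int (card V) - int (\<Sum>x\<in>V. card (col x))"
 unfolding euler2_def fst_letters_Q card_darts[symmetric] card_letters_Q by (simp add: algebra_simps)

end

section \<open>Products of complete bipartite graphs and paths\<close>

lemma edges_box_product: "e : edges (G1 \<box> G2) \<longleftrightarrow> (\<exists>v1 v2 w1 w2. e = {(v1, v2), (w1, w2)} &
  (v1 = w1 & v1 : verts G1 & {v2, w2} : edges G2 \<or> {v1, w1} : edges G1 & v2 = w2 & v2 : verts G2))"
 by (simp add: box_product_def)

lemma verts_box_list: "verts (box_list Xs) = {xs. length xs = length Xs & (\<forall>t<length Xs. xs ! t : verts (Xs ! t))}"
proof (induction Xs)
 case (Cons X Xs)
 have "verts (box_list (X # Xs)) = (\<lambda>(x, xs). x # xs) ` (verts X \<times> verts (box_list Xs))"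
  by (simp add: map_graph_def box_product_def)
 also have "\<dots> = {xs. length xs = length (X # Xs) & (\<forall>t<length (X # Xs). xs ! t : verts ((X # Xs) ! t))}" (is "?A = ?B")
 proof (intro equalityI subsetI)
  fix zs assume "zs : ?A"
  thus "zs : ?B" using Cons.IH by (auto simp: nth_Cons split: nat.splits)
 next
  fix zs assume zs: "zs : ?B"
  then obtain x xs where z: "zs = x # xs" by (cases zs) auto
  have "x : verts X" using zs z by force
  moreover have "xs : verts (box_list Xs)" unfolding Cons.IH using zs z by force
  ultimately show "zs : ?A" using z by force
 qed
 finally show ?case .
qed simp

lemma edges_box_list_Cons: "e : edges (box_list (X # Xs)) \<longleftrightarrow> (\<exists>v1 v2 w1 w2. e = {v1 # v2, w1 # w2} &
  (v1 = w1 & v1 : verts X & {v2, w2} : edges (box_list Xs) \<or> {v1, w1} : edges X & v2 = w2 & v2 : verts (box_list Xs)))"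
proof -
 have "e : edges (box_list (X # Xs)) \<longleftrightarrow> (\<exists>e'. e' : edges (X \<box> box_list Xs) & e = (\<lambda>(x, xs). x # xs) ` e')"
  by (auto simp: map_graph_def)
 thus ?thesis unfolding edges_box_product by (auto, (metis (no_types, lifting) image_insert image_empty case_prod_conv)+)
qed

declare box_list.simps(2) [simp del]

lemma edges_box_list:
 "e : edges (box_list Xs) \<longleftrightarrow> (\<exists>xs t y. xs : verts (box_list Xs) & t < length Xs & {xs ! t, y} : edges (Xs ! t) & y : verts (Xs ! t) & e = {xs, xs[t := y]})"
 if wf: "\<And>X u v. X : set Xs ==> {u, v} : edges X ==> u : verts X & v : verts X"
 using wf
proof (induction Xs arbitrary: e)
 case Nil
 thus ?case by simp
next
 case (Cons X Xs)
 have IH: "e : edges (box_list Xs) \<longleftrightarrow> (\<exists>xs t y. xs : verts (box_list Xs) & t < length Xs & {xs ! t, y} : edges (Xs ! t) & y : verts (Xs ! t) & e = {xs, xs[t := y]})" for e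
  using Cons by auto
 have mem: "x # xs : verts (box_list (X # Xs)) \<longleftrightarrow> x : verts X & xs : verts (box_list Xs)" for x xs
  unfolding verts_box_list by (auto simp: nth_Cons split: nat.splits)
 show ?case
 proof
  assume "e : edges (box_list (X # Xs))"
  then obtain v1 v2 w1 w2 where e: "e = {v1 # v2, w1 # w2}" and c: "v1 = w1 & v1 : verts X & {v2, w2} : edges (box_list Xs) \<or> {v1, w1} : edges X & v2 = w2 & v2 : verts (box_list Xs)"
   unfolding edges_box_list_Cons by blast
  from c show "\<exists>xs t y. xs : verts (box_list (X # Xs)) & t < length (X # Xs) & {xs ! t, y} : edges ((X # Xs) ! t) & y : verts ((X # Xs) ! t) & e = {xs, xs[t := y]}"
  proof
   assume h: "v1 = w1 & v1 : verts X & {v2, w2} : edges (box_list Xs)"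
   then obtain xs t y where x: "xs : verts (box_list Xs)" "t < length Xs" "{xs ! t, y} : edges (Xs ! t)" "y : verts (Xs ! t)" "{v2, w2} = {xs, xs[t := y]}"
    unfolding IH by blast
   have "e = (#) v1 ` {v2, w2}" using h e by simp
   hence "e = {v1 # xs, (v1 # xs)[Suc t := y]}" unfolding x(5) by simp
   moreover have "v1 # xs : verts (box_list (X # Xs))" using x(1) h mem by blast
   ultimately show ?thesis using x(2-4) by (intro exI[of _ "v1 # xs"] exI[of _ "Suc t"] exI[of _ y]) simp
  next
   assume h: "{v1, w1} : edges X & v2 = w2 & v2 : verts (box_list Xs)"
   hence "v1 : verts X" "w1 : verts X" using Cons.prems[of X v1 w1] by auto
   hence "v1 # v2 : verts (box_list (X # Xs))" "w1 : verts X" using h mem by blast+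
   thus ?thesis using h e by (intro exI[of _ "v1 # v2"] exI[of _ 0] exI[of _ w1]) simp
  qed
 next
  assume "\<exists>xs t y. xs : verts (box_list (X # Xs)) & t < length (X # Xs) & {xs ! t, y} : edges ((X # Xs) ! t) & y : verts ((X # Xs) ! t) & e = {xs, xs[t := y]}"
  then obtain zs t y where z: "zs : verts (box_list (X # Xs))" "t < length (X # Xs)" "{zs ! t, y} : edges ((X # Xs) ! t)" "y : verts ((X # Xs) ! t)" "e = {zs, zs[t := y]}" by blast
  obtain x xs where zs: "zs = x # xs" using z(1) unfolding verts_box_list by (cases zs) auto
  have m: "x : verts X" "xs : verts (box_list Xs)" using z(1) mem zs by auto
  show "e : edges (box_list (X # Xs))"
  proof (cases t)
   case 0
   thus ?thesis unfolding edges_box_list_Cons using z(3,5) zs m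
    by (intro exI[of _ x] exI[of _ xs] exI[of _ y]) simp
  next
   case (Suc u)
   hence "{xs, xs[u := y]} : edges (box_list Xs)" unfolding IH using z m zs by auto
   thus ?thesis unfolding edges_box_list_Cons using z(5) zs m Suc
    by (intro exI[of _ x] exI[of _ xs] exI[of _ x] exI[of _ "xs[u := y]"]) simp
  qed
 qed
qed

section \<open>Cyclic successors in a list and counting in products\<close>

definition pos :: "'a list => 'a => nat" where "pos xs k = (THE t. t < length xs & xs ! t = k)"

definition csucc :: "'a list => 'a => 'a" where "csucc xs k = xs ! ((pos xs k + 1) mod length xs)"

lemma csucc_nth:
 assumes "distinct xs" "t < length xs"
 shows "csucc xs (xs ! t) = xs ! ((t + 1) mod length xs)"
proof -
 have "pos xs (xs ! t) = t" unfolding pos_def using assms by (intro the_equality) (auto simp: nth_eq_iff_index_eq)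
 thus ?thesis by (simp add: csucc_def)
qed

lemma csucc_in: "distinct xs ==> k : set xs ==> csucc xs k : set xs"
 by (metis csucc_nth in_set_conv_nth length_pos_if_in_set mod_less_divisor nth_mem)

lemma csucc_neq:
 assumes "distinct xs" "2 <= length xs" "k : set xs"
 shows "csucc xs k ~= k"
proof -
 obtain t where t: "t < length xs" "k = xs ! t" using assms(3) by (metis in_set_conv_nth)
 have "(t + 1) mod length xs ~= t & (t + 1) mod length xs < length xs"
 proof (cases "t + 1 = length xs")
  case True
  hence "(t + 1) mod length xs = 0" by simp
  thus ?thesis using True assms(2) by linarith
 next
  case False
  hence "(t + 1) mod length xs = t + 1" using t(1) by simp
  thus ?thesis using False t(1) by linarith
 qed
 thus ?thesis unfolding t(2) csucc_nth[OF assms(1) t(1)] using nth_eq_iff_index_eq[OF assms(1)] t(1) by simp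
qed

lemma csucc_inj:
 assumes "distinct xs"
 shows "inj_on (csucc xs) (set xs)"
proof (rule inj_onI)
 fix k k' assume k: "k : set xs" "k' : set xs" "csucc xs k = csucc xs k'"
 obtain t where t: "t < length xs" "k = xs ! t" using k(1) by (metis in_set_conv_nth)
 obtain t' where t': "t' < length xs" "k' = xs ! t'" using k(2) by (metis in_set_conv_nth)
 have l: "(u + 1) mod length xs < length xs" for u using t(1) by (intro mod_less_divisor) linarith
 have "(t + 1) mod length xs = (t' + 1) mod length xs"
  using k(3) nth_eq_iff_index_eq[OF assms l l] unfolding t(2) t'(2) csucc_nth[OF assms t(1)] csucc_nth[OF assms t'(1)] by simp
 hence "t = t'" using t(1) t'(1) by (cases "t + 1 = length xs"; cases "t' + 1 = length xs") auto
 thus "k = k'" using t t' by simp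
qed

lemma csucc_cycle:
 assumes d: "distinct xs" and A: "A <= set xs" "A ~= {}" "\<And>k. k : A ==> csucc xs k : A"
 shows "A = set xs"
proof -
 obtain t where t: "t < length xs" "xs ! t : A" using A(1,2) by (metis in_set_conv_nth equals0I subsetD)
 have pos: "0 < length xs" by (rule le_less_trans[OF le0 t(1)])
 have all: "xs ! ((t + u) mod length xs) : A" for u
 proof (induction u)
  case 0
  thus ?case using t by simp
 next
  case (Suc u)
  have "csucc xs (xs ! ((t + u) mod length xs)) = xs ! (((t + u) mod length xs + 1) mod length xs)"
   using pos by (intro csucc_nth[OF d]) simp
  thus ?case using A(3)[OF Suc] by (simp add: mod_simps)
 qed
 have "xs ! v : A" if v: "v < length xs" for v
 proof -
  have "(t + (v + length xs - t)) mod length xs = v" using v t(1) by simp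
  thus ?thesis using all[of "v + length xs - t"] by simp
 qed
 hence "set xs <= A" by (metis in_set_conv_nth subsetI)
 thus ?thesis using A(1) by blast
qed

lemma card_boxed_lists:
 assumes "\<And>s. s < j ==> finite (D s)"
 shows "finite {b. length b = j & (\<forall>s<j. b ! s : D s)}" "card {b. length b = j & (\<forall>s<j. b ! s : D s)} = (\<Prod>s<j. card (D s))"
proof -
 let ?P = "PiE {..<j} D"
 have e: "{b. length b = j & (\<forall>s<j. b ! s : D s)} = (\<lambda>h. map h [0..<j]) ` ?P"
 proof (intro equalityI subsetI)
  fix b assume b: "b : {b. length b = j & (\<forall>s<j. b ! s : D s)}"
  thus "b : (\<lambda>h. map h [0..<j]) ` ?P"
   by (intro image_eqI[of _ _ "restrict (nth b) {..<j}"]) (auto intro!: nth_equalityI)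
 next
  fix b assume "b : (\<lambda>h. map h [0..<j]) ` ?P"
  then obtain h where "h : ?P" "b = map h [0..<j]" by blast
  thus "b : {b. length b = j & (\<forall>s<j. b ! s : D s)}" by (simp add: PiE_mem)
 qed
 have inj: "inj_on (\<lambda>h. map h [0..<j]) ?P"
 proof (rule inj_onI)
  fix h h' assume h: "h : ?P" "h' : ?P" "map h [0..<j] = map h' [0..<j]"
  have hu: "h u = h' u" if "u : {..<j}" for u using h(3) that by simp
  show "h = h'" by (rule PiE_ext[OF h(1,2) hu])
 qed
 show "finite {b. length b = j & (\<forall>s<j. b ! s : D s)}" unfolding e using assms by (intro finite_imageI finite_PiE) auto
 show "card {b. length b = j & (\<forall>s<j. b ! s : D s)} = (\<Prod>s<j. card (D s))" unfolding e card_image[OF inj] by (simp add: card_PiE)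
qed

text \<open>Entries are replaced one at a time from the left, which reduces connectedness of a
  product to its factors.\<close>

lemma update_all:
 assumes X: "xs : X" and len: "length ys = length xs" and D: "\<And>t. t < length xs ==> ys ! t : D t"
  and up: "\<And>zs t y. zs : X ==> length zs = length xs ==> t < length xs ==> y : D t ==> zs[t := y] : X"
 shows "ys : X"
proof -
 have "take l ys @ drop l xs : X" if "l <= length xs" for l
  using that
 proof (induction l)
  case 0
  thus ?case using X by simp
 next
  case (Suc l)
  have "(take l ys @ drop l xs)[l := ys ! l] : X" using Suc D len by (intro up) auto
  moreover have "(take l ys @ drop l xs)[l := ys ! l] = take (Suc l) ys @ drop (Suc l) xs"
   using Suc.prems len by (auto intro!: nth_equalityI simp: nth_append nth_list_update)
  ultimately show ?case by simp
 qed
 from this[of "length xs"] show ?thesis using len by simp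
qed

text \<open>\<open>K t\<close> is matching number \<open>t mod n\<close> in the bipartite factor
  \<open>t div n\<close>. On path number \<open>s\<close>, \<open>PA s\<close> pairs
  \<open>2 q\<close> with \<open>2 q + 1\<close> and \<open>PB s\<close> pairs
  \<open>2 q + 1\<close> with \<open>2 q + 2\<close>.\<close>

datatype colour = K nat | PA nat | PB nat

text \<open>
 In one factor, colour \<open>c\<close> is a perfect matching of the complete bipartite graph, shifting by
 \<open>c\<close> upwards from even and downwards from odd vertices of the first part; matchings whose
 indices have different parity commute.
\<close>

definition neg :: "nat => nat => nat" where "neg n c = n - c"

definition mt :: "nat => nat => nat + nat => nat + nat" where
 "mt n c z = (case z of
   Inl q => Inr (if even q then (q + c) mod n else (q + neg n c) mod n)
  | Inr q => Inl (if even (q + c) then (q + neg n c) mod n else (q + c) mod n))"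

definition part :: "nat => (nat + nat) set" where "part n = {..<n} <+> {..<n}"

lemma mt_simps: "mt n c (Inl q) = Inr (if even q then (q + c) mod n else (q + neg n c) mod n)"
 "mt n c (Inr q) = Inl (if even (q + c) then (q + neg n c) mod n else (q + c) mod n)"
 by (simp_all add: mt_def)

lemma even_mod: "even n ==> even (q mod n) \<longleftrightarrow> even (q::nat)"
 by (simp add: dvd_mod_iff)

lemma shift_cancel:
 assumes "c < n" "q < (n::nat)"
 shows "((q + c) mod n + neg n c) mod n = q" "((q + neg n c) mod n + c) mod n = q"
proof -
 have "(q + c + neg n c) mod n = q" "(q + neg n c + c) mod n = q" using assms by (auto simp: neg_def)
 thus "((q + c) mod n + neg n c) mod n = q" "((q + neg n c) mod n + c) mod n = q" by (simp_all only: mod_add_left_eq)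
qed

lemma shift_inj:
 assumes "c < n" "c' < (n::nat)" "(q + c) mod n = (q + c') mod n"
 shows "c = c'"
proof -
 have "((q + c) mod n + (n - q mod n)) mod n = ((q + c') mod n + (n - q mod n)) mod n" using assms(3) by simp
 moreover have "((q + u) mod n + (n - q mod n)) mod n = u" if "u < n" for u
 proof -
  have "((q + u) mod n + k) mod n = (q mod n + u + k) mod n" for k by (simp only: mod_add_left_eq add.assoc)
  hence "((q + u) mod n + (n - q mod n)) mod n = (q mod n + u + (n - q mod n)) mod n" .
  also have "q mod n + u + (n - q mod n) = u + n" using that by simp
  finally show ?thesis using that by simp
 qed
 ultimately show ?thesis using assms by metis
qed

lemma shift_inj_minus:
 assumes "c < n" "c' < (n::nat)" "q < n" "(q + neg n c) mod n = (q + neg n c') mod n"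
 shows "c = c'"
proof -
 have "((q + neg n c) mod n + c + c') mod n = (q + c') mod n" using shift_cancel(2)[OF assms(1,3)] by (metis mod_add_left_eq)
 moreover have "((q + neg n c') mod n + c' + c) mod n = (q + c) mod n" using shift_cancel(2)[OF assms(2,3)] by (metis mod_add_left_eq)
 ultimately have "(q + c) mod n = (q + c') mod n" using assms(4) by (simp add: add.commute add.left_commute)
 thus ?thesis by (rule shift_inj[OF assms(1,2)])
qed

context
 fixes n :: nat
 assumes n: "even n" "0 < n"
begin

lemma mt_part: "z : part n ==> mt n c z : part n"
 using n by (auto simp: part_def mt_simps)

lemma mt_neq: "mt n c z ~= z"
 by (cases z) (auto simp: mt_simps)

lemma even_neg: "c < n ==> even (neg n c) \<longleftrightarrow> even c"
 using n by (simp add: neg_def)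

lemma mt_mt:
 assumes "z : part n" "c < n"
 shows "mt n c (mt n c z) = z"
 using assms shift_cancel[OF assms(2)] by (cases z) (auto simp: part_def mt_simps even_mod[OF n(1)] even_neg)

lemma mt_inj:
 assumes "z : part n" "c < n" "c' < n" "mt n c z = mt n c' z"
 shows "c = c'"
proof (cases z)
 case (Inl q)
 thus ?thesis using assms shift_inj[OF assms(2,3), of q] shift_inj_minus[OF assms(2,3), of q] by (auto simp: part_def mt_simps split: if_splits)
next
 case (Inr q)
 have q: "q < n" using assms(1) Inr by (auto simp: part_def)
 have e: "even (q + c) \<longleftrightarrow> even (if even (q + c) then (q + neg n c) mod n else (q + c) mod n)" if "c < n" for c
  using even_mod[OF n(1)] even_neg[OF that] by simp
 have eq: "(if even (q + c) then (q + neg n c) mod n else (q + c) mod n) = (if even (q + c') then (q + neg n c') mod n else (q + c') mod n)"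
  using assms(4) Inr by (simp add: mt_simps)
 have "even (q + c) \<longleftrightarrow> even (if even (q + c') then (q + neg n c') mod n else (q + c') mod n)" using e[OF assms(2)] unfolding eq .
 also have "\<dots> \<longleftrightarrow> even (q + c')" using e[OF assms(3)] by (rule sym)
 finally have "even (q + c) \<longleftrightarrow> even (q + c')" .
 show ?thesis
 proof (cases "even (q + c)")
  case True
  hence "(q + neg n c) mod n = (q + neg n c') mod n" using eq \<open>even (q + c) \<longleftrightarrow> even (q + c')\<close> by (simp only: if_True)
  thus ?thesis by (rule shift_inj_minus[OF assms(2,3) q])
 next
  case False
  hence "(q + c) mod n = (q + c') mod n" using eq \<open>even (q + c) \<longleftrightarrow> even (q + c')\<close> by (simp only: if_False)
  thus ?thesis by (rule shift_inj[OF assms(2,3)])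
 qed
qed

text \<open>From \<open>Inl q\<close> either order shifts twice in the same direction, so the total
  is \<open>c + c'\<close> or its negative. From \<open>Inr q\<close> either order shifts up by the
  one index and down by the other, and opposite parity makes this the same choice in both
  orders.\<close>

lemma mt_commute:
 assumes "z : part n" "c < n" "c' < n" "odd (c + c')"
 shows "mt n c (mt n c' z) = mt n c' (mt n c z)"
proof (cases z)
 case (Inl q)
 show ?thesis
  using assms even_neg[OF assms(2)] even_neg[OF assms(3)] unfolding Inl mt_simps
  by (auto simp: even_mod[OF n(1)] mod_simps ac_simps)
next
 case (Inr q)
 show ?thesis
  using assms even_neg[OF assms(2)] even_neg[OF assms(3)] unfolding Inr mt_simps
  by (auto simp: even_mod[OF n(1)] mod_simps ac_simps)
qed

lemma mt_surj:
 assumes "q < n" "q' < n"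
 shows "\<exists>c<n. mt n c (Inl q) = Inr q'" "\<exists>c<n. mt n c (Inr q) = Inl q'"
proof -
 let ?f = "\<lambda>c. projr (mt n c (Inl q))"
 have "inj_on ?f {..<n}"
 proof (rule inj_onI)
  fix c c' assume c: "c : {..<n}" "c' : {..<n}" "?f c = ?f c'"
  hence "mt n c (Inl q) = mt n c' (Inl q)" by (simp add: mt_simps)
  thus "c = c'" using mt_inj[of "Inl q" c c'] c assms by (auto simp: part_def)
 qed
 moreover have "?f ` {..<n} <= {..<n}" using n by (auto simp: mt_simps)
 ultimately have "?f ` {..<n} = {..<n}" by (simp add: endo_inj_surj)
 hence "q' : ?f ` {..<n}" using assms by simp
 then obtain c where "c < n" "?f c = q'" by blast
 thus "\<exists>c<n. mt n c (Inl q) = Inr q'" by (auto simp: mt_simps)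
 let ?h = "\<lambda>c. projl (mt n c (Inr q))"
 have "inj_on ?h {..<n}"
 proof (rule inj_onI)
  fix c c' assume c: "c : {..<n}" "c' : {..<n}" "?h c = ?h c'"
  hence "mt n c (Inr q) = mt n c' (Inr q)" by (simp add: mt_simps)
  thus "c = c'" using mt_inj[of "Inr q" c c'] c assms by (auto simp: part_def)
 qed
 moreover have "?h ` {..<n} <= {..<n}" using n by (auto simp: mt_simps)
 ultimately have "?h ` {..<n} = {..<n}" by (simp add: endo_inj_surj)
 hence "q' : ?h ` {..<n}" using assms by simp
 then obtain c where "c < n" "?h c = q'" by blast
 thus "\<exists>c<n. mt n c (Inr q) = Inl q'" by (auto simp: mt_simps)
qed

end

text \<open>The two matchings that partition the edges of a path. On \<open>2 m\<close> vertices
  \<open>flip\<close> is perfect, whereas \<open>flop\<close> has no edge at the two ends; there its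
  value is a junk value, excluded by \<open>avail\<close>. The missing \<open>2\<close> out of
  \<open>2 m\<close> give the term \<open>1/m\<close>.\<close>

definition flip :: "nat => nat" where "flip q = (if even q then q + 1 else q - 1)"
definition flop :: "nat => nat" where "flop q = (if odd q then q + 1 else q - 1)"

lemma even_sum_list_update:
 assumes "k < length ns" "odd (v + ns ! k)"
 shows "even (sum_list (ns[k := v])) \<longleftrightarrow> odd (sum_list (ns :: nat list))"
proof -
 have "sum_list (ns[k := v]) = sum_list ns + v - ns ! k" using assms(1) by (rule sum_list_update)
 moreover have "ns ! k <= sum_list ns" using assms(1) by (rule elem_le_sum_list)
 ultimately have "sum_list (ns[k := v]) + ns ! k = sum_list ns + v" by simp
 thus ?thesis using assms(2) by presburger
qed

lemma path_edge: "{q, y} : edges (path_graph N) \<longleftrightarrow> (y = Suc q & Suc q < N) \<or> (q = Suc y & Suc y < N)"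
 by (auto simp: path_graph_def doubleton_eq_iff)

lemma bipartite_edge: "{z, y} : edges (complete_bipartite n n) \<longleftrightarrow>
  (\<exists>u v. u < n & v < n & (z = Inl u & y = Inr v \<or> z = Inr v & y = Inl u))"
 by (auto simp: complete_bipartite_def doubleton_eq_iff)

lemma flip_flip: "flip (flip q) = q" and flip_neq: "flip q ~= q" and flip_odd: "odd (flip q + q)"
 by (auto simp: flip_def elim: oddE)

lemma flip_less: "q < 2 * M ==> flip q < 2 * (M::nat)"
 by (auto simp: flip_def elim!: evenE)

lemma flop_flop: "0 < q ==> flop (flop q) = q" and flop_odd: "0 < q ==> odd (flop q + q)" and flop_flip: "0 < q ==> flop q ~= flip q"
 by (auto simp: flop_def flip_def elim!: oddE)

lemma flop_range:
 fixes M :: nat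
 assumes "0 < q" "q < 2 * M - 1"
 shows "0 < flop q" "flop q < 2 * M - 1"
proof -
 have "(odd q --> q + 2 < 2 * M) & (even q --> 1 < q)" using assms by presburger
 thus "0 < flop q" "flop q < 2 * M - 1" using assms by (auto simp: flop_def)
qed

section \<open>The coloured product graph and its rotation\<close>

locale grid =
 fixes i r j :: nat and m :: "nat => nat"
 assumes i1: "1 <= i" and r1: "1 <= r" and j1: "1 <= j" and m1: "s < j ==> 1 <= m (Suc s)"
begin

definition n :: nat where "n = 2 * r"

lemma n: "even n" "0 < n" "2 <= n" using r1 by (auto simp: n_def)

definition A :: "(nat + nat) list set" where "A = {a. length a = i & (\<forall>t<i. a ! t : part n)}"
definition B :: "nat list set" where "B = {b. length b = j & (\<forall>s<j. b ! s : {..<2 * m (Suc s)})}"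

definition avail :: "nat list => nat => bool" where
 "avail b s \<longleftrightarrow> 0 < b ! s & b ! s < 2 * m (Suc s) - 1"

definition col :: "(nat + nat) list \<times> nat list => colour set" where
 "col x = K ` {..<n * i} \<union> PA ` {..<j} \<union> PB ` {s. s < j & avail (snd x) s}"

primrec nb :: "colour => (nat + nat) list \<times> nat list => (nat + nat) list \<times> nat list" where
 "nb (K t) x = ((fst x)[t div n := mt n (t mod n) (fst x ! (t div n))], snd x)"
| "nb (PA s) x = (fst x, (snd x)[s := flip (snd x ! s)])"
| "nb (PB s) x = (fst x, (snd x)[s := flop (snd x ! s)])"

definition ev :: "(nat + nat) list \<times> nat list => bool" where
 "ev x \<longleftrightarrow> even (sum_list (map (\<lambda>z. if isl z then 0 else 1) (fst x)) + sum_list (snd x))"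

text \<open>Cyclic neighbours have to commute. Matchings \<open>K\<close> are adjacent only to
  \<open>K\<close> of opposite parity, also across the wrap-around since \<open>n * i\<close> is
  even, and they commute with all path colours, so they keep the \<open>PA\<close> away from the
  \<open>PB\<close>. A \<open>PA\<close> step can change which \<open>PB\<close> exist; therefore
  the \<open>PA\<close> stand between \<open>K 0\<close> and \<open>K 1\<close>, which are present
  at every vertex.\<close>

definition ord :: "(nat + nat) list \<times> nat list => colour list" where
 "ord x = K 0 # map PA [0..<j] @ map K [1..<n * i] @ map PB (filter (avail (snd x)) [0..<j])"

lemma ni: "2 <= n * i" "even (n * i)" using n i1 by (auto intro: order_trans[OF n(3)])

lemma colour_index: "t < n * i ==> t div n < i" "t mod n < n"
 using n(2) by (simp_all add: less_mult_imp_div_less mult.commute)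

lemma set_ord: "set (ord x) = col x"
proof -
 have "{..<n * i} = insert 0 {1..<n * i}" using ni by auto
 hence "K ` {..<n * i} = insert (K 0) (K ` {1..<n * i})" by (simp only: image_insert)
 thus ?thesis by (auto simp: ord_def col_def)
qed

lemma distinct_ord: "distinct (ord x)"
 by (auto simp: ord_def distinct_map inj_on_def)

lemma length_ord: "length (ord x) = j + n * i + length (filter (avail (snd x)) [0..<j])"
 using ni by (simp add: ord_def)

lemma ord_nth: "ord x ! 0 = K 0" "s < j ==> ord x ! Suc s = PA s" "1 <= a ==> a < n * i ==> ord x ! (j + a) = K a"
 "u < length (filter (avail (snd x)) [0..<j]) ==> ord x ! (j + n * i + u) = PB (filter (avail (snd x)) [0..<j] ! u)"
proof -
 show "ord x ! 0 = K 0" by (simp add: ord_def)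
 show "s < j ==> ord x ! Suc s = PA s" by (simp add: ord_def nth_append)
 show "ord x ! (j + a) = K a" if a: "1 <= a" "a < n * i"
 proof -
  obtain a' where a': "a = Suc a'" using a by (cases a) auto
  hence "a' < n * i - 1" using a by linarith
  thus ?thesis unfolding a' ord_def by (simp add: nth_append)
 qed
 show "ord x ! (j + n * i + u) = PB (filter (avail (snd x)) [0..<j] ! u)" if u: "u < length (filter (avail (snd x)) [0..<j])"
 proof -
  have e: "j + n * i + u = Suc (j + ((n * i - 1) + u))" using ni by simp
  show ?thesis unfolding e ord_def using u by (simp add: nth_append)
 qed
qed

lemma VB: "x : A \<times> B ==> length (fst x) = i & length (snd x) = j"
 "x : A \<times> B ==> t < i ==> fst x ! t : part n"
 "x : A \<times> B ==> s < j ==> snd x ! s < 2 * m (Suc s)"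
 by (auto simp: A_def B_def)

lemma A_update: "a : A ==> t < i ==> z : part n ==> a[t := z] : A"
 by (auto simp: A_def nth_list_update)

lemma B_update: "b : B ==> y < 2 * m (Suc s) ==> b[s := y] : B"
 by (cases "s < length b") (auto simp: B_def nth_list_update list_update_beyond)

text \<open>Only a \<open>PA\<close> step can move between an end of a path and its inner vertices;
  a \<open>PB\<close> step joins inner vertices.\<close>

lemma avail_nb:
 assumes "x : A \<times> B" "k : col x" "\<And>s. k ~= PA s" "s < j"
 shows "avail (snd (nb k x)) s \<longleftrightarrow> avail (snd x) s"
proof (cases k)
 case (PB u)
 hence "u < j" "avail (snd x) u" using assms(2) by (auto simp: col_def)
 thus ?thesis using PB flop_range[of "snd x ! u" "m (Suc u)"] VB(1)[OF assms(1)] by (cases "s = u") (auto simp: avail_def)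
qed (use assms(3) in auto)

lemma ord_nb:
 assumes "x : A \<times> B" "k : col x" "\<And>s. k ~= PA s"
 shows "ord (nb k x) = ord x"
proof -
 have "filter (avail (snd (nb k x))) [0..<j] = filter (avail (snd x)) [0..<j]"
  using avail_nb[OF assms] by (intro filter_cong) auto
 thus ?thesis by (simp add: ord_def)
qed

lemma isl_mt: "isl (mt n c z) \<longleftrightarrow> \<not> isl z"
 by (cases z) (auto simp: mt_simps)

lemma nb_props:
 assumes x: "x : A \<times> B" and k: "k : col x"
 shows "nb k x : A \<times> B & k : col (nb k x) & nb k (nb k x) = x & ev (nb k x) ~= ev x"
proof -
 obtain a b where ab: "x = (a, b)" "a : A" "b : B" using x by auto
 have l: "length a = i" "length b = j" using VB(1)[OF x] ab by auto
 show ?thesis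
 proof (cases k)
  case (K t)
  hence t: "t < n * i" using k by (auto simp: col_def)
  let ?p = "t div n" and ?c = "t mod n"
  have p: "?p < i" "?c < n" using colour_index(1)[OF t] colour_index(2) by auto
  have z: "a ! ?p : part n" using VB(2)[OF x p(1)] ab by simp
  let ?f = "\<lambda>z. if isl z then 0 else (1::nat)"
  have "odd (?f (mt n ?c (a ! ?p)) + map ?f a ! ?p)" using isl_mt[of ?c "a ! ?p"] p l by auto
  hence "even (sum_list ((map ?f a)[?p := ?f (mt n ?c (a ! ?p))])) \<longleftrightarrow> odd (sum_list (map ?f a))" using p l by (intro even_sum_list_update) auto
  hence "even (sum_list (map ?f (a[?p := mt n ?c (a ! ?p)]))) \<longleftrightarrow> odd (sum_list (map ?f a))" by (simp only: map_update)
  moreover have "ev (nb k x) \<longleftrightarrow> even (sum_list (map ?f (a[?p := mt n ?c (a ! ?p)])) + sum_list b)"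
   "ev x \<longleftrightarrow> even (sum_list (map ?f a) + sum_list b)"
   unfolding K ab(1) by (simp_all only: ev_def nb.simps fst_conv snd_conv)
  ultimately have "ev (nb k x) ~= ev x" unfolding even_add by blast
  moreover have "nb k x : A \<times> B" using A_update[OF ab(2) p(1) mt_part[OF n(1,2) z]] ab K by simp
  moreover have "nb k (nb k x) = x" using K ab p l mt_mt[OF n(1,2) z p(2)] by simp
  moreover have "k : col (nb k x)" using K t by (auto simp: col_def)
  ultimately show ?thesis by blast
 next
  case (PA s)
  hence s: "s < j" using k by (auto simp: col_def)
  have q: "b ! s < 2 * m (Suc s)" using VB(3)[OF x s] ab by simp
  have "even (sum_list (b[s := flip (b ! s)])) \<longleftrightarrow> odd (sum_list b)" using s l flip_odd by (intro even_sum_list_update) auto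
  hence "ev (nb k x) ~= ev x" using PA ab by (simp add: ev_def)
  moreover have "nb k x : A \<times> B" using B_update[OF ab(3) flip_less[OF q]] ab PA by simp
  moreover have "nb k (nb k x) = x" using PA ab s l by (simp add: flip_flip)
  moreover have "k : col (nb k x)" using PA s by (auto simp: col_def)
  ultimately show ?thesis by blast
 next
  case (PB s)
  hence s: "s < j" "avail b s" using k ab by (auto simp: col_def)
  have q: "0 < b ! s" "b ! s < 2 * m (Suc s) - 1" using s(2) by (auto simp: avail_def)
  have "even (sum_list (b[s := flop (b ! s)])) \<longleftrightarrow> odd (sum_list b)" using s l flop_odd[OF q(1)] by (intro even_sum_list_update) auto
  hence "ev (nb k x) ~= ev x" using PB ab by (simp add: ev_def)
  moreover have "flop (b ! s) < 2 * m (Suc s)" using flop_range(2)[OF q] by simp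
  hence "nb k x : A \<times> B" using B_update[OF ab(3)] ab PB by simp
  moreover have "nb k (nb k x) = x" using PB ab s l flop_flop[OF q(1)] by simp
  moreover have "k : col (nb k x)" using PB s avail_nb[OF x k, of s] ab by (auto simp: col_def)
  ultimately show ?thesis by blast
 qed
qed

lemma nb_inject:
 assumes x: "x : A \<times> B" and k: "k : col x" "k' : col x" and eq: "nb k x = nb k' x"
 shows "k = k'"
proof -
 obtain a b where ab: "x = (a, b)" "a : A" "b : B" using x by auto
 have l: "length a = i" "length b = j" using VB(1)[OF x] ab by auto
 have upd: "p = p'" if "xs[p := y] = xs[p' := y']" "y ~= xs ! p" "p < length xs" for xs :: "'z list" and p p' y y'
  using that by (metis nth_list_update_eq nth_list_update_neq)
 have upe: "y = y'" if "xs[p := y] = xs[p := y']" "p < length xs" for xs :: "'z list" and p y y'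
  using that by (metis nth_list_update_eq)
 have chg: "xs[p := y] ~= xs" if "y ~= xs ! p" "p < length xs" for xs :: "'z list" and p y
  using that by (metis nth_list_update_eq)
 have av: "s < j & 0 < b ! s" if "PB s : col x" for s using that ab by (auto simp: col_def avail_def)
 have sj: "s < j" if "PA s : col x" for s using that by (auto simp: col_def)
 have tj: "t div n < i" "t < n * i" if "K t : col x" for t using that colour_index(1) by (auto simp: col_def)
 have fn: "flop q ~= q" if "0 < q" for q using flop_odd[OF that] by auto
 have kk: "t = t'" if t: "K t : col x" "K t' : col x" "nb (K t) x = nb (K t') x" for t t'
 proof -
  have e: "a[t div n := mt n (t mod n) (a ! (t div n))] = a[t' div n := mt n (t' mod n) (a ! (t' div n))]" using t(3) ab by simp
  hence p: "t div n = t' div n" using upd[OF e mt_neq[OF n(1,2)]] tj[OF t(1)] l by simp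
  have "mt n (t mod n) (a ! (t div n)) = mt n (t' mod n) (a ! (t div n))" using upe[OF e[folded p]] tj[OF t(1)] l by simp
  hence "t mod n = t' mod n" using VB(2)[OF x tj(1)[OF t(1)]] ab colour_index(2) by (intro mt_inj[OF n(1,2)]) auto
  thus "t = t'" using p by (metis div_mult_mod_eq)
 qed
 show ?thesis
 proof (cases k)
  case k1: (K t)
  show ?thesis
  proof (cases k')
   case (K t')
   thus ?thesis using kk k eq k1 by blast
  next
   case (PA s)
   thus ?thesis using eq chg[of "mt n (t mod n) (a ! (t div n))" a "t div n"] mt_neq[OF n(1,2)] k1 tj k l ab by auto
  next
   case (PB s)
   thus ?thesis using eq chg[of "mt n (t mod n) (a ! (t div n))" a "t div n"] mt_neq[OF n(1,2)] k1 tj k l ab by auto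
  qed
 next
  case k1: (PA s)
  show ?thesis
  proof (cases k')
   case (K t)
   thus ?thesis using eq[symmetric] chg[of "mt n (t mod n) (a ! (t div n))" a "t div n"] mt_neq[OF n(1,2)] k1 tj k l ab by auto
  next
   case (PA s')
   thus ?thesis using eq upd[of b s "flip (b ! s)" s'] flip_neq sj k k1 l ab by auto
  next
   case (PB s')
   have e: "b[s := flip (b ! s)] = b[s' := flop (b ! s')]" using eq k1 PB ab by simp
   hence "s = s'" using upd[OF e flip_neq] sj k k1 l by auto
   thus ?thesis using upe[of b s "flip (b ! s)" "flop (b ! s)"] e flop_flip av k k1 PB l by (metis)
  qed
 next
  case k1: (PB s)
  have s: "s < j" "0 < b ! s" using av k k1 by auto
  show ?thesis
  proof (cases k')
   case (K t)
   thus ?thesis using eq[symmetric] chg[of "mt n (t mod n) (a ! (t div n))" a "t div n"] mt_neq[OF n(1,2)] k1 tj k l ab by auto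
  next
   case (PA s')
   have e: "b[s := flop (b ! s)] = b[s' := flip (b ! s')]" using eq k1 PA ab by simp
   hence "s = s'" using upd[OF e fn[OF s(2)]] s l by auto
   thus ?thesis using upe[of b s "flop (b ! s)" "flip (b ! s)"] e flop_flip[OF s(2)] s l by metis
  next
   case (PB s')
   thus ?thesis using eq upd[of b s "flop (b ! s)" s'] fn[OF s(2)] s k1 l ab by auto
  qed
 qed
qed

text \<open>A sufficient test for commuting involutions. For \<open>K\<close> the parity suffices
  because \<open>n\<close> is even, so it survives reduction modulo \<open>n\<close> within one
  factor. \<open>PA\<close> and \<open>PB\<close> are rejected altogether; they are never neighbours
  in \<open>ord\<close>.\<close>

fun cm :: "colour => colour => bool" where
 "cm (K t) (K u) \<longleftrightarrow> odd (t + u)"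
| "cm (PA s) (PA u) \<longleftrightarrow> s ~= u"
| "cm (PB s) (PB u) \<longleftrightarrow> s ~= u"
| "cm (K t) _ \<longleftrightarrow> True"
| "cm _ (K t) \<longleftrightarrow> True"
| "cm _ _ \<longleftrightarrow> False"

lemma nb_commute:
 assumes x: "x : A \<times> B" and k: "k : col x" "k' : col x" and c: "cm k k'"
 shows "nb k' (nb k x) = nb k (nb k' x)"
proof -
 obtain a b where ab: "x = (a, b)" "a : A" "b : B" using x by auto
 have l: "length a = i" "length b = j" using VB(1)[OF x] ab by auto
 show ?thesis using c
 proof (cases rule: cm.elims(2))
  case (1 t u)
  have tu: "t div n < i" "u div n < i" using k 1 colour_index(1) by (auto simp: col_def)
  show ?thesis
  proof (cases "t div n = u div n")
   case True
   have "odd (t mod n + u mod n)" using 1(3) even_mod[OF n(1)] by simp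
   hence "mt n (t mod n) (mt n (u mod n) (a ! (u div n))) = mt n (u mod n) (mt n (t mod n) (a ! (u div n)))"
    using VB(2)[OF x tu(2)] ab colour_index(2) by (intro mt_commute[OF n(1,2)]) auto
   thus ?thesis using 1 ab True tu l by simp
  next
   case False
   thus ?thesis using 1 ab tu l list_update_swap[OF False, of a] by simp
  qed
 next
  case (2 s u)
  thus ?thesis using ab l list_update_swap[OF 2(3), of b] by simp
 next
  case (3 s u)
  thus ?thesis using ab l list_update_swap[OF 3(3), of b] by simp
 qed (use ab in simp_all)
qed

lemma square:
 assumes x: "x : A \<times> B" and k: "k : col x" and k': "csucc (ord x) k = k'"
 shows "k' : col (nb k x) & csucc (ord (nb k x)) k = k' & k : col (nb k' x) & csucc (ord (nb k' x)) k = k' & nb k' (nb k x) = nb k (nb k' x)"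
proof -
 obtain q where q: "q < length (ord x)" "k = ord x ! q" using k unfolding set_ord[symmetric] in_set_conv_nth by blast
 let ?F = "filter (avail (snd x)) [0..<j]"
 have k'q: "k' = ord x ! ((q + 1) mod length (ord x))" using csucc_nth[OF distinct_ord q(1)] k' q(2) by simp
 have k'c: "k' : col x" using csucc_in[OF distinct_ord] k k' set_ord by metis
 show ?thesis
 proof (cases "q <= j")
  \<comment> \<open>The positions up to \<open>j + 1\<close> hold \<open>K 0\<close>, the
    \<open>PA\<close> and \<open>K 1\<close> at every vertex; so the successor of \<open>k\<close>
    is the same everywhere, even where a \<open>PA\<close> step changes the rest of the
    list.\<close>
  case True
  have pre: "ord y ! u = (if u = 0 then K 0 else if u <= j then PA (u - 1) else K 1)" if "u <= j + 1" for y u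
   using that ord_nth(1)[of y] ord_nth(2)[of "u - 1" y] ord_nth(3)[of 1 y] ni by (cases u) (auto simp: le_Suc_eq)
  have ln: "q + 1 < length (ord y)" for y using True ni by (simp add: length_ord)
  have k'1: "k' = ord x ! (q + 1)" using k'q ln[of x] by simp
  have yy: "k = ord y ! q" "k' = ord y ! (q + 1)" for y unfolding q(2) k'1 using pre[of q] pre[of "q + 1"] True by simp_all
  have cy: "k : col y" "k' : col y" for y using yy[of y] ln[of y] unfolding set_ord[symmetric] by (metis nth_mem add_lessD1)+
  have sy: "csucc (ord y) k = k'" for y
   using csucc_nth[OF distinct_ord, of q y] yy[of y] ln[of y] by simp
  have kk: "k = (if q = 0 then K 0 else PA (q - 1))" "k' = (if q + 1 <= j then PA q else K 1)"
   using yy(1)[of x] yy(2)[of x] pre[of q x] pre[of "q + 1" x] True by simp_all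
  have "cm k k'" unfolding kk using j1 by (cases "q = 0"; cases "q + 1 <= j") simp_all
  thus ?thesis using cy sy nb_commute[OF x k k'c] by blast
 next
  \<comment> \<open>From here on neither \<open>k\<close> nor \<open>k'\<close> is a
    \<open>PA\<close>, so both steps leave the whole order unchanged.\<close>
  case False
  define a where "a = q - j"
  have a: "q = j + a" "1 <= a" using False by (auto simp: a_def)
  have len: "length (ord x) = j + n * i + length ?F" by (rule length_ord)
  have "(\<forall>s. k ~= PA s) & (\<forall>s. k' ~= PA s) & cm k k'"
  proof (cases "a < n * i")
   case True
   have ka: "k = K a" using q(2) a ord_nth(3)[OF a(2) True] by simp
   show ?thesis
   proof (cases "a + 1 < n * i")
    case True
    have "(q + 1) mod length (ord x) = j + (a + 1)" using True a len by simp
    hence "k' = K (a + 1)" using k'q ord_nth(3)[of "a + 1" x] True by simp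
    thus ?thesis using ka by simp
   next
    case F: False
    hence a1: "a + 1 = n * i" using True by simp
    show ?thesis
    proof (cases "?F = []")
     case True
     hence "length ?F = 0" by (simp only: list.size)
     hence "q + 1 = length (ord x)" using a a1 len by linarith
     hence "(q + 1) mod length (ord x) = 0" by simp
     hence "k' = K 0" using k'q ord_nth(1)[of x] by simp
     \<comment> \<open>The last matching has odd index because \<open>n * i\<close> is even, hence
       it commutes with \<open>K 0\<close> when no \<open>PB\<close> lies between them.\<close>
     moreover have "odd a" using a1 ni(2) by presburger
     ultimately show ?thesis using ka by simp
    next
     case False
     hence F0: "0 < length ?F" by (rule iffD2[OF length_greater_0_conv])
     hence "(q + 1) mod length (ord x) = j + n * i + 0" using a a1 len by simp
     hence "k' = PB (?F ! 0)" using k'q ord_nth(4)[OF F0] by simp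
     thus ?thesis using ka by simp
    qed
   qed
  next
   case F: False
   define u where "u = a - n * i"
   have u: "q = j + n * i + u" "u < length ?F" using F a q(1) len by (auto simp: u_def)
   have ku: "k = PB (?F ! u)" using q(2) u ord_nth(4)[OF u(2)] by simp
   show ?thesis
   proof (cases "u + 1 < length ?F")
    case True
    have "(q + 1) mod length (ord x) = j + n * i + (u + 1)" using True u len by simp
    hence "k' = PB (?F ! (u + 1))" using k'q ord_nth(4)[OF True] by simp
    moreover have "?F ! (u + 1) ~= ?F ! u" using nth_eq_iff_index_eq[of ?F "u + 1" u] True u(2) by simp
    ultimately show ?thesis using ku by auto
   next
    case False
    hence "q + 1 = length (ord x)" using u len by simp
    hence "k' = K 0" using k'q ord_nth(1)[of x] by simp
    thus ?thesis using ku by simp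
   qed
  qed
  hence h: "\<And>s. k ~= PA s" "\<And>s. k' ~= PA s" "cm k k'" by auto
  have o: "ord (nb k x) = ord x" "ord (nb k' x) = ord x" using ord_nb[OF x k h(1)] ord_nb[OF x k'c h(2)] by auto
  hence "col (nb k x) = col x" "col (nb k' x) = col x" using set_ord by metis+
  thus ?thesis using o k k'c k' nb_commute[OF x k k'c h(3)] by simp
 qed
qed

lemma connected:
 assumes X: "X <= A \<times> B" "X ~= {}" and cl: "\<And>x k. x : X ==> k : col x ==> nb k x : X"
 shows "X = A \<times> B"
proof
 show "X <= A \<times> B" by (rule X)
 obtain a b where ab: "(a, b) : X" using X(2) by auto
 have abV: "a : A" "b : B" using ab X(1) by auto
 show "A \<times> B <= X"
 proof
  fix y assume "y : A \<times> B"
  then obtain a' b' where y: "y = (a', b')" "a' : A" "b' : B" by auto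
  have mv: "(zs[p := mt n c (zs ! p)], b0) : X" if "(zs, b0) : X" "p < i" "c < n" for zs b0 p c
  proof -
   let ?t = "p * n + c"
   have "?t < (p + 1) * n" using that(3) by simp
   also have "\<dots> <= i * n" using that(2) by (intro mult_le_mono1) simp
   finally have "?t < n * i" by (simp add: mult.commute)
   moreover have "?t div n = p" "?t mod n = c" using that(3) n(2) by simp_all
   ultimately show ?thesis using cl[OF that(1), of "K ?t"] by (simp add: col_def)
  qed
  have "a' : {zs. (zs, b) : X}"
  proof (rule update_all[of a _ _ "\<lambda>_. part n"])
   show "a : {zs. (zs, b) : X}" "length a' = length a" using ab abV y by (auto simp: A_def)
   show "a' ! t : part n" if "t < length a" for t using that abV y by (auto simp: A_def)
   fix zs t z assume h: "zs : {zs. (zs, b) : X}" "length zs = length a" "t < length a" "z : part n"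
   have t: "t < i" "t < length zs" using h abV by (auto simp: A_def)
   have zX: "(zs, b) : X" using h by simp
   have zp: "zs ! t : part n" using zX X(1) t by (auto simp: A_def)
   have one: "(ys[t := w], b) : X" if yw: "(ys, b) : X" "ys ! t : part n" "w : part n" "isl w \<longleftrightarrow> \<not> isl (ys ! t)" for ys w
   proof -
    have "\<exists>c<n. mt n c (ys ! t) = w"
     using yw(2-4) mt_surj[OF n(1,2)] by (cases "ys ! t"; cases w) (auto simp: part_def)
    thus ?thesis using mv[OF yw(1) t(1)] by blast
   qed
   show "zs[t := z] : {zs. (zs, b) : X}"
   proof (cases "isl z \<longleftrightarrow> isl (zs ! t)")
    case False
    thus ?thesis using one[OF zX zp h(4)] by simp
   next
    case True
    \<comment> \<open>Entries in the same part are not adjacent; the detour goes through a neighbour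
      of \<open>z\<close> in the other part.\<close>
    let ?w = "mt n 0 z"
    have w: "?w : part n" "isl ?w \<longleftrightarrow> \<not> isl z" using mt_part[OF n(1,2) h(4)] isl_mt by auto
    hence "(zs[t := ?w], b) : X" using one[OF zX zp w(1)] True by simp
    hence "((zs[t := ?w])[t := z], b) : X" by (rule one) (use t w h(4) in auto)
    thus ?thesis by simp
   qed
  qed
  hence a'b: "(a', b) : X" by simp
  have "b' : {zs. (a', zs) : X}"
  proof (rule update_all[of b _ _ "\<lambda>s. {..<2 * m (Suc s)}"])
   show "b : {zs. (a', zs) : X}" "length b' = length b" using a'b abV y by (auto simp: B_def)
   show "b' ! t : {..<2 * m (Suc t)}" if "t < length b" for t using that abV y by (auto simp: B_def)
   fix zs s v assume h: "zs : {zs. (a', zs) : X}" "length zs = length b" "s < length b" "v : {..<2 * m (Suc s)}"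
   have s: "s < j" "s < length zs" using h abV by (auto simp: B_def)
   have zX: "(a', zs) : X" using h by simp
   have zs: "zs ! s < 2 * m (Suc s)" using zX X(1) s by (auto simp: B_def)
   let ?P = "\<lambda>q. (a', zs[s := q]) : X"
   have fl: "?P (flip q)" if "?P q" for q using cl[OF that, of "PA s"] s by (simp add: col_def)
   have fo: "?P (flop q)" if "?P q" "0 < q" "q < 2 * m (Suc s) - 1" for q
    using cl[OF that(1), of "PB s"] s that(2,3) by (simp add: col_def avail_def)
   have up: "?P (Suc q)" if "?P q" "Suc q < 2 * m (Suc s)" for q
   proof (cases "even q")
    case True
    thus ?thesis using fl[OF that(1)] by (simp add: flip_def)
   next
    case False
    hence "0 < q" by (cases q) auto
    thus ?thesis using fo[OF that(1)] that(2) False by (simp add: flop_def)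
   qed
   have down: "?P q" if "?P (Suc q)" "Suc q < 2 * m (Suc s)" for q
   proof (cases "even q")
    case True
    thus ?thesis using fl[OF that(1)] by (simp add: flip_def)
   next
    case False
    hence "Suc q < 2 * m (Suc s) - 1" using that(2) by presburger
    thus ?thesis using fo[OF that(1)] False by (simp add: flop_def)
   qed
   \<comment> \<open>Any value of the path coordinate is reached by descending to \<open>0\<close>
     and climbing from there.\<close>
   have "?P 0" if "?P q" "q < 2 * m (Suc s)" for q using that by (induction q) (use down in auto)
   hence "?P 0" using zX zs by (metis list_update_id)
   hence "?P q" if "q < 2 * m (Suc s)" for q using that by (induction q) (use up in auto)
   thus "zs[s := v] : {zs. (a', zs) : X}" using h(4) by simp
  qed
  thus "y : X" using y by simp
 qed
qed

lemma part_card: "finite (part n)" "card (part n) = 2 * n"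
 by (auto simp: part_def card_Plus)

lemma card_A: "finite A" "card A = (2 * n) ^ i"
 unfolding A_def using card_boxed_lists[of i "\<lambda>_. part n"] part_card by auto

lemma card_B: "finite B" "card B = (\<Prod>s<j. 2 * m (Suc s))"
 unfolding B_def using card_boxed_lists[of j "\<lambda>s. {..<2 * m (Suc s)}"] by auto

lemma nonempty: "A \<times> B ~= {}"
proof -
 have "0 < m (Suc s)" if "s < j" for s using m1[OF that] by simp
 hence "replicate i (Inl 0) : A" "replicate j 0 : B" using n by (auto simp: A_def B_def part_def)
 thus ?thesis by blast
qed

sublocale rotation "A \<times> B" col nb "\<lambda>x. csucc (ord x)" ev
proof
 show "finite (A \<times> B)" using card_A card_B by simp
 show "A \<times> B ~= {}" by (rule nonempty)
 fix x assume x: "x : A \<times> B"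
 show "finite (col x) & col x ~= {}" using j1 unfolding set_ord[symmetric] by (simp add: ord_def)
 show "inj_on (csucc (ord x)) (col x)" using csucc_inj[OF distinct_ord] set_ord by metis
 show "nb k x : A \<times> B & k : col (nb k x) & nb k (nb k x) = x & ev (nb k x) ~= ev x" if "k : col x" for k by (rule nb_props[OF x that])
 show "k = k'" if "k : col x" "k' : col x" "nb k x = nb k' x" for k k' by (rule nb_inject[OF x that])
 show "csucc (ord x) k : col x & csucc (ord x) k ~= k" if "k : col x" for k
  using csucc_in[OF distinct_ord, of k x] csucc_neq[OF distinct_ord, of x k] that ni by (simp add: set_ord length_ord)
 show "S = col x" if "S <= col x" "S ~= {}" "\<And>k. k : S ==> csucc (ord x) k : S" for S
  using csucc_cycle[OF distinct_ord, of S x] that by (simp add: set_ord)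
 show "k' : col (nb k x) & csucc (ord (nb k x)) k = k' & k : col (nb k' x) & csucc (ord (nb k' x)) k = k' & nb k' (nb k x) = nb k (nb k' x)"
  if "k : col x" "csucc (ord x) k = k'" for k k' by (rule square[OF x that])
next
 fix X assume h: "X <= A \<times> B" "X ~= {}" "\<And>x k. x : X ==> k : col x ==> nb k x : X"
 show "X = A \<times> B" by (rule connected[OF h(1,2)]) (rule h(3))
qed

end

section \<open>Identification with the product graph, degree count and genus\<close>

lemma path_step:
 assumes "y = Suc q & Suc q < 2 * M \<or> q = Suc y & Suc y < 2 * M" "y ~= flip q"
 shows "y = flop q & 0 < q & q < 2 * (M::nat) - 1"
proof (cases "even q")
 case True
 hence q: "q = Suc y" "q < 2 * M" using assms by (auto simp: flip_def)
 hence "q < 2 * M - 1" using True by presburger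
 thus ?thesis using q True by (simp add: flop_def)
next
 case False
 hence "y = Suc q" "Suc q < 2 * M" using assms by (auto simp: flip_def)
 thus ?thesis using False by (auto simp: flop_def elim: oddE)
qed

lemma edges_box_productI:
 "v : verts G1 ==> {v2, w2} : edges G2 ==> {(v, v2), (v, w2)} : edges (G1 \<box> G2)"
 "v2 : verts G2 ==> {v, w} : edges G1 ==> {(v, v2), (w, v2)} : edges (G1 \<box> G2)"
proof -
 show "{(v, v2), (v, w2)} : edges (G1 \<box> G2)" if "v : verts G1" "{v2, w2} : edges G2"
  unfolding edges_box_product using that by (intro exI[of _ v] exI[of _ v2] exI[of _ v] exI[of _ w2]) simp
 show "{(v, v2), (w, v2)} : edges (G1 \<box> G2)" if "v2 : verts G2" "{v, w} : edges G1"
  unfolding edges_box_product using that by (intro exI[of _ v] exI[of _ v2] exI[of _ w] exI[of _ v2]) simp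
qed

context grid
begin

abbreviation torus_graph :: "((nat + nat) list \<times> nat list) graph" where
 "torus_graph \<equiv> box_list (replicate i (complete_bipartite (2 * r) (2 * r))) \<box> box_list (map (\<lambda>\<alpha>. path_graph (2 * m \<alpha>)) [1..<j + 1])"

lemma verts_A: "verts (box_list (replicate i (complete_bipartite (2 * r) (2 * r)))) = A"
 by (auto simp: verts_box_list A_def complete_bipartite_def part_def n_def)

lemma paths_nth: "s < j ==> map (\<lambda>\<alpha>. path_graph (2 * m \<alpha>)) [1..<j + 1] ! s = path_graph (2 * m (Suc s))"
 by (subst nth_map_upt) simp_all

lemma verts_B: "verts (box_list (map (\<lambda>\<alpha>. path_graph (2 * m \<alpha>)) [1..<j + 1])) = B"
proof -
 have l: "length (map (\<lambda>\<alpha>. path_graph (2 * m \<alpha>)) [1..<j + 1]) = j" by simp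
 have v: "verts (path_graph N) = {..<N}" for N by (simp add: path_graph_def)
 show ?thesis unfolding verts_box_list B_def l using paths_nth v by (intro Collect_cong) (metis (no_types, lifting))
qed

lemma verts_torus: "verts torus_graph = A \<times> B"
 by (simp only: box_product_def graph.simps verts_A verts_B)

lemma edges_A: "e : edges (box_list (replicate i (complete_bipartite (2 * r) (2 * r)))) \<longleftrightarrow>
 (\<exists>a t y. a : A & t < i & {a ! t, y} : edges (complete_bipartite n n) & e = {a, a[t := y]})"
proof -
 have wf: "u : verts X & v : verts X" if "X : set (replicate i (complete_bipartite (2 * r) (2 * r)))" "{u, v} : edges X" for X u v
  using that by (auto simp: complete_bipartite_def doubleton_eq_iff split: if_splits)
 have y: "{z, y} : edges (complete_bipartite n n) ==> y : verts (complete_bipartite n n)" for z y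
  by (auto simp: complete_bipartite_def doubleton_eq_iff)
 have nth: "replicate i (complete_bipartite (2 * r) (2 * r)) ! t = complete_bipartite n n" if "t < i" for t using that by (simp add: n_def)
 show ?thesis
 proof
  assume "\<exists>a t y. a : A & t < i & {a ! t, y} : edges (complete_bipartite n n) & e = {a, a[t := y]}"
  then obtain a t z where a: "a : A" "t < i" "{a ! t, z} : edges (complete_bipartite n n)" "e = {a, a[t := z]}" by blast
  show "e : edges (box_list (replicate i (complete_bipartite (2 * r) (2 * r))))"
   by (rule iffD2[OF edges_box_list[OF wf]], assumption+, intro exI[of _ a] exI[of _ t] exI[of _ z])
    (use a nth[OF a(2)] y verts_A in simp)
 next
  assume "e : edges (box_list (replicate i (complete_bipartite (2 * r) (2 * r))))"
  then obtain a t z where a: "a : verts (box_list (replicate i (complete_bipartite (2 * r) (2 * r))))" "t < length (replicate i (complete_bipartite (2 * r) (2 * r)))"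
   "{a ! t, z} : edges (replicate i (complete_bipartite (2 * r) (2 * r)) ! t)" "e = {a, a[t := z]}"
   using edges_box_list[OF wf, where e = e] by blast
  hence "a : A" "t < i" unfolding verts_A by simp_all
  with a show "\<exists>a t y. a : A & t < i & {a ! t, y} : edges (complete_bipartite n n) & e = {a, a[t := y]}"
   using nth by (intro exI[of _ a] exI[of _ t] exI[of _ z]) simp
 qed
qed

lemma edges_B: "e : edges (box_list (map (\<lambda>\<alpha>. path_graph (2 * m \<alpha>)) [1..<j + 1])) \<longleftrightarrow>
 (\<exists>b s y. b : B & s < j & {b ! s, y} : edges (path_graph (2 * m (Suc s))) & e = {b, b[s := y]})"
proof -
 let ?Xs = "map (\<lambda>\<alpha>. path_graph (2 * m \<alpha>)) [1..<j + 1]"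
 have wf: "u : verts X & v : verts X" if "X : set ?Xs" "{u, v} : edges X" for X u v
  using that by (auto simp: path_graph_def doubleton_eq_iff)
 have y: "{z, y} : edges (path_graph N) ==> y : verts (path_graph N)" for z y N
  by (auto simp: path_graph_def doubleton_eq_iff)
 have l: "length ?Xs = j" by simp
 show ?thesis
 proof
  assume "\<exists>b s y. b : B & s < j & {b ! s, y} : edges (path_graph (2 * m (Suc s))) & e = {b, b[s := y]}"
  then obtain b s z where b: "b : B" "s < j" "{b ! s, z} : edges (path_graph (2 * m (Suc s)))" "e = {b, b[s := z]}" by blast
  hence "{b ! s, z} : edges (?Xs ! s)" "z : verts (?Xs ! s)" unfolding paths_nth[OF b(2)] using y by blast+
  moreover have "s < length ?Xs" "b : verts (box_list ?Xs)" using b verts_B l by simp_all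
  ultimately show "e : edges (box_list ?Xs)" using edges_box_list[OF wf, where e = e] b(4) by blast
 next
  assume "e : edges (box_list ?Xs)"
  then obtain b s z where b: "b : verts (box_list ?Xs)" "s < length ?Xs" "{b ! s, z} : edges (?Xs ! s)" "e = {b, b[s := z]}"
   using edges_box_list[OF wf, where e = e] by blast
  have s: "s < j" using b(2) l by simp
  have "{b ! s, z} : edges (path_graph (2 * m (Suc s)))" using b(3) unfolding paths_nth[OF s] .
  thus "\<exists>b s y. b : B & s < j & {b ! s, y} : edges (path_graph (2 * m (Suc s))) & e = {b, b[s := y]}"
   using b s unfolding verts_B by blast
 qed
qed

lemma edges_torus: "edges torus_graph = (\<lambda>(u, v). {u, v}) ` letters Q"
proof (intro equalityI subsetI)
 fix e assume "e : edges torus_graph"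
 then obtain a b a' b' where e: "e = {(a, b), (a', b')}"
  and c: "a = a' & a : A & {b, b'} : edges (box_list (map (\<lambda>\<alpha>. path_graph (2 * m \<alpha>)) [1..<j + 1])) \<or>
   {a, a'} : edges (box_list (replicate i (complete_bipartite (2 * r) (2 * r)))) & b = b' & b : B"
  unfolding edges_box_product verts_A verts_B by blast
 have "\<exists>x\<in>A \<times> B. \<exists>k\<in>col x. e = {x, nb k x}"
  using c
 proof
  assume h: "a = a' & a : A & {b, b'} : edges (box_list (map (\<lambda>\<alpha>. path_graph (2 * m \<alpha>)) [1..<j + 1]))"
  then obtain b0 s y where b0: "b0 : B" "s < j" "{b0 ! s, y} : edges (path_graph (2 * m (Suc s)))" "{b, b'} = {b0, b0[s := y]}"
   unfolding edges_B by blast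
  have "e = Pair a ` {b, b'}" using e h by simp
  hence e': "e = {(a, b0), (a, b0[s := y])}" unfolding b0(4) by simp
  have x: "(a, b0) : A \<times> B" using h b0(1) by blast
  have y: "y = Suc (b0 ! s) & Suc (b0 ! s) < 2 * m (Suc s) \<or> b0 ! s = Suc y & Suc y < 2 * m (Suc s)"
   using b0(3) unfolding path_edge .
  show ?thesis
  proof (cases "y = flip (b0 ! s)")
   case True
   hence "e = {(a, b0), nb (PA s) (a, b0)}" using e' by simp
   moreover have "PA s : col (a, b0)" using b0(2) by (simp add: col_def)
   ultimately show ?thesis using x by blast
  next
   case False
   hence "y = flop (b0 ! s) & avail b0 s"
    using path_step[OF y] unfolding avail_def by blast
   hence "e = {(a, b0), nb (PB s) (a, b0)}" "PB s : col (a, b0)" using e' b0(2) by (simp_all add: col_def)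
   thus ?thesis using x by blast
  qed
 next
  assume h: "{a, a'} : edges (box_list (replicate i (complete_bipartite (2 * r) (2 * r)))) & b = b' & b : B"
  then obtain a0 t y where a0: "a0 : A" "t < i" "{a0 ! t, y} : edges (complete_bipartite n n)" "{a, a'} = {a0, a0[t := y]}"
   unfolding edges_A by blast
  have "e = (\<lambda>a. (a, b)) ` {a, a'}" using e h by simp
  hence e': "e = {(a0, b), (a0[t := y], b)}" unfolding a0(4) by simp
  have x: "(a0, b) : A \<times> B" using h a0(1) by blast
  obtain c where c: "c < n" "mt n c (a0 ! t) = y" using a0(3) mt_surj[OF n(1,2)] unfolding bipartite_edge by metis
  let ?t = "t * n + c"
  have "?t < (t + 1) * n" using c(1) by simp
  also have "\<dots> <= i * n" using a0(2) by (intro mult_le_mono1) simp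
  finally have "?t < n * i" by (simp add: mult.commute)
  moreover have "?t div n = t" "?t mod n = c" using c(1) n(2) by simp_all
  ultimately have "e = {(a0, b), nb (K ?t) (a0, b)}" "K ?t : col (a0, b)" using e' c by (simp_all add: col_def)
  thus ?thesis using x by blast
 qed
 thus "e : (\<lambda>(u, v). {u, v}) ` letters Q" unfolding letters_darts darts_def by force
next
 fix e assume "e : (\<lambda>(u, v). {u, v}) ` letters Q"
 then obtain x k where x: "x : A \<times> B" "k : col x" "e = {x, nb k x}" unfolding letters_darts darts_def by auto
 obtain a b where ab: "x = (a, b)" "a : A" "b : B" using x(1) by auto
 have path: "e : edges torus_graph" if s: "s < j" and y: "nb k x = (a, b[s := y])" "{b ! s, y} : edges (path_graph (2 * m (Suc s)))" for s y
 proof -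
  have "{b, b[s := y]} : edges (box_list (map (\<lambda>\<alpha>. path_graph (2 * m \<alpha>)) [1..<j + 1]))" unfolding edges_B using ab(3) s y(2) by blast
  moreover have xe: "e = {(a, b), (a, b[s := y])}" using x(3) y(1) ab(1) by metis
  ultimately show ?thesis unfolding xe by (intro edges_box_productI(1)) (use ab(2) verts_A in simp)
 qed
 show "e : edges torus_graph"
 proof (cases k)
  case (K t)
  hence t: "t < n * i" using x(2) by (auto simp: col_def)
  let ?y = "mt n (t mod n) (a ! (t div n))"
  have z: "a ! (t div n) : part n" using VB(2)[OF x(1) colour_index(1)[OF t]] ab by simp
  have "{a ! (t div n), ?y} : edges (complete_bipartite n n)" unfolding bipartite_edge
   using z mt_part[OF n(1,2) z, of "t mod n"] isl_mt[of "t mod n" "a ! (t div n)"] by (auto simp: part_def)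
  hence "{a, a[t div n := ?y]} : edges (box_list (replicate i (complete_bipartite (2 * r) (2 * r))))"
   unfolding edges_A using ab(2) colour_index(1)[OF t] by blast
  moreover have "nb k x = (a[t div n := ?y], b)" using K ab by simp
  hence xe: "e = {(a, b), (a[t div n := ?y], b)}" using x(3) ab(1) by simp
  ultimately show ?thesis unfolding xe by (intro edges_box_productI(2)) (use ab(3) verts_B in simp)
 next
  case (PA s)
  hence s: "s < j" using x(2) by (auto simp: col_def)
  have q: "b ! s < 2 * m (Suc s)" using VB(3)[OF x(1) s] ab by simp
  have "{b ! s, flip (b ! s)} : edges (path_graph (2 * m (Suc s)))" unfolding path_edge
   using q by (cases "even (b ! s)") (auto simp: flip_def elim!: evenE oddE)
  thus ?thesis using path[OF s] PA ab by simp
 next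
  case (PB s)
  hence s: "s < j" "avail b s" using x(2) ab by (auto simp: col_def)
  hence "{b ! s, flop (b ! s)} : edges (path_graph (2 * m (Suc s)))" unfolding path_edge
   by (cases "even (b ! s)") (auto simp: flop_def avail_def elim!: evenE oddE)
  thus ?thesis using path[OF s(1)] PB ab by simp
 qed
qed

lemma card_col: "card (col x) = n * i + j + card {s. s < j & avail (snd x) s}"
proof -
 have f: "finite {s. s < j & avail (snd x) s}" by simp
 have "card (col x) = card (K ` {..<n * i} \<union> PA ` {..<j}) + card (PB ` {s. s < j & avail (snd x) s})"
  unfolding col_def by (rule card_Un_disjoint) auto
 also have "card (K ` {..<n * i} \<union> PA ` {..<j}) = card (K ` {..<n * i}) + card (PA ` {..<j})"
  by (rule card_Un_disjoint) auto
 finally show ?thesis by (simp add: card_image inj_on_def)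
qed

text \<open>Of the \<open>2 m\<close> values of the coordinate exactly the two ends are excluded, a
  proportion of \<open>1/m\<close>.\<close>

lemma card_avail:
 assumes s: "s < j"
 shows "real (card {b : B. avail b s}) = (1 - 1 / m (Suc s)) * real (card B)"
proof -
 let ?D = "\<lambda>u. if u = s then {1..<2 * m (Suc s) - 1} else {..<2 * m (Suc u)}"
 have "{b : B. avail b s} = {b. length b = j & (\<forall>u<j. b ! u : ?D u)}"
 proof (intro set_eqI iffI)
  fix b assume "b : {b. length b = j & (\<forall>u<j. b ! u : ?D u)}"
  hence b: "length b = j" "\<And>u. u < j ==> b ! u : ?D u" by auto
  have "b ! u < 2 * m (Suc u)" if "u < j" for u using b(2)[OF that] by (cases "u = s") auto
  thus "b : {b : B. avail b s}" using b(1) b(2)[OF s] by (auto simp: B_def avail_def)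
 qed (auto simp: B_def avail_def)
 hence c: "card {b : B. avail b s} = (\<Prod>u<j. card (?D u))" using card_boxed_lists(2)[of j ?D] by simp
 have "(\<Prod>u<j. real (card (?D u))) = real (card (?D s)) * (\<Prod>u\<in>{..<j} - {s}. real (card (?D u)))"
  using s by (intro prod.remove) auto
 also have "(\<Prod>u\<in>{..<j} - {s}. real (card (?D u))) = (\<Prod>u\<in>{..<j} - {s}. real (2 * m (Suc u)))"
  by (intro prod.cong) auto
 also have "real (card (?D s)) = (1 - 1 / m (Suc s)) * real (2 * m (Suc s))"
  using m1[OF s] by (simp add: field_simps of_nat_diff)
 finally have "real (card {b : B. avail b s}) = (1 - 1 / m (Suc s)) * (real (2 * m (Suc s)) * (\<Prod>u\<in>{..<j} - {s}. real (2 * m (Suc u))))"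
  unfolding c by simp
 also have "real (2 * m (Suc s)) * (\<Prod>u\<in>{..<j} - {s}. real (2 * m (Suc u))) = (\<Prod>u<j. real (2 * m (Suc u)))"
  using s by (intro prod.remove[symmetric]) auto
 finally show ?thesis unfolding card_B(2) by simp
qed

lemma sum_col: "real (\<Sum>x\<in>A \<times> B. card (col x)) = real (card (A \<times> B)) * (n * i + 2 * j - (\<Sum>s<j. 1 / m (Suc s)))"
proof -
 have "(\<Sum>x\<in>A \<times> B. card {s. s < j & avail (snd x) s}) = card A * (\<Sum>b\<in>B. card {s. s < j & avail b s})"
 proof -
  have "(\<Sum>x\<in>A \<times> B. card {s. s < j & avail (snd x) s}) = (\<Sum>(a, b)\<in>A \<times> B. card {s. s < j & avail b s})"
   by (rule sum.cong) auto
  also have "\<dots> = (\<Sum>a\<in>A. \<Sum>b\<in>B. card {s. s < j & avail b s})" by (rule sum.cartesian_product[symmetric])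
  finally show ?thesis by simp
 qed
 also have "(\<Sum>b\<in>B. card {s. s < j & avail b s}) = (\<Sum>b\<in>B. \<Sum>s<j. of_bool (avail b s))"
  by (intro sum.cong) (auto simp: of_bool_def sum.If_cases Int_def)
 also have "\<dots> = (\<Sum>s<j. \<Sum>b\<in>B. of_bool (avail b s))" by (rule sum.swap)
 also have "\<dots> = (\<Sum>s<j. card {b : B. avail b s})" using card_B(1)
  by (intro sum.cong) (auto simp: of_bool_def sum.If_cases Int_def)
 finally have "real (\<Sum>x\<in>A \<times> B. card {s. s < j & avail (snd x) s}) = real (card A) * (\<Sum>s<j. real (card {b : B. avail b s}))"
  by simp
 also have "(\<Sum>s<j. real (card {b : B. avail b s})) = (\<Sum>s<j. (1 - 1 / m (Suc s)) * real (card B))"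
  using card_avail by (intro sum.cong) auto
 also have "\<dots> = (j - (\<Sum>s<j. 1 / m (Suc s))) * real (card B)"
  by (simp add: sum_distrib_right[symmetric] sum_subtractf)
 finally have e: "real (\<Sum>x\<in>A \<times> B. card {s. s < j & avail (snd x) s}) = real (card A) * ((j - (\<Sum>s<j. 1 / m (Suc s))) * real (card B))" .
 have "real (\<Sum>x\<in>A \<times> B. card (col x)) = real (card (A \<times> B)) * (n * i + j) + real (\<Sum>x\<in>A \<times> B. card {s. s < j & avail (snd x) s})"
  unfolding card_col by (simp add: sum.distrib algebra_simps)
 thus ?thesis unfolding e by (simp add: card_cartesian_product algebra_simps)
qed

lemma infinite_vertices: "infinite (UNIV :: ((nat + nat) list \<times> nat list) set)"
 by (simp add: finite_prod infinite_UNIV_listI)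

text \<open>The Euler number of the rotation system gives a genus \<open>h\<close> at which the
  graph embeds; \<open>embedding_bound\<close>, with twice the number of edges equal to the degree
  sum, gives the same number as a lower bound.\<close>

lemma genus_torus: "8 * real (genus torus_graph) = 8 - 4 * real (card (A \<times> B)) + real (\<Sum>x\<in>A \<times> B. card (col x))"
proof -
 let ?T = "real (\<Sum>x\<in>A \<times> B. card (col x))"
 have nl: "fst d ~= fst (rv d)" if "d : letters Q" for d using that darts_swap unfolding letters_darts by simp
 obtain h :: nat where h: "euler2 fst Q = 4 - 4 * int h"
  using euler2_even_genus[OF infinite_vertices okmap_Q wconn_Q Q_nonempty nl] by blast
 have "2 * (4 - 4 * int h) = 4 * int (card (A \<times> B)) - int (\<Sum>x\<in>A \<times> B. card (col x))" using euler_Q unfolding h .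
 hence "real_of_int (2 * (4 - 4 * int h)) = real_of_int (4 * int (card (A \<times> B)) - int (\<Sum>x\<in>A \<times> B. card (col x)))" by (rule arg_cong)
 hence hT: "8 * real h = 8 - 4 * real (card (A \<times> B)) + ?T" by simp
 interpret p: plate "hcell h 1" "int 1" by (rule plate_hcell) simp
 have hW: "hW h 1 = p.W" unfolding hW_def by (rule refl)
 have inf: "infinite (UNIV :: ((int \<times> int) \<times> int) set)" by (simp add: finite_prod infinite_UNIV_int)
 have ok: "okmap fst p.W" by (rule p.okmap_W) simp
 have nl': "fst d ~= fst (rv d)" if "d : letters p.W" for d using p.swap_letters[OF that] by (auto simp: prod_eq_iff)
 have "euler2 fst p.W = euler2 fst Q" unfolding h by (rule euler_handle) simp
 hence "realizes (handle_surface h) fst Q"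
  using same_surface[OF inf infinite_vertices ok p.wconn p.nonempty_W nl' okmap_Q wconn_Q Q_nonempty nl _ realizes_handle_surface[of h, unfolded hW]] by blast
 hence emb: "embeds_in torus_graph (handle_surface h)"
  by (rule embeds_in_of_realizes) (use darts_swap letters_darts fst_letters_Q verts_torus edges_torus in auto)
 have "h <= g" if g: "embeds_in torus_graph (handle_surface g)" for g
 proof -
  \<comment> \<open>One dart for each edge, directed from the even end to the odd end as
    \<open>embedding_bound\<close> expects.\<close>
  let ?E = "{d : darts. ev (fst d)}"
  have par: "ev (snd d) \<longleftrightarrow> \<not> ev (fst d)" "fst d : A \<times> B" "snd d : A \<times> B" if "d : darts" for d
   using that nb unfolding darts_def by auto
  have fd: "finite darts" using okmap_finite_letters[OF okmap_Q] letters_darts by simp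
  have u: "darts = ?E \<union> rv ` ?E"
  proof (intro equalityI subsetI)
   fix d assume d: "d : darts"
   show "d : ?E \<union> rv ` ?E"
   proof (cases "ev (fst d)")
    case False
    hence "rv d : ?E" using darts_swap[OF d] par[OF d] by simp
    hence "rv (rv d) : rv ` ?E" by (rule imageI)
    thus ?thesis by simp
   qed (use d in simp)
  qed (use darts_swap in auto)
  have "?E \<inter> rv ` ?E = {}"
  proof (rule ccontr)
   assume "?E \<inter> rv ` ?E ~= {}"
   then obtain d where d: "d : ?E" "rv d : ?E" by blast
   hence "d : darts" "ev (fst d)" "ev (snd d)" by simp_all
   thus False using par(1) by blast
  qed
  hence "card (?E \<union> rv ` ?E) = card ?E + card (rv ` ?E)" using fd by (intro card_Un_disjoint) simp_all
  hence "card darts = card ?E + card (rv ` ?E)" using arg_cong[OF u, of card] by (rule trans[rotated])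
  also have "card (rv ` ?E) = card ?E" by (simp add: card_image)
  finally have cE: "2 * card ?E = (\<Sum>x\<in>A \<times> B. card (col x))" using card_darts letters_darts by simp
  have "edges torus_graph = (\<lambda>(u, v). {u, v}) ` ?E"
  proof -
   let ?f = "\<lambda>(u, v). {u, v}"
   have "?f ` rv ` ?E = ?f ` ?E"
    unfolding image_image by (rule image_cong) (auto simp: insert_commute)
   hence "?f ` (?E \<union> rv ` ?E) = ?f ` ?E" by (simp only: image_Un Un_absorb)
   thus ?thesis unfolding edges_torus letters_darts using arg_cong[OF u, of "image ?f"] by (rule trans[rotated])
  qed
  moreover have "?E <= {u : verts torus_graph. ev u} \<times> {v : verts torus_graph. \<not> ev v}"
   unfolding verts_torus using par by (auto simp: mem_Times_iff)
  moreover have "finite (verts torus_graph)" unfolding verts_torus using card_A card_B by simp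
  moreover have "3 <= card (verts torus_graph)"
  proof -
   have "4 ^ 1 <= (2 * n) ^ i" using n(3) i1 by (intro order_trans[OF power_increasing[of 1 i 4] power_mono]) auto
   moreover have "1 <= card B" unfolding card_B using m1 by (intro prod_ge_1) (auto dest: m1)
   ultimately have "4 * 1 <= card A * card B" unfolding card_A by (intro mult_le_mono) auto
   thus ?thesis unfolding verts_torus by (simp add: card_cartesian_product)
  qed
  ultimately have "card ?E + 4 <= 2 * card (A \<times> B) + 4 * g"
   using embedding_bound[of torus_graph ?E ev g] g verts_torus by simp
  hence "real (card ?E + 4) <= real (2 * card (A \<times> B) + 4 * g)" by (rule of_nat_mono)
  hence "real (card ?E) + 4 <= 2 * real (card (A \<times> B)) + 4 * real g" by (simp only: of_nat_add of_nat_mult of_nat_numeral)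
  moreover have "real (2 * card ?E) = ?T" using cE by (rule arg_cong)
  hence "2 * real (card ?E) = ?T" by (simp only: of_nat_mult of_nat_numeral)
  ultimately show "h <= g" using hT by linarith
 qed
 hence "genus torus_graph = h" unfolding genus_def using emb by (intro Least_equality) auto
 thus ?thesis using hT by simp
qed

end

theorem theorem2:
  fixes i r j :: nat and m :: "nat \<Rightarrow> nat" and M s :: real
  assumes "i \<ge> 1" and "r \<ge> 1" and "j \<ge> 1"
    and "\<And>\<alpha>. \<alpha> \<in> {1..j} \<Longrightarrow> m \<alpha> \<ge> 1"
    and "M = (\<Prod>\<alpha>=1..j. real (m \<alpha>))"
    and "s = (\<Sum>\<alpha>=1..j. 1 / real (m \<alpha>))"
  shows "real (genus (box_list (replicate i (complete_bipartite (2 * r) (2 * r))) \<box>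
                      box_list (map (\<lambda>\<alpha>. path_graph (2 * m \<alpha>)) [1..<j + 1]))) =
         1 + 2 ^ (2 * i + j - 3) * real r ^ i * M * (2 * real i * real r + 2 * real j - s - 4)"
proof -
 interpret grid i r j m by unfold_locales (use assms in auto)
 have M: "M = (\<Prod>s<j. real (m (Suc s)))" unfolding assms(5) by (simp add: prod.atLeast1_atMost_eq)
 have s: "s = (\<Sum>s<j. 1 / real (m (Suc s)))" unfolding assms(6) by (simp add: sum.atLeast1_atMost_eq)
 have "real (card (A \<times> B)) = (2 * real n) ^ i * (\<Prod>s<j. 2 * real (m (Suc s)))"
  by (simp add: card_cartesian_product card_A card_B)
 also have "\<dots> = 4 ^ i * real r ^ i * (2 ^ j * M)" by (simp add: n_def M prod.distrib power_mult_distrib)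
 also have "\<dots> = 8 * 2 ^ (2 * i + j - 3) * real r ^ i * M"
 proof -
  \<comment> \<open>The subtraction of natural numbers is exact here. The split-off
    \<open>2 ^ 3\<close> is the factor \<open>8\<close> in front of the genus in
    \<open>genus_torus\<close>.\<close>
  have "2 * i + j = 3 + (2 * i + j - 3)" using assms(1,3) by simp
  hence "(2::real) ^ (2 * i + j) = 2 ^ (3 + (2 * i + j - 3))" by simp
  hence "(4::real) ^ i * 2 ^ j = 8 * 2 ^ (2 * i + j - 3)" by (simp add: power_add power_mult)
  thus ?thesis by (simp add: ac_simps)
 qed
 finally have V: "real (card (A \<times> B)) = 8 * 2 ^ (2 * i + j - 3) * real r ^ i * M" .
 have "8 * real (genus torus_graph) = 8 + real (card (A \<times> B)) * (2 * real i * real r + 2 * real j - s - 4)"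
  unfolding genus_torus sum_col s by (simp add: n_def algebra_simps)
 thus ?thesis unfolding V by simp
qed

end
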